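(* Let $r,\ell\in\mathbb{N}$ with $r>\ell\ge \frac{3}{4}r$. For every $\mu>0$ there exist $\alpha>0$ and $N\in\mathbb{N}$ such that for every $n\in r\mathbb{N}$ with $n>N$, every $n$-vertex graph $G$ with $$\delta(G)\ge\left(\frac{1}{2-\varrho_{\ell}(r-1)}+\mu\right)n\quad\text{and}\quad \alpha_{\ell}(G)\le \alpha n$$ contains a $K_r$-factor. Moreover, the minimum degree condition is asymptotically best possible: for every $\eta>0$ and every $\alpha>0$ there exist arbitrarily large $n\in r\mathbb{N}$ and $n$-vertex graphs $G$ with $\delta(G)\ge\left(\frac{1}{2-\varrho_{\ell}(r-1)}-\eta\right)n$ and $\alpha_\ell(G)\le\alpha n$ that contain no $K_r$-factor.
   Context: For a graph $G$ and an integer $\ell\ge 2$, the $\ell$-independence number $\alpha_\ell(G)$ is the maximum number of vertices of an induced subgraph of $G$ containing no copy of $K_\ell$. A $K_r$-factor of $G$ is a collection of vertex-disjoint copies of $K_r$ in $G$ covering all vertices of $G$. $\delta(G)$ is the minimum degree. For $s\in\mathbb{N}$ and $\varepsilon>0$, let $\mathbf{RT}_\ell(n,K_s,\varepsilon n)$ be the maximum number of edges of an $n$-vertex $K_s$-free graph $G$ with $\alpha_\ell(G)\le\varepsilon n$, and the Ramsey–Turán density is $\varrho_\ell(s):=\lim_{\varepsilon\to 0}\lim_{n\to\infty}\mathbf{RT}_\ell(n,K_s,\varepsilon n)/\binom{n}{2}$. *)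

theory Defs
  imports "HOL-Analysis.Analysis" "HOL-Library.Ramsey" "HOL-Library.Disjoint_Sets"
begin

definition simple_graph :: "'a set \<Rightarrow> 'a set set \<Rightarrow> bool" where
  "simple_graph V E \<longleftrightarrow> finite V \<and> (\<forall>e\<in>E. e \<subseteq> V \<and> card e = 2)"

definition degree :: "'a set set \<Rightarrow> 'a \<Rightarrow> nat" where
  "degree E v = card {e \<in> E. v \<in> e}"

text \<open>Only meaningful for graphs with at least one vertex.\<close>

definition min_degree :: "'a set \<Rightarrow> 'a set set \<Rightarrow> nat" where
  "min_degree V E = Min (degree E ` V)"

definition is_K :: "nat \<Rightarrow> 'a set set \<Rightarrow> 'a set \<Rightarrow> bool" where
  "is_K m E S \<longleftrightarrow> finite S \<and> card S = m \<and> clique S E"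

definition induced_edges :: "'a set set \<Rightarrow> 'a set \<Rightarrow> 'a set set" where
  "induced_edges E U = {e \<in> E. e \<subseteq> U}"

definition K_free :: "nat \<Rightarrow> 'a set \<Rightarrow> 'a set set \<Rightarrow> bool" where
  "K_free m V E \<longleftrightarrow> \<not> (\<exists>S\<subseteq>V. is_K m E S)"

definition indep_number :: "nat \<Rightarrow> 'a set \<Rightarrow> 'a set set \<Rightarrow> nat" where
  "indep_number l V E = Max {card U | U. U \<subseteq> V \<and> K_free l U (induced_edges E U)}"

definition K_factor :: "nat \<Rightarrow> 'a set \<Rightarrow> 'a set set \<Rightarrow> 'a set set \<Rightarrow> bool" where
  "K_factor r V E F \<longleftrightarrow> partition_on V F \<and> (\<forall>S\<in>F. is_K r E S)"

text \<open>
  Vertex sets are finite sets of natural numbers, so all graphs are covered up to isomorphism.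
  The supremum over \<^typ>\<open>nat\<close> is the maximum, and it is 0 for the empty set. Thus the
  Ramsey-Turan number is 0 when no graph qualifies. This convention is needed: for
  \<open>s = l\<close> and \<open>a < n\<close> a \<open>K_s\<close>-free graph on n vertices has l-independence number n,
  so no graph qualifies, and the density below comes out as 0.
\<close>

definition RT :: "nat \<Rightarrow> nat \<Rightarrow> nat \<Rightarrow> real \<Rightarrow> nat" where
  "RT l n s a = Sup {card E | (V :: nat set) E.
     simple_graph V E \<and> card V = n \<and> K_free s V E \<and> real (indep_number l V E) \<le> a}"

text \<open>
  The constant \<^const>\<open>Lim\<close> only has a meaning when the limit exists. Both limits below do for
  \<open>l \<ge> 2\<close>: the inner one by a blow-up argument, the outer one because the inner limit is
  bounded and monotone in \<open>\<epsilon>\<close>. (For \<open>s \<le> l\<close> the inner one is 0 whenever \<open>\<epsilon> < 1\<close>.)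
\<close>

definition RT_density :: "nat \<Rightarrow> nat \<Rightarrow> real" where
  "RT_density l s =
     Lim (at_right 0) (\<lambda>\<epsilon>. lim (\<lambda>n. real (RT l n s (\<epsilon> * real n)) / real (n choose 2)))"

end

theory Submission
  imports Defs "HOL-Probability.Probability"
begin

text \<open>
  Write \<open>\<rho>\<close> for the Ramsey--Turan density and \<open>\<delta> = 1 / (2 - \<rho>)\<close>. Two facts drive the proof. First, in a
  set of \<open>m\<close> vertices with minimum degree above \<open>\<delta> m\<close>, every neighbourhood has density above \<open>\<rho>\<close>, so every
  vertex lies in many copies of \<open>K\<^sub>r\<close>. Second, two sets of edge density above \<open>1 / 2\<close> contain a clique
  made of \<open>l\<close> vertices of one and more than \<open>l / 2\<close> vertices of the other; here \<open>l \<ge> 3 r / 4\<close> is used.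

  The second fact gives an almost perfect tiling by augmentation of a maximum one. The leftover is
  handled by absorption: by regularity and Ramsey's theorem, among boundedly many vertices two can be
  exchanged for each other robustly in a tiling, so almost all vertices split into boundedly many classes
  of mutually exchangeable vertices. The second fact lets one merge these into a single class.
  Exchangeability gives absorbers for all \<open>r\<close>-sets of the class, and a sparse robustly matchable template
  assembles them into a set \<open>A\<close> such that \<open>A \<union> X'\<close> has a \<open>K\<^sub>r\<close>-factor for every subset \<open>X'\<close> of the right size
  of a random reservoir \<open>X\<close>. The vertices missed by the tiling are then covered by cliques into \<open>X\<close>.

  The bound is asymptotically attained by a vertex whose neighbourhood is an extremal \<open>K\<^bsub>r-1\<^esub>\<close>-free graph, or, if
  \<open>\<rho> = 0\<close>, by two disjoint cliques whose orders are not divisible by \<open>r\<close>.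
\<close>


section \<open>Graphs\<close>

text \<open>The value \<open>1 / (2 - \<rho>)\<close> is read off one vertex: if all degrees are at
  least \<open>\<delta> m\<close>, then \<open>\<delta> m\<close> neighbours of a vertex induce
  degrees at least \<open>(2 * \<delta> - 1) * m\<close>, a relative density of
  \<open>2 - 1 / \<delta>\<close>, and this equals \<open>\<rho>\<close> exactly at
  \<open>\<delta> = 1 / (2 - \<rho>)\<close>. Tiling and merging only exploit that
  \<open>\<delta> \<ge> 1 / 2\<close>. The obstacle is that sublinear independence numbers give no
  supersaturation: a graph may have all the required cliques and still few copies of each. Hence
  nothing is counted; every robust statement asks for a copy avoiding an arbitrary forbidden set
  \<open>F\<close> of linear order, and disjoint copies are picked greedily. A second obstacle: some
  vertices may lie in no class, and the tiling leaves a small but linear remainder. So absorbers are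
  built only for subsets of the reservoir; any other leftover vertex is hooked to the reservoir by a
  clique, and a slack of \<open>k\<close> reservoir vertices pays for this. The bound
  \<open>3 * r \<le> 4 * l\<close> enters as \<open>2 * (r - l) \<le> r / 2\<close> when a tile is
  split and as \<open>r \<le> l div 2 + 1 + l\<close> when cliques are found across a dense
  pair.\<close>

definition nb :: "'a set set \<Rightarrow> 'a \<Rightarrow> 'a set" where
  "nb E v = {u. {v, u} \<in> E}"

text \<open>Ordered pairs are counted, so an edge inside \<open>X \<inter> Y\<close> contributes
  twice and \<open>ee E V V\<close> is twice the number of edges.\<close>

definition ee :: "'a set set \<Rightarrow> 'a set \<Rightarrow> 'a set \<Rightarrow> real" where
  "ee E X Y = (\<Sum>x\<in>X. \<Sum>y\<in>Y. of_bool ({x, y} \<in> E))"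

text \<open>Equivalent to every K_l-free subset having fewer than \<open>a\<close> vertices. The
  threshold is an absolute real number, so the property is inherited by subsets of \<open>V\<close>
  without rescaling.\<close>

definition K_dense :: "nat \<Rightarrow> 'a set \<Rightarrow> 'a set set \<Rightarrow> real \<Rightarrow> bool" where
  "K_dense l V E a \<longleftrightarrow> (\<forall>U\<subseteq>V. a \<le> real (card U) \<longrightarrow> (\<exists>S\<subseteq>U. is_K l E S))"

lemma nb_subset: "simple_graph V E \<Longrightarrow> nb E v \<subseteq> V"
  by (auto simp: simple_graph_def nb_def)

lemma not_loop: "simple_graph V E \<Longrightarrow> {v} \<notin> E"
  by (auto simp: simple_graph_def)

lemma nb_irrefl: "simple_graph V E \<Longrightarrow> v \<notin> nb E v"
  using not_loop[of V E v] by (simp add: nb_def)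

lemma finite_nb: "simple_graph V E \<Longrightarrow> finite (nb E v)"
  using nb_subset[of V E v] by (auto simp: simple_graph_def intro: finite_subset)

lemma degree_eq_card_nb:
  assumes "simple_graph V E"
  shows "degree E v = card (nb E v)"
proof -
  have "{e \<in> E. v \<in> e} = (\<lambda>u. {v, u}) ` nb E v"
  proof (intro equalityI subsetI)
    fix e assume "e \<in> {e \<in> E. v \<in> e}"
    then have e: "e \<in> E" "v \<in> e" by auto
    then have "card e = 2" using assms by (auto simp: simple_graph_def)
    then obtain u where "e = {v, u}" using e(2) by (auto simp: card_2_iff)
    then show "e \<in> (\<lambda>u. {v, u}) ` nb E v" using e by (auto simp: nb_def)
  qed (auto simp: nb_def)
  moreover have "inj_on (\<lambda>u. {v, u}) (nb E v)"
    by (auto simp: inj_on_def doubleton_eq_iff)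
  ultimately show ?thesis by (simp add: degree_def card_image)
qed

lemma min_degree_le:
  assumes "simple_graph V E" "v \<in> V"
  shows "min_degree V E \<le> card (nb E v)"
  unfolding min_degree_def degree_eq_card_nb[OF assms(1), of v, symmetric]
  using assms by (intro Min_le) (auto simp: simple_graph_def)

lemma ee_eq_sum_card: "finite Y \<Longrightarrow> ee E X Y = (\<Sum>x\<in>X. real (card (nb E x \<inter> Y)))"
  unfolding ee_def nb_def by (intro sum.cong refl) (simp add: Int_def conj_commute)

lemma ee_commute: "ee E X Y = ee E Y X"
  unfolding ee_def by (subst sum.swap) (simp add: insert_commute)

lemma ee_nonneg: "0 \<le> ee E X Y"
  unfolding ee_def by (intro sum_nonneg) auto

lemma ee_le: "ee E X Y \<le> real (card X) * real (card Y)"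
proof -
  have "ee E X Y \<le> (\<Sum>x\<in>X. \<Sum>y\<in>Y. 1)"
    unfolding ee_def by (intro sum_mono) auto
  then show ?thesis by simp
qed

lemma double_card_edges:
  assumes "simple_graph V E"
  shows "2 * real (card E) = ee E V V"
proof -
  have fV: "finite V" and eE: "\<And>e. e \<in> E \<Longrightarrow> e \<subseteq> V \<and> card e = 2"
    using assms by (auto simp: simple_graph_def)
  have fE: "finite E" using fV eE by (intro finite_subset[of E "Pow V"]) auto
  have "ee E V V = (\<Sum>x\<in>V. real (degree E x))"
    using fV nb_subset[OF assms]
    by (simp add: ee_eq_sum_card degree_eq_card_nb[OF assms] Int_absorb2)
  also have "\<dots> = (\<Sum>x\<in>V. \<Sum>e\<in>E. of_bool (x \<in> e))"
    using fE by (intro sum.cong refl) (simp add: degree_def Int_def)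
  also have "\<dots> = (\<Sum>e\<in>E. \<Sum>x\<in>V. of_bool (x \<in> e))" by (rule sum.swap)
  also have "\<dots> = (\<Sum>e\<in>E. 2)"
  proof (intro sum.cong refl)
    fix e assume "e \<in> E"
    then have "V \<inter> {x. x \<in> e} = e" "card e = 2" using eE by auto
    then show "(\<Sum>x\<in>V. of_bool (x \<in> e)) = (2::real)" using fV by simp
  qed
  finally show ?thesis by simp
qed

lemma is_K_subset: "is_K m E S \<Longrightarrow> T \<subseteq> S \<Longrightarrow> is_K (card T) E T"
  unfolding is_K_def by (auto intro: finite_subset smaller_clique)

lemma is_K_obtain:
  assumes "is_K m E S" "k \<le> m"
  obtains T where "T \<subseteq> S" "is_K k E T"
proof -
  obtain T where "T \<subseteq> S" "card T = k"
    using assms obtain_subset_with_card_n[of k S] by (auto simp: is_K_def)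
  then show ?thesis using that is_K_subset[OF assms(1), of T] by auto
qed

lemma is_K_Un:
  assumes "is_K a E S" "is_K b E T" "S \<inter> T = {}" "\<And>s t. s \<in> S \<Longrightarrow> t \<in> T \<Longrightarrow> {s, t} \<in> E"
  shows "is_K (a + b) E (S \<union> T)"
  using assms unfolding is_K_def by (auto intro!: clique_Un card_Un_disjoint)

lemma is_K_insert:
  assumes "is_K m E S" "x \<notin> S" "S \<subseteq> nb E x"
  shows "is_K (Suc m) E (insert x S)"
  using assms unfolding is_K_def clique_def nb_def by (auto simp: insert_commute)

lemma is_K_induced: "S \<subseteq> U \<Longrightarrow> is_K m (induced_edges E U) S \<longleftrightarrow> is_K m E S"
  unfolding is_K_def clique_def induced_edges_def by auto

lemma K_free_induced: "K_free m U (induced_edges E U) \<longleftrightarrow> K_free m U E"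
  unfolding K_free_def using is_K_induced by metis

lemma K_free_subset: "K_free m V E \<Longrightarrow> U \<subseteq> V \<Longrightarrow> K_free m U E"
  unfolding K_free_def by blast

lemma indep_number_le_iff:
  assumes "finite V" "0 < l" "0 \<le> a"
  shows "real (indep_number l V E) \<le> a \<longleftrightarrow> (\<forall>U\<subseteq>V. K_free l U E \<longrightarrow> real (card U) \<le> a)"
proof -
  let ?S = "{card U |U. U \<subseteq> V \<and> K_free l U (induced_edges E U)}"
  have fin: "finite ?S"
    by (rule finite_subset[of _ "card ` Pow V"]) (use assms(1) in auto)
  \<comment> \<open>With \<open>0 < l\<close> the empty set qualifies, so the \<open>Max\<close>
    ranges over a nonempty set.\<close>
  have "K_free l {} E" using assms(2) by (auto simp: K_free_def is_K_def)
  then have ne: "?S \<noteq> {}" by (auto simp: K_free_induced)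
  have "real (indep_number l V E) \<le> a \<longleftrightarrow> indep_number l V E \<le> nat \<lfloor>a\<rfloor>"
    using assms(3) by linarith
  also have "\<dots> \<longleftrightarrow> (\<forall>U\<subseteq>V. K_free l U E \<longrightarrow> card U \<le> nat \<lfloor>a\<rfloor>)"
    unfolding indep_number_def Max_le_iff[OF fin ne] by (auto simp: K_free_induced)
  also have "\<dots> \<longleftrightarrow> (\<forall>U\<subseteq>V. K_free l U E \<longrightarrow> real (card U) \<le> a)"
    using assms(3) by (simp add: le_nat_iff le_floor_iff)
  finally show ?thesis .
qed

lemma K_dense_obtain:
  assumes "K_dense l V E a" "U \<subseteq> V" "a \<le> real (card U)"
  obtains S where "S \<subseteq> U" "is_K l E S"
  using assms unfolding K_dense_def by blast

section \<open>Tilings\<close>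

definition tiling :: "nat \<Rightarrow> 'a set set \<Rightarrow> 'a set set \<Rightarrow> bool" where
  "tiling r E F \<longleftrightarrow> finite F \<and> disjoint F \<and> (\<forall>S\<in>F. is_K r E S)"

text \<open>A perfect tiling of a bare vertex set, with the empty set included, so that the notion
  is closed under disjoint unions. All exchange arguments below are disjoint unions of factorable
  sets.\<close>

definition factorable :: "nat \<Rightarrow> 'a set set \<Rightarrow> 'a set \<Rightarrow> bool" where
  "factorable r E U \<longleftrightarrow> (\<exists>F. tiling r E F \<and> \<Union>F = U)"

lemma factorable_imp_K_factor:
  assumes "factorable r E V" "0 < r"
  shows "\<exists>F. K_factor r V E F"
proof -
  obtain F where F: "tiling r E F" "\<Union>F = V" using assms(1) by (auto simp: factorable_def)
  moreover have "{} \<notin> F" using F assms(2) by (auto simp: tiling_def is_K_def)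
  ultimately have "K_factor r V E F"
    by (auto simp: K_factor_def partition_on_def tiling_def)
  then show ?thesis ..
qed

lemma factorable_empty: "factorable r E {}"
  unfolding factorable_def tiling_def by (intro exI[of _ "{}"]) simp

lemma factorable_is_K: "is_K r E S \<Longrightarrow> factorable r E S"
  unfolding factorable_def tiling_def by (intro exI[of _ "{S}"]) simp

lemma tiling_Un:
  assumes "tiling r E F" "tiling r E G" "\<Union>F \<inter> \<Union>G = {}"
  shows "tiling r E (F \<union> G)"
  using assms unfolding tiling_def by (auto intro: disjoint_union)

lemma factorable_Un:
  assumes "factorable r E S" "factorable r E T" "S \<inter> T = {}"
  shows "factorable r E (S \<union> T)"
proof -
  obtain F G where "tiling r E F" "\<Union>F = S" "tiling r E G" "\<Union>G = T"
    using assms(1,2) by (auto simp: factorable_def)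
  then show ?thesis using tiling_Un[of r E F G] assms(3)
    unfolding factorable_def by (intro exI[of _ "F \<union> G"]) auto
qed

lemma factorable_UN:
  assumes "finite I" "\<And>i. i \<in> I \<Longrightarrow> factorable r E (A i)"
    "\<And>i j. i \<in> I \<Longrightarrow> j \<in> I \<Longrightarrow> i \<noteq> j \<Longrightarrow> A i \<inter> A j = {}"
  shows "factorable r E (\<Union>i\<in>I. A i)"
  using assms
proof (induction I rule: finite_induct)
  case (insert i I)
  have "factorable r E (A i \<union> (\<Union>j\<in>I. A j))"
  proof (rule factorable_Un)
    show "factorable r E (\<Union>j\<in>I. A j)" using insert by blast
    show "A i \<inter> (\<Union>j\<in>I. A j) = {}" using insert.prems(2)[of i] insert.hyps(2) by fastforce
  qed (use insert in auto)
  then show ?case by simp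
qed (simp add: factorable_empty)

lemma tiling_card:
  assumes "tiling r E F"
  shows "finite (\<Union>F)" "card (\<Union>F) = r * card F"
proof -
  have fin: "finite F" and dj: "disjoint F" and K: "\<And>S. S \<in> F \<Longrightarrow> finite S \<and> card S = r"
    using assms by (auto simp: tiling_def is_K_def)
  show "finite (\<Union>F)" using fin K by auto
  have "card (\<Union>F) = sum card F"
    by (rule card_Union_disjoint) (use dj K in \<open>auto simp: disjoint_def pairwise_def disjnt_def\<close>)
  also have "\<dots> = r * card F" using K by simp
  finally show "card (\<Union>F) = r * card F" .
qed

lemma factorable_card: "factorable r E U \<Longrightarrow> finite U \<and> r dvd card U"
  unfolding factorable_def using tiling_card by fastforce

section \<open>Cliques on linear sets\<close>

text \<open>The average number of neighbours in \<open>B\<close> is at least \<open>k + c\<close>,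
  and the maximum is at most \<open>b\<close>, so at least a \<open>c / b\<close> fraction of
  \<open>Y\<close> has \<open>k + 1\<close> of them. There are at most \<open>2 ^ b\<close> traces
  on the bounded set \<open>B\<close>; a popular one supplies \<open>T\<close>.\<close>

lemma pigeon_common_nbrs:
  fixes k :: nat and c :: real
  assumes "finite B" "finite Y" "card B \<le> b" "0 < b" "0 < c" "0 < card Y"
    and sum: "(\<Sum>y\<in>Y. real (card (nb E y \<inter> B))) \<ge> (real k + c) * real (card Y)"
  obtains T Y' where "T \<subseteq> B" "card T = k + 1" "Y' \<subseteq> Y - B" "\<And>y t. y \<in> Y' \<Longrightarrow> t \<in> T \<Longrightarrow> {t, y} \<in> E"
      "real (card Y') \<ge> c * real (card Y) / (b * 2 ^ b) - b"
proof -
  let ?N = "\<lambda>y. nb E y \<inter> B"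
  define Y1 where "Y1 = {y\<in>Y. k + 1 \<le> card (?N y)}"
  have fY1: "finite Y1" "Y1 \<subseteq> Y" using assms(2) by (auto simp: Y1_def)
  have "(\<Sum>y\<in>Y. real (card (?N y))) \<le> (\<Sum>y\<in>Y. real b * of_bool (y \<in> Y1) + real k)"
  proof (intro sum_mono)
    fix y assume y: "y \<in> Y"
    have "card (?N y) \<le> card B" using assms(1) by (intro card_mono) auto
    then show "real (card (?N y)) \<le> real b * of_bool (y \<in> Y1) + real k"
      using assms(3) y by (cases "y \<in> Y1") (auto simp: Y1_def)
  qed
  also have "\<dots> = b * real (card Y1) + k * real (card Y)"
  proof -
    have "Y \<inter> {y. y \<in> Y1} = Y1" using fY1 by auto
    then have "(\<Sum>y\<in>Y. of_bool (y \<in> Y1)) = real (card Y1)" using assms(2) by simp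
    then show ?thesis by (simp only: sum.distrib sum_distrib_left[symmetric]) simp
  qed
  finally have Y1: "c * real (card Y) \<le> b * real (card Y1)"
    using sum by (simp add: algebra_simps)
  have "0 < c * real (card Y)" using assms by simp
  then have "Y1 \<noteq> {}" using Y1 by auto
  have "\<exists>T\<in>Pow B. real (card {y\<in>Y1. ?N y = T}) \<ge> real (card Y1) / 2 ^ b"
  proof (rule ccontr)
    assume neg: "\<not> ?thesis"
    have "card (\<Union>T\<in>Pow B. {y\<in>Y1. ?N y = T}) \<le> (\<Sum>T\<in>Pow B. card {y\<in>Y1. ?N y = T})"
      by (rule card_UN_le) (use assms(1) in simp)
    also have "(\<Union>T\<in>Pow B. {y\<in>Y1. ?N y = T}) = Y1"
    proof (intro equalityI subsetI)
      fix y assume "y \<in> Y1"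
      then show "y \<in> (\<Union>T\<in>Pow B. {y\<in>Y1. ?N y = T})" by (intro UN_I[of "?N y"]) simp_all
    qed (elim UN_E CollectE conjE)
    finally have "real (card Y1) \<le> (\<Sum>T\<in>Pow B. real (card {y\<in>Y1. ?N y = T}))"
      unfolding of_nat_sum[symmetric] of_nat_le_iff .
    also have "\<dots> < (\<Sum>T\<in>Pow B. real (card Y1) / 2 ^ b)"
      using neg assms(1) by (intro sum_strict_mono) (auto simp: not_le)
    also have "\<dots> = 2 ^ card B * (real (card Y1) / 2 ^ b)" using assms(1) by (simp add: card_Pow)
    also have "\<dots> \<le> 2 ^ b * (real (card Y1) / 2 ^ b)"
      using assms(3) by (intro mult_right_mono) (auto intro: power_increasing)
    finally show False by simp
  qed
  then obtain T where T: "T \<subseteq> B" "real (card {y\<in>Y1. ?N y = T}) \<ge> real (card Y1) / 2 ^ b" by auto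
  have "card {y\<in>Y1. ?N y = T} > 0"
  proof -
    have "0 < real (card Y1) / 2 ^ b"
      using \<open>Y1 \<noteq> {}\<close> fY1 assms(2) by (simp add: card_gt_0_iff finite_subset)
    then show ?thesis using T(2) by linarith
  qed
  then have "{y\<in>Y1. ?N y = T} \<noteq> {}" by fastforce
  then obtain y0 where y0: "y0 \<in> Y1" "?N y0 = T" by blast
  then have "k + 1 \<le> card T" by (auto simp: Y1_def)
  then obtain T' where T': "T' \<subseteq> T" "card T' = k + 1" by (meson obtain_subset_with_card_n)
  \<comment> \<open>Removing \<open>B\<close> makes \<open>T\<close> and \<open>Y'\<close> disjoint;
    it costs the summand \<open>- b\<close>.\<close>
  define Y' where "Y' = {y\<in>Y1. ?N y = T} - B"
  have "card {y\<in>Y1. ?N y = T} \<le> card Y' + card B"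
    unfolding Y'_def using assms(1) diff_card_le_card_Diff[of B "{y\<in>Y1. ?N y = T}"] by linarith
  moreover have "real (card Y1) / 2 ^ b \<ge> c * real (card Y) / (b * 2 ^ b)"
  proof -
    have "c * real (card Y) / b \<le> real (card Y1)" using Y1 assms(4) by (simp add: field_simps)
    then have "c * real (card Y) / b / 2 ^ b \<le> real (card Y1) / 2 ^ b" by (rule divide_right_mono) simp
    then show ?thesis by simp
  qed
  ultimately have "real (card Y') \<ge> c * real (card Y) / (b * 2 ^ b) - b"
    using T(2) assms(3) by linarith
  moreover have "{t, y} \<in> E" if "y \<in> Y'" "t \<in> T'" for y t
  proof -
    have "t \<in> ?N y" using that T' by (auto simp: Y'_def)
    then show ?thesis by (auto simp: nb_def insert_commute)
  qed
  moreover have "Y' \<subseteq> Y - B" using fY1 by (auto simp: Y'_def)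
  ultimately show ?thesis using that(1)[of T' Y'] T' T(1) by (meson order_trans)
qed

text \<open>Many vertices of \<open>X\<close> see more than half of \<open>Y\<close>, so there is an
  \<open>l\<close>-clique \<open>B\<close> among them. Then the vertices of \<open>Y\<close> see
  more than half of \<open>B\<close> on average, so \<open>l div 2 + 1\<close> vertices of
  \<open>B\<close> have a linear common neighbourhood in \<open>Y\<close>, which contains a second
  \<open>l\<close>-clique.\<close>

lemma dense_pair_clique:
  fixes l :: nat and a c :: real
  assumes G: "simple_graph V E" and D: "K_dense l V E a" and l: "0 < l"
    and XY: "X \<subseteq> V" "Y \<subseteq> V" and c: "0 < c"
    and e: "ee E X Y \<ge> (1/2 + c) * real (card X) * real (card Y)"
    and X: "0 < card X" "a \<le> c / 2 * real (card X)"
    and Y: "0 < card Y" "a + l \<le> c / 2 * real (card Y) / 2 ^ l"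
  obtains T Q where "T \<subseteq> X" "Q \<subseteq> Y" "T \<inter> Q = {}" "card T = l div 2 + 1" "card Q = l"
    "is_K (l div 2 + 1 + l) E (T \<union> Q)"
proof -
  have fin: "finite V" "finite X" "finite Y"
    using G XY by (auto simp: simple_graph_def intro: finite_subset)
  define d where "d x = real (card (nb E x \<inter> Y))" for x
  define X1 where "X1 = {x\<in>X. d x \<ge> (1/2 + c/2) * card Y}"
  have "ee E X Y \<le> (\<Sum>x\<in>X. real (card Y) * of_bool (x \<in> X1) + (1/2 + c/2) * card Y)"
    unfolding ee_eq_sum_card[OF fin(3)]
  proof (intro sum_mono)
    fix x assume x: "x \<in> X"
    have "card (nb E x \<inter> Y) \<le> card Y" using fin by (intro card_mono) auto
    then show "real (card (nb E x \<inter> Y)) \<le> real (card Y) * of_bool (x \<in> X1) + (1/2 + c/2) * card Y"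
      using x c by (cases "x \<in> X1") (auto simp: X1_def d_def intro: add_increasing2)
  qed
  also have "\<dots> = card Y * real (card X1) + (1/2 + c/2) * card Y * card X"
  proof -
    have "X \<inter> {x. x \<in> X1} = X1" by (auto simp: X1_def)
    then have "(\<Sum>x\<in>X. of_bool (x \<in> X1)) = real (card X1)" using fin by simp
    then show ?thesis by (simp only: sum.distrib sum_distrib_left[symmetric]) simp
  qed
  finally have "card Y * (c/2 * card X) \<le> card Y * real (card X1)"
    using e by (simp add: algebra_simps)
  then have "c/2 * card X \<le> real (card X1)" using Y(1) by simp
  then have "a \<le> real (card X1)" using X by linarith
  then obtain B where B: "B \<subseteq> X1" "is_K l E B"
    using K_dense_obtain[OF D, of X1] XY by (auto simp: X1_def)
  have fB: "finite B" "card B = l" using B by (auto simp: is_K_def)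
  have "(\<Sum>y\<in>Y. real (card (nb E y \<inter> B))) = ee E B Y"
    using fB by (subst ee_commute) (simp add: ee_eq_sum_card)
  also have "\<dots> = (\<Sum>x\<in>B. d x)" using fin by (simp add: ee_eq_sum_card d_def)
  also have "\<dots> \<ge> (\<Sum>x\<in>B. (1/2 + c/2) * card Y)"
    using B by (intro sum_mono) (auto simp: X1_def)
  finally have s: "(\<Sum>y\<in>Y. real (card (nb E y \<inter> B))) \<ge> l * ((1/2 + c/2) * card Y)"
    using fB by simp
  \<comment> \<open>Rounding \<open>l / 2\<close> down is harmless: the excess
    \<open>l * c / 2\<close> still forces one vertex more than \<open>l div 2\<close>.\<close>
  have half: "real (l div 2) \<le> l / 2" by linarith
  have "(real (l div 2) + l * c / 2) * card Y \<le> l * ((1/2 + c/2) * card Y)"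
    using mult_right_mono[OF half, of "real (card Y)"] by (simp add: algebra_simps)
  with s have s': "(real (l div 2) + l * c / 2) * card Y \<le> (\<Sum>y\<in>Y. real (card (nb E y \<inter> B)))" by linarith
  obtain T Y' where T: "T \<subseteq> B" "card T = l div 2 + 1" "Y' \<subseteq> Y - B"
      "\<And>y t. y \<in> Y' \<Longrightarrow> t \<in> T \<Longrightarrow> {t, y} \<in> E"
      "real (card Y') \<ge> l * c / 2 * real (card Y) / (l * 2 ^ l) - l"
    using pigeon_common_nbrs[OF fB(1) fin(3) _ l _ Y(1) s'] fB l c by (metis order.refl divide_pos_pos mult_pos_pos of_nat_0_less_iff zero_less_numeral)
  have "l * c / 2 * real (card Y) / (l * 2 ^ l) = c / 2 * real (card Y) / 2 ^ l"
    using l by simp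
  then have "a \<le> real (card Y')" using T(5) Y(2) by linarith
  then obtain Q where Q: "Q \<subseteq> Y'" "is_K l E Q"
    using K_dense_obtain[OF D, of Y'] T(3) XY by blast
  have "is_K (card T + l) E (T \<union> Q)"
    by (rule is_K_Un[OF is_K_subset[OF B(2) T(1)] Q(2)]) (use T Q in blast)+
  moreover have "T \<inter> Q = {}" "T \<subseteq> X" "Q \<subseteq> Y" using T Q B by (auto simp: X1_def)
  moreover have "card Q = l" using Q by (simp add: is_K_def)
  ultimately show ?thesis using that T(2) by metis
qed

text \<open>In a maximum tiling with a large uncovered set \<open>U\<close>, some tile sends at least \<open>r / 2\<close> edges
  on average to the vertices of \<open>U\<close>. As \<open>2 * (r - l) \<le> r / 2\<close>, this tile contains two
  disjoint sets of size \<open>r - l\<close> that extend to two copies of \<open>K\<^sub>r\<close> inside \<open>U\<close>.\<close>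

lemma almost_perfect_tiling:
  fixes l r :: nat and a :: real
  assumes G: "simple_graph V E" and D: "K_dense l V E a" and a: "1 \<le> a"
    and lr: "l < r" "3 * r \<le> 4 * l"
    and deg: "\<And>v. v \<in> V \<Longrightarrow> real (card V) / 2 \<le> real (card (nb E v))"
  shows "\<exists>F. tiling r E F \<and> \<Union>F \<subseteq> V \<and> real (card (V - \<Union>F)) \<le> (4 * r * 2 ^ r * (2 * r + 1)) * a"
proof -
  have r0: "0 < r" using lr by auto
  have fV: "finite V" using G by (simp add: simple_graph_def)
  define \<C> where "\<C> = {F. tiling r E F \<and> \<Union>F \<subseteq> V}"
  have "finite \<C>" by (rule finite_subset[of _ "Pow (Pow V)"]) (use fV in \<open>auto simp: \<C>_def\<close>)
  moreover have "{} \<in> \<C>" by (auto simp: \<C>_def tiling_def)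
  ultimately obtain F where F: "F \<in> \<C>" and max: "\<And>F'. F' \<in> \<C> \<Longrightarrow> card F' \<le> card F"
    using Max_in[of "card ` \<C>"] Max_ge[of "card ` \<C>"] by (smt (verit, best) empty_iff finite_imageI image_iff image_is_empty)
  have tF: "tiling r E F" "\<Union>F \<subseteq> V" using F by (auto simp: \<C>_def)
  have finF: "finite F" and KF: "\<And>K. K \<in> F \<Longrightarrow> is_K r E K" using tF by (auto simp: tiling_def)
  define U where "U = V - \<Union>F"
  have UV: "U \<subseteq> V" "finite U" using fV by (auto simp: U_def)
  have cardV: "card V = card U + r * card F"
    using tiling_card[OF tF(1)] tF(2) fV by (simp add: U_def card_Diff_subset) (metis card_mono le_add_diff_inverse2)
  have noK: "\<not> (\<exists>S\<subseteq>U. is_K r E S)"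
  proof
    assume "\<exists>S\<subseteq>U. is_K r E S"
    then obtain S where S: "S \<subseteq> U" "is_K r E S" by auto
    have "tiling r E {S}" using S by (simp add: tiling_def)
    then have "tiling r E (F \<union> {S})"
      using tiling_Un[OF tF(1), of "{S}"] S by (auto simp: U_def)
    then have "F \<union> {S} \<in> \<C>" using S tF UV by (auto simp: \<C>_def)
    moreover have "S \<noteq> {}" using S(2) r0 by (auto simp: is_K_def)
    then have "S \<notin> F" using S(1) unfolding U_def by blast
    ultimately show False using max[of "F \<union> {S}"] finF by simp
  qed
  show ?thesis
  proof (rule ccontr)
    assume neg: "\<not> ?thesis"
    have bigU: "real (card U) > (4 * r * 2 ^ r * (2 * r + 1)) * a"
    proof -
      have "\<not> real (card U) \<le> (4 * r * 2 ^ r * (2 * r + 1)) * a"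
        using neg tF unfolding U_def by blast
      then show ?thesis by (simp only: not_le)
    qed
    have r1: "1 \<le> real r" using r0 by simp
    \<comment> \<open>Vertices with many neighbours inside the uncovered set. There are fewer than
      \<open>a\<close> of them: by \<open>r - l \<le> l / 2\<close>, some \<open>r - l\<close>
      vertices of an \<open>l\<close>-clique among them would share a linear neighbourhood in
      \<open>U\<close>, and an \<open>l\<close>-clique there would complete an uncovered
      \<open>r\<close>-clique.\<close>
    define U1 where "U1 = {u\<in>U. real (card (nb E u \<inter> U)) \<ge> card U / 2}"
    \<comment> \<open>The constant in the statement is chosen for this: even half of
      \<open>U\<close> leaves \<open>2 * r * a\<close> vertices after the pigeonhole loss
      \<open>r * 2 ^ r\<close>, enough for two disjoint \<open>l\<close>-cliques.\<close>
    have key: "2 * real r * a \<le> real (card U0) / (r * 2 ^ r) - r" if "2 * real (card U0) \<ge> card U" for U0 :: "'a set"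
    proof -
      have "(2 * r * (2 ^ r) * (2 * r + 1)) * a \<le> real (card U0)" using that bigU by linarith
      then have "(r * 2 ^ r) * (2 * (2 * r + 1) * a) \<le> real (card U0)" by (simp add: algebra_simps)
      then have "2 * (2 * r + 1) * a \<le> real (card U0) / (r * 2 ^ r)"
        using r0 by (simp add: field_simps)
      moreover have "real r \<le> real r * a" using a r1 by simp
      moreover have "2 * (2 * r + 1) * a = 4 * (r * a) + 2 * a" "2 * real r * a = 2 * (r * a)"
        by (simp_all add: algebra_simps)
      ultimately show ?thesis using a by linarith
    qed
    have cU: "0 < card U" using bigU a r0
      by (metis (no_types, opaque_lifting) less_le_trans mult_nonneg_nonneg not_less of_nat_0_le_iff of_nat_0_less_iff order_trans zero_le_one)
    have U1: "real (card U1) < a"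
    proof (rule ccontr)
      assume "\<not> real (card U1) < a"
      then obtain B where B: "B \<subseteq> U1" "is_K l E B"
        using K_dense_obtain[OF D, of U1] UV by (auto simp: U1_def)
      have fB: "finite B" "card B = l" using B by (auto simp: is_K_def)
      have "(\<Sum>y\<in>U. real (card (nb E y \<inter> B))) = ee E B U"
        using fB by (subst ee_commute) (simp add: ee_eq_sum_card)
      also have "\<dots> = (\<Sum>x\<in>B. real (card (nb E x \<inter> U)))" using UV by (simp add: ee_eq_sum_card)
      also have "\<dots> \<ge> (\<Sum>x\<in>B. card U / 2)" using B by (intro sum_mono) (auto simp: U1_def)
      finally have "l / 2 * card U \<le> (\<Sum>y\<in>U. real (card (nb E y \<inter> B)))" using fB by simp
      moreover have "real (r - l - 1) + 1 \<le> l / 2" using lr by (simp add: of_nat_diff)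
      then have "(real (r - l - 1) + 1) * card U \<le> l / 2 * card U" by (rule mult_right_mono) simp
      ultimately have s: "(real (r - l - 1) + 1) * card U \<le> (\<Sum>y\<in>U. real (card (nb E y \<inter> B)))" by linarith
      have lr': "card B \<le> r" using fB lr by simp
      from pigeon_common_nbrs[OF fB(1) UV(2) lr' r0 zero_less_one cU s] obtain T Y'
        where T: "T \<subseteq> B" "card T = r - l - 1 + 1" "Y' \<subseteq> U - B"
          "\<And>y t. y \<in> Y' \<Longrightarrow> t \<in> T \<Longrightarrow> {t, y} \<in> E"
          "real (card Y') \<ge> 1 * real (card U) / (r * 2 ^ r) - r"
        by blast
      have "2 * r * a \<le> real (card Y')" using key[of U] T(5) by simp
      then have "a \<le> real (card Y')" using r1 a mult_right_mono[of 1 "2 * real r" a] by linarith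
      then obtain Q where Q: "Q \<subseteq> Y'" "is_K l E Q"
        using K_dense_obtain[OF D, of Y'] T(3) UV by blast
      have "is_K (card T + l) E (T \<union> Q)"
        by (rule is_K_Un[OF is_K_subset[OF B(2) T(1)] Q(2)]) (use T Q in blast)+
      moreover have "card T + l = r" using T(2) lr by simp
      ultimately have "is_K r E (T \<union> Q)" by simp
      moreover have "T \<union> Q \<subseteq> U" using T Q B by (auto simp: U1_def)
      ultimately show False using noK by blast
    qed
    define U0 where "U0 = U - U1"
    have U0: "U0 \<subseteq> U" "finite U0" using UV by (auto simp: U0_def)
    have "card U \<le> card U0 + card U1"
      using diff_card_le_card_Diff[of U1 U] UV(2) by (simp add: U0_def U1_def)
    moreover have "2 * a \<le> card U"
    proof -
      have "1 * 1 * 1 \<le> r * 2 ^ r * (2 * r + 1)"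
        by (intro mult_le_mono) (use r0 in simp_all)
      moreover have "4 * r * 2 ^ r * (2 * r + 1) = 4 * (r * 2 ^ r * (2 * r + 1))"
        by (simp only: mult.assoc)
      ultimately have "2 \<le> 4 * r * 2 ^ r * (2 * r + 1)" by linarith
      then have "real 2 \<le> real (4 * r * 2 ^ r * (2 * r + 1))" by (simp only: of_nat_le_iff)
      then have "real 2 * a \<le> (4 * r * 2 ^ r * (2 * r + 1)) * a"
        by (rule mult_right_mono) (use a in linarith)
      then have "2 * a \<le> (4 * r * 2 ^ r * (2 * r + 1)) * a" by (simp only: of_nat_numeral)
      then show ?thesis using bigU by linarith
    qed
    ultimately have U0big: "2 * real (card U0) \<ge> card U" using U1 by linarith
    have cU0: "0 < card U0" using U0big cU by linarith
    \<comment> \<open>A vertex outside \<open>U1\<close> has at most \<open>card U / 2\<close>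
      neighbours in \<open>U\<close>, so it is adjacent to at least half of the covered
      vertices.\<close>
    have tile_deg: "(\<Sum>K\<in>F. real (card (nb E u \<inter> K))) \<ge> r / 2 * card F" if u: "u \<in> U0" for u
    proof -
      have "card V / 2 \<le> real (card (nb E u))" using deg u U0 UV by auto
      moreover have "real (card (nb E u)) \<le> real (card (nb E u \<inter> U)) + (\<Sum>K\<in>F. real (card (nb E u \<inter> K)))"
      proof -
        have "nb E u \<subseteq> (nb E u \<inter> U) \<union> (\<Union>K\<in>F. nb E u \<inter> K)"
          using nb_subset[OF G, of u] by (auto simp: U_def)
        then have "card (nb E u) \<le> card ((nb E u \<inter> U) \<union> (\<Union>K\<in>F. nb E u \<inter> K))"
          using finF finite_nb[OF G, of u] by (intro card_mono) auto
        also have "\<dots> \<le> card (nb E u \<inter> U) + card (\<Union>K\<in>F. nb E u \<inter> K)" by (rule card_Un_le)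
        also have "card (\<Union>K\<in>F. nb E u \<inter> K) \<le> (\<Sum>K\<in>F. card (nb E u \<inter> K))" by (rule card_UN_le[OF finF])
        finally show ?thesis unfolding of_nat_sum[symmetric] of_nat_add[symmetric] of_nat_le_iff by simp
      qed
      moreover have "real (card (nb E u \<inter> U)) \<le> card U / 2" using u by (auto simp: U0_def U1_def)
      moreover have "real (card V) = card U + r * card F" using cardV by simp
      ultimately show ?thesis by (simp add: field_simps)
    qed
    have F0: "F \<noteq> {}"
    proof
      assume "F = {}"
      then have "U = V" by (simp add: U_def)
      then have "U1 = U" using deg UV nb_subset[OF G] by (auto simp: U1_def Int_absorb2)
      then show False using U0_def cU0 by simp
    qed
    obtain K where K: "K \<in> F" "(\<Sum>u\<in>U0. real (card (nb E u \<inter> K))) \<ge> r / 2 * card U0"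
    proof (rule ccontr)
      assume neg: "\<not> thesis"
      have "(\<Sum>K\<in>F. \<Sum>u\<in>U0. real (card (nb E u \<inter> K))) < (\<Sum>K\<in>F. r / 2 * card U0)"
      proof (intro sum_strict_mono finF F0)
        fix K assume "K \<in> F"
        then show "(\<Sum>u\<in>U0. real (card (nb E u \<inter> K))) < r / 2 * card U0"
          using neg that by (meson not_le)
      qed
      also have "\<dots> = (\<Sum>u\<in>U0. r / 2 * card F)" by simp
      also have "\<dots> \<le> (\<Sum>u\<in>U0. \<Sum>K\<in>F. real (card (nb E u \<inter> K)))"
        using tile_deg by (intro sum_mono) auto
      also have "\<dots> = (\<Sum>K\<in>F. \<Sum>u\<in>U0. real (card (nb E u \<inter> K)))" by (rule sum.swap)
      finally show False by simp
    qed
    define k where "k = 2 * (r - l) - 1"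
    have "real k + 1 \<le> r / 2" using lr by (simp add: k_def of_nat_diff)
    then have "(real k + 1) * card U0 \<le> r / 2 * card U0" by (rule mult_right_mono) simp
    then have s: "(real k + 1) * card U0 \<le> (\<Sum>u\<in>U0. real (card (nb E u \<inter> K)))" using K(2) by linarith
    have fK: "finite K" "card K \<le> r" using KF[OF K(1)] by (auto simp: is_K_def)
    from pigeon_common_nbrs[OF fK(1) U0(2) fK(2) r0 zero_less_one cU0 s] obtain T Y'
      where T: "T \<subseteq> K" "card T = k + 1" "Y' \<subseteq> U0 - K"
        "\<And>y t. y \<in> Y' \<Longrightarrow> t \<in> T \<Longrightarrow> {t, y} \<in> E"
        "real (card Y') \<ge> 1 * real (card U0) / (r * 2 ^ r) - r"
      by blast
    have Y': "2 * r * a \<le> real (card Y')" using key[OF U0big] T(5) by simp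
    have ra: "a \<le> r * a" "real r \<le> r * a" using r1 a mult_right_mono[of 1 "real r" a] mult_left_mono[of 1 a "real r"] by auto
    have Y'V: "Y' \<subseteq> V" "finite Y'" using T(3) U0 UV by (auto intro: finite_subset)
    obtain Q1 where Q1: "Q1 \<subseteq> Y'" "is_K l E Q1"
    proof -
      have "a \<le> real (card Y')" using Y' ra a by linarith
      then show ?thesis using K_dense_obtain[OF D Y'V(1)] that by blast
    qed
    have "card Q1 = l" "finite Q1" using Q1 by (auto simp: is_K_def)
    then have "card (Y' - Q1) + l = card Y'" using Q1 Y'V by (metis card_Diff_subset card_mono le_add_diff_inverse2)
    then have "a \<le> real (card (Y' - Q1))" using Y' ra lr by linarith
    then obtain Q2 where Q2: "Q2 \<subseteq> Y' - Q1" "is_K l E Q2"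
      using K_dense_obtain[OF D, of "Y' - Q1"] Y'V by (metis Diff_subset order_trans)
    have k: "k + 1 = (r - l) + (r - l)" using lr by (simp add: k_def)
    obtain T1 where T1: "T1 \<subseteq> T" "card T1 = r - l"
      using obtain_subset_with_card_n[of "r - l" T] T(2) k by (metis le_add1)
    define T2 where "T2 = T - T1"
    have fT: "finite T" by (rule finite_subset[OF T(1) fK(1)])
    have T2: "T2 \<subseteq> T" "card T2 = r - l" "T1 \<inter> T2 = {}"
      using T1 T(2) k fT by (auto simp: T2_def card_Diff_subset finite_subset)
    have KT: "T1 \<subseteq> K" "T2 \<subseteq> K" using T1 T2 T by auto
    have "is_K (card T1 + l) E (T1 \<union> Q1)"
      by (rule is_K_Un[OF is_K_subset[OF KF[OF K(1)] KT(1)] Q1(2)]) (use T1 T Q1 in blast)+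
    then have K1: "is_K r E (T1 \<union> Q1)" using lr T1(2) by simp
    have "is_K (card T2 + l) E (T2 \<union> Q2)"
      by (rule is_K_Un[OF is_K_subset[OF KF[OF K(1)] KT(2)] Q2(2)]) (use T2(1) T Q2 in blast)+
    then have K2: "is_K r E (T2 \<union> Q2)" using lr T2(2) by simp
    have Kdis: "\<And>K'. K' \<in> F \<Longrightarrow> K' \<noteq> K \<Longrightarrow> K' \<inter> K = {}"
      using tF K(1) by (auto simp: tiling_def disjoint_def)
    have QU: "Q1 \<subseteq> U" "Q2 \<subseteq> U" using Q1 Q2 T(3) U0 by auto
    have QK: "Q1 \<inter> \<Union>F = {}" "Q2 \<inter> \<Union>F = {}" using QU by (auto simp: U_def)
    have TQ: "T1 \<inter> Q2 = {}" "T2 \<inter> Q1 = {}"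
    proof -
      have "K \<subseteq> \<Union>F" using K(1) by blast
      then show "T1 \<inter> Q2 = {}" "T2 \<inter> Q1 = {}" using KT QK by blast+
    qed
    have dis12: "(T1 \<union> Q1) \<inter> (T2 \<union> Q2) = {}"
      using T2(3) Q2(1) TQ by blast
    \<comment> \<open>Swapping \<open>K\<close> for the two new cliques enlarges the tiling by one,
      against maximality.\<close>
    define F' where "F' = (F - {K}) \<union> {T1 \<union> Q1, T2 \<union> Q2}"
    have t1: "tiling r E (F - {K})" using tF by (auto simp: tiling_def disjoint_def)
    have ne: "T1 \<noteq> {}" "T2 \<noteq> {}" using T1 T2 lr by auto
    have t2: "tiling r E {T1 \<union> Q1, T2 \<union> Q2}"
      using K1 K2 dis12 by (auto simp: tiling_def disjoint_def)
    have "\<Union>(F - {K}) \<inter> \<Union>{T1 \<union> Q1, T2 \<union> Q2} = {}"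

    proof -
      have "\<Union>(F - {K}) \<inter> K = {}" using Kdis by blast
      moreover have "\<Union>(F - {K}) \<subseteq> \<Union>F" by blast
      ultimately show ?thesis using KT QK by blast
    qed
    then have "tiling r E F'" unfolding F'_def by (rule tiling_Un[OF t1 t2])
    moreover have "\<Union>F' \<subseteq> V" using tF(2) KT K(1) QU UV by (auto simp: F'_def)
    ultimately have "F' \<in> \<C>" by (simp add: \<C>_def)
    then have le: "card F' \<le> card F" by (rule max)
    have n1: "T1 \<union> Q1 \<notin> F - {K}" using Kdis KT ne by blast
    have n2: "T2 \<union> Q2 \<notin> F - {K}" using Kdis KT ne by blast
    have n3: "T1 \<union> Q1 \<noteq> T2 \<union> Q2" using dis12 ne by blast
    have "card F' = card (F - {K}) + 2"
      using n1 n2 n3 finF by (simp add: F'_def)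
    moreover have "card (F - {K}) = card F - 1" "0 < card F" using K(1) finF F0 by (auto simp: card_gt_0_iff)
    ultimately show False using le by simp
  qed
qed

section \<open>The Ramsey--Turan density\<close>

text \<open>The bound on edge counts makes the supremum over naturals an attained maximum, except
  for the default value 0 when no graph qualifies. An extremal graph may therefore be picked only
  after the value 0 has been excluded.\<close>

lemma RT_cases:
  "RT l n s a = 0 \<or> (\<exists>(V :: nat set) E. simple_graph V E \<and> card V = n \<and> K_free s V E \<and>
     real (indep_number l V E) \<le> a \<and> card E = RT l n s a)"
  and RT_upper_bound: "2 * real (RT l n s a) \<le> (real n)\<^sup>2"
  and RT_ge: "simple_graph V E \<Longrightarrow> card V = n \<Longrightarrow> K_free s V E \<Longrightarrow>
     real (indep_number l V E) \<le> a \<Longrightarrow> card (E :: nat set set) \<le> RT l n s a"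
proof -
  let ?S = "{card E | (V :: nat set) E. simple_graph V E \<and> card V = n \<and> K_free s V E \<and>
     real (indep_number l V E) \<le> a}"
  have bound: "2 * real (card E) \<le> (real n)\<^sup>2" if "simple_graph V E" "card V = n" for V and E :: "nat set set"
    using double_card_edges[OF that(1)] ee_le[of E V V] that(2) by (simp add: power2_eq_square)
  have "?S \<subseteq> {..n * n}"
  proof
    fix x assume "x \<in> ?S"
    then obtain V and E :: "nat set set" where "simple_graph V E" "card V = n" "x = card E" by blast
    then have "2 * real x \<le> real n * real n" using bound[of V E] by (simp add: power2_eq_square)
    then have "2 * x \<le> n * n" by (metis of_nat_le_iff of_nat_mult of_nat_numeral)
    then show "x \<in> {..n * n}" by simp
  qed
  then have fin: "finite ?S" by (rule finite_subset) simp
  have RT: "RT l n s a = (if ?S = {} then 0 else Max ?S)"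
    unfolding RT_def by (rule Sup_nat_def)
  have 1: "RT l n s a = 0 \<or> (\<exists>(V :: nat set) E. simple_graph V E \<and> card V = n \<and> K_free s V E \<and>
     real (indep_number l V E) \<le> a \<and> card E = RT l n s a)"
  proof (cases "?S = {}")
    case False
    have "RT l n s a = Max ?S" by (rule trans[OF RT]) (rule if_not_P[OF False])
    moreover have "Max ?S \<in> ?S" by (rule Max_in[OF fin False])
    ultimately obtain V and E :: "nat set set" where "RT l n s a = card E" "simple_graph V E"
      "card V = n" "K_free s V E" "real (indep_number l V E) \<le> a" by auto
    then show ?thesis by metis
  qed (use RT in simp)
  then show "RT l n s a = 0 \<or> (\<exists>(V :: nat set) E. simple_graph V E \<and> card V = n \<and> K_free s V E \<and>
     real (indep_number l V E) \<le> a \<and> card E = RT l n s a)" .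
  show "2 * real (RT l n s a) \<le> (real n)\<^sup>2"
  proof (cases "RT l n s a = 0")
    case False
    then obtain V and E :: "nat set set" where "simple_graph V E" "card V = n" "card E = RT l n s a"
      using 1 by metis
    then show ?thesis using bound[of V E] by simp
  qed simp
  show "card (E :: nat set set) \<le> RT l n s a" if "simple_graph V E" "card V = n" "K_free s V E"
     "real (indep_number l V E) \<le> a" for V E
  proof -
    have "card E \<in> ?S" using that by blast
    then show ?thesis using RT Max_ge[OF fin, of "card E"] by auto
  qed
qed

section \<open>Monotonicity, blow-ups and mixtures\<close>

lemma RT_mono:
  assumes "a \<le> b"
  shows "RT l n s a \<le> RT l n s b"
  using RT_cases[of l n s a] RT_ge[of _ _ n s l b] assms by (metis le0 order_trans)

text \<open>Each vertex \<open>v\<close> becomes an independent set of \<open>w v\<close> twins. A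
  clique meets every twin class at most once, so K_s-freeness survives; conversely a clique in the
  projection of a set lifts to that set by choosing representatives, so a K_l-free set is bounded by
  the weight of its projection.\<close>

lemma blow_up_RT:
  fixes V :: "'a::countable set" and w :: "'a \<Rightarrow> nat"
  assumes G: "simple_graph V E" and Kf: "K_free s V E" and l: "0 < l"
    and wt: "\<And>U. U \<subseteq> V \<Longrightarrow> K_free l U E \<Longrightarrow> real (\<Sum>v\<in>U. w v) \<le> a"
  shows "(\<Sum>u\<in>V. \<Sum>v\<in>V. of_bool ({u, v} \<in> E) * real (w u) * real (w v)) \<le> 2 * real (RT l (\<Sum>v\<in>V. w v) s a)"
proof -
  have fV: "finite V" using G by (simp add: simple_graph_def)
  \<comment> \<open>Countability of the vertex type serves to encode the twins as natural numbers,
    the vertex type in \<open>RT\<close>.\<close>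
  define \<Sigma> where "\<Sigma> = (SIGMA v:V. {..<w v})"
  define V' where "V' = to_nat ` \<Sigma>"
  define \<pi> :: "nat \<Rightarrow> 'a" where "\<pi> x = fst (from_nat x :: 'a \<times> nat)" for x
  define E' where "E' = {{x, y} | x y. x \<in> V' \<and> y \<in> V' \<and> {\<pi> x, \<pi> y} \<in> E}"
  have "finite \<Sigma>" using fV by (simp add: \<Sigma>_def)
  then have fV': "finite V'" by (simp add: V'_def)
  have \<pi>V: "\<pi> x \<in> V" if "x \<in> V'" for x using that by (auto simp: V'_def \<Sigma>_def \<pi>_def)
  have E': "{x, y} \<in> E' \<longleftrightarrow> x \<in> V' \<and> y \<in> V' \<and> {\<pi> x, \<pi> y} \<in> E" for x y
    by (auto simp: E'_def doubleton_eq_iff insert_commute)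
  have ne: "\<pi> x \<noteq> \<pi> y" if "{\<pi> x, \<pi> y} \<in> E" for x y
    using that not_loop[OF G, of "\<pi> x"] by auto
  have G': "simple_graph V' E'"
  proof -
    have "e \<subseteq> V' \<and> card e = 2" if e: "e \<in> E'" for e
    proof -
      obtain x y where xy: "e = {x, y}" "x \<in> V'" "y \<in> V'" "{\<pi> x, \<pi> y} \<in> E"
        using e unfolding E'_def by blast
      then have "x \<noteq> y" using ne by blast
      then show ?thesis using xy by simp
    qed
    then show ?thesis using fV' by (simp add: simple_graph_def)
  qed
  have project: "is_K m E (\<pi> ` S)" if "is_K m E' S" for m S
  proof -
    have adj: "{\<pi> x, \<pi> y} \<in> E" if "x \<in> S" "y \<in> S" "x \<noteq> y" for x y
      using that \<open>is_K m E' S\<close> E' by (auto simp: is_K_def clique_def)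
    then have "inj_on \<pi> S" using ne by (meson inj_onI)
    moreover have "clique (\<pi> ` S) E" unfolding clique_def using adj by blast
    ultimately show ?thesis using that by (simp add: is_K_def card_image)
  qed
  have K': "K_free s V' E'" unfolding K_free_def
  proof (intro notI, elim exE conjE)
    fix S assume "S \<subseteq> V'" "is_K s E' S"
    then have "\<pi> ` S \<subseteq> V" "is_K s E (\<pi> ` S)" using project \<pi>V by auto
    then show False using Kf by (auto simp: K_free_def)
  qed
  have fiber: "card {x\<in>V'. \<pi> x = v} = w v" if "v \<in> V" for v
  proof -
    have "{x\<in>V'. \<pi> x = v} = to_nat ` ({v} \<times> {..<w v})"
      using that by (force simp: V'_def \<pi>_def \<Sigma>_def)
    then show ?thesis by (simp add: card_image inj_on_def)
  qed
  have cU: "card U' \<le> (\<Sum>v\<in>\<pi> ` U'. w v)" if U': "U' \<subseteq> V'" for U'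
  proof -
    have fU: "finite U'" using U' fV' by (rule finite_subset)
    have "card U' \<le> card (\<Union>v\<in>\<pi> ` U'. {x\<in>V'. \<pi> x = v})"
      using U' fV' fU by (intro card_mono) auto
    also have "\<dots> \<le> (\<Sum>v\<in>\<pi> ` U'. card {x\<in>V'. \<pi> x = v})"
      using fU by (intro card_UN_le) simp
    also have "\<dots> = (\<Sum>v\<in>\<pi> ` U'. w v)" using fiber U' \<pi>V by (intro sum.cong) auto
    finally show ?thesis .
  qed
  have a0: "0 \<le> a" using wt[of "{}"] l by (simp add: K_free_def is_K_def)
  have ind: "real (indep_number l V' E') \<le> a"
    unfolding indep_number_le_iff[OF fV' l a0]
  proof (intro allI impI)
    fix U' assume U': "U' \<subseteq> V'" "K_free l U' E'"
    have "K_free l (\<pi> ` U') E" unfolding K_free_def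
    proof (intro notI, elim exE conjE)
      fix S assume S: "S \<subseteq> \<pi> ` U'" "is_K l E S"
      let ?\<sigma> = "inv_into U' \<pi>"
      have \<sigma>: "?\<sigma> v \<in> U'" "\<pi> (?\<sigma> v) = v" if "v \<in> S" for v
        using that S(1) by (auto intro: inv_into_into f_inv_into_f)
      have inj: "inj_on ?\<sigma> S" using \<sigma>(2) by (rule inj_on_inverseI)
      have "clique (?\<sigma> ` S) E'"
        unfolding clique_def
      proof (intro ballI impI)
        fix x y assume "x \<in> ?\<sigma> ` S" "y \<in> ?\<sigma> ` S" "x \<noteq> y"
        then obtain u v where uv: "x = ?\<sigma> u" "y = ?\<sigma> v" "u \<in> S" "v \<in> S" "u \<noteq> v" by auto
        then have "{u, v} \<in> E" using S(2) by (auto simp: is_K_def clique_def)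
        then show "{x, y} \<in> E'" using uv \<sigma> U'(1) by (auto simp: E')
      qed
      then have "is_K l E' (?\<sigma> ` S)" using S(2) inj by (simp add: is_K_def card_image)
      then show False using U'(2) \<sigma>(1) unfolding K_free_def by blast
    qed
    then have "real (\<Sum>v\<in>\<pi> ` U'. w v) \<le> a" using wt[of "\<pi> ` U'"] U' \<pi>V by blast
    then show "real (card U') \<le> a" using cU[OF U'(1)] by linarith
  qed
  have inj: "inj_on to_nat \<Sigma>" by (simp add: inj_on_def)
  have c: "card V' = (\<Sum>v\<in>V. w v)"
    using fV by (simp add: V'_def card_image[OF inj]) (simp add: \<Sigma>_def)
  have "(\<Sum>u\<in>V. \<Sum>v\<in>V. of_bool ({u, v} \<in> E) * real (w u) * real (w v)) =
     (\<Sum>u\<in>V. \<Sum>i<w u. \<Sum>v\<in>V. \<Sum>j<w v. of_bool ({u, v} \<in> E))"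
    by (simp add: sum_distrib_left sum_distrib_right mult_ac)
  also have "\<dots> = (\<Sum>p\<in>\<Sigma>. \<Sum>q\<in>\<Sigma>. of_bool ({fst p, fst q} \<in> E))"
  proof -
    have sig: "(\<Sum>p\<in>\<Sigma>. f (fst p)) = (\<Sum>v\<in>V. \<Sum>i<w v. f v)" for f :: "'a \<Rightarrow> real"
      unfolding \<Sigma>_def using sum.Sigma[of V "\<lambda>v. {..<w v}" "\<lambda>v i. f v"] fV by (simp add: split_def)
    have "(\<Sum>p\<in>\<Sigma>. \<Sum>q\<in>\<Sigma>. of_bool ({fst p, fst q} \<in> E)) =
        (\<Sum>p\<in>\<Sigma>. \<Sum>v\<in>V. \<Sum>j<w v. (of_bool ({fst p, v} \<in> E) :: real))"
      by (intro sum.cong refl sig)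
    also have "\<dots> = (\<Sum>u\<in>V. \<Sum>i<w u. \<Sum>v\<in>V. \<Sum>j<w v. of_bool ({u, v} \<in> E))"
      by (rule sig)
    finally show ?thesis by simp
  qed
  also have "\<dots> = (\<Sum>p\<in>\<Sigma>. \<Sum>q\<in>\<Sigma>. of_bool ({to_nat p, to_nat q} \<in> E'))"
  proof (intro sum.cong refl)
    fix p q assume "p \<in> \<Sigma>" "q \<in> \<Sigma>"
    then have "to_nat p \<in> V'" "to_nat q \<in> V'" by (auto simp: V'_def)
    then show "of_bool ({fst p, fst q} \<in> E) = (of_bool ({to_nat p, to_nat q} \<in> E') :: real)"
      by (simp add: E' \<pi>_def)
  qed
  also have "\<dots> = ee E' V' V'"
    unfolding ee_def V'_def by (simp add: sum.reindex[OF inj])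
  also have "\<dots> = 2 * real (card E')" by (rule double_card_edges[OF G', symmetric])
  also have "\<dots> \<le> 2 * real (RT l (\<Sum>v\<in>V. w v) s a)"
    using RT_ge[OF G' c K' ind] by simp
  finally show ?thesis .
qed

text \<open>The disjoint union of the \<open>q\<close>-fold blow-up of an extremal graph and a
  nearly balanced blow-up of a second K_s-free graph reaches any prescribed order \<open>n\<close>.
  The second graph is a filler for the remainder \<open>m\<close>; its edges are dropped in the
  estimate.\<close>

lemma RT_mixture:
  fixes V0 V1 :: "nat set" and \<epsilon> :: real
  assumes G0: "simple_graph V0 E0" "K_free s V0 E0" "real (indep_number l V0 E0) \<le> \<epsilon> * card V0"
    and H: "simple_graph V1 E1" "K_free s V1 E1" "real (indep_number l V1 E1) \<le> \<epsilon> / 2 * card V1"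
    and l: "0 < l" and \<epsilon>: "0 < \<epsilon>" and V1: "0 < card V1"
    and n: "n = q * card V0 + m" "card V1 \<le> m"
  shows "(real q)\<^sup>2 * (2 * card E0) \<le> 2 * real (RT l n s (\<epsilon> * n))"
proof -
  have f: "finite V0" "finite V1" using G0 H by (auto simp: simple_graph_def)
  define h where "h = card V1"
  have mh: "m mod h \<le> card V1" using V1 by (simp add: h_def less_imp_le)
  obtain R where R: "R \<subseteq> V1" "card R = m mod h" "finite R"
    using obtain_subset_with_card_n[OF mh] by blast
  define V :: "(nat + nat) set" where "V = Inl ` V0 \<union> Inr ` V1"
  define E :: "(nat + nat) set set" where "E = (`) Inl ` E0 \<union> (`) Inr ` E1"
  \<comment> \<open>The \<open>m\<close> remaining vertices are spread over \<open>V1\<close> as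
    evenly as possible, the vertices of \<open>R\<close> getting one more. As
    \<open>h \<le> m\<close>, rounding up at most doubles the share \<open>m / h\<close>, which is
    why the filler is taken with \<open>\<epsilon> / 2\<close>.\<close>
  define w :: "nat + nat \<Rightarrow> nat" where
    "w = case_sum (\<lambda>_. q) (\<lambda>v. m div h + of_bool (v \<in> R))"
  have e0: "{Inl x, Inl y} \<in> E \<longleftrightarrow> {x, y} \<in> E0" for x y
  proof
    assume "{Inl x, Inl y} \<in> E"
    then have "{Inl x, Inl y} \<in> (`) Inl ` E0 \<union> (`) Inr ` E1" by (simp only: E_def)
    then show "{x, y} \<in> E0"
    proof (elim UnE imageE)
      fix e assume e: "{Inl x, Inl y} = (Inl ` e :: (nat + nat) set)" "e \<in> E0"
      then have "Inl ` {x, y} = (Inl ` e :: (nat + nat) set)" by (simp only: image_insert image_empty)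
      then have "{x, y} = e" by (simp only: inj_image_eq_iff[OF inj_Inl])
      then show "{x, y} \<in> E0" using e by simp
    next
      fix e assume "{Inl x, Inl y} = (Inr ` e :: (nat + nat) set)"
      then have "Inl x \<in> Inr ` e" by (metis insertI1)
      then show "{x, y} \<in> E0" by blast
    qed
  next
    assume "{x, y} \<in> E0"
    then have "Inl ` {x, y} \<in> E" unfolding E_def by (intro UnI1 imageI)
    then show "{Inl x, Inl y} \<in> E" by simp
  qed
  have e1: "{Inr x, Inr y} \<in> E \<longleftrightarrow> {x, y} \<in> E1" for x y
  proof
    assume "{Inr x, Inr y} \<in> E"
    then have "{Inr x, Inr y} \<in> (`) Inl ` E0 \<union> (`) Inr ` E1" by (simp only: E_def)
    then show "{x, y} \<in> E1"
    proof (elim UnE imageE)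
      fix e assume "{Inr x, Inr y} = (Inl ` e :: (nat + nat) set)"
      then have "Inr x \<in> Inl ` e" by (metis insertI1)
      then show "{x, y} \<in> E1" by blast
    next
      fix e assume e: "{Inr x, Inr y} = (Inr ` e :: (nat + nat) set)" "e \<in> E1"
      then have "Inr ` {x, y} = (Inr ` e :: (nat + nat) set)" by (simp only: image_insert image_empty)
      then have "{x, y} = e" by (simp only: inj_image_eq_iff[OF inj_Inr])
      then show "{x, y} \<in> E1" using e by simp
    qed
  next
    assume "{x, y} \<in> E1"
    then have "Inr ` {x, y} \<in> E" unfolding E_def by (intro UnI2 imageI)
    then show "{Inr x, Inr y} \<in> E" by simp
  qed
  have e01: "{Inl x, Inr y} \<notin> E" for x y unfolding E_def by blast
  have G: "simple_graph V E"
  proof -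
    have "e \<subseteq> V \<and> card e = 2" if e: "e \<in> E" for e
    proof -
      from e have "(\<exists>e'\<in>E0. e = Inl ` e') \<or> (\<exists>e'\<in>E1. e = Inr ` e')"
        unfolding E_def Un_iff image_iff .
      then show ?thesis
      proof (elim disjE bexE)
        fix e' assume e': "e' \<in> E0" "e = Inl ` e'"
        then have "e' \<subseteq> V0" "card e' = 2" using G0(1) by (auto simp: simple_graph_def)
        then show ?thesis using e'(2) by (auto simp: V_def card_image)
      next
        fix e' assume e': "e' \<in> E1" "e = Inr ` e'"
        then have "e' \<subseteq> V1" "card e' = 2" using H(1) by (auto simp: simple_graph_def)
        then show ?thesis using e'(2) by (auto simp: V_def card_image)
      qed
    qed
    moreover have "finite V" using f by (simp add: V_def)
    ultimately show ?thesis by (simp add: simple_graph_def)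
  qed
  have split: "U = Inl ` (Inl -` U) \<union> Inr ` (Inr -` U)" for U :: "(nat + nat) set"
  proof (intro equalityI subsetI)
    fix x assume "x \<in> U" then show "x \<in> Inl ` (Inl -` U) \<union> Inr ` (Inr -` U)" by (cases x) auto
  qed auto
  have K0: "is_K k E (Inl ` S) \<longleftrightarrow> is_K k E0 S" for k S
    unfolding is_K_def clique_def using e0 by (auto simp: card_image finite_image_iff)
  have K1: "is_K k E (Inr ` S) \<longleftrightarrow> is_K k E1 S" for k S
    unfolding is_K_def clique_def using e1 by (auto simp: card_image finite_image_iff)
  have Kf: "K_free s V E" unfolding K_free_def
  proof (intro notI, elim exE conjE)
    fix S assume S: "S \<subseteq> V" "is_K s E S"
    have "Inl -` S = {} \<or> Inr -` S = {}"
      using S(2) e01 by (force simp: is_K_def clique_def)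
    then show False
    proof
      assume "Inr -` S = {}"
      then have e: "Inl ` (Inl -` S) = S"
        using split[of S, symmetric] by (simp only: image_empty Un_empty_right)
      then have "is_K s E0 (Inl -` S)" using S(2) K0[of s "Inl -` S"] by simp
      moreover have "Inl -` S \<subseteq> V0" using S(1) by (auto simp: V_def)
      ultimately show False using G0(2) by (auto simp: K_free_def)
    next
      assume "Inl -` S = {}"
      then have e: "Inr ` (Inr -` S) = S"
        using split[of S, symmetric] by (simp only: image_empty Un_empty_left)
      then have "is_K s E1 (Inr -` S)" using S(2) K1[of s "Inr -` S"] by simp
      moreover have "Inr -` S \<subseteq> V1" using S(1) by (auto simp: V_def)
      ultimately show False using H(2) by (auto simp: K_free_def)
    qed
  qed
  have sumV: "(\<Sum>v\<in>Inl ` A \<union> Inr ` B. w v) = q * card A + (m div h * card B + card (B \<inter> R))"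
    if "finite A" "finite B" for A B
  proof -
    have "(\<Sum>v\<in>Inl ` A \<union> Inr ` B. w v) = (\<Sum>v\<in>Inl ` A. w v) + (\<Sum>v\<in>Inr ` B. w v)"
      using that by (intro sum.union_disjoint) auto
    also have "(\<Sum>v\<in>Inl ` A. w v) = q * card A" by (simp add: sum.reindex w_def)
    also have "(\<Sum>v\<in>Inr ` B. w v) = m div h * card B + card (B \<inter> R)"
      using that by (simp add: sum.reindex w_def sum.distrib Int_def)
    finally show ?thesis .
  qed
  have "V1 \<inter> R = R" using R by auto
  then have wV: "(\<Sum>v\<in>V. w v) = n"
    unfolding V_def sumV[OF f] by (simp add: R n h_def)
  have wt: "real (\<Sum>v\<in>U. w v) \<le> \<epsilon> * n" if U: "U \<subseteq> V" "K_free l U E" for U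
  proof -
    define A where "A = Inl -` U"
    define B where "B = Inr -` U"
    have U': "U = Inl ` A \<union> Inr ` B" using split[of U] by (simp add: A_def B_def)
    have AB: "A \<subseteq> V0" "B \<subseteq> V1" using U(1) by (auto simp: A_def B_def V_def)
    have fAB: "finite A" "finite B" using AB f by (auto intro: finite_subset)
    have "K_free l A E0" unfolding K_free_def
    proof (intro notI, elim exE conjE)
      fix S assume "S \<subseteq> A" "is_K l E0 S"
      then have "Inl ` S \<subseteq> U" "is_K l E (Inl ` S)" using K0 by (auto simp: A_def)
      then show False using U(2) by (auto simp: K_free_def)
    qed
    then have A: "real (card A) \<le> \<epsilon> * card V0"
      using G0(3) indep_number_le_iff[OF f(1) l, of "\<epsilon> * card V0" E0] \<epsilon> AB by simp
    have "K_free l B E1" unfolding K_free_def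
    proof (intro notI, elim exE conjE)
      fix S assume "S \<subseteq> B" "is_K l E1 S"
      then have "Inr ` S \<subseteq> U" "is_K l E (Inr ` S)" using K1 by (auto simp: B_def)
      then show False using U(2) by (auto simp: K_free_def)
    qed
    then have B: "real (card B) \<le> \<epsilon> / 2 * h"
      using H(3) indep_number_le_iff[OF f(2) l, of "\<epsilon> / 2 * card V1" E1] \<epsilon> AB by (simp add: h_def)
    have "card (B \<inter> R) \<le> card B" using fAB by (intro card_mono) auto
    then have "real (\<Sum>v\<in>U. w v) \<le> q * card A + (m div h + 1) * card B"
      unfolding U' sumV[OF fAB] by (simp add: algebra_simps)
    also have "\<dots> \<le> q * (\<epsilon> * card V0) + (real (m div h) + 1) * (\<epsilon> / 2 * h)"
      unfolding of_nat_add of_nat_mult of_nat_1 using A B by (intro add_mono mult_left_mono) auto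
    also have "(real (m div h) + 1) * (\<epsilon> / 2 * h) = \<epsilon> / 2 * (real (m div h * h) + h)"
      by (simp add: algebra_simps)
    also have "\<dots> \<le> \<epsilon> / 2 * (real m + real m)"
    proof -
      have "real (m div h * h) \<le> real m" by (simp only: of_nat_le_iff) simp
      moreover have "real h \<le> real m" using n(2) by (simp add: h_def)
      ultimately show ?thesis using \<epsilon> by (intro mult_left_mono) auto
    qed
    also have "q * (\<epsilon> * card V0) + \<epsilon> / 2 * (real m + real m) = \<epsilon> * n"
      by (simp add: n algebra_simps)
    finally show ?thesis by simp
  qed
  have fV: "finite V" using f by (simp add: V_def)
  have "(real q)\<^sup>2 * (2 * card E0) = (real q)\<^sup>2 * ee E0 V0 V0"
    by (simp add: double_card_edges[OF G0(1)])
  also have "\<dots> = (\<Sum>u\<in>Inl ` V0. \<Sum>v\<in>Inl ` V0. of_bool ({u, v} \<in> E) * real (w u) * real (w v))"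
    by (simp add: sum.reindex e0 w_def ee_def power2_eq_square sum_distrib_left mult_ac)
  also have "\<dots> \<le> (\<Sum>u\<in>V. \<Sum>v\<in>Inl ` V0. of_bool ({u, v} \<in> E) * real (w u) * real (w v))"
    by (intro sum_mono2 fV sum_nonneg) (auto simp: V_def)
  also have "\<dots> \<le> (\<Sum>u\<in>V. \<Sum>v\<in>V. of_bool ({u, v} \<in> E) * real (w u) * real (w v))"
    by (intro sum_mono sum_mono2 fV) (auto simp: V_def)
  also have "\<dots> \<le> 2 * real (RT l (\<Sum>v\<in>V. w v) s (\<epsilon> * n))"
    by (rule blow_up_RT[OF G Kf l]) (use wt in blast)
  finally show ?thesis by (simp add: wV)
qed

text \<open>Normalised by half the square of \<open>n\<close> instead of \<open>n choose 2\<close>: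
  the limit is the same, every value lies in the unit interval, and blow-ups scale exactly.\<close>

definition RT_ratio :: "nat \<Rightarrow> nat \<Rightarrow> real \<Rightarrow> nat \<Rightarrow> real" where
  "RT_ratio l s \<epsilon> n = 2 * real (RT l n s (\<epsilon> * n)) / (real n)\<^sup>2"

lemma RT_ratio_bounds: "0 \<le> RT_ratio l s \<epsilon> n" "RT_ratio l s \<epsilon> n \<le> 1"
  using RT_upper_bound[of l n s "\<epsilon> * n"]
  by (auto simp: RT_ratio_def divide_le_eq_1)

text \<open>Either graphs that are \<open>K\<^sub>s\<close>-free with arbitrarily small relative \<open>l\<close>-independence number
  exist, and mixing a small blow-up of one of them into a blow-up of an extremal graph absorbs all
  rounding errors; or no graph qualifies for small \<open>\<epsilon>\<close>.\<close>

lemma RT_ratio_convergent: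
  assumes l: "0 < l"
  obtains \<kappa> where "0 < \<kappa>"
    "\<And>\<epsilon>. 0 < \<epsilon> \<Longrightarrow> \<epsilon> \<le> \<kappa> \<Longrightarrow> \<exists>L. (\<forall>n. RT_ratio l s \<epsilon> n \<le> L) \<and> RT_ratio l s \<epsilon> \<longlonglongrightarrow> L"
proof (cases "\<forall>\<epsilon>>(0::real). \<exists>(V :: nat set) E. simple_graph V E \<and> 0 < card V \<and> K_free s V E \<and>
     real (indep_number l V E) \<le> \<epsilon> * card V")
  case True
  note graphs = True
  have "\<exists>L. (\<forall>n. RT_ratio l s \<epsilon> n \<le> L) \<and> RT_ratio l s \<epsilon> \<longlonglongrightarrow> L" if \<epsilon>: "0 < \<epsilon>" for \<epsilon>
  proof -
    \<comment> \<open>Blow-ups make the ratio almost monotone, so the supremum is the limit; in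
      particular every single ratio is bounded by it.\<close>
    define L where "L = (SUP n. RT_ratio l s \<epsilon> n)"
    have bdd: "bdd_above (range (RT_ratio l s \<epsilon>))"
      by (intro bdd_aboveI[of _ 1]) (auto simp: RT_ratio_bounds)
    have le: "RT_ratio l s \<epsilon> n \<le> L" for n
      unfolding L_def using bdd by (rule cSUP_upper2) auto
    have "\<exists>N. \<forall>n\<ge>N. L - \<eta> < RT_ratio l s \<epsilon> n" if \<eta>: "0 < \<eta>" for \<eta>
    proof -
      obtain n0 where n0: "L - \<eta> / 2 < RT_ratio l s \<epsilon> n0"
        using less_cSUP_iff[OF _ bdd, of "L - \<eta> / 2"] \<eta> by (auto simp: L_def)
      show ?thesis
      proof (cases "RT l n0 s (\<epsilon> * n0) = 0 \<or> n0 = 0")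
        case True
        then have "L - \<eta> / 2 < 0" using n0 by (auto simp: RT_ratio_def)
        then have "L - \<eta> < RT_ratio l s \<epsilon> n" for n using RT_ratio_bounds(1)[of l s \<epsilon> n] \<eta> by linarith
        then show ?thesis by blast
      next
        case False
        then obtain V0 and E0 :: "nat set set" where G0: "simple_graph V0 E0" "card V0 = n0" "K_free s V0 E0"
            "real (indep_number l V0 E0) \<le> \<epsilon> * n0" "card E0 = RT l n0 s (\<epsilon> * n0)"
          using RT_cases[of l n0 s "\<epsilon> * n0"] by blast
        have n0p: "0 < n0" using False by simp
        obtain V1 and E1 :: "nat set set" where H: "simple_graph V1 E1" "0 < card V1" "K_free s V1 E1"
            "real (indep_number l V1 E1) \<le> \<epsilon> / 2 * card V1"
          using graphs[rule_format, OF half_gt_zero[OF \<epsilon>]] by blast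
        \<comment> \<open>Keeping only a \<open>1 - 2 * \<delta>\<close> share of the vertices costs
          a factor \<open>(1 - 2 * \<delta>)\<^sup>2 \<ge> 1 - 4 * \<delta>\<close>, so at most
          \<open>\<eta> / 4\<close> beyond the \<open>\<eta> / 2\<close> lost in choosing
          \<open>n0\<close>.\<close>
        define \<delta> where "\<delta> = min (\<eta> / 16) (1 / 4)"
        have \<delta>: "0 < \<delta>" "\<delta> \<le> 1/4" "4 * \<delta> \<le> \<eta> / 4" using \<eta> by (auto simp: \<delta>_def)
        define N where "N = nat \<lceil>max (real n0 / \<delta>) (card V1 / \<delta>)\<rceil> + 1"
        have "L - \<eta> < RT_ratio l s \<epsilon> n" if "N \<le> n" for n
        proof -
          have n: "real n0 / \<delta> \<le> n" "card V1 / \<delta> \<le> n" "0 < n"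
          proof -
            have "max (real n0 / \<delta>) (card V1 / \<delta>) \<le> real (nat \<lceil>max (real n0 / \<delta>) (card V1 / \<delta>)\<rceil>)"
              by (rule real_nat_ceiling_ge)
            also have "\<dots> \<le> n" using that unfolding N_def by linarith
            finally show "real n0 / \<delta> \<le> n" "card V1 / \<delta> \<le> n" by simp_all
            show "0 < n" using that by (simp add: N_def)
          qed
          have n': "real n0 \<le> \<delta> * n" "real (card V1) \<le> \<delta> * n"
            using n \<delta>(1) by (auto simp: field_simps)
          \<comment> \<open>Rounded down from a \<open>1 - \<delta>\<close> share: at least
            \<open>\<delta> * n\<close> vertices remain, enough for the filler graph, and the
            rounding loses at most another \<open>n0 \<le> \<delta> * n\<close>.\<close>
          define q where "q = nat \<lfloor>(1 - \<delta>) * n / n0\<rfloor>"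
          have x0: "0 \<le> (1 - \<delta>) * n / n0" using \<delta> by simp
          have "real q \<le> (1 - \<delta>) * n / n0" using x0 by (simp add: q_def)
          then have q1: "real q * n0 \<le> (1 - \<delta>) * n" using n0p by (simp add: field_simps)
          have "(1 - \<delta>) * n / n0 < real q + 1" using x0 unfolding q_def by linarith
          then have "(1 - \<delta>) * n < (real q + 1) * n0" using n0p by (simp add: field_simps)
          then have q2: "(1 - 2 * \<delta>) * n \<le> real q * n0" using n' by (simp add: algebra_simps)
          define m where "m = n - q * n0"
          have "real (q * n0) \<le> real n" using q1 \<delta>(1) n(3) by (simp add: algebra_simps) (smt (verit) mult_nonneg_nonneg of_nat_0_le_iff)
          then have le_n: "q * n0 \<le> n" by (simp only: of_nat_le_iff)
          then have nm: "n = q * card V0 + m" by (simp add: m_def G0)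
          have "real m = n - real q * n0" using le_n by (simp add: m_def of_nat_diff)
          then have "real (card V1) \<le> real m" using q1 n' by (simp add: algebra_simps)
          then have mV1: "card V1 \<le> m" by simp
          have "(real q)\<^sup>2 * (2 * card E0) \<le> 2 * real (RT l n s (\<epsilon> * n))"
            by (rule RT_mixture[OF G0(1,3) _ H(1,3,4) l \<epsilon> H(2) nm mV1]) (use G0 in simp)
          then have "(real q)\<^sup>2 * (2 * card E0) / (real n)\<^sup>2 \<le> RT_ratio l s \<epsilon> n"
            unfolding RT_ratio_def by (rule divide_right_mono) simp
          moreover have "(1 - 2 * \<delta>)\<^sup>2 * RT_ratio l s \<epsilon> n0 \<le> (real q)\<^sup>2 * (2 * card E0) / (real n)\<^sup>2"
          proof -
            have "((1 - 2 * \<delta>) * n)\<^sup>2 \<le> (real q * n0)\<^sup>2"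
              using q2 \<delta> by (intro power_mono) auto
            then have "((1 - 2 * \<delta>) * n)\<^sup>2 * RT_ratio l s \<epsilon> n0 \<le> (real q * n0)\<^sup>2 * RT_ratio l s \<epsilon> n0"
              using RT_ratio_bounds(1) by (rule mult_right_mono)
            also have "\<dots> = (real q)\<^sup>2 * (2 * card E0)"
              using n0p by (simp add: RT_ratio_def G0(5) power_mult_distrib)
            finally show ?thesis
              using n(3) by (subst pos_le_divide_eq) (simp_all add: power_mult_distrib mult_ac)
          qed
          moreover have "(1 - 4 * \<delta>) * RT_ratio l s \<epsilon> n0 \<le> (1 - 2 * \<delta>)\<^sup>2 * RT_ratio l s \<epsilon> n0"
            by (intro mult_right_mono RT_ratio_bounds) (simp add: power2_eq_square algebra_simps)
          moreover have "4 * \<delta> * RT_ratio l s \<epsilon> n0 \<le> 4 * \<delta> * 1"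
            using \<delta> RT_ratio_bounds(2) by (intro mult_left_mono) auto
          moreover have "(1 - 4 * \<delta>) * RT_ratio l s \<epsilon> n0 = RT_ratio l s \<epsilon> n0 - 4 * \<delta> * RT_ratio l s \<epsilon> n0"
            by (simp add: algebra_simps)
          ultimately show ?thesis using n0 \<delta> \<eta> by linarith
        qed
        then show ?thesis by blast
      qed
    qed
    then have "RT_ratio l s \<epsilon> \<longlonglongrightarrow> L"
      unfolding LIMSEQ_iff using le by (simp add: abs_if) (smt (verit))
    then show ?thesis using le by blast
  qed
  then show ?thesis using that[of 1] by simp
next
  case False
  then obtain \<kappa> :: real where \<kappa>: "0 < \<kappa>" and no: "\<not> (\<exists>(V :: nat set) E. simple_graph V E \<and> 0 < card V \<and>
     K_free s V E \<and> real (indep_number l V E) \<le> \<kappa> * card V)" by blast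
  \<comment> \<open>Below \<open>\<kappa>\<close> no nonempty graph qualifies, so \<open>RT\<close>
    takes its default value 0.\<close>
  have "RT_ratio l s \<epsilon> n = 0" if \<epsilon>: "0 < \<epsilon>" "\<epsilon> \<le> \<kappa>" for \<epsilon> n
  proof (cases "n = 0")
    case False
    have "RT l n s (\<epsilon> * n) = 0"
    proof (rule ccontr)
      assume "RT l n s (\<epsilon> * n) \<noteq> 0"
      then obtain V and E :: "nat set set" where V: "simple_graph V E" "card V = n" "K_free s V E"
         "real (indep_number l V E) \<le> \<epsilon> * n"
        using RT_cases[of l n s "\<epsilon> * n"] by metis
      have "\<epsilon> * n \<le> \<kappa> * n" using \<epsilon> by (intro mult_right_mono) auto
      then have "real (indep_number l V E) \<le> \<kappa> * card V" using order_trans[OF V(4)] V(2) by simp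
      moreover have "0 < card V" using V(2) False by simp
      ultimately show False using no V by blast
    qed
    then show ?thesis by (simp add: RT_ratio_def)
  qed (simp add: RT_ratio_def)
  then have "RT_ratio l s \<epsilon> = (\<lambda>_. 0)" if "0 < \<epsilon>" "\<epsilon> \<le> \<kappa>" for \<epsilon> using that by blast
  then show ?thesis using that[OF \<kappa>] by (metis order.refl tendsto_const)
qed

text \<open>Converts the constants \<open>lim\<close> and \<open>Lim\<close> into inequalities. The
  inner limits exist for small \<open>\<epsilon>\<close> and increase with
  \<open>\<epsilon>\<close>, so the outer limit is their infimum. The upper bound holds for every
  \<open>n\<close> because each inner limit dominates its sequence.\<close>

lemma RT_density_properties:
  fixes l s :: nat
  assumes l: "0 < l"
  defines "\<rho> \<equiv> RT_density l s"
  shows RT_density_bounds: "0 \<le> \<rho>" "\<rho> \<le> 1"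
    and RT_density_upper: "\<And>\<mu>. 0 < \<mu> \<Longrightarrow> \<exists>\<epsilon>>0. \<forall>n. RT_ratio l s \<epsilon> n \<le> \<rho> + \<mu>"
    and RT_density_lower: "\<And>\<eta> \<epsilon>. 0 < \<eta> \<Longrightarrow> 0 < \<epsilon> \<Longrightarrow> \<exists>N. \<forall>n\<ge>N. \<rho> - \<eta> \<le> RT_ratio l s \<epsilon> n"
proof -
  obtain \<kappa> where \<kappa>: "0 < \<kappa>"
    "\<And>\<epsilon>. 0 < \<epsilon> \<Longrightarrow> \<epsilon> \<le> \<kappa> \<Longrightarrow> \<exists>L. (\<forall>n. RT_ratio l s \<epsilon> n \<le> L) \<and> RT_ratio l s \<epsilon> \<longlonglongrightarrow> L"
    using RT_ratio_convergent[OF l] by blast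
  then obtain g where g: "\<And>\<epsilon> n. 0 < \<epsilon> \<Longrightarrow> \<epsilon> \<le> \<kappa> \<Longrightarrow> RT_ratio l s \<epsilon> n \<le> g \<epsilon>"
      "\<And>\<epsilon>. 0 < \<epsilon> \<Longrightarrow> \<epsilon> \<le> \<kappa> \<Longrightarrow> RT_ratio l s \<epsilon> \<longlonglongrightarrow> g \<epsilon>"
    by metis
  have g01: "0 \<le> g \<epsilon>" "g \<epsilon> \<le> 1" if "0 < \<epsilon>" "\<epsilon> \<le> \<kappa>" for \<epsilon>
    by (rule LIMSEQ_le_const[OF g(2)[OF that]], simp add: RT_ratio_bounds)
      (rule LIMSEQ_le_const2[OF g(2)[OF that]], simp add: RT_ratio_bounds)
  have mono: "g \<epsilon> \<le> g \<epsilon>'" if "0 < \<epsilon>" "\<epsilon> \<le> \<epsilon>'" "\<epsilon>' \<le> \<kappa>" for \<epsilon> \<epsilon>'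
  proof (rule LIMSEQ_le)
    show "RT_ratio l s \<epsilon> \<longlonglongrightarrow> g \<epsilon>" "RT_ratio l s \<epsilon>' \<longlonglongrightarrow> g \<epsilon>'" using g(2) that by auto
    have "RT_ratio l s \<epsilon> n \<le> RT_ratio l s \<epsilon>' n" for n
      unfolding RT_ratio_def using that
      by (intro divide_right_mono mult_left_mono) (auto intro!: RT_mono mult_right_mono)
    then show "\<exists>N. \<forall>n\<ge>N. RT_ratio l s \<epsilon> n \<le> RT_ratio l s \<epsilon>' n" by blast
  qed
  have lim: "lim (\<lambda>n. real (RT l n s (\<epsilon> * real n)) / real (n choose 2)) = g \<epsilon>" if "0 < \<epsilon>" "\<epsilon> \<le> \<kappa>" for \<epsilon>
  proof -
    \<comment> \<open>The factor \<open>n / (n - 1)\<close> turns the normalisation into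
      \<open>n choose 2\<close>.\<close>
    have "(\<lambda>n. RT_ratio l s \<epsilon> n * (real n / (real n - 1))) \<longlonglongrightarrow> g \<epsilon> * 1"
      by (intro tendsto_mult g(2) that) real_asymp
    moreover have "\<forall>\<^sub>F n in sequentially. RT_ratio l s \<epsilon> n * (real n / (real n - 1)) =
        real (RT l n s (\<epsilon> * real n)) / real (n choose 2)"
      using eventually_ge_at_top[of 2]
    proof eventually_elim
      case (elim n)
      have "real (n choose 2) = real n * (real n - 1) / 2"
        using elim by (simp add: choose_two real_of_nat_div of_nat_diff algebra_simps)
      moreover have "real n \<noteq> 0" "real n - 1 \<noteq> 0" using elim by auto
      ultimately show ?case by (simp add: RT_ratio_def power2_eq_square divide_simps)
    qed
    ultimately have "(\<lambda>n. real (RT l n s (\<epsilon> * real n)) / real (n choose 2)) \<longlonglongrightarrow> g \<epsilon>"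
      using Lim_transform_eventually by force
    then show ?thesis by (rule limI)
  qed
  define L where "L = (INF \<epsilon>\<in>{0<..\<kappa>}. g \<epsilon>)"
  have bdd: "bdd_below (g ` {0<..\<kappa>})" using g01(1) by (auto intro!: bdd_belowI[of _ 0])
  have ne: "{0<..\<kappa>} \<noteq> {}" using \<kappa>(1) by auto
  have L_le: "L \<le> g \<epsilon>" if "0 < \<epsilon>" "\<epsilon> \<le> \<kappa>" for \<epsilon>
    unfolding L_def by (rule cINF_lower[OF bdd]) (use that in simp)
  have L_ex: "\<exists>\<epsilon>. 0 < \<epsilon> \<and> \<epsilon> \<le> \<kappa> \<and> g \<epsilon> < y" if "L < y" for y
    using that cINF_less_iff[OF ne bdd, of y] by (auto simp: L_def)
  have "((\<lambda>\<epsilon>. lim (\<lambda>n. real (RT l n s (\<epsilon> * real n)) / real (n choose 2))) \<longlongrightarrow> L) (at_right 0)"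
  proof (rule order_tendstoI)
    fix y assume "y < L"
    have "\<forall>\<^sub>F \<epsilon> in at_right 0. \<epsilon> \<in> {0<..<\<kappa>}"
      using \<kappa>(1) by (auto simp: eventually_at_right_field)
    then show "\<forall>\<^sub>F \<epsilon> in at_right 0. y < lim (\<lambda>n. real (RT l n s (\<epsilon> * real n)) / real (n choose 2))"
    proof eventually_elim
      case (elim \<epsilon>)
      then show ?case using lim[of \<epsilon>] L_le[of \<epsilon>] \<open>y < L\<close> by simp
    qed
  next
    fix y assume "L < y"
    then obtain \<epsilon>' where \<epsilon>': "0 < \<epsilon>'" "\<epsilon>' \<le> \<kappa>" "g \<epsilon>' < y" using L_ex by blast
    have "\<forall>\<^sub>F \<epsilon> in at_right 0. \<epsilon> \<in> {0<..<\<epsilon>'}"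
      using \<epsilon>'(1) by (auto simp: eventually_at_right_field)
    then show "\<forall>\<^sub>F \<epsilon> in at_right 0. lim (\<lambda>n. real (RT l n s (\<epsilon> * real n)) / real (n choose 2)) < y"
    proof eventually_elim
      case (elim \<epsilon>)
      then show ?case using lim[of \<epsilon>] mono[of \<epsilon> \<epsilon>'] \<epsilon>' by simp
    qed
  qed
  then have \<rho>L: "\<rho> = L" unfolding \<rho>_def RT_density_def by (intro tendsto_Lim) auto
  show "0 \<le> \<rho>" unfolding \<rho>L L_def by (rule cINF_greatest[OF ne]) (use g01 in auto)
  show "\<rho> \<le> 1" using L_le[of \<kappa>] g01(2)[of \<kappa>] \<kappa>(1) \<rho>L by simp
  show "\<exists>\<epsilon>>0. \<forall>n. RT_ratio l s \<epsilon> n \<le> \<rho> + \<mu>" if "0 < \<mu>" for \<mu>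
  proof -
    have "L < \<rho> + \<mu>" using \<rho>L that by linarith
    then obtain \<epsilon> where "0 < \<epsilon>" "\<epsilon> \<le> \<kappa>" "g \<epsilon> < \<rho> + \<mu>" using L_ex by blast
    then show ?thesis using g(1)[of \<epsilon>] by (meson less_le order_trans)
  qed
  show "\<exists>N. \<forall>n\<ge>N. \<rho> - \<eta> \<le> RT_ratio l s \<epsilon> n" if "0 < \<eta>" "0 < \<epsilon>" for \<eta> \<epsilon>
  proof -
    \<comment> \<open>Above \<open>\<kappa>\<close> no inner limit is known; \<open>RT\<close> is
      monotone in \<open>\<epsilon>\<close>, so a lower bound at the smaller value suffices.\<close>
    define \<epsilon>' where "\<epsilon>' = min \<epsilon> \<kappa>"
    have \<epsilon>': "0 < \<epsilon>'" "\<epsilon>' \<le> \<kappa>" "\<epsilon>' \<le> \<epsilon>" using that \<kappa>(1) by (auto simp: \<epsilon>'_def)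
    have "\<rho> - \<eta> < g \<epsilon>'" using L_le[OF \<epsilon>'(1,2)] \<rho>L that by simp
    then have "\<forall>\<^sub>F n in sequentially. \<rho> - \<eta> < RT_ratio l s \<epsilon>' n"
      using order_tendstoD(1)[OF g(2)[OF \<epsilon>'(1,2)]] by blast
    then obtain N where N: "\<And>n. N \<le> n \<Longrightarrow> \<rho> - \<eta> < RT_ratio l s \<epsilon>' n"
      by (auto simp: eventually_sequentially)
    have "RT_ratio l s \<epsilon>' n \<le> RT_ratio l s \<epsilon> n" for n
      unfolding RT_ratio_def using \<epsilon>'
      by (intro divide_right_mono mult_left_mono) (auto intro!: RT_mono mult_right_mono)
    then show ?thesis using N by (meson less_imp_le order_trans)
  qed
qed

text \<open>The weights play the role of a blow-up.\<close>

lemma weighted_clique_exists: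
  fixes l s :: nat and \<mu> :: real
  assumes l: "0 < l" and \<mu>: "0 < \<mu>"
  shows "\<exists>\<epsilon>>0. \<forall>(V :: nat set) E w. simple_graph V E \<longrightarrow> 0 < (\<Sum>v\<in>V. w v) \<longrightarrow>
       (\<forall>U\<subseteq>V. K_free l U E \<longrightarrow> real (\<Sum>v\<in>U. w v) \<le> \<epsilon> * real (\<Sum>v\<in>V. w v)) \<longrightarrow>
       (RT_density l s + \<mu>) * (real (\<Sum>v\<in>V. w v))\<^sup>2 \<le>
          (\<Sum>u\<in>V. \<Sum>v\<in>V. of_bool ({u, v} \<in> E) * real (w u) * real (w v)) \<longrightarrow>
       (\<exists>S\<subseteq>V. is_K s E S)"
proof -
  \<comment> \<open>Using only half of the excess leaves \<open>\<mu> / 2\<close> for a strict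
    contradiction.\<close>
  obtain \<epsilon> where \<epsilon>: "0 < \<epsilon>" "\<And>n. RT_ratio l s \<epsilon> n \<le> RT_density l s + \<mu> / 2"
    using RT_density_upper[OF l, of "\<mu> / 2" s] \<mu> by auto
  show ?thesis
  proof (intro exI[of _ \<epsilon>] conjI \<epsilon>(1) allI impI, rule ccontr)
    fix V :: "nat set" and E and w :: "nat \<Rightarrow> nat"
    define n where "n = (\<Sum>v\<in>V. w v)"
    assume G: "simple_graph V E" and pos: "0 < (\<Sum>v\<in>V. w v)"
      and wt: "\<forall>U\<subseteq>V. K_free l U E \<longrightarrow> real (\<Sum>v\<in>U. w v) \<le> \<epsilon> * real (\<Sum>v\<in>V. w v)"
      and dens: "(RT_density l s + \<mu>) * (real (\<Sum>v\<in>V. w v))\<^sup>2 \<le>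
          (\<Sum>u\<in>V. \<Sum>v\<in>V. of_bool ({u, v} \<in> E) * real (w u) * real (w v))"
      and "\<not> (\<exists>S\<subseteq>V. is_K s E S)"
    then have Kf: "K_free s V E" by (simp add: K_free_def)
    have n: "0 < n" using pos by (simp only: n_def)
    have "(RT_density l s + \<mu>) * (real n)\<^sup>2 \<le> 2 * real (RT l n s (\<epsilon> * n))"
      using order_trans[OF dens blow_up_RT[OF G Kf l wt[rule_format]]] by (simp add: n_def)
    also have "\<dots> = RT_ratio l s \<epsilon> n * (real n)\<^sup>2" using n by (simp add: RT_ratio_def)
    also have "\<dots> \<le> (RT_density l s + \<mu> / 2) * (real n)\<^sup>2"
      using \<epsilon>(2) by (intro mult_right_mono) auto
    finally have "\<mu> / 2 * (real n)\<^sup>2 \<le> 0" by (simp add: algebra_simps)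
    then show False using \<mu> n by (simp add: mult_le_0_iff)
  qed
qed

section \<open>Graphs without a factor\<close>

definition graph_of :: "'a set \<Rightarrow> ('a \<Rightarrow> 'a \<Rightarrow> bool) \<Rightarrow> 'a set set" where
  "graph_of V P = {{x, y} | x y. x \<in> V \<and> y \<in> V \<and> x \<noteq> y \<and> P x y}"

lemma graph_of_iff:
  assumes "\<And>x y. P x y \<longleftrightarrow> P y x"
  shows "{x, y} \<in> graph_of V P \<longleftrightarrow> x \<in> V \<and> y \<in> V \<and> x \<noteq> y \<and> P x y"
  using assms unfolding graph_of_def by (auto simp: doubleton_eq_iff)

lemma simple_graph_of: "finite V \<Longrightarrow> simple_graph V (graph_of V P)"
  unfolding simple_graph_def graph_of_def by auto

lemma min_degree_ge:
  assumes "simple_graph V E" "V \<noteq> {}" "\<And>v. v \<in> V \<Longrightarrow> x \<le> real (card (nb E v))"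
  shows "x \<le> real (min_degree V E)"
proof -
  have fV: "finite V" using assms(1) by (simp add: simple_graph_def)
  have "min_degree V E \<in> degree E ` V"
    unfolding min_degree_def using fV assms(2) by (intro Min_in) auto
  then show ?thesis using assms(3) degree_eq_card_nb[OF assms(1)] by auto
qed

lemma card_K_free_clique:
  assumes "clique W E" "U \<subseteq> W" "finite U" "K_free l U E" "0 < l"
  shows "card U < l"
proof (rule ccontr)
  assume "\<not> card U < l"
  then obtain S where S: "S \<subseteq> U" "card S = l" using obtain_subset_with_card_n[of l U] by auto
  then have "is_K l E S"
    using assms smaller_clique[OF assms(1), of S] by (auto simp: is_K_def intro: finite_subset)
  then show False using S assms(4) by (auto simp: K_free_def)
qed

text \<open>The cliques have orders \<open>r * m + 1\<close> and \<open>r * m - 1\<close>. The whole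
  order is divisible by \<open>r\<close>, but every \<open>r\<close>-clique lies inside one side,
  and \<open>r\<close> does not divide the order of the first.\<close>

lemma two_cliques_no_factor:
  fixes \<eta> \<alpha> :: real and r l N :: nat
  assumes r: "2 \<le> r" and l: "0 < l" and \<eta>: "0 < \<eta>" and \<alpha>: "0 < \<alpha>"
  shows "\<exists>n>N. r dvd n \<and> (\<exists>(V :: nat set) E. simple_graph V E \<and> card V = n \<and>
      real (min_degree V E) \<ge> (1 / 2 - \<eta>) * real n \<and> real (indep_number l V E) \<le> \<alpha> * real n \<and>
      \<not> (\<exists>F. K_factor r V E F))"
proof -
  \<comment> \<open>Large enough that the degree loss of at most 2 against \<open>n / 2\<close> fits
    into \<open>\<eta> * n\<close>, and that \<open>2 * l\<close>, which bounds every K_l-free set,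
    is at most \<open>\<alpha> * n\<close>.\<close>
  define m where "m = N + 1 + nat \<lceil>1 / \<eta>\<rceil> + nat \<lceil>2 * l / \<alpha>\<rceil>"
  define n where "n = 2 * (r * m)"
  define k where "k = r * m + 1"
  define V where "V = {..<n}"
  define E where "E = graph_of V (\<lambda>x y. x < k \<longleftrightarrow> y < k)"
  have rm: "m \<le> r * m" using r by simp
  have n: "N < n" "k < n" "r dvd n" "0 < m" using rm r by (auto simp: n_def m_def k_def)
  have "1 / \<eta> \<le> m" "2 * l / \<alpha> \<le> m" unfolding m_def by linarith+
  then have m: "1 \<le> \<eta> * m" "2 * l \<le> \<alpha> * m" using \<eta> \<alpha> by (auto simp: field_simps)
  have rmr: "real m \<le> real (r * m)" using rm by (simp only: of_nat_le_iff)
  have nr: "real n = 2 * real (r * m)" by (simp add: n_def)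
  have adj: "{x, y} \<in> E \<longleftrightarrow> x \<in> V \<and> y \<in> V \<and> x \<noteq> y \<and> (x < k \<longleftrightarrow> y < k)" for x y
    unfolding E_def by (rule graph_of_iff) auto
  have fV: "finite V" by (simp add: V_def)
  have G: "simple_graph V E" unfolding E_def by (rule simple_graph_of[OF fV])
  have deg: "real (card (nb E v)) \<ge> (1 / 2 - \<eta>) * n" if v: "v \<in> V" for v
  proof -
    have "nb E v = (if v < k then {..<k} else {k..<n}) - {v}"
      using v n(2) unfolding nb_def adj V_def by (cases "v < k") auto
    moreover have "card ({..<k} - {v}) = k - 1" if "v < k" using that by simp
    moreover have "card ({k..<n} - {v}) = n - k - 1" if "\<not> v < k" using that v by (simp add: V_def)
    moreover have "r * m \<le> k - 1 + 2" "r * m \<le> n - k - 1 + 2"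
      unfolding k_def n_def by linarith+
    ultimately have "card (nb E v) + 2 \<ge> r * m" by (cases "v < k") simp_all
    then have "real (card (nb E v)) + 2 \<ge> real (r * m)" by linarith
    moreover have "(1 / 2 - \<eta>) * n = real (r * m) - 2 * (\<eta> * real (r * m))"
      unfolding nr by (simp add: algebra_simps)
    moreover have "\<eta> * m \<le> \<eta> * real (r * m)" using rmr \<eta> by (intro mult_left_mono) auto
    ultimately show ?thesis using m by linarith
  qed
  have cl: "clique {..<k} E" "clique {k..<n} E" using n by (auto simp: clique_def adj V_def)
  have ind: "real (indep_number l V E) \<le> \<alpha> * n"
  proof (subst indep_number_le_iff[OF fV l])
    show "\<forall>U\<subseteq>V. K_free l U E \<longrightarrow> real (card U) \<le> \<alpha> * n"
    proof (intro allI impI)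
      fix U assume U: "U \<subseteq> V" "K_free l U E"
      have fU: "finite U" using U(1) fV by (rule finite_subset)
      have "U = (U \<inter> {..<k}) \<union> (U \<inter> {k..<n})" using U by (auto simp: V_def)
      then have "card U \<le> card (U \<inter> {..<k}) + card (U \<inter> {k..<n})" by (metis card_Un_le)
      moreover have "card (U \<inter> {..<k}) < l"
        by (rule card_K_free_clique[OF cl(1)]) (use fU l in \<open>auto intro: K_free_subset[OF U(2)]\<close>)
      moreover have "card (U \<inter> {k..<n}) < l"
        by (rule card_K_free_clique[OF cl(2)]) (use fU l in \<open>auto intro: K_free_subset[OF U(2)]\<close>)
      ultimately have "real (card U) \<le> 2 * l" by linarith
      also have "\<dots> \<le> \<alpha> * m" by (rule m(2))
      also have "\<dots> \<le> \<alpha> * n" using rmr nr \<alpha> by (intro mult_left_mono) auto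
      finally show "real (card U) \<le> \<alpha> * n" .
    qed
  qed (use \<alpha> in simp)
  have no: "\<not> (\<exists>F. K_factor r V E F)"
  proof
    assume "\<exists>F. K_factor r V E F"
    then obtain F where F: "partition_on V F" "\<And>S. S \<in> F \<Longrightarrow> is_K r E S" by (auto simp: K_factor_def)
    define F' where "F' = {S\<in>F. S \<inter> {..<k} \<noteq> {}}"
    have sub: "S \<subseteq> {..<k}" if S: "S \<in> F'" for S
    proof
      fix y assume y: "y \<in> S"
      obtain x where x: "x \<in> S" "x < k" using S by (auto simp: F'_def)
      have "is_K r E S" using S F(2) by (auto simp: F'_def)
      then have "x \<noteq> y \<longrightarrow> {x, y} \<in> E" using x(1) y by (simp add: is_K_def clique_def)
      then show "y \<in> {..<k}" using x(2) adj[of x y] by auto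
    qed
    have U: "\<Union>F' = {..<k}"
    proof (intro equalityI subsetI)
      fix x assume "x \<in> {..<k}"
      moreover have "x \<in> \<Union>F" using F(1) calculation n by (auto simp: partition_on_def V_def)
      ultimately show "x \<in> \<Union>F'" by (auto simp: F'_def)
    qed (use sub in blast)
    have "finite F" using F(1) fV by (rule finite_elements[rotated])
    then have "tiling r E F'" using F unfolding tiling_def F'_def partition_on_def disjoint_def by auto
    then have "r dvd k" using tiling_card(2)[of r E F'] U by simp
    then have "r dvd 1" unfolding k_def by (simp only: dvd_add_right_iff dvd_triv_left)
    then show False using r by simp
  qed
  show ?thesis
    by (intro exI[of _ n] conjI exI[of _ V] exI[of _ E] n G ind no)
       (use min_degree_ge[OF G] deg n in \<open>auto simp: V_def\<close>)
qed

text \<open>\<open>A\<close> maximises \<open>ee E A A - c * (card A)\<^sup>2\<close>. Deleting one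
  vertex cannot increase this functional, which is the degree bound; comparing its values at
  \<open>V\<close> and \<open>A\<close> bounds \<open>card A\<close> from below.\<close>

lemma dense_induced_subgraph:
  fixes c \<eta> :: real
  assumes G: "simple_graph V E" and e: "2 * real (card E) \<ge> (c + \<eta>) * (real (card V))\<^sup>2"
    and \<eta>: "0 < \<eta>" and c: "0 \<le> c"
  obtains A where "A \<subseteq> V" "real (card A) \<ge> sqrt \<eta> * card V"
    "\<And>v. v \<in> A \<Longrightarrow> real (card (nb E v \<inter> A)) \<ge> c * (card A - 1 / 2)"
proof -
  have fV: "finite V" using G by (simp add: simple_graph_def)
  define \<phi> where "\<phi> A = ee E A A - c * (real (card A))\<^sup>2" for A
  have "finite (\<phi> ` Pow V)" "\<phi> ` Pow V \<noteq> {}" using fV by auto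
  then have "Max (\<phi> ` Pow V) \<in> \<phi> ` Pow V" "\<And>B. B \<in> Pow V \<Longrightarrow> \<phi> B \<le> Max (\<phi> ` Pow V)" by (auto intro: Max_in)
  then obtain A where A: "A \<subseteq> V" "\<And>B. B \<subseteq> V \<Longrightarrow> \<phi> B \<le> \<phi> A" by (metis PowD PowI imageE)
  have fA: "finite A" using A(1) fV by (rule finite_subset)
  show ?thesis
  proof (rule that[OF A(1)])
    have "\<eta> * (real (card V))\<^sup>2 \<le> \<phi> V"
      using e double_card_edges[OF G] by (simp add: \<phi>_def algebra_simps)
    also have "\<dots> \<le> \<phi> A" by (rule A(2)) simp
    finally have "\<eta> * (real (card V))\<^sup>2 \<le> ee E A A - c * (real (card A))\<^sup>2" by (simp add: \<phi>_def)
    also have "\<dots> \<le> (real (card A))\<^sup>2"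
    proof -
      have "0 \<le> c * (real (card A))\<^sup>2" using c by simp
      then show ?thesis using ee_le[of E A A] by (simp add: power2_eq_square)
    qed
    finally have "sqrt (\<eta> * (real (card V))\<^sup>2) \<le> sqrt ((real (card A))\<^sup>2)"
      by (rule real_sqrt_le_mono)
    then show "real (card A) \<ge> sqrt \<eta> * card V" by (simp add: real_sqrt_mult)
  next
    fix v assume v: "v \<in> A"
    have *: "ee E A A = ee E (A - {v}) (A - {v}) + 2 * card (nb E v \<inter> A)"
    proof -
      have vv: "nb E v \<inter> A = nb E v \<inter> (A - {v})" using nb_irrefl[OF G, of v] by auto
      have "ee E A A = ee E {v} A + ee E (A - {v}) A"
        unfolding ee_def sum.remove[OF fA v, of "\<lambda>x. \<Sum>y\<in>A. of_bool ({x, y} \<in> E)"] by simp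
      also have "ee E (A - {v}) A = ee E (A - {v}) {v} + ee E (A - {v}) (A - {v})"
        unfolding ee_def sum.distrib[symmetric]
        by (intro sum.cong refl) (simp add: sum.remove[OF fA v])
      also have "ee E (A - {v}) {v} = ee E {v} (A - {v})" by (rule ee_commute)
      also have "ee E {v} (A - {v}) = card (nb E v \<inter> A)" using fA by (simp add: ee_eq_sum_card vv)
      also have "ee E {v} A = card (nb E v \<inter> A)" using fA by (simp add: ee_eq_sum_card)
      finally show ?thesis by simp
    qed
    have "\<phi> (A - {v}) \<le> \<phi> A" using A by blast
    moreover have "real (card (A - {v})) = real (card A) - 1"
      using card.remove[OF fA v] by simp
    ultimately show "real (card (nb E v \<inter> A)) \<ge> c * (card A - 1 / 2)"
      using * by (simp add: \<phi>_def power2_eq_square algebra_simps)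
  qed
qed

text \<open>A vertex whose neighbourhood is an extremal \<open>K\<^bsub>r-1\<^esub>\<close>-free graph lies in no copy of \<open>K\<^sub>r\<close>.\<close>

lemma uncovered_vertex:
  fixes \<eta> \<alpha> :: real and r l N :: nat
  assumes r: "2 \<le> r" and l: "0 < l" and \<eta>: "0 < \<eta>" and \<alpha>: "0 < \<alpha>"
    and pos: "0 < RT_density l (r - 1)"
  shows "\<exists>n>N. r dvd n \<and> (\<exists>(V :: nat set) E. simple_graph V E \<and> card V = n \<and>
      real (min_degree V E) \<ge> (1 / (2 - RT_density l (r - 1)) - \<eta>) * real n \<and>
      real (indep_number l V E) \<le> \<alpha> * real n \<and> \<not> (\<exists>F. K_factor r V E F))"
proof -
  define \<rho> where "\<rho> = RT_density l (r - 1)"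
  have \<rho>: "0 < \<rho>" "\<rho> \<le> 1" using pos RT_density_bounds(2)[OF l] by (auto simp: \<rho>_def)
  \<comment> \<open>Three losses of \<open>\<eta>'\<close> occur: in the lower bound on the ratio,
    in passing to the subgraph, and for the half vertex in its degree bound.\<close>
  define \<eta>' where "\<eta>' = min (\<eta> / 3) (\<rho> / 4)"
  have \<eta>': "0 < \<eta>'" "3 * \<eta>' \<le> \<eta>" "4 * \<eta>' \<le> \<rho>" using \<eta> \<rho> by (auto simp: \<eta>'_def)
  define \<sigma> where "\<sigma> = sqrt \<eta>'"
  have \<sigma>: "0 < \<sigma>" using \<eta>' by (simp add: \<sigma>_def)
  define \<epsilon> where "\<epsilon> = \<alpha> * \<sigma> / 2"
  have \<epsilon>: "0 < \<epsilon>" using \<alpha> \<sigma> by (simp add: \<epsilon>_def)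
  obtain N0 where N0: "\<And>n. N0 \<le> n \<Longrightarrow> \<rho> - \<eta>' \<le> RT_ratio l (r - 1) \<epsilon> n"
    using RT_density_lower[OF l \<eta>'(1) \<epsilon>, of "r - 1"] by (auto simp: \<rho>_def)
  define B0 where "B0 = max (real N + 1) (max ((r + 2) / \<eta>) (max (2 * l / \<alpha>) (1 / (2 * \<eta>'))))"
  define n0 where "n0 = N0 + 1 + nat \<lceil>B0 / \<sigma>\<rceil>"
  have "B0 / \<sigma> \<le> n0" unfolding n0_def by linarith
  then have n0: "N0 \<le> n0" "0 < n0" "B0 \<le> \<sigma> * n0" using \<sigma> by (auto simp: n0_def field_simps)
  \<comment> \<open>A positive ratio excludes the default value 0 of \<open>RT\<close>, so an
    extremal graph exists.\<close>
  have "0 < \<rho> - \<eta>'" using \<eta>' \<rho> by linarith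
  then have "0 < RT_ratio l (r - 1) \<epsilon> n0" using N0[OF n0(1)] by linarith
  then have "RT l n0 (r - 1) (\<epsilon> * n0) \<noteq> 0" by (metis RT_ratio_def div_0 less_irrefl mult_zero_right of_nat_0)
  then obtain V0 and E0 :: "nat set set" where G0: "simple_graph V0 E0" "card V0 = n0" "K_free (r - 1) V0 E0"
     "real (indep_number l V0 E0) \<le> \<epsilon> * n0" "card E0 = RT l n0 (r - 1) (\<epsilon> * n0)"
    using RT_cases[of l n0 "r - 1" "\<epsilon> * n0"] by metis
  have "(\<rho> - \<eta>') * (real n0)\<^sup>2 \<le> 2 * real (card E0)"
    using N0[OF n0(1)] n0(2) by (simp add: RT_ratio_def G0(5) pos_le_divide_eq)
  then have e0: "2 * real (card E0) \<ge> ((\<rho> - 2 * \<eta>') + \<eta>') * (real (card V0))\<^sup>2" by (simp add: G0(2))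
  have c0: "0 \<le> \<rho> - 2 * \<eta>'" using \<eta>' \<rho> by linarith
  obtain A where A: "A \<subseteq> V0" "real (card A) \<ge> sqrt \<eta>' * card V0"
      "\<And>v. v \<in> A \<Longrightarrow> real (card (nb E0 v \<inter> A)) \<ge> (\<rho> - 2 * \<eta>') * (card A - 1 / 2)"
    using dense_induced_subgraph[OF G0(1) e0 \<eta>'(1) c0] by blast
  define a where "a = card A"
  have fV0: "finite V0" using G0(1) by (simp add: simple_graph_def)
  have fA: "finite A" using A(1) fV0 by (rule finite_subset)
  have an: "\<sigma> * n0 \<le> a" using A(2) by (simp add: a_def \<sigma>_def G0(2))
  then have aB: "B0 \<le> a" using n0(3) by linarith
  have aB': "real N + 1 \<le> a" "(r + 2) / \<eta> \<le> a" "2 * l / \<alpha> \<le> a" "1 / (2 * \<eta>') \<le> a"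
    using aB unfolding B0_def by linarith+
  have big: "r + 2 \<le> \<eta> * a" "2 * l \<le> \<alpha> * a" "1 / 2 \<le> \<eta>' * a"
    using aB'(2-4) \<eta> \<alpha> \<eta>'(1) by (auto simp: field_simps)
  \<comment> \<open>The order is chosen so that the two critical degrees agree: \<open>v0\<close>
    has degree \<open>a\<close>, about \<open>n / (2 - \<rho>)\<close>, and a vertex of
    \<open>A\<close> has about \<open>\<rho> * a + (n - a)\<close>, which is again \<open>a\<close>
    when \<open>n = (2 - \<rho>) * a\<close>.\<close>
  define q where "q = nat \<lceil>((2 - \<rho>) * a + 2) / r\<rceil>"
  define n where "n = r * q"
  have x0: "0 \<le> ((2 - \<rho>) * a + 2) / r" using \<rho> by simp
  have "((2 - \<rho>) * a + 2) / r \<le> q" "q < ((2 - \<rho>) * a + 2) / r + 1"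
    unfolding q_def using x0 by linarith+
  then have n: "(2 - \<rho>) * a + 2 \<le> n" "n \<le> (2 - \<rho>) * a + 2 + r"
    using r by (auto simp: n_def field_simps)
  have "1 * real a \<le> (2 - \<rho>) * a" using \<rho> by (intro mult_right_mono) auto
  then have an2: "real a + 2 \<le> n" using n by linarith
  define v0 where "v0 = Suc (Max (insert 0 A))"
  define B where "B = {v0 + 1..<v0 + n - a}"
  have Av0: "x < v0" if "x \<in> A" for x
    using fA that unfolding v0_def by (simp add: le_imp_less_Suc)
  have B: "finite B" "card B = n - a - 1" by (auto simp: B_def)
  have dis: "v0 \<notin> A" "v0 \<notin> B" "A \<inter> B = {}" using Av0 by (force simp: B_def)+
  define V where "V = insert v0 (A \<union> B)"
  have fV: "finite V" using fA B by (simp add: V_def)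
  have cV: "card V = n" using fA B dis an2 by (simp add: V_def card_Un_disjoint a_def)
  \<comment> \<open>\<open>B\<close> is a clique completely joined to \<open>A\<close>, and
    \<open>v0\<close> is adjacent exactly to \<open>A\<close>.\<close>
  define P where "P x y \<longleftrightarrow> (x \<in> A \<and> y \<in> A \<and> {x, y} \<in> E0) \<or> (x \<in> B \<and> y \<noteq> v0) \<or> (y \<in> B \<and> x \<noteq> v0)
      \<or> (x = v0 \<and> y \<in> A) \<or> (y = v0 \<and> x \<in> A)" for x y
  define E where "E = graph_of V P"
  have adj: "{x, y} \<in> E \<longleftrightarrow> x \<in> V \<and> y \<in> V \<and> x \<noteq> y \<and> P x y" for x y
    unfolding E_def by (rule graph_of_iff) (auto simp: P_def insert_commute)
  have G: "simple_graph V E" unfolding E_def by (rule simple_graph_of[OF fV])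
  define d where "d = 1 / (2 - \<rho>)"
  have d: "0 < d" "d \<le> 1" "d * (2 - \<rho>) = 1" using \<rho> by (auto simp: d_def field_simps)
  have dn: "d * n \<le> a + (2 + r)"
  proof -
    have "d * n \<le> d * ((2 - \<rho>) * a + (2 + r))" using n d by (intro mult_left_mono) auto
    also have "\<dots> = (d * (2 - \<rho>)) * a + d * (2 + r)" by (simp add: algebra_simps)
    also have "d * real (2 + r) \<le> 1 * real (2 + r)" using d by (intro mult_right_mono) auto
    finally show ?thesis using d(3) by simp
  qed
  have dn2: "real a \<le> d * n"
  proof -
    have "d * ((2 - \<rho>) * a) \<le> d * n" using n d by (intro mult_left_mono) auto
    then show ?thesis using d(3) by (simp add: mult.assoc[symmetric])
  qed
  have \<eta>n: "\<eta> * a \<le> \<eta> * n" using an2 \<eta> by (intro mult_left_mono) auto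
  have deg: "real (card (nb E v)) \<ge> (d - \<eta>) * n" if v: "v \<in> V" for v
  proof -
    consider "v = v0" | "v \<in> B" | "v \<in> A" using v by (auto simp: V_def)
    then show ?thesis
    proof cases
      case 1
      have "nb E v = A" unfolding nb_def adj using dis 1 by (auto simp: V_def P_def)
      then have "real (card (nb E v)) = a" by (simp add: a_def)
      then show ?thesis using dn big \<eta>n by (simp add: algebra_simps)
    next
      case 2
      then have "V - {v0, v} \<subseteq> nb E v" unfolding nb_def adj by (auto simp: V_def P_def)
      then have "card (V - {v0, v}) \<le> card (nb E v)" by (intro card_mono finite_nb[OF G])
      moreover have "card (V - {v0, v}) = n - 2"
      proof -
        have "v \<noteq> v0" using 2 dis by blast
        then show ?thesis using 2 cV by (subst card_Diff_subset) (auto simp: V_def)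
      qed
      ultimately have "real n - 2 \<le> card (nb E v)" using an2 by linarith
      moreover have "d * n \<le> 1 * real n" using d by (intro mult_right_mono) auto
      ultimately show ?thesis using \<eta>n big by (simp add: algebra_simps)
    next
      case 3
      have "(nb E0 v \<inter> A) \<union> insert v0 B \<subseteq> nb E v"
        using 3 dis nb_irrefl[OF G0(1), of v] unfolding nb_def adj by (auto simp: V_def P_def)
      then have "card ((nb E0 v \<inter> A) \<union> insert v0 B) \<le> card (nb E v)"
        by (intro card_mono finite_nb[OF G])
      moreover have "card ((nb E0 v \<inter> A) \<union> insert v0 B) = card (nb E0 v \<inter> A) + (n - a)"
        using dis B fA an2 by (subst card_Un_disjoint) auto
      ultimately have "real (card (nb E0 v \<inter> A)) + (real n - a) \<le> card (nb E v)"
        using an2 by linarith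
      moreover have "real (card (nb E0 v \<inter> A)) \<ge> (\<rho> - 2 * \<eta>') * (a - 1 / 2)"
        using A(3)[OF 3] by (simp add: a_def)
      moreover have "(\<rho> - 2 * \<eta>') * (a - 1 / 2) \<ge> (\<rho> - 3 * \<eta>') * a"
      proof -
        have "(\<rho> - 2 * \<eta>') * (1 / 2) \<le> 1 / 2" using \<rho> \<eta>' by simp
        then show ?thesis using big(3) by (simp add: algebra_simps)
      qed
      moreover have "(1 - \<rho> + 3 * \<eta>') * a \<le> (1 - \<rho> + 3 * \<eta>') * (d * n)"
        using dn2 \<rho> \<eta>' by (intro mult_left_mono) auto
      moreover have "(1 - \<rho> + 3 * \<eta>') * (d * n) \<le> (1 - \<rho>) * (d * n) + \<eta> * n"
      proof -
        have "d * n \<le> 1 * real n" using d by (intro mult_right_mono) auto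
        then have "3 * \<eta>' * (d * n) \<le> \<eta> * (1 * real n)" using \<eta>' d by (intro mult_mono) auto
        then show ?thesis by (simp add: algebra_simps)
      qed
      moreover have "(1 - \<rho>) * (d * n) = n - d * n"
      proof -
        have "(1 - \<rho>) * (d * n) = (d * (2 - \<rho>)) * n - d * n" by (simp add: algebra_simps)
        then show ?thesis by (simp only: d(3) mult_1)
      qed
      moreover have "(1 - \<rho> + 3 * \<eta>') * a = a - (\<rho> - 3 * \<eta>') * a" "(d - \<eta>) * n = d * n - \<eta> * n"
        by (simp_all add: algebra_simps)
      ultimately show ?thesis by linarith
    qed
  qed
  have ind: "real (indep_number l V E) \<le> \<alpha> * n"
  proof (subst indep_number_le_iff[OF fV l])
    show "\<forall>U\<subseteq>V. K_free l U E \<longrightarrow> real (card U) \<le> \<alpha> * n"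
    proof (intro allI impI)
      fix U assume U: "U \<subseteq> V" "K_free l U E"
      have fU: "finite U" using U(1) fV by (rule finite_subset)
      have "U \<subseteq> insert v0 ((U \<inter> A) \<union> (U \<inter> B))" using U by (auto simp: V_def)
      then have "card U \<le> card (insert v0 ((U \<inter> A) \<union> (U \<inter> B)))" using fU by (intro card_mono) auto
      also have "\<dots> \<le> Suc (card ((U \<inter> A) \<union> (U \<inter> B)))" by (rule card_insert_le_m1) auto
      also have "card ((U \<inter> A) \<union> (U \<inter> B)) \<le> card (U \<inter> A) + card (U \<inter> B)" by (rule card_Un_le)
      finally have "card U \<le> card (U \<inter> A) + card (U \<inter> B) + 1" by simp
      moreover have "clique B E" using dis by (auto simp: clique_def adj V_def P_def)
      then have "card (U \<inter> B) < l"
        by (rule card_K_free_clique) (use fU l in \<open>auto intro: K_free_subset[OF U(2)]\<close>)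
      moreover have "real (card (U \<inter> A)) \<le> \<epsilon> * n0"
      proof -
        have "K_free l (U \<inter> A) E0" unfolding K_free_def
        proof (intro notI, elim exE conjE)
          fix S assume S: "S \<subseteq> U \<inter> A" "is_K l E0 S"
          then have "is_K l E S" by (auto simp: is_K_def clique_def adj V_def P_def)
          then show False using S U(2) by (auto simp: K_free_def)
        qed
        moreover have "\<forall>U\<subseteq>V0. K_free l U E0 \<longrightarrow> real (card U) \<le> \<epsilon> * n0"
          using indep_number_le_iff[OF fV0 l, of "\<epsilon> * n0" E0] G0(4) \<epsilon> by simp
        ultimately show ?thesis using A(1) by blast
      qed
      moreover have "\<epsilon> * n0 \<le> \<alpha> / 2 * a"
        using mult_left_mono[OF an, of "\<alpha> / 2"] \<alpha> by (simp add: \<epsilon>_def)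
      ultimately have "real (card U) \<le> \<alpha> / 2 * a + l" by linarith
      also have "\<dots> \<le> \<alpha> * a" using big by linarith
      also have "\<dots> \<le> \<alpha> * n" using an2 \<alpha> by (intro mult_left_mono) auto
      finally show "real (card U) \<le> \<alpha> * n" .
    qed
  qed (use \<alpha> in simp)
  have no: "\<not> (\<exists>F. K_factor r V E F)"
  proof
    assume "\<exists>F. K_factor r V E F"
    then obtain F where F: "partition_on V F" "\<And>S. S \<in> F \<Longrightarrow> is_K r E S" by (auto simp: K_factor_def)
    have "v0 \<in> \<Union>F" using F(1) by (auto simp: partition_on_def V_def)
    then obtain S where S: "S \<in> F" "v0 \<in> S" by auto
    have K: "is_K r E S" by (rule F(2)[OF S(1)])
    have SA: "S - {v0} \<subseteq> A"
    proof
      fix x assume "x \<in> S - {v0}"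
      then have "{v0, x} \<in> E" using K S by (auto simp: is_K_def clique_def)
      then show "x \<in> A" using dis by (auto simp: adj P_def)
    qed
    have "{x, y} \<in> E0" if "x \<in> S - {v0}" "y \<in> S - {v0}" "x \<noteq> y" for x y
    proof -
      have "{x, y} \<in> E" using that K by (auto simp: is_K_def clique_def)
      moreover have "x \<in> A" "y \<in> A" using SA that by auto
      ultimately show ?thesis using dis by (auto simp: adj P_def)
    qed
    then have "is_K (r - 1) E0 (S - {v0})" using K S by (auto simp: is_K_def clique_def)
    then show False using G0(3) SA A(1) by (auto simp: K_free_def)
  qed
  have "real (min_degree V E) \<ge> (d - \<eta>) * n"
    using min_degree_ge[OF G] deg by (auto simp: V_def)
  moreover have "N < n" using aB'(1) an2 by linarith
  ultimately show ?thesis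
    using G cV ind no unfolding d_def \<rho>_def by (intro exI[of _ n]) (auto simp: n_def)
qed

section \<open>Regularity\<close>

text \<open>A partition of \<open>V\<close> is represented by a family \<open>\<A>\<close> of subsets: its parts are the atoms of \<open>\<A>\<close>,
  so that refining a partition amounts to enlarging the family.\<close>

definition cell :: "'a set \<Rightarrow> 'a set set \<Rightarrow> 'a \<Rightarrow> 'a set" where
  "cell V \<A> x = {y \<in> V. \<forall>A\<in>\<A>. x \<in> A \<longleftrightarrow> y \<in> A}"

definition dens :: "'a set set \<Rightarrow> 'a set \<Rightarrow> 'a set \<Rightarrow> real" where
  "dens E X Y = ee E X Y / (real (card X) * real (card Y))"

definition irregular :: "real \<Rightarrow> 'a set set \<Rightarrow> 'a set \<Rightarrow> 'a set \<Rightarrow> bool" where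
  "irregular \<epsilon> E X Y \<longleftrightarrow> (\<exists>A\<subseteq>X. \<exists>B\<subseteq>Y. \<epsilon> * card X \<le> card A \<and> \<epsilon> * card Y \<le> card B \<and>
     \<epsilon> < \<bar>dens E A B - dens E X Y\<bar>)"

lemma cell_self: "x \<in> V \<Longrightarrow> x \<in> cell V \<A> x"
  and cell_subset: "cell V \<A> x \<subseteq> V"
  and cell_eq: "y \<in> cell V \<A> x \<Longrightarrow> cell V \<A> y = cell V \<A> x"
  and cell_mem_sym: "x \<in> V \<Longrightarrow> y \<in> cell V \<A> x \<Longrightarrow> x \<in> cell V \<A> y"
  and cell_mem: "y \<in> cell V \<A> x \<Longrightarrow> A \<in> \<A> \<Longrightarrow> y \<in> A \<longleftrightarrow> x \<in> A"
  by (auto simp: cell_def)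

lemma cell_anti_mono: "\<A> \<subseteq> \<B> \<Longrightarrow> cell V \<B> x \<subseteq> cell V \<A> x"
  by (auto simp: cell_def)

section \<open>Cell counts and averages over cells\<close>

lemma card_cells:
  assumes "finite \<A>" "card \<A> \<le> m"
  shows "finite (cell V \<A> ` V)" "card (cell V \<A> ` V) \<le> 2 ^ m"
proof -
  have sub: "cell V \<A> ` V \<subseteq> (\<lambda>\<B>. {y\<in>V. \<forall>A\<in>\<A>. A \<in> \<B> \<longleftrightarrow> y \<in> A}) ` Pow \<A>"
  proof
    fix X assume "X \<in> cell V \<A> ` V"
    then obtain x where "X = cell V \<A> x" by auto
    then have "X = (\<lambda>\<B>. {y\<in>V. \<forall>A\<in>\<A>. A \<in> \<B> \<longleftrightarrow> y \<in> A}) {A\<in>\<A>. x \<in> A}"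
      by (auto simp: cell_def)
    then show "X \<in> (\<lambda>\<B>. {y\<in>V. \<forall>A\<in>\<A>. A \<in> \<B> \<longleftrightarrow> y \<in> A}) ` Pow \<A>" by blast
  qed
  show "finite (cell V \<A> ` V)" by (rule finite_subset[OF sub]) (use assms in simp)
  have "card (cell V \<A> ` V) \<le> card (Pow \<A>)" by (rule surj_card_le[OF _ sub]) (use assms in simp)
  also have "\<dots> \<le> 2 ^ m" using assms by (simp add: card_Pow)
  finally show "card (cell V \<A> ` V) \<le> 2 ^ m" .
qed

text \<open>At most \<open>2 ^ m\<close> cells exist, and each of the small ones holds fewer than
  \<open>b\<close> vertices.\<close>

lemma small_cells:
  assumes "finite V" "finite \<A>" "card \<A> \<le> m" and b: "0 \<le> b"
  shows "real (card {x\<in>V. real (card (cell V \<A> x)) < b}) \<le> 2 ^ m * b"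
proof -
  let ?S = "{x\<in>V. real (card (cell V \<A> x)) < b}"
  let ?C = "cell V \<A> ` ?S"
  have finC: "finite ?C" using assms(1) by simp
  have "?S \<subseteq> \<Union>?C"
  proof
    fix x assume x: "x \<in> ?S"
    then have "x \<in> cell V \<A> x" by (intro cell_self) simp
    then show "x \<in> \<Union>?C" using x by (intro UnionI[of "cell V \<A> x"] imageI)
  qed
  moreover have "\<Union>?C \<subseteq> V" by (intro UN_least cell_subset)
  then have "finite (\<Union>?C)" using assms(1) by (rule finite_subset)
  ultimately have "card ?S \<le> card (\<Union>?C)" by (intro card_mono)
  also have "\<dots> \<le> (\<Sum>X\<in>?C. card X)" using card_UN_le[OF finC, of "\<lambda>x. x"] by simp
  finally have "real (card ?S) \<le> (\<Sum>X\<in>?C. real (card X))"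
    unfolding of_nat_sum[symmetric] of_nat_le_iff .
  also have "\<dots> \<le> (\<Sum>X\<in>?C. b)" by (intro sum_mono) auto
  finally have le: "real (card ?S) \<le> card ?C * b" by simp
  have "card ?C \<le> card (cell V \<A> ` V)" using card_cells(1)[OF assms(2,3)] by (intro card_mono) auto
  also have "\<dots> \<le> 2 ^ m" by (rule card_cells(2)[OF assms(2,3)])
  finally have "real (card ?C) \<le> real (2 ^ m)" by (simp only: of_nat_le_iff)
  then have "card ?C * b \<le> 2 ^ m * b" using b by (intro mult_right_mono) simp_all
  then show ?thesis using le by linarith
qed

text \<open>Averaging over cells is a conditional expectation: it leaves the sum against any
  function constant on cells unchanged. Working with functions of vertices rather than of parts
  weights every cell by its order automatically.\<close>

lemma cell_average:
  fixes g k :: "'a \<Rightarrow> real"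
  assumes fV: "finite V" and k: "\<And>x y. x \<in> V \<Longrightarrow> y \<in> cell V \<A> x \<Longrightarrow> k y = k x"
  shows "(\<Sum>x\<in>V. (\<Sum>u\<in>cell V \<A> x. g u) / card (cell V \<A> x) * k x) = (\<Sum>u\<in>V. g u * k u)"
proof -
  let ?c = "cell V \<A>"
  have "(\<Sum>x\<in>V. (\<Sum>u\<in>?c x. g u) / card (?c x) * k x) =
      (\<Sum>x\<in>V. \<Sum>u\<in>V. of_bool (u \<in> ?c x) * (g u / card (?c u) * k u))"
  proof (intro sum.cong refl)
    fix x assume x: "x \<in> V"
    have "(\<Sum>u\<in>?c x. g u) / card (?c x) * k x = (\<Sum>u\<in>?c x. g u / card (?c x) * k x)"
      by (simp add: sum_divide_distrib sum_distrib_right)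
    also have "\<dots> = (\<Sum>u\<in>?c x. g u / card (?c u) * k u)"
    proof (intro sum.cong refl)
      fix u assume u: "u \<in> ?c x"
      show "g u / card (?c x) * k x = g u / card (?c u) * k u" by (simp only: k[OF x u] cell_eq[OF u])
    qed
    also have "\<dots> = (\<Sum>u\<in>V. of_bool (u \<in> ?c x) * (g u / card (?c u) * k u))"
      by (rule sum.mono_neutral_cong_left[OF fV cell_subset]) auto
    finally show "(\<Sum>u\<in>?c x. g u) / card (?c x) * k x = \<dots>" .
  qed
  also have "\<dots> = (\<Sum>u\<in>V. \<Sum>x\<in>V. of_bool (u \<in> ?c x) * (g u / card (?c u) * k u))" by (rule sum.swap)
  also have "\<dots> = (\<Sum>u\<in>V. g u * k u)"
  proof (intro sum.cong refl)
    fix u assume u: "u \<in> V"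
    have "V \<inter> {x. u \<in> ?c x} = ?c u" using u by (auto simp: cell_def)
    then have "(\<Sum>x\<in>V. of_bool (u \<in> ?c x)) = real (card (?c u))" using fV by simp
    moreover have "card (?c u) \<noteq> 0" using cell_self[OF u] finite_subset[OF cell_subset fV] by (auto simp: card_eq_0_iff)
    ultimately show "(\<Sum>x\<in>V. of_bool (u \<in> ?c x) * (g u / card (?c u) * k u)) = g u * k u"
      unfolding sum_distrib_right[symmetric] by simp
  qed
  finally show ?thesis .
qed

lemma cell_average2:
  fixes g h :: "'a \<Rightarrow> 'a \<Rightarrow> real"
  assumes fV: "finite V"
    and h1: "\<And>x y x'. x \<in> V \<Longrightarrow> x' \<in> cell V \<A> x \<Longrightarrow> h x' y = h x y"
    and h2: "\<And>x y y'. y \<in> V \<Longrightarrow> y' \<in> cell V \<A> y \<Longrightarrow> h x y' = h x y"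
  shows "(\<Sum>x\<in>V. \<Sum>y\<in>V. (\<Sum>u\<in>cell V \<A> x. \<Sum>v\<in>cell V \<A> y. g u v) / (real (card (cell V \<A> x)) * real (card (cell V \<A> y))) * h x y)
    = (\<Sum>u\<in>V. \<Sum>v\<in>V. g u v * h u v)"
proof -
  let ?c = "cell V \<A>"
  define G where "G u y = (\<Sum>v\<in>?c y. g u v) / card (?c y)" for u y
  have "(\<Sum>u\<in>?c x. \<Sum>v\<in>?c y. g u v) / (real (card (?c x)) * real (card (?c y))) =
      (\<Sum>u\<in>?c x. G u y) / card (?c x)" for x y
    unfolding G_def sum_divide_distrib[symmetric] by (simp add: mult.commute)
  then have "(\<Sum>x\<in>V. \<Sum>y\<in>V. (\<Sum>u\<in>?c x. \<Sum>v\<in>?c y. g u v) / (real (card (?c x)) * real (card (?c y))) * h x y) =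
      (\<Sum>x\<in>V. \<Sum>y\<in>V. (\<Sum>u\<in>?c x. G u y) / card (?c x) * h x y)"
    by (simp only:)
  also have "\<dots> = (\<Sum>y\<in>V. \<Sum>x\<in>V. (\<Sum>u\<in>?c x. G u y) / card (?c x) * h x y)" by (rule sum.swap)
  also have "\<dots> = (\<Sum>y\<in>V. \<Sum>u\<in>V. G u y * h u y)"
  proof (rule sum.cong[OF refl])
    fix y
    show "(\<Sum>x\<in>V. (\<Sum>u\<in>?c x. G u y) / card (?c x) * h x y) = (\<Sum>u\<in>V. G u y * h u y)"
      by (rule cell_average[OF fV, where g = "\<lambda>u. G u y" and k = "\<lambda>u. h u y"]) (rule h1)
  qed
  also have "\<dots> = (\<Sum>u\<in>V. \<Sum>y\<in>V. G u y * h u y)" by (rule sum.swap)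
  also have "\<dots> = (\<Sum>u\<in>V. \<Sum>v\<in>V. g u v * h u v)"
  proof (rule sum.cong[OF refl])
    fix u
    show "(\<Sum>y\<in>V. G u y * h u y) = (\<Sum>v\<in>V. g u v * h u v)"
      unfolding G_def
      by (rule cell_average[OF fV, where g = "\<lambda>v. g u v" and k = "\<lambda>v. h u v"]) (rule h2)
  qed
  finally show ?thesis .
qed

text \<open>The conditional expectation of the adjacency indicator on pairs of cells, read as a
  function of two vertices; its squared norm is the energy of the partition.\<close>

abbreviation cdens :: "'a set \<Rightarrow> 'a set set \<Rightarrow> 'a set set \<Rightarrow> 'a \<Rightarrow> 'a \<Rightarrow> real" where
  "cdens V \<A> E x y \<equiv> dens E (cell V \<A> x) (cell V \<A> y)"

lemma dens_nonneg: "0 \<le> dens E X Y"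
  unfolding dens_def using ee_nonneg by (intro divide_nonneg_nonneg) auto

lemma dens_le_1: "dens E X Y \<le> 1"
proof (cases "real (card X) * real (card Y) = 0")
  case False
  then have "0 < real (card X) * real (card Y)" by (simp add: zero_less_mult_iff)
  then show ?thesis unfolding dens_def using ee_le[of E X Y] by (subst divide_le_eq_1_pos)
qed (auto simp: dens_def)

lemma dens_commute: "dens E X Y = dens E Y X"
  unfolding dens_def by (subst ee_commute) (simp add: mult.commute)

lemma cdens_sum:
  assumes "finite V"
    and "\<And>x y x'. x \<in> V \<Longrightarrow> x' \<in> cell V \<A> x \<Longrightarrow> h x' y = h x y"
    and "\<And>x y y'. y \<in> V \<Longrightarrow> y' \<in> cell V \<A> y \<Longrightarrow> h x y' = h x y"
  shows "(\<Sum>x\<in>V. \<Sum>y\<in>V. cdens V \<A> E x y * h x y) = (\<Sum>x\<in>V. \<Sum>y\<in>V. of_bool ({x, y} \<in> E) * h x y)"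
  unfolding dens_def ee_def using assms by (rule cell_average2)

lemma cdens_sum_sets:
  assumes "finite V" "A \<subseteq> V" "B \<subseteq> V"
    and "\<And>x. x \<in> A \<Longrightarrow> cell V \<A> x \<subseteq> A" "\<And>x. x \<in> B \<Longrightarrow> cell V \<A> x \<subseteq> B"
  shows "(\<Sum>x\<in>A. \<Sum>y\<in>B. cdens V \<A> E x y) = ee E A B"
proof -
  let ?h = "\<lambda>x y. of_bool (x \<in> A) * of_bool (y \<in> B) :: real"
  have A: "x' \<in> A \<longleftrightarrow> x \<in> A" if "x \<in> V" "x' \<in> cell V \<A> x" for x x'
    using assms(4)[of x] assms(4)[of x'] cell_mem_sym[OF that] that(2) by blast
  have B: "x' \<in> B \<longleftrightarrow> x \<in> B" if "x \<in> V" "x' \<in> cell V \<A> x" for x x'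
    using assms(5)[of x] assms(5)[of x'] cell_mem_sym[OF that] that(2) by blast
  have restrict: "(\<Sum>x\<in>V. \<Sum>y\<in>V. F x y * ?h x y) = (\<Sum>x\<in>A. \<Sum>y\<in>B. F x y)" for F :: "'a \<Rightarrow> 'a \<Rightarrow> real"
  proof -
    have "(\<Sum>x\<in>V. \<Sum>y\<in>V. F x y * ?h x y) = (\<Sum>x\<in>A. \<Sum>y\<in>V. F x y * ?h x y)"
      using assms(1,2) by (intro sum.mono_neutral_right) auto
    also have "\<dots> = (\<Sum>x\<in>A. \<Sum>y\<in>B. F x y)"
      using assms(1,3) by (intro sum.cong refl sum.mono_neutral_cong_right) auto
    finally show ?thesis .
  qed
  show ?thesis
    using cdens_sum[OF assms(1), of \<A> ?h E] A B unfolding restrict ee_def by auto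
qed

text \<open>The sum is the average degree over the cell of \<open>x\<close>.\<close>

lemma cdens_degree:
  assumes "finite V" "x \<in> V" "\<And>v. v \<in> V \<Longrightarrow> D \<le> real (card (nb E v \<inter> V))"
  shows "D \<le> (\<Sum>y\<in>V. cdens V \<A> E x y)"
proof -
  let ?c = "cell V \<A>"
  have fin: "finite (?c y)" for y using finite_subset[OF cell_subset assms(1)] .
  have px: "0 < card (?c x)" using cell_self[OF assms(2)] fin by (auto simp: card_gt_0_iff)
  define g where "g v = (\<Sum>u\<in>?c x. of_bool ({u, v} \<in> E)) / real (card (?c x))" for v
  have "(\<Sum>y\<in>V. cdens V \<A> E x y) = (\<Sum>y\<in>V. (\<Sum>v\<in>?c y. g v) / card (?c y) * 1)"
    unfolding dens_def ee_def g_def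
    by (intro sum.cong refl) (subst sum.swap, simp add: sum_divide_distrib[symmetric])
  also have "\<dots> = (\<Sum>v\<in>V. g v * 1)" by (rule cell_average[OF assms(1)]) simp
  also have "\<dots> = ee E (?c x) V / card (?c x)"
    unfolding g_def ee_def by (simp add: sum_divide_distrib[symmetric] sum.swap[of _ V])
  also have "\<dots> \<ge> D"
  proof -
    have "(\<Sum>u\<in>?c x. D) \<le> ee E (?c x) V"
      unfolding ee_eq_sum_card[OF assms(1)]
      by (intro sum_mono assms(3)) (rule subsetD[OF cell_subset])
    then show ?thesis using px by (simp add: pos_le_divide_eq mult.commute)
  qed
  finally show ?thesis .
qed

text \<open>Pythagoras: the coarse densities are the conditional expectation of the fine ones, so
  the difference of the two is orthogonal to the coarse densities.\<close>

lemma energy_increment: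
  assumes fV: "finite V" and AB: "\<A> \<subseteq> \<B>"
  shows "(\<Sum>x\<in>V. \<Sum>y\<in>V. (cdens V \<B> E x y)\<^sup>2) =
     (\<Sum>x\<in>V. \<Sum>y\<in>V. (cdens V \<A> E x y)\<^sup>2) + (\<Sum>x\<in>V. \<Sum>y\<in>V. (cdens V \<B> E x y - cdens V \<A> E x y)\<^sup>2)"
proof -
  let ?f = "cdens V \<A> E" and ?g = "cdens V \<B> E"
  have sub: "x' \<in> cell V \<B> x \<Longrightarrow> x' \<in> cell V \<A> x" for x x' using cell_anti_mono[OF AB] by blast
  have "(\<Sum>x\<in>V. \<Sum>y\<in>V. ?g x y * ?f x y) = (\<Sum>x\<in>V. \<Sum>y\<in>V. of_bool ({x, y} \<in> E) * ?f x y)"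
    by (rule cdens_sum[OF fV]) (simp_all add: cell_eq[OF sub])
  also have "\<dots> = (\<Sum>x\<in>V. \<Sum>y\<in>V. ?f x y * ?f x y)"
    by (rule cdens_sum[OF fV, symmetric]) (simp_all add: cell_eq)
  finally have gf: "(\<Sum>x\<in>V. \<Sum>y\<in>V. ?g x y * ?f x y) = (\<Sum>x\<in>V. \<Sum>y\<in>V. ?f x y * ?f x y)" .
  have "(\<Sum>x\<in>V. \<Sum>y\<in>V. (?g x y - ?f x y)\<^sup>2) = (\<Sum>x\<in>V. \<Sum>y\<in>V. ?g x y * ?g x y) - 2 * (\<Sum>x\<in>V. \<Sum>y\<in>V. ?g x y * ?f x y)
      + (\<Sum>x\<in>V. \<Sum>y\<in>V. ?f x y * ?f x y)"
    unfolding sum_distrib_left sum_subtractf[symmetric] sum.distrib[symmetric]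
    by (intro sum.cong refl) (simp add: power2_eq_square algebra_simps)
  then show ?thesis unfolding gf by (simp add: power2_eq_square)
qed

text \<open>The witnesses \<open>A\<close> and \<open>B\<close> are unions of fine cells, so on
  \<open>A \<times> B\<close> the fine densities deviate by more than \<open>\<epsilon>\<close> on
  average. By Cauchy-Schwarz the mean square deviation there is at least
  \<open>\<epsilon>\<^sup>2\<close>, and \<open>A \<times> B\<close> makes up at least a fraction
  \<open>\<epsilon>\<^sup>2\<close> of the pair of cells.\<close>

lemma irregular_energy:
  fixes \<epsilon> :: real
  assumes fV: "finite V" and AB: "\<A> \<subseteq> \<B>" and \<epsilon>: "0 < \<epsilon>" and xy: "x \<in> V" "y \<in> V"
    and W: "A \<in> \<B>" "B \<in> \<B>" "A \<subseteq> cell V \<A> x" "B \<subseteq> cell V \<A> y"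
      "\<epsilon> * card (cell V \<A> x) \<le> card A" "\<epsilon> * card (cell V \<A> y) \<le> card B"
      "\<epsilon> < \<bar>dens E A B - cdens V \<A> E x y\<bar>"
  shows "\<epsilon> ^ 4 \<le> (\<Sum>u\<in>cell V \<A> x. \<Sum>v\<in>cell V \<A> y. (cdens V \<B> E u v - cdens V \<A> E u v)\<^sup>2)
     / (real (card (cell V \<A> x)) * real (card (cell V \<A> y)))"
proof -
  let ?X = "cell V \<A> x" and ?Y = "cell V \<A> y"
  define D where "D u v = cdens V \<B> E u v - cdens V \<A> E u v" for u v
  have XV: "?X \<subseteq> V" "?Y \<subseteq> V" by (rule cell_subset)+
  have finXY: "finite ?X" "finite ?Y" by (rule finite_subset[OF XV(1) fV], rule finite_subset[OF XV(2) fV])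
  have finAB: "finite A" "finite B" by (rule finite_subset[OF W(3) finXY(1)], rule finite_subset[OF W(4) finXY(2)])
  note fin = finXY finAB
  have pos: "0 < card ?X" "0 < card ?Y"
    using cell_self[OF xy(1), of \<A>] cell_self[OF xy(2), of \<A>] fin by (auto simp: card_gt_0_iff)
  have pA: "0 < real (card A)" by (rule less_le_trans[OF _ W(5)]) (use \<epsilon> pos in simp)
  have pB: "0 < real (card B)" by (rule less_le_trans[OF _ W(6)]) (use \<epsilon> pos in simp)
  have "(\<Sum>u\<in>A. \<Sum>v\<in>B. cdens V \<B> E u v) = ee E A B"
  proof (rule cdens_sum_sets[OF fV])
    show "A \<subseteq> V" "B \<subseteq> V" using W(3,4) XV by blast+
    show "cell V \<B> u \<subseteq> A" if "u \<in> A" for u using cell_mem[OF _ W(1)] that by blast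
    show "cell V \<B> u \<subseteq> B" if "u \<in> B" for u using cell_mem[OF _ W(2)] that by blast
  qed
  moreover have "(\<Sum>u\<in>A. \<Sum>v\<in>B. cdens V \<A> E u v) = (\<Sum>u\<in>A. \<Sum>v\<in>B. cdens V \<A> E x y)"
  proof (intro sum.cong refl)
    fix u v assume uv: "u \<in> A" "v \<in> B"
    show "cdens V \<A> E u v = cdens V \<A> E x y"
      by (simp only: cell_eq[OF subsetD[OF W(3) uv(1)]] cell_eq[OF subsetD[OF W(4) uv(2)]])
  qed
  ultimately have sD: "(\<Sum>u\<in>A. \<Sum>v\<in>B. D u v) = real (card A) * real (card B) * (dens E A B - cdens V \<A> E x y)"
    using pA pB by (simp add: D_def sum_subtractf dens_def[of E A B] algebra_simps)
  have "(\<Sum>u\<in>A. \<Sum>v\<in>B. D u v)\<^sup>2 = (\<Sum>p\<in>A \<times> B. D (fst p) (snd p))\<^sup>2"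
    by (simp add: sum.cartesian_product split_def)
  also have "\<dots> \<le> real (card (A \<times> B)) * (\<Sum>p\<in>A \<times> B. (D (fst p) (snd p))\<^sup>2)"
    using sum_squared_le_sum_of_squares[of "\<lambda>p. D (fst p) (snd p)" "A \<times> B"] by (simp only: mult.commute)
  also have "(\<Sum>p\<in>A \<times> B. (D (fst p) (snd p))\<^sup>2) = (\<Sum>u\<in>A. \<Sum>v\<in>B. (D u v)\<^sup>2)"
    by (simp add: sum.cartesian_product split_def)
  finally have "(real (card A) * real (card B) * (dens E A B - cdens V \<A> E x y))\<^sup>2 \<le>
      (real (card A) * real (card B)) * (\<Sum>u\<in>A. \<Sum>v\<in>B. (D u v)\<^sup>2)"
    unfolding sD card_cartesian_product of_nat_mult .
  then have "(real (card A) * real (card B)) * ((real (card A) * real (card B)) * (dens E A B - cdens V \<A> E x y)\<^sup>2) \<le>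
      (real (card A) * real (card B)) * (\<Sum>u\<in>A. \<Sum>v\<in>B. (D u v)\<^sup>2)"
    by (simp add: power2_eq_square mult_ac)
  then have 1: "(real (card A) * real (card B)) * (dens E A B - cdens V \<A> E x y)\<^sup>2 \<le> (\<Sum>u\<in>A. \<Sum>v\<in>B. (D u v)\<^sup>2)"
    using pA pB by simp
  have p1: "\<epsilon>\<^sup>2 \<le> (dens E A B - cdens V \<A> E x y)\<^sup>2"
    using W(7) \<epsilon> by (metis abs_le_square_iff abs_of_pos less_imp_le)
  have p2: "(\<epsilon> * card ?X) * (\<epsilon> * card ?Y) \<le> real (card A) * real (card B)"
    using W(5,6) \<epsilon> by (intro mult_mono) auto
  have "((\<epsilon> * card ?X) * (\<epsilon> * card ?Y)) * \<epsilon>\<^sup>2 \<le> (real (card A) * real (card B)) * (dens E A B - cdens V \<A> E x y)\<^sup>2"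
    by (rule mult_mono[OF p2 p1]) simp_all
  also note 1
  also have "(\<Sum>u\<in>A. \<Sum>v\<in>B. (D u v)\<^sup>2) \<le> (\<Sum>u\<in>?X. \<Sum>v\<in>B. (D u v)\<^sup>2)"
    using W(3) fin by (intro sum_mono2 sum_nonneg) auto
  also have "\<dots> \<le> (\<Sum>u\<in>?X. \<Sum>v\<in>?Y. (D u v)\<^sup>2)"
    using W(4) fin by (intro sum_mono sum_mono2) auto
  finally have "\<epsilon> ^ 4 * (real (card ?X) * real (card ?Y)) \<le> (\<Sum>u\<in>?X. \<Sum>v\<in>?Y. (D u v)\<^sup>2)"
    by (simp add: power2_eq_square power4_eq_xxxx mult_ac)
  then show ?thesis using pos unfolding D_def by (subst pos_le_divide_eq) auto
qed

text \<open>The energy never exceeds \<open>(card V)\<^sup>2\<close>, while a partition with too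
  many irregular pairs can be refined by its witnesses to gain \<open>\<epsilon> ^ 4\<close> on each
  of them, in total \<open>\<epsilon> ^ 5 * (card V)\<^sup>2\<close>. Irregularity is measured in
  pairs of vertices, which takes the place of an equipartition.\<close>

lemma regularity:
  fixes \<epsilon> :: real and m :: nat
  assumes \<epsilon>: "0 < \<epsilon>"
  shows "\<exists>M. \<forall>(V :: 'a set) E \<A>. finite V \<longrightarrow> finite \<A> \<longrightarrow> card \<A> \<le> m \<longrightarrow>
    (\<exists>\<B>. \<A> \<subseteq> \<B> \<and> finite \<B> \<and> card \<B> \<le> M \<and>
      real (card {(x, y) \<in> V \<times> V. irregular \<epsilon> E (cell V \<B> x) (cell V \<B> y)}) \<le> \<epsilon> * (real (card V))\<^sup>2)"
proof -
  \<comment> \<open>Two witnesses are added for each of the at most \<open>2 ^ k * 2 ^ k\<close>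
    pairs of cells.\<close>
  define \<phi> :: "nat \<Rightarrow> nat" where "\<phi> k = k + 2 * (2 ^ k * 2 ^ k)" for k
  have mono: "mono \<phi>" unfolding \<phi>_def mono_def by (intro allI impI add_mono mult_le_mono power_increasing) auto
  have step: "\<exists>\<B>. \<A> \<subseteq> \<B> \<and> finite \<B> \<and> card \<B> \<le> \<phi> k \<and>
      (\<Sum>x\<in>V. \<Sum>y\<in>V. (cdens V \<A> E x y)\<^sup>2) + \<epsilon> ^ 5 * (real (card V))\<^sup>2 \<le> (\<Sum>x\<in>V. \<Sum>y\<in>V. (cdens V \<B> E x y)\<^sup>2)"
    if fV: "finite V" and A: "finite \<A>" "card \<A> \<le> k"
      and irr: "real (card {(x, y) \<in> V \<times> V. irregular \<epsilon> E (cell V \<A> x) (cell V \<A> y)}) > \<epsilon> * (real (card V))\<^sup>2"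
    for V :: "'a set" and E \<A> k
  proof -
    let ?c = "cell V \<A>"
    define I where "I = {(x, y) \<in> V \<times> V. irregular \<epsilon> E (?c x) (?c y)}"
    \<comment> \<open>The witnesses are chosen per pair of cells, not per pair of vertices; this
      bounds the number of added sets independently of \<open>V\<close>.\<close>
    define wA where "wA X Y = (SOME A. \<exists>B. A \<subseteq> X \<and> B \<subseteq> Y \<and> \<epsilon> * card X \<le> card A \<and> \<epsilon> * card Y \<le> card B \<and>
       \<epsilon> < \<bar>dens E A B - dens E X Y\<bar>)" for X Y
    define wB where "wB X Y = (SOME B. wA X Y \<subseteq> X \<and> B \<subseteq> Y \<and> \<epsilon> * card X \<le> card (wA X Y) \<and> \<epsilon> * card Y \<le> card B \<and>
       \<epsilon> < \<bar>dens E (wA X Y) B - dens E X Y\<bar>)" for X Y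
    have w: "wA X Y \<subseteq> X \<and> wB X Y \<subseteq> Y \<and> \<epsilon> * card X \<le> card (wA X Y) \<and> \<epsilon> * card Y \<le> card (wB X Y) \<and>
       \<epsilon> < \<bar>dens E (wA X Y) (wB X Y) - dens E X Y\<bar>" if i: "irregular \<epsilon> E X Y" for X Y
    proof -
      from i have "\<exists>A B. A \<subseteq> X \<and> B \<subseteq> Y \<and> \<epsilon> * card X \<le> card A \<and> \<epsilon> * card Y \<le> card B \<and>
       \<epsilon> < \<bar>dens E A B - dens E X Y\<bar>" unfolding irregular_def by blast
      from someI_ex[OF this, folded wA_def] show ?thesis unfolding wB_def by (rule someI_ex)
    qed
    define P where "P = ?c ` V"
    define \<B> where "\<B> = \<A> \<union> ((\<lambda>(X, Y). wA X Y) ` (P \<times> P) \<union> (\<lambda>(X, Y). wB X Y) ` (P \<times> P))"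
    have fP: "finite P" "card P \<le> 2 ^ k" using card_cells[OF A, of V] by (auto simp: P_def)
    have "card \<B> \<le> card \<A> + (card (P \<times> P) + card (P \<times> P))"
      unfolding \<B>_def using fP
      by (intro order_trans[OF card_Un_le] add_mono card_image_le) auto
    also have "card (P \<times> P) \<le> 2 ^ k * 2 ^ k"
      using fP by (simp add: card_cartesian_product mult_le_mono)
    finally have cB: "card \<B> \<le> \<phi> k" using A by (simp add: \<phi>_def)
    have fB: "finite \<B>" using A fP by (simp add: \<B>_def)
    have AB: "\<A> \<subseteq> \<B>" by (auto simp: \<B>_def)
    let ?D = "\<lambda>u v. (cdens V \<B> E u v - cdens V \<A> E u v)\<^sup>2"
    have "\<epsilon> ^ 5 * (real (card V))\<^sup>2 = \<epsilon> ^ 4 * (\<epsilon> * (real (card V))\<^sup>2)"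
      by (simp add: power_numeral_reduce)
    also have "\<dots> \<le> \<epsilon> ^ 4 * real (card I)"
      using irr \<epsilon> by (intro mult_left_mono) (auto simp: I_def)
    also have "\<dots> = (\<Sum>p\<in>I. \<epsilon> ^ 4)" by simp
    also have "\<dots> \<le> (\<Sum>p\<in>I. (\<Sum>u\<in>?c (fst p). \<Sum>v\<in>?c (snd p). ?D u v) / (real (card (?c (fst p))) * real (card (?c (snd p)))))"
    proof (intro sum_mono)
      fix p assume "p \<in> I"
      then obtain x y where p: "p = (x, y)" and xy: "x \<in> V" "y \<in> V" and i: "irregular \<epsilon> E (?c x) (?c y)"
        by (auto simp: I_def)
      have P: "(?c x, ?c y) \<in> P \<times> P" using xy by (simp add: P_def)
      have mem: "wA (?c x) (?c y) \<in> \<B>" "wB (?c x) (?c y) \<in> \<B>"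
        unfolding \<B>_def using P by force+
      show "\<epsilon> ^ 4 \<le> (\<Sum>u\<in>?c (fst p). \<Sum>v\<in>?c (snd p). ?D u v) / (real (card (?c (fst p))) * real (card (?c (snd p))))"
        unfolding p fst_conv snd_conv
        by (rule irregular_energy[OF fV AB \<epsilon> xy mem]) (use w[OF i] in blast)+
    qed
    also have "\<dots> \<le> (\<Sum>p\<in>V \<times> V. (\<Sum>u\<in>?c (fst p). \<Sum>v\<in>?c (snd p). ?D u v) / (real (card (?c (fst p))) * real (card (?c (snd p)))))"
      using fV by (intro sum_mono2) (auto simp: I_def intro!: divide_nonneg_nonneg sum_nonneg)
    also have "\<dots> = (\<Sum>x\<in>V. \<Sum>y\<in>V. (\<Sum>u\<in>?c x. \<Sum>v\<in>?c y. ?D u v) / (real (card (?c x)) * real (card (?c y))) * 1)"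
      by (simp add: sum.cartesian_product split_def)
    also have "\<dots> = (\<Sum>u\<in>V. \<Sum>v\<in>V. ?D u v * 1)"
      by (rule cell_average2[OF fV]) simp_all
    finally have "\<epsilon> ^ 5 * (real (card V))\<^sup>2 \<le> (\<Sum>u\<in>V. \<Sum>v\<in>V. ?D u v)" by simp
    then show ?thesis using energy_increment[OF fV AB, of E] AB fB cB by (intro exI[of _ \<B>]) simp
  qed
  \<comment> \<open>More than \<open>1 / \<epsilon> ^ 5\<close> successful refinements would push
    the energy above its maximum.\<close>
  define K where "K = nat \<lceil>1 / \<epsilon> ^ 5\<rceil> + 1"
  have K: "1 < real K * \<epsilon> ^ 5"
  proof -
    have "1 / \<epsilon> ^ 5 < real K" unfolding K_def by linarith
    then show ?thesis using \<epsilon> by (simp add: field_simps)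
  qed
  define M where "M = (\<phi> ^^ K) m"
  have incr: "k \<le> \<phi> k" for k by (simp add: \<phi>_def)
  have main: "\<exists>\<B>. \<A> \<subseteq> \<B> \<and> finite \<B> \<and> card \<B> \<le> (\<phi> ^^ j) m \<and>
     (real (card {(x, y) \<in> V \<times> V. irregular \<epsilon> E (cell V \<B> x) (cell V \<B> y)}) \<le> \<epsilon> * (real (card V))\<^sup>2 \<or>
      real j * \<epsilon> ^ 5 * (real (card V))\<^sup>2 \<le> (\<Sum>x\<in>V. \<Sum>y\<in>V. (cdens V \<B> E x y)\<^sup>2))"
    if fV: "finite V" and A: "finite \<A>" "card \<A> \<le> m" for V :: "'a set" and E \<A> j
  proof (induction j)
    case 0
    show ?case using A by (intro exI[of _ \<A>]) (auto intro!: sum_nonneg)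
  next
    case (Suc j)
    then obtain \<B> where B: "\<A> \<subseteq> \<B>" "finite \<B>" "card \<B> \<le> (\<phi> ^^ j) m"
     and or: "real (card {(x, y) \<in> V \<times> V. irregular \<epsilon> E (cell V \<B> x) (cell V \<B> y)}) \<le> \<epsilon> * (real (card V))\<^sup>2 \<or>
      real j * \<epsilon> ^ 5 * (real (card V))\<^sup>2 \<le> (\<Sum>x\<in>V. \<Sum>y\<in>V. (cdens V \<B> E x y)\<^sup>2)" by blast
    show ?case
    proof (cases "real (card {(x, y) \<in> V \<times> V. irregular \<epsilon> E (cell V \<B> x) (cell V \<B> y)}) \<le> \<epsilon> * (real (card V))\<^sup>2")
      case True
      then show ?thesis using B incr[of "(\<phi> ^^ j) m"] by (intro exI[of _ \<B>]) auto
    next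
      case False
      then have gt: "real (card {(x, y) \<in> V \<times> V. irregular \<epsilon> E (cell V \<B> x) (cell V \<B> y)}) > \<epsilon> * (real (card V))\<^sup>2"
        by (simp only: not_le)
      obtain \<C> where "\<B> \<subseteq> \<C>" "finite \<C>" "card \<C> \<le> \<phi> ((\<phi> ^^ j) m)"
       "(\<Sum>x\<in>V. \<Sum>y\<in>V. (cdens V \<B> E x y)\<^sup>2) + \<epsilon> ^ 5 * (real (card V))\<^sup>2 \<le> (\<Sum>x\<in>V. \<Sum>y\<in>V. (cdens V \<C> E x y)\<^sup>2)"
        using step[OF fV B(2,3) gt] by blast
      moreover have "real j * \<epsilon> ^ 5 * (real (card V))\<^sup>2 \<le> (\<Sum>x\<in>V. \<Sum>y\<in>V. (cdens V \<B> E x y)\<^sup>2)"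
        using or False by blast
      ultimately show ?thesis using B(1) by (intro exI[of _ \<C>]) (auto simp: algebra_simps)
    qed
  qed
  show ?thesis
  proof (intro exI[of _ M] allI impI)
    fix V :: "'a set" and E and \<A> :: "'a set set"
    assume fV: "finite V" and A: "finite \<A>" "card \<A> \<le> m"
    obtain \<B> where B: "\<A> \<subseteq> \<B>" "finite \<B>" "card \<B> \<le> M"
     and or: "real (card {(x, y) \<in> V \<times> V. irregular \<epsilon> E (cell V \<B> x) (cell V \<B> y)}) \<le> \<epsilon> * (real (card V))\<^sup>2 \<or>
      real K * \<epsilon> ^ 5 * (real (card V))\<^sup>2 \<le> (\<Sum>x\<in>V. \<Sum>y\<in>V. (cdens V \<B> E x y)\<^sup>2)"
      using main[OF fV A, where j = K] unfolding M_def by blast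
    have "(\<Sum>x\<in>V. \<Sum>y\<in>V. (cdens V \<B> E x y)\<^sup>2) \<le> (\<Sum>x\<in>V. \<Sum>y\<in>V. 1)"
      by (intro sum_mono power_le_one dens_nonneg dens_le_1)
    then have le: "(\<Sum>x\<in>V. \<Sum>y\<in>V. (cdens V \<B> E x y)\<^sup>2) \<le> 1 * (real (card V))\<^sup>2"
      by (simp add: power2_eq_square)
    have "real (card {(x, y) \<in> V \<times> V. irregular \<epsilon> E (cell V \<B> x) (cell V \<B> y)}) \<le> \<epsilon> * (real (card V))\<^sup>2"
    proof (cases "V = {}")
      case False
      then have "0 < (real (card V))\<^sup>2" using fV by (simp add: card_gt_0_iff)
      then have "1 * (real (card V))\<^sup>2 < real K * \<epsilon> ^ 5 * (real (card V))\<^sup>2"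
        using K by (intro mult_strict_right_mono)
      then show ?thesis using or le by linarith
    qed simp
    then show "\<exists>\<B>. \<A> \<subseteq> \<B> \<and> finite \<B> \<and> card \<B> \<le> M \<and>
      real (card {(x, y) \<in> V \<times> V. irregular \<epsilon> E (cell V \<B> x) (cell V \<B> y)}) \<le> \<epsilon> * (real (card V))\<^sup>2"
      using B by blast
  qed
qed

lemma regular_pair:
  assumes "\<not> irregular \<epsilon> E X Y" "A \<subseteq> X" "B \<subseteq> Y" "\<epsilon> * card X \<le> card A" "\<epsilon> * card Y \<le> card B"
    "finite A" "finite B"
  shows "(dens E X Y - \<epsilon>) * (real (card A) * real (card B)) \<le> ee E A B"
proof -
  have le: "dens E X Y - \<epsilon> \<le> dens E A B"
  proof -
    have "\<bar>dens E A B - dens E X Y\<bar> \<le> \<epsilon>" using assms unfolding irregular_def by (meson not_le)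
    then show ?thesis by linarith
  qed
  show ?thesis
  proof (cases "card A = 0 \<or> card B = 0")
    case False
    then have "ee E A B = dens E A B * (real (card A) * real (card B))" by (simp add: dens_def)
    then show ?thesis using le by (simp add: mult_right_mono)
  qed (use ee_nonneg[of E A B] in auto)
qed

section \<open>Cliques in common neighbourhoods\<close>

text \<open>Each pair of elements is coloured by some \<open>C\<close> for which it is bad; with
  boundedly many colours, Ramsey's theorem makes one \<open>C\<close> bad for all pairs of a
  \<open>q\<close>-set.\<close>

lemma ramsey_pairs:
  fixes K q :: nat
  shows "\<exists>R. \<forall>(I :: 'a set) (P :: 'b set) bad. finite I \<longrightarrow> R \<le> card I \<longrightarrow> finite P \<longrightarrow> card P \<le> K \<longrightarrow>
      (\<forall>C x y. bad C x y \<longrightarrow> bad C y x) \<longrightarrow> (\<forall>x\<in>I. \<forall>y\<in>I. x \<noteq> y \<longrightarrow> (\<exists>C\<in>P. bad C x y)) \<longrightarrow>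
      (\<exists>C. \<exists>H\<subseteq>I. finite H \<and> card H = q \<and> (\<forall>x\<in>H. \<forall>y\<in>H. x \<noteq> y \<longrightarrow> bad C x y))"
proof -
  obtain R :: nat where R: "partn_lst {..<R} (replicate (Suc K) q) 2"
    using ramsey_full[of "replicate (Suc K) q" 2] by blast
  show ?thesis
  proof (intro exI[of _ R] allI impI)
    fix I :: "'a set" and P :: "'b set" and bad
    assume I: "finite I" "R \<le> card I" and P: "finite P" "card P \<le> K"
      and sym: "\<forall>C x y. bad C x y \<longrightarrow> bad C y x"
      and bad: "\<forall>x\<in>I. \<forall>y\<in>I. x \<noteq> y \<longrightarrow> (\<exists>C\<in>P. bad C x y)"
    obtain I0 where I0: "I0 \<subseteq> I" "card I0 = R" using obtain_subset_with_card_n[OF I(2)] by blast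
    have "finite I0" using I0(1) I(1) by (rule finite_subset)
    then obtain h where h: "bij_betw h {0..<R} I0" using ex_bij_betw_nat_finite[of I0] I0(2) by auto
    then have h': "inj_on h {..<R}" "h ` {..<R} = I0" by (auto simp: bij_betw_def atLeast0LessThan)
    obtain idx where idx: "bij_betw idx P {0..<card P}" using ex_bij_betw_finite_nat[OF P(1)] by blast
    define col where "col e = (SOME C. C \<in> P \<and> (\<forall>x\<in>e. \<forall>y\<in>e. x \<noteq> y \<longrightarrow> bad C (h x) (h y)))" for e
    have col: "col e \<in> P \<and> (\<forall>x\<in>e. \<forall>y\<in>e. x \<noteq> y \<longrightarrow> bad (col e) (h x) (h y))" if "e \<in> nsets {..<R} 2" for e
    proof -
      obtain x y where e: "e = {x, y}" "x < R" "y < R" "x \<noteq> y"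
        using \<open>e \<in> _\<close> by (elim nsets2_E) auto
      have "h x \<in> I" "h y \<in> I" "h x \<noteq> h y"
        using e h' I0(1) by (auto simp: inj_on_def)
      then obtain C where "C \<in> P" "bad C (h x) (h y)" using bad by blast
      then have "C \<in> P \<and> (\<forall>x\<in>e. \<forall>y\<in>e. x \<noteq> y \<longrightarrow> bad C (h x) (h y))" using e sym by auto
      then show ?thesis unfolding col_def by (rule someI)
    qed
    have "(\<lambda>e. idx (col e)) \<in> nsets {..<R} 2 \<rightarrow> {..<Suc K}"
    proof
      fix e assume "e \<in> nsets {..<R} 2"
      then have "idx (col e) \<in> {0..<card P}" using col idx by (auto simp: bij_betw_def)
      then show "idx (col e) \<in> {..<Suc K}" using P(2) by simp
    qed
    then obtain i H where H: "i < Suc K" "H \<in> nsets {..<R} (replicate (Suc K) q ! i)"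
        "(\<lambda>e. idx (col e)) ` nsets H 2 \<subseteq> {i}"
      using partn_lstE[OF R, of "\<lambda>e. idx (col e)" "Suc K"] by (metis length_replicate)
    have H': "H \<subseteq> {..<R}" "finite H" "card H = q" using H(1,2) by (auto simp: nsets_def nth_replicate simp del: replicate_Suc)
    define C where "C = inv_into P idx i"
    have "bad C (h x) (h y)" if "x \<in> H" "y \<in> H" "x \<noteq> y" for x y
    proof -
      have e: "{x, y} \<in> nsets H 2" using that by simp
      then have eR: "{x, y} \<in> nsets {..<R} 2" using nsets_mono[OF H'(1)] by blast
      have "idx (col {x, y}) = i" using H(3) e by blast
      then have "col {x, y} = C" using col[OF eR] idx unfolding C_def bij_betw_def by (metis inv_into_f_f)
      then show ?thesis using col[OF eR] that by auto
    qed
    moreover have "inj_on h H" using h'(1) H'(1) by (rule inj_on_subset)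
    moreover have "h ` H \<subseteq> I" using H'(1) h'(2) I0(1) by blast
    ultimately have "h ` H \<subseteq> I \<and> finite (h ` H) \<and> card (h ` H) = q \<and>
       (\<forall>x\<in>h ` H. \<forall>y\<in>h ` H. x \<noteq> y \<longrightarrow> bad C x y)"
      using H'(2,3) by (auto simp: card_image)
    then show "\<exists>C. \<exists>H\<subseteq>I. finite H \<and> card H = q \<and> (\<forall>x\<in>H. \<forall>y\<in>H. x \<noteq> y \<longrightarrow> bad C x y)" by blast
  qed
qed

lemma large_fibre:
  assumes "finite I" "finite T" "f ` I \<subseteq> T" "card T * k < card I"
  obtains t where "t \<in> T" "k < card {x\<in>I. f x = t}"
proof (rule ccontr)
  assume neg: "\<not> thesis"
  have "I = (\<Union>t\<in>T. {x\<in>I. f x = t})" using assms(3) by auto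
  then have "card I \<le> (\<Sum>t\<in>T. card {x\<in>I. f x = t})" by (metis card_UN_le assms(2))
  also have "\<dots> \<le> (\<Sum>t\<in>T. k)" using neg that by (intro sum_mono) (meson not_le)
  finally show False using assms(4) by simp
qed

text \<open>A second moment argument: let \<open>g z\<close> count the \<open>x \<in> H\<close> with
  \<open>z \<in> N x\<close>. It is an integer, so \<open>(g z - 1) * (g z - 2) \<ge> 0\<close>.
  Small intersections give \<open>\<Sum> g\<^sup>2 \<le> \<Sum> g + card C\<close>, hence
  \<open>2 * \<Sum> g \<le> 3 * card C\<close>, against
  \<open>\<Sum> g \<ge> q * p * card C \<ge> 2 * card C\<close>.\<close>

lemma not_all_pairs_nearly_disjoint:
  fixes p c :: real and N :: "'b \<Rightarrow> 'a set"
  assumes C: "finite C" "0 < card C" and H: "finite H" "card H = q"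
    and big: "\<And>x. x \<in> H \<Longrightarrow> p * card C \<le> card (N x \<inter> C)"
    and small: "\<And>x y. x \<in> H \<Longrightarrow> y \<in> H \<Longrightarrow> x \<noteq> y \<Longrightarrow> card (N x \<inter> N y \<inter> C) \<le> c * card C"
    and q: "2 \<le> q * p" "c * (real q)\<^sup>2 \<le> 1" "0 \<le> c"
  shows False
proof -
  define g where "g z = (\<Sum>x\<in>H. of_bool (z \<in> N x) :: real)" for z
  have g1: "(\<Sum>z\<in>C. g z) = (\<Sum>x\<in>H. real (card (N x \<inter> C)))"
    unfolding g_def by (subst sum.swap) (use C in \<open>simp add: Int_def conj_commute\<close>)
  have "(\<Sum>z\<in>C. g z * g z) = (\<Sum>z\<in>C. \<Sum>x\<in>H. \<Sum>y\<in>H. of_bool (z \<in> N x) * of_bool (z \<in> N y))"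
    by (simp only: g_def sum_product)
  also have "\<dots> = (\<Sum>x\<in>H. \<Sum>y\<in>H. \<Sum>z\<in>C. of_bool (z \<in> N x) * of_bool (z \<in> N y))"
    by (subst sum.swap, rule sum.cong[OF refl], rule sum.swap)
  also have "\<dots> = (\<Sum>x\<in>H. \<Sum>y\<in>H. real (card (N x \<inter> N y \<inter> C)))"
  proof (intro sum.cong refl)
    fix x y
    have "(\<Sum>z\<in>C. of_bool (z \<in> N x) * of_bool (z \<in> N y) :: real) = (\<Sum>z\<in>C. of_bool (z \<in> N x \<inter> N y))"
      by (intro sum.cong refl) simp
    also have "\<dots> = real (card (N x \<inter> N y \<inter> C))"
      using C by (simp add: Int_def conj_commute)
    finally show "(\<Sum>z\<in>C. of_bool (z \<in> N x) * of_bool (z \<in> N y)) = real (card (N x \<inter> N y \<inter> C))" .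
  qed
  also have "\<dots> \<le> (\<Sum>x\<in>H. \<Sum>y\<in>H. of_bool (x = y) * real (card (N x \<inter> C)) + c * card C)"
  proof (intro sum_mono)
    fix x y assume "x \<in> H" "y \<in> H"
    then show "real (card (N x \<inter> N y \<inter> C)) \<le> of_bool (x = y) * real (card (N x \<inter> C)) + c * card C"
      using small[of x y] q(3) by (cases "x = y") auto
  qed
  also have "\<dots> = (\<Sum>x\<in>H. real (card (N x \<inter> C))) + real q * (real q * (c * card C))"
    using H by (simp add: sum.distrib sum.delta' sum_distrib_right[symmetric])
  finally have g2: "(\<Sum>z\<in>C. g z * g z) \<le> (\<Sum>z\<in>C. g z) + real q * (real q * (c * card C))"
    by (simp only: g1)
  have "real q * (real q * (c * card C)) = (c * (real q)\<^sup>2) * card C" by (simp add: power2_eq_square mult_ac)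
  also have "\<dots> \<le> 1 * real (card C)" by (rule mult_right_mono[OF q(2)]) simp
  finally have g3: "(\<Sum>z\<in>C. g z * g z) \<le> (\<Sum>z\<in>C. g z) + card C" using g2 by linarith
  have "2 * real (card C) \<le> q * p * card C" by (rule mult_right_mono[OF q(1)]) simp
  also have "\<dots> = (\<Sum>x\<in>H. p * card C)" using H by simp
  also have "\<dots> \<le> (\<Sum>z\<in>C. g z)" unfolding g1 by (rule sum_mono[OF big])
  finally have g4: "2 * real (card C) \<le> (\<Sum>z\<in>C. g z)" .
  have "(\<Sum>z\<in>C. 3 * g z - g z * g z) \<le> (\<Sum>z\<in>C. 2)"
  proof (intro sum_mono)
    fix z
    have "g z = real (card {x\<in>H. z \<in> N x})" unfolding g_def using H by (simp add: Int_def)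
    then obtain k :: nat where k: "g z = k" by blast
    have "0 \<le> (real k - 1) * (real k - 2)"
    proof (cases "k \<le> 1")
      case True then show ?thesis by (cases "k = 0") (auto simp: le_Suc_eq)
    qed (intro mult_nonneg_nonneg, auto)
    then show "3 * g z - g z * g z \<le> 2" unfolding k by (simp add: algebra_simps)
  qed
  then have "3 * (\<Sum>z\<in>C. g z) - (\<Sum>z\<in>C. g z * g z) \<le> 2 * card C"
    by (simp add: sum_subtractf sum_distrib_left)
  then show False using g3 g4 C(2) by linarith
qed

text \<open>Here \<open>m\<close> is the order of the ambient vertex set and \<open>Y\<close> plays
  the role of a neighbourhood. With \<open>\<delta> = 1 / (2 - \<rho>)\<close>, a vertex misses at
  most \<open>(1 - \<delta> - \<mu>) * m\<close> vertices of \<open>Y\<close>, and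
  \<open>m \<le> (2 - \<rho>) * card Y\<close>; since
  \<open>(1 - \<delta>) * (2 - \<rho>) = 1 - \<rho>\<close>, this is at most a
  \<open>1 - \<rho> - \<mu>\<close> fraction of \<open>Y\<close>.\<close>

lemma dense_neighbourhood:
  fixes \<rho> \<mu> m :: real
  assumes \<rho>: "0 \<le> \<rho>" "\<rho> \<le> 1" and \<mu>: "0 \<le> \<mu>" "1 / (2 - \<rho>) + \<mu> \<le> 1"
    and Y: "finite Y" "1 / (2 - \<rho>) * m \<le> real (card Y)" "0 \<le> m"
    and deg: "\<And>v. v \<in> Y \<Longrightarrow> real (card Y) - (1 - 1 / (2 - \<rho>) - \<mu>) * m \<le> real (card (nb E v \<inter> Y))"
  shows "(\<rho> + \<mu>) * (real (card Y))\<^sup>2 \<le> ee E Y Y"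
proof -
  define d where "d = 1 / (2 - \<rho>)"
  define y where "y = real (card Y)"
  have d: "0 < d" "d * (2 - \<rho>) = 1" using \<rho> by (auto simp: d_def)
  have "m * 1 = m * (d * (2 - \<rho>))" by (simp only: d(2))
  also have "\<dots> = (2 - \<rho>) * (d * m)" by (simp add: mult_ac)
  also have "\<dots> \<le> (2 - \<rho>) * y" using \<rho> Y(2) by (intro mult_left_mono) (auto simp: d_def y_def)
  finally have "m \<le> (2 - \<rho>) * y" by simp
  then have "(1 - d - \<mu>) * m \<le> (1 - d - \<mu>) * ((2 - \<rho>) * y)"
    using \<mu> by (intro mult_left_mono) (auto simp: d_def)
  also have "\<dots> = (2 - \<rho>) * y - (d * (2 - \<rho>)) * y - \<mu> * (2 - \<rho>) * y" by (simp add: algebra_simps)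
  also have "\<dots> = (1 - \<rho>) * y - \<mu> * (2 - \<rho>) * y" unfolding d(2) by (simp add: algebra_simps)
  also have "\<dots> \<le> (1 - \<rho>) * y - \<mu> * y"
  proof -
    have "\<mu> * 1 * y \<le> \<mu> * (2 - \<rho>) * y"
      using \<rho> \<mu> by (intro mult_right_mono mult_left_mono) (auto simp: y_def)
    then show ?thesis by simp
  qed
  finally have *: "(\<rho> + \<mu>) * y \<le> y - (1 - d - \<mu>) * m" by (simp add: algebra_simps)
  have "(\<rho> + \<mu>) * (real (card Y))\<^sup>2 = (\<Sum>v\<in>Y. (\<rho> + \<mu>) * y)"
    by (simp add: y_def power2_eq_square)
  also have "\<dots> \<le> (\<Sum>v\<in>Y. real (card (nb E v \<inter> Y)))"
    using * deg by (intro sum_mono) (force simp: d_def y_def)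
  also have "\<dots> = ee E Y Y" using Y(1) by (simp add: ee_eq_sum_card)
  finally show ?thesis .
qed

text \<open>Choosing in each cell \<open>C\<close> of a regular partition a set \<open>X C\<close> and giving the vertices of \<open>X C\<close>
  a weight proportional to \<open>card C / card (X C)\<close> preserves the edge density up to the regularity error.\<close>

lemma clique_in_transversal_subsets:
  fixes l s :: nat and \<mu> c :: real
  assumes l: "0 < l" and \<mu>: "0 < \<mu>" and c: "0 < c"
  shows "\<exists>\<epsilon>>0. \<forall>(V :: nat set) E P X. simple_graph V E \<longrightarrow> finite P \<longrightarrow> disjoint P \<longrightarrow> \<Union>P \<subseteq> V \<longrightarrow> {} \<notin> P \<longrightarrow> P \<noteq> {} \<longrightarrow>
      (\<forall>C\<in>P. X C \<subseteq> C \<and> c * real (card C) \<le> real (card (X C))) \<longrightarrow>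
      K_dense l V E (\<epsilon> * real (card (\<Union>P))) \<longrightarrow>
      (RT_density l s + \<mu>) * (real (card (\<Union>P)))\<^sup>2 \<le>
         (\<Sum>C\<in>P. \<Sum>D\<in>P. dens E (X C) (X D) * (real (card C) * real (card D))) \<longrightarrow>
      (\<exists>S\<subseteq>(\<Union>C\<in>P. X C). is_K s E S)"
proof -
  obtain \<epsilon> :: real where \<epsilon>: "0 < \<epsilon>" and W:
    "\<forall>(V :: nat set) E w. simple_graph V E \<longrightarrow> 0 < (\<Sum>v\<in>V. w v) \<longrightarrow>
       (\<forall>U\<subseteq>V. K_free l U E \<longrightarrow> real (\<Sum>v\<in>U. w v) \<le> \<epsilon> * real (\<Sum>v\<in>V. w v)) \<longrightarrow>
       (RT_density l s + \<mu>) * (real (\<Sum>v\<in>V. w v))\<^sup>2 \<le>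
          (\<Sum>u\<in>V. \<Sum>v\<in>V. of_bool ({u, v} \<in> E) * real (w u) * real (w v)) \<longrightarrow>
       (\<exists>S\<subseteq>V. is_K s E S)"
    using weighted_clique_exists[OF l \<mu>, of s] by blast
  show ?thesis
  \<comment> \<open>Weights reach up to \<open>\<theta> / c\<close>, so the factor \<open>c\<close>
    compensates for converting cardinalities into weights.\<close>
  proof (intro exI[of _ "\<epsilon> * c"] conjI allI impI)
    show "0 < \<epsilon> * c" using \<epsilon> c by simp
  next
    fix V :: "nat set" and E P X
    assume G: "simple_graph V E" and P: "finite P" "disjoint P" "\<Union>P \<subseteq> V" "{} \<notin> P" "P \<noteq> {}"
      and X': "\<forall>C\<in>P. X C \<subseteq> C \<and> c * real (card C) \<le> real (card (X C))"
      and D: "K_dense l V E (\<epsilon> * c * card (\<Union>P))"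
      and dens: "(RT_density l s + \<mu>) * (real (card (\<Union>P)))\<^sup>2 \<le>
         (\<Sum>C\<in>P. \<Sum>D\<in>P. dens E (X C) (X D) * (real (card C) * real (card D)))"
    note X = X'[rule_format]
    have fV: "finite V" using G by (simp add: simple_graph_def)
    have fC: "finite C" "0 < card C" if "C \<in> P" for C
    proof -
      show "finite C" using that P(3) fV by (meson Sup_upper finite_subset order_trans)
      then show "0 < card C" using that P(4) by (metis card_gt_0_iff)
    qed
    have fX: "finite (X C)" "0 < card (X C)" if "C \<in> P" for C
    proof -
      show "finite (X C)" using X[OF that] fC[OF that] by (auto intro: finite_subset)
      have "0 < c * card C" using c fC[OF that] by simp
      then show "0 < card (X C)" using X[OF that] by linarith
    qed
    have cX: "c * card C \<le> card (X C)" if "C \<in> P" for C using X that by blast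
    define W' where "W' = (\<Union>C\<in>P. X C)"
    have disX: "X C \<inter> X D = {}" if "C \<in> P" "D \<in> P" "C \<noteq> D" for C D
      using X that P(2) unfolding disjoint_def by blast
    have W'V: "W' \<subseteq> V" using X P(3) unfolding W'_def by blast
    have fW': "finite W'" using W'V fV by (rule finite_subset)
    \<comment> \<open>A common denominator of the ratios \<open>card C / card (X C)\<close>;
      multiplying by it makes all weights natural numbers, each set \<open>X C\<close> having total
      weight \<open>\<theta> * card C\<close>.\<close>
    define \<theta> where "\<theta> = (\<Prod>C\<in>P. card (X C))"
    define wt where "wt C = card C * (\<Prod>D\<in>P - {C}. card (X D))" for C
    define cl where "cl u = (THE C. C \<in> P \<and> u \<in> X C)" for u
    define w where "w u = wt (cl u)" for u
    have cl: "cl u = C" if "C \<in> P" "u \<in> X C" for u C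
      unfolding cl_def using that disX by (intro the_equality) auto
    have \<theta>0: "0 < \<theta>" unfolding \<theta>_def using fX by (intro prod_pos) auto
    have "wt C * card (X C) = card C * \<theta>" if "C \<in> P" for C
      unfolding wt_def \<theta>_def prod.remove[OF P(1) that, of "\<lambda>C. card (X C)"] by (simp add: mult_ac)
    then have wtr: "real (wt C) = real (card C) * real \<theta> / real (card (X C))" if "C \<in> P" for C
      using fX(2)[OF that] that by (simp add: field_simps flip: of_nat_mult)
    have sumW: "(\<Sum>u\<in>W'. f u) = (\<Sum>C\<in>P. \<Sum>u\<in>X C. f u)" for f :: "nat \<Rightarrow> real"
      unfolding W'_def using P(1) fX disX by (intro sum.UNION_disjoint) auto
    have wX: "w u = wt C" if "C \<in> P" "u \<in> X C" for u C using cl[OF that] by (simp add: w_def)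
    have cardP: "card (\<Union>P) = (\<Sum>C\<in>P. card C)"
      by (rule card_Union_disjoint) (use P(2) fC in \<open>auto simp: disjoint_def pairwise_def disjnt_def\<close>)
    have tot: "real (\<Sum>u\<in>W'. w u) = real \<theta> * real (card (\<Union>P))"
    proof -
      have "real (\<Sum>u\<in>W'. w u) = (\<Sum>C\<in>P. \<Sum>u\<in>X C. real (w u))"
        unfolding of_nat_sum by (rule sumW)
      also have "\<dots> = (\<Sum>C\<in>P. \<Sum>u\<in>X C. real (wt C))"
        by (intro sum.cong refl) (simp add: wX)
      also have "\<dots> = (\<Sum>C\<in>P. real \<theta> * real (card C))"
      proof (rule sum.cong[OF refl])
        fix C assume C: "C \<in> P"
        show "(\<Sum>u\<in>X C. real (wt C)) = real \<theta> * real (card C)" using fX(2)[OF C] by (simp add: wtr[OF C])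
      qed
      also have "\<dots> = real \<theta> * real (card (\<Union>P))" by (simp add: cardP sum_distrib_left)
      finally show ?thesis .
    qed
    obtain C0 where C0: "C0 \<in> P" using P(5) by blast
    have fUP: "finite (\<Union>P)" using P(3) fV by (rule finite_subset)
    have "C0 \<subseteq> \<Union>P" using C0 by blast
    then have "0 < card (\<Union>P)" using fC(2)[OF C0] card_mono[OF fUP] by (metis le_0_eq not_gr0)
    then have tot0: "0 < real (\<Sum>u\<in>W'. w u)" unfolding tot using \<theta>0 by simp
    have Gw: "simple_graph W' {e\<in>E. e \<subseteq> W'}"
      using G fW' by (auto simp: simple_graph_def)
    have K: "is_K k {e\<in>E. e \<subseteq> W'} S \<longleftrightarrow> is_K k E S" if "S \<subseteq> W'" for k S
      using is_K_induced[OF that] by (simp add: induced_edges_def)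
    have "\<exists>S\<subseteq>W'. is_K s {e\<in>E. e \<subseteq> W'} S"
    proof (rule W[rule_format, OF Gw])
      show "0 < (\<Sum>u\<in>W'. w u)" using tot0 by (simp only: of_nat_0_less_iff)
    next
      fix U assume U: "U \<subseteq> W'" "K_free l U {e\<in>E. e \<subseteq> W'}"
      have "\<not> (\<exists>S\<subseteq>U. is_K l E S)"
        using U K unfolding K_free_def by (meson order_trans)
      then have cU: "real (card U) \<le> \<epsilon> * c * card (\<Union>P)"
        using D U(1) W'V unfolding K_dense_def by (meson linear order_trans)
      have wle: "real (w u) \<le> real \<theta> / c" if u: "u \<in> U" for u
      proof -
        obtain C where C: "C \<in> P" "u \<in> X C" using u U(1) by (auto simp: W'_def)
        have "real (card C) * real \<theta> * c \<le> real \<theta> * real (card (X C))"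
          using mult_left_mono[OF cX[OF C(1)], of "real \<theta>"] by (simp add: mult_ac)
        then have "real (card C) * real \<theta> / real (card (X C)) \<le> real \<theta> / c"
          using c fX(2)[OF C(1)] by (simp add: divide_simps)
        then show ?thesis by (simp add: wX[OF C] wtr[OF C(1)])
      qed
      have "real (\<Sum>u\<in>U. w u) \<le> (\<Sum>u\<in>U. real \<theta> / c)"
        unfolding of_nat_sum by (rule sum_mono[OF wle])
      also have "\<dots> = real (card U) * (real \<theta> / c)" by simp
      also have "\<dots> \<le> (\<epsilon> * c * card (\<Union>P)) * (real \<theta> / c)"
        using cU c by (intro mult_right_mono) auto
      also have "\<dots> = \<epsilon> * real (\<Sum>u\<in>W'. w u)" using c unfolding tot by simp
      finally show "real (\<Sum>u\<in>U. w u) \<le> \<epsilon> * real (\<Sum>u\<in>W'. w u)" .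
    next
      have "(\<Sum>u\<in>W'. \<Sum>v\<in>W'. of_bool ({u, v} \<in> {e\<in>E. e \<subseteq> W'}) * real (w u) * real (w v)) =
         (\<Sum>u\<in>W'. \<Sum>v\<in>W'. of_bool ({u, v} \<in> E) * real (w u) * real (w v))"
        by (intro sum.cong refl) auto
      also have "\<dots> = (\<Sum>C\<in>P. \<Sum>u\<in>X C. \<Sum>D\<in>P. \<Sum>v\<in>X D. of_bool ({u, v} \<in> E) * real (w u) * real (w v))"
        by (simp only: sumW)
      also have "\<dots> = (\<Sum>C\<in>P. \<Sum>D\<in>P. \<Sum>u\<in>X C. \<Sum>v\<in>X D. of_bool ({u, v} \<in> E) * real (w u) * real (w v))"
        by (intro sum.cong refl sum.swap)
      also have "\<dots> = (\<Sum>C\<in>P. \<Sum>D\<in>P. (real \<theta>)\<^sup>2 * (dens E (X C) (X D) * (real (card C) * real (card D))))"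
      proof (rule sum.cong[OF refl], rule sum.cong[OF refl])
        fix C D assume CD: "C \<in> P" "D \<in> P"
        have "(\<Sum>u\<in>X C. \<Sum>v\<in>X D. of_bool ({u, v} \<in> E) * real (w u) * real (w v)) =
           (\<Sum>u\<in>X C. \<Sum>v\<in>X D. of_bool ({u, v} \<in> E) * (real (wt C) * real (wt D)))"
          by (intro sum.cong refl) (simp add: wX[OF CD(1)] wX[OF CD(2)])
        also have "\<dots> = ee E (X C) (X D) * (real (wt C) * real (wt D))"
          unfolding ee_def sum_distrib_right ..
        also have "\<dots> = (real \<theta>)\<^sup>2 * (dens E (X C) (X D) * (real (card C) * real (card D)))"
          by (simp add: wtr[OF CD(1)] wtr[OF CD(2)] dens_def power2_eq_square)
        finally show "(\<Sum>u\<in>X C. \<Sum>v\<in>X D. of_bool ({u, v} \<in> E) * real (w u) * real (w v)) = \<dots>" .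
      qed
      also have "\<dots> = (real \<theta>)\<^sup>2 * (\<Sum>C\<in>P. \<Sum>D\<in>P. dens E (X C) (X D) * (real (card C) * real (card D)))"
        by (simp only: sum_distrib_left)
      also have "\<dots> \<ge> (real \<theta>)\<^sup>2 * ((RT_density l s + \<mu>) * (real (card (\<Union>P)))\<^sup>2)"
        by (rule mult_left_mono[OF dens]) simp
      finally show "(RT_density l s + \<mu>) * (real (\<Sum>u\<in>W'. w u))\<^sup>2 \<le>
         (\<Sum>u\<in>W'. \<Sum>v\<in>W'. of_bool ({u, v} \<in> {e\<in>E. e \<subseteq> W'}) * real (w u) * real (w v))"
        unfolding tot by (simp add: power_mult_distrib mult_ac)
    qed
    then show "\<exists>S\<subseteq>(\<Union>C\<in>P. X C). is_K s E S" using K unfolding W'_def by blast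
  qed
qed

lemma K_dense_mono: "K_dense l V E a \<Longrightarrow> a \<le> b \<Longrightarrow> K_dense l V E b"
  unfolding K_dense_def by (meson order_trans)

lemma Union_cells:
  assumes "J \<subseteq> cell V \<A> ` V"
  shows "\<Union>J \<subseteq> V" "disjoint J" "{} \<notin> J" "\<And>C u. C \<in> J \<Longrightarrow> u \<in> C \<Longrightarrow> cell V \<A> u = C"
proof -
  show cell: "cell V \<A> u = C" if C: "C \<in> J" and u: "u \<in> C" for C u
  proof -
    obtain x where "C = cell V \<A> x" using assms C by (metis imageE subsetD)
    then show ?thesis using cell_eq[of u V \<A> x] u by simp
  qed
  show "\<Union>J \<subseteq> V"
  proof (rule Union_least)
    fix C assume "C \<in> J"
    then obtain x where "C = cell V \<A> x" using assms by (metis imageE subsetD)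
    then show "C \<subseteq> V" by (simp add: cell_subset)
  qed
  show "disjoint J" unfolding disjoint_def
  proof (intro ballI impI)
    fix C D assume "C \<in> J" "D \<in> J" "C \<noteq> D"
    then show "C \<inter> D = {}" using cell[of C] cell[of D] by (metis disjoint_iff)
  qed
  show "{} \<notin> J"
  proof
    assume "{} \<in> J"
    then obtain x where "x \<in> V" "{} = cell V \<A> x" using assms by (metis imageE subsetD)
    then show False using cell_self[of x V \<A>] by simp
  qed
qed

lemma sum_over_cells:
  fixes h :: "'a set \<Rightarrow> real"
  assumes "finite V" "J \<subseteq> cell V \<A> ` V"
  shows "(\<Sum>u\<in>\<Union>J. h (cell V \<A> u)) = (\<Sum>C\<in>J. h C * real (card C))"
proof -
  note U = Union_cells[OF assms(2)]
  have fin: "finite J" "\<And>C. C \<in> J \<Longrightarrow> finite C"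
    using assms U(1) by (auto intro: finite_subset)
  have "(\<Sum>u\<in>\<Union>J. h (cell V \<A> u)) = (\<Sum>C\<in>J. \<Sum>u\<in>C. h (cell V \<A> u))"
    using fin U(2) by (subst sum.Union_disjoint) (auto simp: disjoint_def)
  also have "\<dots> = (\<Sum>C\<in>J. \<Sum>u\<in>C. h C)"
    by (intro sum.cong refl) (simp add: U(4))
  finally show ?thesis by (simp add: mult.commute)
qed

text \<open>In every cell at most a \<open>p\<close> fraction is counted: either the trace of
  \<open>N\<close> on the cell is below that proportion, or nothing is counted there.\<close>

lemma low_density_cells:
  fixes p :: real
  assumes "finite V" "N \<subseteq> V" "0 \<le> p"
  shows "real (card {z\<in>N. real (card (N \<inter> cell V \<A> z)) < p * card (cell V \<A> z)}) \<le> p * card V"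
proof -
  let ?c = "cell V \<A>"
  define k where "k z = (of_bool (real (card (N \<inter> ?c z)) < p * card (?c z)) :: real)" for z
  have fin: "finite (?c z)" for z using finite_subset[OF cell_subset assms(1)] .
  have "real (card {z\<in>N. real (card (N \<inter> ?c z)) < p * card (?c z)}) = (\<Sum>z\<in>V. of_bool (z \<in> N) * k z)"
  proof -
    have "(\<Sum>z\<in>V. of_bool (z \<in> N) * k z) = (\<Sum>z\<in>V. of_bool (z \<in> {z\<in>N. real (card (N \<inter> ?c z)) < p * card (?c z)}))"
      by (intro sum.cong refl) (simp add: k_def)
    moreover have "V \<inter> {z\<in>N. real (card (N \<inter> ?c z)) < p * card (?c z)} = {z\<in>N. real (card (N \<inter> ?c z)) < p * card (?c z)}"
      using assms(2) by auto
    ultimately show ?thesis using assms(1) by (simp add: Collect_conj_eq)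
  qed
  also have "\<dots> = (\<Sum>x\<in>V. (\<Sum>u\<in>?c x. of_bool (u \<in> N)) / card (?c x) * k x)"
    by (rule cell_average[OF assms(1), symmetric]) (simp add: k_def cell_eq)
  also have "\<dots> \<le> (\<Sum>x\<in>V. p)"
  proof (intro sum_mono)
    fix x assume x: "x \<in> V"
    have "0 < card (?c x)" using cell_self[OF x, of \<A>] fin by (auto simp: card_gt_0_iff)
    moreover have "(\<Sum>u\<in>?c x. of_bool (u \<in> N)) = real (card (N \<inter> ?c x))"
      using fin by (simp add: Int_def conj_commute)
    ultimately show "(\<Sum>u\<in>?c x. of_bool (u \<in> N)) / card (?c x) * k x \<le> p"
      using assms(3) by (auto simp: k_def divide_le_eq)
  qed
  finally show ?thesis by (simp add: mult.commute)
qed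

text \<open>Vertices meeting the same cells have, by Ramsey's theorem, a pair whose common neighbourhood
  still meets every one of these cells in a positive proportion.\<close>

lemma common_clique:
  fixes l s :: nat and \<mu> :: real
  assumes l: "0 < l" and \<mu>: "0 < \<mu>"
  shows "\<exists>m \<beta> \<alpha>. 0 < \<beta> \<and> 0 < \<alpha> \<and> (\<forall>(V :: nat set) E I. simple_graph V E \<longrightarrow> V \<noteq> {} \<longrightarrow>
     K_dense l V E (\<alpha> * real (card V)) \<longrightarrow>
     (\<forall>v\<in>V. (1 / (2 - RT_density l s) + \<mu>) * real (card V) \<le> real (card (nb E v))) \<longrightarrow>
     I \<subseteq> V \<longrightarrow> m \<le> card I \<longrightarrow>
     (\<exists>x\<in>I. \<exists>y\<in>I. x \<noteq> y \<and> (\<forall>F. finite F \<longrightarrow> real (card F) \<le> \<beta> * real (card V) \<longrightarrow>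
        (\<exists>S\<subseteq>nb E x \<inter> nb E y - F. is_K s E S))))"
proof -
  define \<rho> where "\<rho> = RT_density l s"
  have \<rho>: "0 \<le> \<rho>" "\<rho> \<le> 1" using RT_density_bounds[OF l] by (auto simp: \<rho>_def)
  define \<delta> where "\<delta> = 1 / (2 - \<rho>)"
  have \<delta>: "1 / 2 \<le> \<delta>" using \<rho> by (simp add: \<delta>_def divide_simps)
  define p where "p = \<mu> / 4"
  have p: "0 < p" using \<mu> by (simp add: p_def)
  \<comment> \<open>In one cell there cannot be \<open>q\<close> sets of density \<open>p\<close>
    whose pairwise intersections all have density below \<open>c = 1 / q\<^sup>2\<close>; this fixes
    \<open>q\<close> and \<open>c\<close>.\<close>
  define q where "q = nat \<lceil>2 / p\<rceil> + 2"
  have "2 / p \<le> q" unfolding q_def by linarith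
  then have qp: "2 \<le> real q * p" using p by (simp add: field_simps)
  define c where "c = 1 / (real q)\<^sup>2"
  have q0: "0 < real q" by (simp add: q_def)
  have c: "0 < c" "c * (real q)\<^sup>2 \<le> 1" using q0 by (auto simp: c_def)
  have c2: "0 < c / 2" and \<mu>2: "0 < \<mu> / 2" using c \<mu> by auto
  obtain \<epsilon>0 :: real where \<epsilon>0: "0 < \<epsilon>0" and T: "\<forall>(V :: nat set) E P X. simple_graph V E \<longrightarrow> finite P \<longrightarrow> disjoint P \<longrightarrow> \<Union>P \<subseteq> V \<longrightarrow> {} \<notin> P \<longrightarrow> P \<noteq> {} \<longrightarrow>
      (\<forall>C\<in>P. X C \<subseteq> C \<and> c / 2 * real (card C) \<le> real (card (X C))) \<longrightarrow>
      K_dense l V E (\<epsilon>0 * real (card (\<Union>P))) \<longrightarrow>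
      (RT_density l s + \<mu> / 2) * (real (card (\<Union>P)))\<^sup>2 \<le>
         (\<Sum>C\<in>P. \<Sum>D\<in>P. dens E (X C) (X D) * (real (card C) * real (card D))) \<longrightarrow>
      (\<exists>S\<subseteq>(\<Union>C\<in>P. X C). is_K s E S)"
    using clique_in_transversal_subsets[OF l \<mu>2 c2, of s] by blast
  define \<epsilon> where "\<epsilon> = min (c / 2) (\<mu> / 10)"
  have \<epsilon>: "0 < \<epsilon>" "\<epsilon> \<le> c / 2" "10 * \<epsilon> \<le> \<mu>" using c \<mu> by (auto simp: \<epsilon>_def)
  obtain M where M: "\<forall>(V :: nat set) E \<A>. finite V \<longrightarrow> finite \<A> \<longrightarrow> card \<A> \<le> 0 \<longrightarrow>
    (\<exists>\<B>. \<A> \<subseteq> \<B> \<and> finite \<B> \<and> card \<B> \<le> M \<and>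
      real (card {(x, y) \<in> V \<times> V. irregular \<epsilon> E (cell V \<B> x) (cell V \<B> y)}) \<le> \<epsilon> * (real (card V))\<^sup>2)"
    using regularity[OF \<epsilon>(1), of 0] by blast
  define K :: nat where "K = 2 ^ M"
  have K0: "0 < real K" by (simp add: K_def)
  obtain R where R: "\<forall>(I :: nat set) (P :: nat set set) bad. finite I \<longrightarrow> R \<le> card I \<longrightarrow> finite P \<longrightarrow> card P \<le> K \<longrightarrow>
      (\<forall>C x y. bad C x y \<longrightarrow> bad C y x) \<longrightarrow> (\<forall>x\<in>I. \<forall>y\<in>I. x \<noteq> y \<longrightarrow> (\<exists>C\<in>P. bad C x y)) \<longrightarrow>
      (\<exists>C. \<exists>H\<subseteq>I. finite H \<and> card H = q \<and> (\<forall>x\<in>H. \<forall>y\<in>H. x \<noteq> y \<longrightarrow> bad C x y))"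
    using ramsey_pairs[of K q] by blast
  \<comment> \<open>There are at most \<open>2 ^ K\<close> possible sets \<open>J x\<close> of
    cells, so among \<open>m\<close> vertices more than \<open>R\<close> share the same one.\<close>
  define m where "m = 2 ^ K * R + 1"
  \<comment> \<open>All cells in use have at least \<open>\<epsilon> * n / K\<close> vertices, so
    deleting \<open>\<beta> * n\<close> vertices costs at most half of a common neighbourhood of
    density \<open>c\<close>.\<close>
  define \<beta> where "\<beta> = c / 2 * (\<epsilon> / K)"
  define \<alpha> where "\<alpha> = \<epsilon>0 / 2"
  have \<beta>0: "0 < \<beta>" using c \<epsilon> K0 by (simp add: \<beta>_def)
  have \<alpha>0: "0 < \<alpha>" using \<epsilon>0 by (simp add: \<alpha>_def)
  have main: "\<exists>x\<in>I. \<exists>y\<in>I. x \<noteq> y \<and> (\<forall>F. finite F \<longrightarrow> real (card F) \<le> \<beta> * real (card V) \<longrightarrow>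
        (\<exists>S\<subseteq>nb E x \<inter> nb E y - F. is_K s E S))"
    if G: "simple_graph V E" and V0: "V \<noteq> {}" and D: "K_dense l V E (\<alpha> * real (card V))"
      and deg: "\<And>v. v \<in> V \<Longrightarrow> (\<delta> + \<mu>) * real (card V) \<le> real (card (nb E v))"
      and I: "I \<subseteq> V" "m \<le> card I"
    for V E and I :: "nat set"
  proof -
    define n where "n = real (card V)"
    have fV: "finite V" using G by (simp add: simple_graph_def)
    have n0: "0 < n" using fV V0 by (simp add: n_def card_gt_0_iff)
    have nbV: "nb E v \<subseteq> V" for v by (rule nb_subset[OF G])
    have \<delta>\<mu>: "\<delta> + \<mu> \<le> 1"
    proof -
      obtain v where "v \<in> V" using V0 by blast
      then have "(\<delta> + \<mu>) * n \<le> real (card (nb E v))" using deg by (simp add: n_def)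
      also have "\<dots> \<le> n" unfolding n_def using nbV fV by (simp add: card_mono)
      finally show ?thesis using n0 by simp
    qed
    obtain \<B> where B: "finite \<B>" "card \<B> \<le> M"
      and irr: "real (card {(x, y) \<in> V \<times> V. irregular \<epsilon> E (cell V \<B> x) (cell V \<B> y)}) \<le> \<epsilon> * (real (card V))\<^sup>2"
      using M[rule_format, OF fV, of "{}" E] by auto
    let ?c = "cell V \<B>"
    have fc: "finite (?c z)" for z using finite_subset[OF cell_subset fV] .
    have cells: "finite (?c ` V)" "card (?c ` V) \<le> K" using card_cells[OF B, of V] by (auto simp: K_def)
    define b where "b = \<epsilon> * n / K"
    have b0: "0 \<le> b" using \<epsilon> n0 K0 by (simp add: b_def)
    \<comment> \<open>\<open>Y x\<close> is the neighbourhood of \<open>x\<close> rounded to cells: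
      a union of cells that are not tiny and meet the neighbourhood in a proportion
      \<open>p\<close>. The rounding loses at most \<open>\<mu> * n\<close> neighbours.\<close>
    define Y where "Y x = {z\<in>V. b \<le> card (?c z) \<and> p * card (?c z) \<le> card (nb E x \<inter> ?c z)}" for x
    define J where "J x = ?c ` Y x" for x
    have Jc: "J x \<subseteq> ?c ` V" for x by (auto simp: J_def Y_def)
    have UJ: "\<Union>(J x) = Y x" for x
    proof (intro equalityI subsetI)
      fix z assume "z \<in> \<Union>(J x)"
      then obtain z' where z': "z' \<in> Y x" "z \<in> ?c z'" by (auto simp: J_def)
      then show "z \<in> Y x" using cell_eq[OF z'(2)] subsetD[OF cell_subset z'(2)] by (auto simp: Y_def)
    next
      fix z assume "z \<in> Y x"
      then show "z \<in> \<Union>(J x)" using cell_self[of z V \<B>] by (auto simp: J_def Y_def)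
    qed
    have YV: "Y x \<subseteq> V" for x by (auto simp: Y_def)
    have cY: "\<delta> * n \<le> card (Y x)" if x: "x \<in> V" for x
    proof -
      have "nb E x \<subseteq> Y x \<union> ({z\<in>V. real (card (?c z)) < b} \<union> {z\<in>nb E x. real (card (nb E x \<inter> ?c z)) < p * card (?c z)})"
        using nbV[of x] by (auto simp: Y_def not_le)
      then have "card (nb E x) \<le> card (Y x \<union> ({z\<in>V. real (card (?c z)) < b} \<union> {z\<in>nb E x. real (card (nb E x \<inter> ?c z)) < p * card (?c z)}))"
        by (rule card_mono[rotated]) (simp add: finite_nb[OF G] finite_subset[OF YV fV] fV)
      also have "\<dots> \<le> card (Y x) + (card {z\<in>V. real (card (?c z)) < b} + card {z\<in>nb E x. real (card (nb E x \<inter> ?c z)) < p * card (?c z)})"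
        by (intro order_trans[OF card_Un_le] add_mono order_refl card_Un_le)
      finally have "real (card (nb E x)) \<le> card (Y x) + (real (card {z\<in>V. real (card (?c z)) < b}) + real (card {z\<in>nb E x. real (card (nb E x \<inter> ?c z)) < p * card (?c z)}))"
        by linarith
      moreover have "real (card {z\<in>V. real (card (?c z)) < b}) \<le> 2 ^ M * b" by (rule small_cells[OF fV B b0])
      moreover have "2 ^ M * b = \<epsilon> * n" using K0 by (simp add: b_def K_def)
      moreover have "real (card {z\<in>nb E x. real (card (nb E x \<inter> ?c z)) < p * card (?c z)}) \<le> p * n"
        unfolding n_def by (rule low_density_cells[OF fV nbV]) (use p in simp)
      moreover have "(\<delta> + \<mu>) * n \<le> real (card (nb E x))" using deg[OF x] by (simp add: n_def)
      moreover have "\<epsilon> * n + p * n \<le> \<mu> * n"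
        unfolding distrib_right[symmetric] using \<epsilon> n0 \<mu> by (intro mult_right_mono) (auto simp: p_def)
      ultimately show ?thesis by (simp add: distrib_right)
    qed
    have fI: "finite I" using I(1) fV by (rule finite_subset)
    have cP: "card (Pow (?c ` V)) \<le> 2 ^ K"
      using cells by (simp add: card_Pow)
    have JP: "J ` I \<subseteq> Pow (?c ` V)" using Jc by blast
    have "card (Pow (?c ` V)) * R \<le> 2 ^ K * R" by (rule mult_le_mono1[OF cP])
    then have big: "card (Pow (?c ` V)) * R < card I" using I(2) unfolding m_def by linarith
    have fP: "finite (Pow (?c ` V))" using cells by simp
    obtain J0 where J0: "R < card {x\<in>I. J x = J0}"
      by (rule large_fibre[OF fI fP JP big], rule that)
    define I' where "I' = {x\<in>I. J x = J0}"
    have I': "finite I'" "R \<le> card I'" "I' \<subseteq> V" using J0 fI I(1) by (auto simp: I'_def)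
    have "I' \<noteq> {}" using J0 by (metis I'_def card.empty not_less_zero)
    then obtain x0 where x0: "x0 \<in> I'" by blast
    have J0c: "J0 \<subseteq> ?c ` V" using x0 Jc by (auto simp: I'_def)
    note U0 = Union_cells[OF J0c]
    have fJ0: "finite J0" using J0c cells by (auto intro: finite_subset)
    have cJ0: "card J0 \<le> K" using card_mono[OF cells(1) J0c] cells(2) by linarith
    define Z where "Z = \<Union>J0"
    have Z: "Z = Y x" if "x \<in> I'" for x using UJ[of x] that by (simp add: Z_def I'_def)
    have ZV: "Z \<subseteq> V" "finite Z" using U0(1) fV by (auto simp: Z_def intro: finite_subset)
    have J0_prop: "b \<le> card C" "p * card C \<le> card (nb E x \<inter> C)" if C: "C \<in> J0" and x: "x \<in> I'" for C x
    proof -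
      have "C \<in> J x" using C x by (simp add: I'_def)
      then obtain z where "z \<in> Y x" "C = ?c z" by (auto simp: J_def)
      then show "b \<le> card C" "p * card C \<le> card (nb E x \<inter> C)" by (auto simp: Y_def)
    qed
    have fC: "finite C" "0 < card C" if "C \<in> J0" for C
    proof -
      show "finite C" using that J0c fc by auto
      then show "0 < card C" using that U0(3) by (metis card_gt_0_iff)
    qed
    \<comment> \<open>Otherwise every pair of \<open>I'\<close> is bad in one of the cells, and
      Ramsey's theorem gives \<open>q\<close> vertices whose neighbourhoods are pairwise nearly
      disjoint in a single cell.\<close>
    obtain x y where xy: "x \<in> I'" "y \<in> I'" "x \<noteq> y"
      and common: "\<And>C. C \<in> J0 \<Longrightarrow> c * card C \<le> card (nb E x \<inter> nb E y \<inter> C)"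
    proof (rule ccontr)
      assume neg: "\<not> thesis"
      define bad where "bad C x y \<longleftrightarrow> C \<in> J0 \<and> card (nb E x \<inter> nb E y \<inter> C) < c * card C" for C x y
      have "\<forall>x\<in>I'. \<forall>y\<in>I'. x \<noteq> y \<longrightarrow> (\<exists>C\<in>J0. bad C x y)"
        using neg that unfolding bad_def by (meson not_le)
      moreover have "\<forall>C x y. bad C x y \<longrightarrow> bad C y x" by (auto simp: bad_def Int_commute)
      ultimately obtain C H where H: "H \<subseteq> I'" "finite H" "card H = q" "\<forall>x\<in>H. \<forall>y\<in>H. x \<noteq> y \<longrightarrow> bad C x y"
        using R[rule_format, OF I'(1,2) fJ0 cJ0, of bad] by blast
      have "\<not> card H \<le> Suc 0" using H(3) by (simp add: q_def)
      then obtain u v where "u \<in> H" "v \<in> H" "u \<noteq> v" using card_le_Suc0_iff_eq[OF H(2)] by blast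
      then have C: "C \<in> J0" using H(4) by (auto simp: bad_def)
      show False
      proof (rule not_all_pairs_nearly_disjoint[OF fC[OF C] H(2,3)])
        show "p * card C \<le> card (nb E x \<inter> C)" if "x \<in> H" for x using J0_prop(2)[OF C] that H(1) by blast
        show "card (nb E x \<inter> nb E y \<inter> C) \<le> c * card C" if "x \<in> H" "y \<in> H" "x \<noteq> y" for x y
          using H(4) that by (auto simp: bad_def less_imp_le)
      qed (use qp c in auto)
    qed
    have "\<exists>S\<subseteq>nb E x \<inter> nb E y - F. is_K s E S" if F: "finite F" "real (card F) \<le> \<beta> * real (card V)" for F
    proof -
      define X where "X C = nb E x \<inter> nb E y \<inter> C - F" for C
      have X: "X C \<subseteq> C" "c / 2 * real (card C) \<le> real (card (X C))" if C: "C \<in> J0" for C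
      proof -
        show "X C \<subseteq> C" by (auto simp: X_def)
        have "card (nb E x \<inter> nb E y \<inter> C) \<le> card (X C) + card F"
          unfolding X_def using F(1) diff_card_le_card_Diff[of F "nb E x \<inter> nb E y \<inter> C"] by linarith
        moreover have "\<beta> * n = c / 2 * b" by (simp add: \<beta>_def b_def)
        moreover have "c / 2 * b \<le> c / 2 * card C" using J0_prop(1)[OF C x0] c by (intro mult_left_mono) auto
        ultimately show "c / 2 * real (card C) \<le> real (card (X C))"
          using common[OF C] F(2) by (simp add: n_def)
      qed
      have Zx: "Z = Y x" using Z[OF xy(1)] .
      have xV: "x \<in> V" using xy(1) I'(3) by blast
      have nZ: "\<delta> * n \<le> card Z" using cY[OF xV] Zx by simp
      then have n2: "n \<le> 2 * card Z" using \<delta> n0 mult_right_mono[OF \<delta>, of n] by linarith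
      \<comment> \<open>The common neighbourhood itself may be far too small for a degree argument.
        The density is found on the rounded neighbourhood \<open>Z\<close> instead and carried to
        the sets \<open>X C\<close> by regularity.\<close>
      have "(\<rho> + \<mu>) * (real (card Z))\<^sup>2 \<le> ee E Z Z"
      proof (rule dense_neighbourhood[OF \<rho>, where m = n])
        fix v assume v: "v \<in> Z"
        have "card (nb E v) + card Z \<le> card (nb E v \<inter> Z) + card V"
        proof -
          have "card (nb E v) + card Z = card (nb E v \<union> Z) + card (nb E v \<inter> Z)"
            by (rule card_Un_Int) (use finite_nb[OF G] ZV in auto)
          moreover have "card (nb E v \<union> Z) \<le> card V" using nbV ZV fV by (intro card_mono) auto
          ultimately show ?thesis by linarith
        qed
        moreover have "(\<delta> + \<mu>) * n \<le> real (card (nb E v))" using deg v ZV by (auto simp: n_def)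
        ultimately show "real (card Z) - (1 - 1 / (2 - \<rho>) - \<mu>) * n \<le> real (card (nb E v \<inter> Z))"
          unfolding \<delta>_def[symmetric] n_def by (simp add: algebra_simps)
      qed (use \<mu> \<delta>\<mu> nZ ZV n0 in \<open>auto simp: \<delta>_def\<close>)
      moreover have "ee E Z Z = (\<Sum>u\<in>Z. \<Sum>v\<in>Z. cdens V \<B> E u v)"
      proof (rule cdens_sum_sets[OF fV ZV(1) ZV(1), symmetric])
        show "?c u \<subseteq> Z" if "u \<in> Z" for u using that U0(4) by (auto simp: Z_def)
        then show "?c u \<subseteq> Z" if "u \<in> Z" for u using that .
      qed
      moreover have "(\<Sum>u\<in>Z. \<Sum>v\<in>Z. cdens V \<B> E u v) \<le>
          (\<Sum>u\<in>Z. \<Sum>v\<in>Z. dens E (X (?c u)) (X (?c v)) + \<epsilon> + of_bool (irregular \<epsilon> E (?c u) (?c v)))"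
      proof (intro sum_mono)
        fix u v assume uv: "u \<in> Z" "v \<in> Z"
        have CD: "?c u \<in> J0" "?c v \<in> J0" using uv U0(4) by (auto simp: Z_def)
        show "cdens V \<B> E u v \<le> dens E (X (?c u)) (X (?c v)) + \<epsilon> + of_bool (irregular \<epsilon> E (?c u) (?c v))"
        proof (cases "irregular \<epsilon> E (?c u) (?c v)")
          case True
          then show ?thesis using dens_le_1[of E "?c u" "?c v"] dens_nonneg[of E "X (?c u)" "X (?c v)"] \<epsilon> by simp
        next
          case False
          have "\<epsilon> * card (?c w) \<le> card (X (?c w))" if "?c w \<in> J0" for w
          proof -
            have "\<epsilon> * card (?c w) \<le> c / 2 * card (?c w)" using \<epsilon> by (intro mult_right_mono) auto
            then show ?thesis using X(2)[OF that] by linarith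
          qed
          then have "\<bar>dens E (X (?c u)) (X (?c v)) - cdens V \<B> E u v\<bar> \<le> \<epsilon>"
            using False CD X(1) unfolding irregular_def by (meson not_le)
          then show ?thesis using False by simp
        qed
      qed
      moreover have "(\<Sum>u\<in>Z. \<Sum>v\<in>Z. dens E (X (?c u)) (X (?c v)) + \<epsilon> + of_bool (irregular \<epsilon> E (?c u) (?c v))) =
          (\<Sum>u\<in>Z. \<Sum>v\<in>Z. dens E (X (?c u)) (X (?c v))) + \<epsilon> * (real (card Z))\<^sup>2
          + (\<Sum>u\<in>Z. \<Sum>v\<in>Z. of_bool (irregular \<epsilon> E (?c u) (?c v)))"
        by (simp only: sum.distrib) (simp add: power2_eq_square)
      \<comment> \<open>The total error is \<open>5 * \<epsilon> * (card Z)\<^sup>2\<close>: one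
        part from regular pairs, and four from irregular ones because
        \<open>n \<le> 2 * card Z\<close>.\<close>
      moreover have "(\<Sum>u\<in>Z. \<Sum>v\<in>Z. of_bool (irregular \<epsilon> E (?c u) (?c v))) \<le> \<epsilon> * (4 * (real (card Z))\<^sup>2)"
      proof -
        have "(\<Sum>u\<in>Z. \<Sum>v\<in>Z. of_bool (irregular \<epsilon> E (?c u) (?c v)) :: real) = (\<Sum>p\<in>Z \<times> Z. of_bool (irregular \<epsilon> E (?c (fst p)) (?c (snd p))))"
          by (simp add: sum.cartesian_product split_def)
        also have "\<dots> = real (card (Z \<times> Z \<inter> {p. irregular \<epsilon> E (?c (fst p)) (?c (snd p))}))"
          using ZV by simp
        also have "card (Z \<times> Z \<inter> {p. irregular \<epsilon> E (?c (fst p)) (?c (snd p))}) \<le>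
            card {(x, y) \<in> V \<times> V. irregular \<epsilon> E (?c x) (?c y)}"
          using ZV fV by (intro card_mono finite_subset[of "{(x, y) \<in> V \<times> V. irregular \<epsilon> E (?c x) (?c y)}" "V \<times> V"]) auto
        finally have "(\<Sum>u\<in>Z. \<Sum>v\<in>Z. of_bool (irregular \<epsilon> E (?c u) (?c v))) \<le> \<epsilon> * n\<^sup>2"
          using irr by (simp add: n_def)
        moreover have "n\<^sup>2 \<le> (2 * real (card Z))\<^sup>2" using n2 n0 by (intro power_mono) auto
        then have "\<epsilon> * n\<^sup>2 \<le> \<epsilon> * (2 * real (card Z))\<^sup>2" using \<epsilon> by (intro mult_left_mono) auto
        ultimately show ?thesis by (simp add: power_mult_distrib)
      qed
      moreover have "10 * \<epsilon> * (real (card Z))\<^sup>2 \<le> \<mu> * (real (card Z))\<^sup>2"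
        by (rule mult_right_mono[OF \<epsilon>(3)]) simp
      ultimately have "(\<rho> + \<mu> / 2) * (real (card Z))\<^sup>2 \<le> (\<Sum>u\<in>Z. \<Sum>v\<in>Z. dens E (X (?c u)) (X (?c v)))"
        by (simp add: distrib_right)
      also have "\<dots> = (\<Sum>u\<in>Z. \<Sum>D\<in>J0. dens E (X (?c u)) (X D) * real (card D))"
        unfolding Z_def by (intro sum.cong refl sum_over_cells[OF fV J0c, of "\<lambda>D. dens E (X (?c _)) (X D)"])
      also have "\<dots> = (\<Sum>C\<in>J0. (\<Sum>D\<in>J0. dens E (X C) (X D) * real (card D)) * real (card C))"
        unfolding Z_def by (rule sum_over_cells[OF fV J0c, of "\<lambda>C. \<Sum>D\<in>J0. dens E (X C) (X D) * real (card D)"])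
      also have "\<dots> = (\<Sum>C\<in>J0. \<Sum>D\<in>J0. dens E (X C) (X D) * (real (card C) * real (card D)))"
        unfolding sum_distrib_right by (intro sum.cong refl) (simp add: mult_ac)
      finally have den: "(RT_density l s + \<mu> / 2) * (real (card (\<Union>J0)))\<^sup>2 \<le> \<dots>"
        by (simp add: Z_def \<rho>_def)
      have "0 < card Z" using n2 n0 by linarith
      then have ne: "J0 \<noteq> {}" by (auto simp: Z_def)
      have "\<alpha> * real (card V) \<le> \<epsilon>0 * real (card (\<Union>J0))"
        using mult_left_mono[OF n2, of "\<epsilon>0 / 2"] \<epsilon>0 by (simp add: \<alpha>_def n_def Z_def)
      then have "K_dense l V E (\<epsilon>0 * real (card (\<Union>J0)))" by (rule K_dense_mono[OF D])
      then obtain S where "S \<subseteq> (\<Union>C\<in>J0. X C)" "is_K s E S"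
        using T[rule_format, OF G fJ0 U0(2,1,3) ne _ _ den] X by blast
      then show ?thesis unfolding X_def by blast
    qed
    then show ?thesis using xy by (auto simp: I'_def)
  qed
  show ?thesis
    unfolding \<rho>_def[symmetric] \<delta>_def[symmetric]
    by (intro exI[of _ m] exI[of _ \<beta>] exI[of _ \<alpha>] conjI \<beta>0 \<alpha>0 allI impI) (rule main; blast)
qed

section \<open>Reachability\<close>

text \<open>Exchangeability of \<open>x\<close> and \<open>y\<close>: one connector \<open>S\<close>
  completes either of them to a factorable set. The forbidden set \<open>F\<close> may contain
  \<open>x\<close> and \<open>y\<close> themselves.\<close>

definition reach :: "nat \<Rightarrow> 'a set \<Rightarrow> 'a set set \<Rightarrow> real \<Rightarrow> nat \<Rightarrow> 'a \<Rightarrow> 'a \<Rightarrow> bool" where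
  "reach r V E b c x y \<longleftrightarrow> (\<forall>F. finite F \<longrightarrow> real (card F) \<le> b \<longrightarrow>
     (\<exists>S\<subseteq>V - F. finite S \<and> card S \<le> c \<and> x \<notin> S \<and> y \<notin> S \<and>
        factorable r E (insert x S) \<and> factorable r E (insert y S)))"

lemma reachD:
  assumes "reach r V E b c x y" "finite F" "real (card F) \<le> b"
  obtains S where "S \<subseteq> V" "S \<inter> F = {}" "finite S" "card S \<le> c" "x \<notin> S" "y \<notin> S"
    "factorable r E (insert x S)" "factorable r E (insert y S)"
proof -
  obtain S where S: "S \<subseteq> V - F" "finite S" "card S \<le> c" "x \<notin> S" "y \<notin> S"
      "factorable r E (insert x S)" "factorable r E (insert y S)"
    using assms unfolding reach_def by meson
  show ?thesis by (rule that[of S]) (use S in blast)+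
qed

lemma reach_sym: "reach r V E b c x y \<Longrightarrow> reach r V E b c y x"
  unfolding reach_def by meson

lemma reach_mono:
  assumes "reach r V E b c x y" "b' \<le> b" "c \<le> c'"
  shows "reach r V E b' c' x y"
  using assms unfolding reach_def by (meson order_trans)

text \<open>Chaining through a vertex \<open>z\<close> of \<open>Z\<close>: with connectors
  \<open>S1\<close> for \<open>x, z\<close> and \<open>S2\<close> for \<open>z, y\<close>, the set
  \<open>S = {z} \<union> S1 \<union> S2\<close> works, as \<open>z\<close> goes with
  \<open>S2\<close> when \<open>x\<close> is added and with \<open>S1\<close> when \<open>y\<close>
  is added. Many middle vertices are needed because \<open>z\<close> becomes part of the connector
  and must avoid \<open>F\<close>.\<close>

lemma reach_trans:
  assumes Z: "Z \<subseteq> V" "finite Z" "b + 2 < real (card Z)"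
    and R: "\<And>z. z \<in> Z \<Longrightarrow> reach r V E b1 c x z" "\<And>z. z \<in> Z \<Longrightarrow> reach r V E b1 c z y"
    and b: "b + real c + 3 \<le> b1"
  shows "reach r V E b (2 * c + 1) x y"
  unfolding reach_def
proof (intro allI impI)
  fix F :: "'a set" assume F: "finite F" "real (card F) \<le> b"
  have "card (insert x (insert y F)) \<le> card F + 2" by (metis F(1) add_2_eq_Suc' card_insert_if finite_insert le_Suc_eq le_refl)
  then have "card (insert x (insert y F)) < card Z" using F(2) Z(3) by linarith
  then have "\<not> Z \<subseteq> insert x (insert y F)"
    using card_mono[of "insert x (insert y F)" Z] F(1) by auto
  then obtain z where z: "z \<in> Z" "z \<noteq> x" "z \<noteq> y" "z \<notin> F" by blast
  define F1 where "F1 = insert x (insert y (insert z F))"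
  have F1: "finite F1" "card F1 \<le> card F + 3"
    unfolding F1_def using F(1) by (auto simp: card_insert_if)
  have "real (card F1) \<le> b1" using F1(2) F(2) b by linarith
  then obtain S1 where S1: "S1 \<subseteq> V" "S1 \<inter> F1 = {}" "finite S1" "card S1 \<le> c"
    "factorable r E (insert x S1)" "factorable r E (insert z S1)"
    using reachD[OF R(1)[OF z(1)] F1(1)] by metis
  have "card (F1 \<union> S1) \<le> card F + 3 + c" using card_Un_le[of F1 S1] F1(2) S1(4) by linarith
  then have "real (card (F1 \<union> S1)) \<le> b1" using F(2) b by linarith
  then obtain S2 where S2: "S2 \<subseteq> V" "S2 \<inter> (F1 \<union> S1) = {}" "finite S2" "card S2 \<le> c"
    "factorable r E (insert z S2)" "factorable r E (insert y S2)"
    using reachD[OF R(2)[OF z(1)], of "F1 \<union> S1"] F1(1) S1(3) by (metis finite_UnI)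
  let ?S = "insert z (S1 \<union> S2)"
  have "factorable r E (insert x S1 \<union> insert z S2)"
    by (rule factorable_Un[OF S1(5) S2(5)]) (use S1(2) S2(2) z in \<open>auto simp: F1_def\<close>)
  moreover have "insert x S1 \<union> insert z S2 = insert x ?S" by auto
  moreover have "factorable r E (insert z S1 \<union> insert y S2)"
    by (rule factorable_Un[OF S1(6) S2(6)]) (use S1(2) S2(2) z in \<open>auto simp: F1_def\<close>)
  moreover have "insert z S1 \<union> insert y S2 = insert y ?S" by auto
  moreover have "?S \<subseteq> V - F" using S1(1,2) S2(1,2) z Z(1) by (auto simp: F1_def)
  moreover have "card ?S \<le> 2 * c + 1"
    using card_Un_le[of S1 S2] S1(3,4) S2(3,4) by (simp add: card_insert_if)
  moreover have "x \<notin> ?S" "y \<notin> ?S" using S1(2) S2(2) z by (auto simp: F1_def)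
  ultimately show "\<exists>S\<subseteq>V - F. finite S \<and> card S \<le> 2 * c + 1 \<and> x \<notin> S \<and> y \<notin> S \<and>
        factorable r E (insert x S) \<and> factorable r E (insert y S)"
    using S1(3) S2(3) by (intro exI[of _ ?S]) auto
qed

text \<open>Replacing one vertex after the other exchanges a set for a reachable one.\<close>

lemma reach_sets:
  assumes A: "finite A" and h: "\<And>x. x \<in> A \<Longrightarrow> reach r V E b c x (h x)" and inj: "inj_on h A"
    and dis: "A \<inter> h ` A = {}"
    and F: "finite F" "real (card F) + 2 * card A + card A * c \<le> b"
  shows "\<exists>S\<subseteq>V - F. finite S \<and> card S \<le> card A * c \<and> S \<inter> (A \<union> h ` A) = {} \<and>
     factorable r E (A \<union> S) \<and> factorable r E (h ` A \<union> S)"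
  using A h inj dis F
proof (induction A arbitrary: F rule: finite_induct)
  case empty
  then show ?case by (intro exI[of _ "{}"]) (simp add: factorable_empty)
next
  case (insert x A)
  let ?F = "insert x (insert (h x) F)"
  have cF: "card ?F \<le> card F + 2" using insert.prems(4) by (simp add: card_insert_if)
  have cA: "card (insert x A) = Suc (card A)" using insert.hyps by simp
  have b: "real (card F) + 2 * (1 + real (card A)) + (c + real (card A) * c) \<le> b"
    using insert.prems(5) unfolding cA by (simp add: algebra_simps)
  have "real (card ?F) + 2 * card A + card A * c \<le> b" using b cF by simp
  then obtain S where S: "S \<subseteq> V - ?F" "finite S" "card S \<le> card A * c" "S \<inter> (A \<union> h ` A) = {}"
     "factorable r E (A \<union> S)" "factorable r E (h ` A \<union> S)"
    using insert.IH[of ?F] insert.prems by (auto simp: inj_on_insert)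
  let ?G = "F \<union> S \<union> insert x A \<union> h ` insert x A"
  have "card ?G \<le> card F + card S + card (insert x A) + card (h ` insert x A)"
    by (intro order_trans[OF card_Un_le] add_mono order_refl)
  also have "\<dots> \<le> card F + card A * c + Suc (card A) + Suc (card A)"
    using S(3) cA card_image_le[of "insert x A" h] insert.hyps(1) by (intro add_mono) auto
  finally have "real (card ?G) \<le> real (card F + card A * c + Suc (card A) + Suc (card A))"
    by (simp only: of_nat_le_iff)
  then have "real (card ?G) \<le> b" using b by simp
  moreover have "finite ?G" using insert S(2) by simp
  ultimately obtain S' where S': "S' \<subseteq> V" "S' \<inter> ?G = {}" "finite S'" "card S' \<le> c"
    "factorable r E (insert x S')" "factorable r E (insert (h x) S')"
    using reachD[OF insert.prems(1)[of x]] by (metis insertI1)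
  have xA: "x \<notin> A" "x \<notin> h ` A" "h x \<notin> A" "h x \<notin> h ` A" "x \<noteq> h x"
    using insert.hyps(2) insert.prems(2,3) by auto
  have "factorable r E ((A \<union> S) \<union> insert x S')"
    by (rule factorable_Un[OF S(5) S'(5)]) (use S(1) S'(2) xA in auto)
  moreover have "(A \<union> S) \<union> insert x S' = insert x A \<union> (S \<union> S')" by auto
  moreover have "factorable r E ((h ` A \<union> S) \<union> insert (h x) S')"
    by (rule factorable_Un[OF S(6) S'(6)]) (use S(1) S'(2) xA in auto)
  moreover have "(h ` A \<union> S) \<union> insert (h x) S' = h ` insert x A \<union> (S \<union> S')" by auto
  moreover have "card (S \<union> S') \<le> card (insert x A) * c"
    using card_Un_le[of S S'] S(3) S'(4) unfolding cA by simp
  moreover have "S \<union> S' \<subseteq> V - F" using S(1) S'(1,2) by auto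
  moreover have "(S \<union> S') \<inter> (insert x A \<union> h ` insert x A) = {}" using S(1,4) S'(2) by auto
  ultimately show ?case using S(2) S'(3) by (intro exI[of _ "S \<union> S'"]) auto
qed

text \<open>The maximum order of an \<open>R t\<close>-independent set cannot grow with
  \<open>t\<close> and starts at \<open>m\<close> or less, so it stalls at some
  \<open>t \<le> m\<close>. At a stall, a largest set independent for \<open>R (Suc t)\<close> is
  also a largest one for \<open>R t\<close>.\<close>

lemma stable_independent_set:
  fixes R :: "nat \<Rightarrow> 'a \<Rightarrow> 'a \<Rightarrow> bool"
  assumes fV: "finite V" and mono: "\<And>t x y. R t x y \<Longrightarrow> R (Suc t) x y"
    and m: "\<And>I. I \<subseteq> V \<Longrightarrow> m \<le> card I \<Longrightarrow> \<exists>x\<in>I. \<exists>y\<in>I. x \<noteq> y \<and> R 0 x y"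
  obtains t W where "t \<le> m" "W \<subseteq> V" "card W \<le> m" "\<And>x y. x \<in> W \<Longrightarrow> y \<in> W \<Longrightarrow> x \<noteq> y \<Longrightarrow> \<not> R (Suc t) x y"
    "\<And>I. I \<subseteq> V \<Longrightarrow> card W < card I \<Longrightarrow> \<exists>x\<in>I. \<exists>y\<in>I. x \<noteq> y \<and> R t x y"
proof -
  define ind where "ind t I \<longleftrightarrow> I \<subseteq> V \<and> (\<forall>x\<in>I. \<forall>y\<in>I. x \<noteq> y \<longrightarrow> \<not> R t x y)" for t I
  define d where "d t = Max (card ` {I. ind t I})" for t
  have fin: "finite (card ` {I. ind t I})" for t
    by (rule finite_imageI, rule finite_subset[of _ "Pow V"]) (use fV in \<open>auto simp: ind_def\<close>)
  have ne: "card ` {I. ind t I} \<noteq> {}" for t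
    using image_eqI[of 0 card "{}" "{I. ind t I}"] by (auto simp: ind_def)
  have d_le: "card I \<le> d t" if "ind t I" for t I
    unfolding d_def using fin that by (intro Max_ge) auto
  have d_ex: "\<exists>I. ind t I \<and> card I = d t" for t
    using Max_in[OF fin ne, of t] unfolding d_def[symmetric] by auto
  have R0: "R 0 x y \<Longrightarrow> R t x y" for t x y by (induction t) (auto intro: mono)
  have dm: "d t \<le> m" for t
  proof (rule ccontr)
    assume "\<not> d t \<le> m"
    moreover obtain I where "ind t I" "card I = d t" using d_ex by blast
    ultimately show False using m[of I] R0 by (fastforce simp: ind_def)
  qed
  have "\<exists>t\<le>m. d t \<le> d (Suc t)"
  proof (rule ccontr)
    assume "\<not> ?thesis"
    then have dec: "d (Suc t) < d t" if "t \<le> m" for t using that by (meson not_le)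
    have "d t + t \<le> d 0" if "t \<le> Suc m" for t using that
    proof (induction t)
      case (Suc t)
      then show ?case using dec[of t] by simp
    qed simp
    from this[of "Suc m"] show False using dm[of 0] by simp
  qed
  then obtain t where t: "t \<le> m" "d t \<le> d (Suc t)" by blast
  obtain W where W: "ind (Suc t) W" "card W = d (Suc t)" using d_ex by blast
  show ?thesis
  proof (rule that[of t W])
    show "W \<subseteq> V" "\<And>x y. x \<in> W \<Longrightarrow> y \<in> W \<Longrightarrow> x \<noteq> y \<Longrightarrow> \<not> R (Suc t) x y" using W(1) by (auto simp: ind_def)
    show "\<exists>x\<in>I. \<exists>y\<in>I. x \<noteq> y \<and> R t x y" if "I \<subseteq> V" "card W < card I" for I
      using d_le[of t I] that t(2) W(2) by (fastforce simp: ind_def)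
  qed (use t W dm in auto)
qed

text \<open>The stalled set \<open>W\<close> serves as a set of centres, and a class consists of the
  vertices close to exactly one centre. Two vertices of a class are close, since otherwise replacing
  their centre by both would enlarge an independent set. Few vertices are close to two centres,
  since otherwise these centres would be related at the next level by transitivity.\<close>

lemma closed_classes:
  fixes m c r :: nat and \<beta> :: real
  assumes \<beta>: "0 < \<beta>"
  shows "\<exists>\<beta>'>0. \<exists>c' N. \<forall>(V :: 'a set) E. finite V \<longrightarrow> N \<le> card V \<longrightarrow>
    (\<forall>I\<subseteq>V. m \<le> card I \<longrightarrow> (\<exists>x\<in>I. \<exists>y\<in>I. x \<noteq> y \<and> reach r V E (\<beta> * card V) c x y)) \<longrightarrow>
    (\<exists>\<C>. finite \<C> \<and> card \<C> \<le> m \<and> disjoint \<C> \<and> \<Union>\<C> \<subseteq> V \<and>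
      real (card (V - \<Union>\<C>)) \<le> (real m)\<^sup>2 * (2 * \<beta> * card V) \<and>
      (\<forall>C\<in>\<C>. \<forall>x\<in>C. \<forall>y\<in>C. x \<noteq> y \<longrightarrow> reach r V E (\<beta>' * real (card V)) c' x y))"
proof -
  \<comment> \<open>One transitivity step turns \<open>c\<close> into \<open>2 * c + 1\<close> and
    needs spare room in \<open>b\<close>; tripling \<open>c\<close> and quartering \<open>b\<close>
    at each level is enough for large \<open>n\<close>.\<close>
  define bs where "bs t = \<beta> / 4 ^ t" for t :: nat
  define cs where "cs t = (c + 1) * 3 ^ t" for t :: nat
  have bs0: "0 < bs t" for t using \<beta> by (simp add: bs_def)
  have bs_mono: "bs t \<le> bs t'" if "t' \<le> t" for t t'
    unfolding bs_def using \<beta> that by (intro divide_left_mono power_increasing) auto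
  have cs_mono: "cs t \<le> cs t'" if "t \<le> t'" for t t'
    unfolding cs_def using that by (intro mult_le_mono2 power_increasing) auto
  have cs_step: "2 * cs t + 1 \<le> cs (Suc t)" for t
  proof -
    have "1 * 1 \<le> cs t" unfolding cs_def by (intro mult_le_mono) auto
    then show ?thesis by (simp add: cs_def)
  qed
  define N where "N = nat \<lceil>(real (cs (Suc m)) + 5) / bs (Suc m)\<rceil> + 1"
  show ?thesis
  proof (rule exI[of _ "bs (Suc m)"], rule conjI[OF bs0], rule exI[of _ "cs (Suc m)"], rule exI[of _ N],
      intro allI impI)
    fix V :: "'a set" and E
    assume fV: "finite V" and nN: "N \<le> card V"
      and pairs: "\<forall>I\<subseteq>V. m \<le> card I \<longrightarrow> (\<exists>x\<in>I. \<exists>y\<in>I. x \<noteq> y \<and> reach r V E (\<beta> * card V) c x y)"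
    define n where "n = real (card V)"
    have "(real (cs (Suc m)) + 5) / bs (Suc m) \<le> real N" unfolding N_def by linarith
    also have "\<dots> \<le> n" using nN by (simp add: n_def)
    finally have n: "real (cs (Suc m)) + 5 \<le> bs (Suc m) * n" using bs0[of "Suc m"] by (simp add: field_simps)
    have n0: "0 \<le> n" by (simp add: n_def)
    define R where "R t = reach r V E (bs t * n) (cs t)" for t
    have Rmono: "R t x y \<Longrightarrow> R (Suc t) x y" for t x y
      unfolding R_def using bs_mono[of t "Suc t"] cs_mono[of t "Suc t"] n0
      by (elim reach_mono) (auto intro: mult_right_mono)
    have Rsym: "R t x y \<Longrightarrow> R t y x" for t x y unfolding R_def by (rule reach_sym)
    have R0: "\<exists>x\<in>I. \<exists>y\<in>I. x \<noteq> y \<and> R 0 x y" if I: "I \<subseteq> V" "m \<le> card I" for I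
    proof -
      obtain x y where "x \<in> I" "y \<in> I" "x \<noteq> y" "reach r V E (\<beta> * card V) c x y"
        using pairs[rule_format, OF I] by blast
      moreover have "reach r V E (bs 0 * n) (cs 0) x y"
        by (rule reach_mono[OF calculation(4)]) (auto simp: bs_def cs_def n_def)
      ultimately show ?thesis unfolding R_def by blast
    qed
    obtain t W where tm: "t \<le> m" and W: "W \<subseteq> V" "card W \<le> m"
        and Wind: "\<And>x y. x \<in> W \<Longrightarrow> y \<in> W \<Longrightarrow> x \<noteq> y \<Longrightarrow> \<not> R (Suc t) x y"
        and Wmax: "\<And>I. I \<subseteq> V \<Longrightarrow> card W < card I \<Longrightarrow> \<exists>x\<in>I. \<exists>y\<in>I. x \<noteq> y \<and> R t x y"
      by (rule stable_independent_set[of V R m, OF fV Rmono R0]) (assumption | blast)+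
    have fW: "finite W" using W(1) fV by (rule finite_subset)
    define N where "N v = {x\<in>V. x = v \<or> R t x v}" for v
    define U where "U v = N v - (\<Union>w\<in>W - {v}. N w)" for v
    have cover: "\<exists>v\<in>W. x \<in> N v" if x: "x \<in> V" for x
    proof (cases "x \<in> W")
      case True then show ?thesis using x by (auto simp: N_def)
    next
      case False
      then have "card W < card (insert x W)" using fW by simp
      then obtain u v where uv: "u \<in> insert x W" "v \<in> insert x W" "u \<noteq> v" "R t u v"
        using Wmax[of "insert x W"] W(1) x by blast
      then show ?thesis using Wind Rmono[OF uv(4)] Rsym[OF uv(4)] x by (auto simp: N_def)
    qed
    have closed: "R t x y" if v: "v \<in> W" and xy: "x \<in> U v" "y \<in> U v" "x \<noteq> y" for v x y
    proof -
      have xyV: "x \<in> V" "y \<in> V" using xy by (auto simp: U_def N_def)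
      have out: "z \<notin> W - {v}" "\<And>w. w \<in> W - {v} \<Longrightarrow> \<not> R t z w" if "z \<in> U v" "z \<in> V" for z
        using that by (auto simp: U_def N_def)
      have nW: "x \<notin> W - {v}" "y \<notin> W - {v}" using out xy xyV by blast+
      have "card (insert y (W - {v})) = Suc (card (W - {v}))"
        by (rule card_insert_disjoint) (use fW nW in auto)
      moreover have "card (insert x (insert y (W - {v}))) = Suc (card (insert y (W - {v})))"
        by (rule card_insert_disjoint) (use fW nW xy(3) in auto)
      ultimately have lt: "card W < card (insert x (insert y (W - {v})))"
        using card_Suc_Diff1[OF fW v] by linarith
      have sub: "insert x (insert y (W - {v})) \<subseteq> V" using W(1) xyV by blast
      obtain p q where pq: "p \<in> insert x (insert y (W - {v}))" "q \<in> insert x (insert y (W - {v}))" "p \<noteq> q" "R t p q"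
        using Wmax[OF sub lt] by blast
      have "\<not> (p \<in> W - {v} \<and> q \<in> W - {v})" using Wind[of p q] pq(3) Rmono[OF pq(4)] by blast
      moreover have "\<not> (p \<in> {x, y} \<and> q \<in> W - {v})" using out(2)[of p q] xy xyV pq(4) by blast
      moreover have "\<not> (q \<in> {x, y} \<and> p \<in> W - {v})" using out(2)[of q p] xy xyV Rsym[OF pq(4)] by blast
      ultimately have "p \<in> {x, y}" "q \<in> {x, y}" using pq(1,2) by blast+
      then show ?thesis using pq(3,4) Rsym by auto
    qed
    have overlap: "real (card (N v \<inter> N w)) \<le> 2 * \<beta> * n" if vw: "v \<in> W" "w \<in> W" "v \<noteq> w" for v w
    proof (rule ccontr)
      assume neg: "\<not> ?thesis"
      define Z where "Z = N v \<inter> N w - {v, w}"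
      have Z: "Z \<subseteq> V" "finite Z" using fV by (auto simp: Z_def N_def)
      have "card (N v \<inter> N w) \<le> card Z + card {v, w}"
        unfolding Z_def using diff_card_le_card_Diff[of "{v, w}" "N v \<inter> N w"] by simp
      then have "2 * \<beta> * n < real (card Z) + 2" using neg vw(3) by simp
      moreover have "bs (Suc t) * n \<le> \<beta> * n"
        using bs_mono[of 0 "Suc t"] n0 by (intro mult_right_mono) (auto simp: bs_def)
      moreover have "5 \<le> \<beta> * n"
      proof -
        have "bs (Suc m) * n \<le> bs 0 * n" using bs_mono n0 by (intro mult_right_mono) auto
        then show ?thesis using n by (simp add: bs_def)
      qed
      ultimately have big: "bs (Suc t) * n + 2 < real (card Z)" by linarith
      have "real (cs t) + 3 \<le> bs (Suc t) * n"
      proof -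
        have "bs (Suc m) * n \<le> bs (Suc t) * n" using bs_mono tm n0 by (intro mult_right_mono) auto
        moreover have "real (cs t) \<le> real (cs (Suc m))" using cs_mono[of t "Suc m"] tm by simp
        ultimately show ?thesis using n by linarith
      qed
      moreover have "bs t * n = 4 * (bs (Suc t) * n)" by (simp add: bs_def)
      moreover have "0 \<le> bs (Suc t) * n" using bs0[of "Suc t"] n0 by simp
      ultimately have b: "bs (Suc t) * n + real (cs t) + 3 \<le> bs t * n" by linarith
      have "reach r V E (bs (Suc t) * n) (2 * cs t + 1) v w"
        by (rule reach_trans[OF Z big _ _ b])
          (use Rsym in \<open>auto simp: Z_def N_def R_def\<close>)
      then have "R (Suc t) v w" unfolding R_def using cs_step by (rule reach_mono[OF _ order_refl])
      then show False using Wind vw by blast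
    qed
    define \<C> where "\<C> = U ` W"
    have "V - \<Union>\<C> \<subseteq> (\<Union>v\<in>W. \<Union>w\<in>W - {v}. N v \<inter> N w)"
    proof
      fix x assume x: "x \<in> V - \<Union>\<C>"
      then obtain v where v: "v \<in> W" "x \<in> N v" using cover by blast
      moreover have "x \<notin> U v" using x v(1) by (auto simp: \<C>_def)
      ultimately show "x \<in> (\<Union>v\<in>W. \<Union>w\<in>W - {v}. N v \<inter> N w)" by (auto simp: U_def)
    qed
    then have "card (V - \<Union>\<C>) \<le> card (\<Union>v\<in>W. \<Union>w\<in>W - {v}. N v \<inter> N w)"
      using fW fV by (intro card_mono) (auto simp: N_def)
    also have "\<dots> \<le> (\<Sum>v\<in>W. card (\<Union>w\<in>W - {v}. N v \<inter> N w))" by (rule card_UN_le[OF fW])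
    also have "\<dots> \<le> (\<Sum>v\<in>W. \<Sum>w\<in>W - {v}. card (N v \<inter> N w))"
      using fW by (intro sum_mono card_UN_le) auto
    finally have "real (card (V - \<Union>\<C>)) \<le> (\<Sum>v\<in>W. \<Sum>w\<in>W - {v}. real (card (N v \<inter> N w)))"
      unfolding of_nat_sum[symmetric] of_nat_le_iff .
    also have "\<dots> \<le> (\<Sum>v\<in>W. \<Sum>w\<in>W - {v}. 2 * \<beta> * n)"
      using overlap by (intro sum_mono) auto
    also have "\<dots> \<le> (\<Sum>v\<in>W. \<Sum>w\<in>W. 2 * \<beta> * n)"
      using \<beta> n0 fW by (intro sum_mono sum_mono2) auto
    also have "\<dots> = real (card W) * real (card W) * (2 * \<beta> * n)" by simp
    also have "\<dots> \<le> real m * real m * (2 * \<beta> * n)"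
      using W(2) \<beta> n0 by (intro mult_right_mono mult_mono) auto
    finally have exc: "real (card (V - \<Union>\<C>)) \<le> (real m)\<^sup>2 * (2 * \<beta> * n)" by (simp add: power2_eq_square)
    have "disjoint \<C>"
      unfolding disjoint_def \<C>_def U_def by blast
    moreover have "card \<C> \<le> m" unfolding \<C>_def using card_image_le[OF fW, of U] W(2) by linarith
    moreover have "\<Union>\<C> \<subseteq> V" by (auto simp: \<C>_def U_def N_def)
    moreover have "\<forall>C\<in>\<C>. \<forall>x\<in>C. \<forall>y\<in>C. x \<noteq> y \<longrightarrow> reach r V E (bs (Suc m) * n) (cs (Suc m)) x y"
    proof (intro ballI impI)
      fix C x y assume "C \<in> \<C>" "x \<in> C" "y \<in> C" "x \<noteq> y"
      then obtain v where "v \<in> W" "x \<in> U v" "y \<in> U v" by (auto simp: \<C>_def)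
      then have "R t x y" using closed \<open>x \<noteq> y\<close> by blast
      then show "reach r V E (bs (Suc m) * n) (cs (Suc m)) x y"
        unfolding R_def using bs_mono[of t "Suc m"] cs_mono[of t "Suc m"] tm n0
        by (elim reach_mono) (auto intro: mult_right_mono)
    qed
    ultimately show "\<exists>\<C>. finite \<C> \<and> card \<C> \<le> m \<and> disjoint \<C> \<and> \<Union>\<C> \<subseteq> V \<and>
      real (card (V - \<Union>\<C>)) \<le> (real m)\<^sup>2 * (2 * \<beta> * card V) \<and>
      (\<forall>C\<in>\<C>. \<forall>x\<in>C. \<forall>y\<in>C. x \<noteq> y \<longrightarrow> reach r V E (bs (Suc m) * card V) (cs (Suc m)) x y)"
      using exc fW unfolding n_def by (intro exI[of _ \<C>]) (simp add: \<C>_def)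
  qed
qed

section \<open>Merging closed classes\<close>

lemma irregular_commute: "irregular \<epsilon> E X Y \<longleftrightarrow> irregular \<epsilon> E Y X"
  unfolding irregular_def by (metis dens_commute)

text \<open>Bijections between the traces on each class are glued along the class of the
  argument.\<close>

lemma class_preserving_bijection:
  assumes R: "finite R" "R \<subseteq> \<Union>\<C>" and R': "finite R'" "R' \<subseteq> \<Union>\<C>" and dis: "disjoint \<C>"
    and eq: "\<And>C. C \<in> \<C> \<Longrightarrow> card (R \<inter> C) = card (R' \<inter> C)"
  obtains h where "inj_on h R" "h ` R = R'" "\<And>u C. u \<in> R \<Longrightarrow> C \<in> \<C> \<Longrightarrow> u \<in> C \<Longrightarrow> h u \<in> C"
proof -
  have "\<forall>C\<in>\<C>. \<exists>g. bij_betw g (R \<inter> C) (R' \<inter> C)"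
    using eq R(1) R'(1) by (auto intro: finite_same_card_bij)
  then obtain g where g: "\<And>C. C \<in> \<C> \<Longrightarrow> bij_betw (g C) (R \<inter> C) (R' \<inter> C)" by metis
  define cls where "cls u = (THE C. C \<in> \<C> \<and> u \<in> C)" for u
  have uniq: "C = D" if "C \<in> \<C>" "D \<in> \<C>" "u \<in> C" "u \<in> D" for C D u
    using dis that unfolding disjoint_def by blast
  have cls: "cls u = C" if "C \<in> \<C>" "u \<in> C" for u C
    unfolding cls_def using that uniq by (intro the_equality) blast+
  define h where "h u = g (cls u) u" for u
  have hC: "h u \<in> R' \<inter> C" if "u \<in> R" "C \<in> \<C>" "u \<in> C" for u C
  proof -
    have "h u = g C u" using cls[OF that(2,3)] by (simp add: h_def)
    then show ?thesis using bij_betwE[OF g[OF that(2)]] that by auto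
  qed
  show ?thesis
  proof (rule that[of h])
    show "inj_on h R"
    proof (rule inj_onI)
      fix u v assume uv: "u \<in> R" "v \<in> R" "h u = h v"
      obtain C where C: "C \<in> \<C>" "u \<in> C" using uv R(2) by blast
      obtain D where D: "D \<in> \<C>" "v \<in> D" using uv R(2) by blast
      have "h u \<in> C" "h u \<in> D" using hC[OF uv(1) C] hC[OF uv(2) D] uv(3) by auto
      then have "C = D" using uniq C(1) D(1) by blast
      then have "g C u = g C v" using uv(3) cls[OF C] cls[OF D] by (simp add: h_def)
      then show "u = v" using g[OF C(1)] uv(1,2) C D \<open>C = D\<close> by (auto simp: bij_betw_def inj_on_def)
    qed
    show "h ` R = R'"
    proof (intro equalityI subsetI)
      fix w assume "w \<in> h ` R"
      then obtain u where u: "u \<in> R" "w = h u" by blast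
      then obtain C where "C \<in> \<C>" "u \<in> C" using R(2) by blast
      then show "w \<in> R'" using hC u by blast
    next
      fix w assume w: "w \<in> R'"
      then obtain C where C: "C \<in> \<C>" "w \<in> C" using R'(2) by blast
      then have "w \<in> g C ` (R \<inter> C)" using g[OF C(1)] w by (auto simp: bij_betw_def)
      then obtain u where u: "u \<in> R" "u \<in> C" "w = g C u" by blast
      then have "w = h u" using cls[OF C(1) u(2)] by (simp add: h_def)
      then show "w \<in> h ` R" using u(1) by blast
    qed
  qed (use hC in blast)
qed

text \<open>Two classes \<open>A\<close> that admit rooted cliques with the same distribution \<open>\<kappa>\<close> can be merged.\<close>

definition rooted_clique :: "nat \<Rightarrow> 'a set set \<Rightarrow> 'a set set \<Rightarrow> 'a set \<Rightarrow> ('a set \<Rightarrow> nat) \<Rightarrow> 'a set \<Rightarrow> bool" where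
  "rooted_clique r E \<C> A \<kappa> F \<longleftrightarrow> (\<exists>p R. p \<in> A - F \<and> R \<subseteq> \<Union>\<C> - F \<and> p \<notin> R \<and> is_K r E (insert p R) \<and>
     (\<forall>C\<in>\<C>. card (R \<inter> C) = \<kappa> C))"

text \<open>Take rooted cliques at \<open>p \<in> A\<close> and \<open>q \<in> B\<close> with rests
  \<open>R\<close> and \<open>R'\<close>. Equal distributions let \<open>R\<close> be exchanged for
  \<open>R'\<close> class by class through \<open>S1\<close>, while \<open>S2\<close> exchanges
  \<open>x\<close> for \<open>p\<close> and \<open>S3\<close> exchanges \<open>y\<close> for
  \<open>q\<close>. All these pieces together connect \<open>x\<close> and \<open>y\<close>.\<close>

lemma merge_reach:
  fixes b b1 \<phi> :: real
  assumes \<C>: "disjoint \<C>" "\<Union>\<C> \<subseteq> V" and AB: "A \<in> \<C>" "B \<in> \<C>" "A \<noteq> B"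
    and reach: "\<And>C x y. C \<in> \<C> \<Longrightarrow> x \<in> C \<Longrightarrow> y \<in> C \<Longrightarrow> x \<noteq> y \<Longrightarrow> reach r V E b c x y"
    and \<kappa>: "\<And>F. finite F \<Longrightarrow> real (card F) \<le> \<phi> \<Longrightarrow> rooted_clique r E \<C> A \<kappa> F \<and> rooted_clique r E \<C> B \<kappa> F"
    and b: "b1 + 4 * real r + real (r * c) + 2 * real c + 4 \<le> b" "b1 + 4 * real r + real (r * c) + 2 * real c + 4 \<le> \<phi>"
    and xy: "x \<in> A" "y \<in> B" and r: "0 < r"
  shows "reach r V E b1 (2 * r + r * c + 2 * c) x y"
  unfolding reach_def
proof (intro allI impI)
  fix F :: "'a set" assume F: "finite F" "real (card F) \<le> b1"
  have AB0: "A \<inter> B = {}" using \<C>(1) AB unfolding disjoint_def by blast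
  define F0 where "F0 = insert x (insert y F)"
  have F0: "finite F0" "card F0 \<le> card F + 2" using F(1) by (auto simp: F0_def card_insert_if)
  have "real (card F0) \<le> \<phi>" using F0(2) F(2) b(2) by linarith
  then have "rooted_clique r E \<C> A \<kappa> F0" using \<kappa>[OF F0(1)] by blast
  then obtain p R where p: "p \<in> A - F0" "R \<subseteq> \<Union>\<C> - F0" "p \<notin> R" "is_K r E (insert p R)"
    "\<And>C. C \<in> \<C> \<Longrightarrow> card (R \<inter> C) = \<kappa> C" unfolding rooted_clique_def by blast
  have fR: "finite R" "Suc (card R) = r" using p(3,4) by (auto simp: is_K_def)
  define F1 where "F1 = F0 \<union> insert p R"
  have F1: "finite F1" "card F1 \<le> card F + 2 + r"
    using F0 fR p(3) card_Un_le[of F0 "insert p R"] by (auto simp: F1_def)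
  have "real (card F1) \<le> \<phi>" using F1(2) F(2) b(2) by linarith
  then have "rooted_clique r E \<C> B \<kappa> F1" using \<kappa>[OF F1(1)] by blast
  then obtain q R' where q: "q \<in> B - F1" "R' \<subseteq> \<Union>\<C> - F1" "q \<notin> R'" "is_K r E (insert q R')"
    "\<And>C. C \<in> \<C> \<Longrightarrow> card (R' \<inter> C) = \<kappa> C" unfolding rooted_clique_def by blast
  have fR': "finite R'" "Suc (card R') = r" using q(3,4) by (auto simp: is_K_def)
  have RU: "R \<subseteq> \<Union>\<C>" "R' \<subseteq> \<Union>\<C>" using p q by auto
  obtain h where h: "inj_on h R" "h ` R = R'" "\<And>u C. u \<in> R \<Longrightarrow> C \<in> \<C> \<Longrightarrow> u \<in> C \<Longrightarrow> h u \<in> C"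
    using class_preserving_bijection[OF fR(1) RU(1) fR'(1) RU(2) \<C>(1)] p(5) q(5) by metis
  have disR: "R \<inter> R' = {}" using q(2) by (auto simp: F1_def)
  have hr: "reach r V E b c u (h u)" if u: "u \<in> R" for u
  proof -
    obtain C where C: "C \<in> \<C>" "u \<in> C" using u RU(1) by blast
    have "h u \<in> R'" using u h(2) by blast
    then have "u \<noteq> h u" using u disR by auto
    then show ?thesis by (rule reach[OF C h(3)[OF u C]])
  qed
  define F2 where "F2 = F1 \<union> insert q R'"
  have F2: "finite F2" "card F2 \<le> card F + 2 + 2 * r"
    using F1 fR' q(3) card_Un_le[of F1 "insert q R'"] by (auto simp: F2_def)
  have rc: "card R * c \<le> r * c" using fR(2) by (intro mult_le_mono1) simp
  have rcr: "real (card R * c) \<le> real (r * c)" using rc by (simp only: of_nat_le_iff)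
  have "real (card F2) + 2 * card R + card R * c \<le> b" using F2(2) F(2) b(1) rcr fR(2) by linarith
  then obtain S1 where S1: "S1 \<subseteq> V - F2" "finite S1" "card S1 \<le> card R * c"
     "factorable r E (R \<union> S1)" "factorable r E (R' \<union> S1)"
    using reach_sets[OF fR(1) hr h(1) _ F2(1)] disR h(2) by auto
  define F3 where "F3 = F2 \<union> S1"
  have F3: "finite F3" "card F3 \<le> card F + 2 + 2 * r + r * c"
  proof -
    show "finite F3" using F2(1) S1(2) by (simp add: F3_def)
    have "card F3 \<le> card F2 + card S1" unfolding F3_def by (rule card_Un_le)
    then show "card F3 \<le> card F + 2 + 2 * r + r * c" using F2(2) S1(3) rc by linarith
  qed
  have "p \<in> A" "x \<noteq> p" using p(1) by (auto simp: F0_def)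
  then have "reach r V E b c x p" using reach[OF AB(1) xy(1)] by blast
  moreover have "real (card F3) \<le> b"
  proof -
    have "real (card F3) \<le> real (card F + 2 + 2 * r + r * c)" using F3(2) by (simp only: of_nat_le_iff)
    then show ?thesis using F(2) b(1) by simp
  qed
  ultimately obtain S2 where S2: "S2 \<subseteq> V" "S2 \<inter> F3 = {}" "finite S2" "card S2 \<le> c"
     "factorable r E (insert x S2)" "factorable r E (insert p S2)"
    using reachD[OF _ F3(1)] by metis
  define F4 where "F4 = F3 \<union> S2"
  have F4: "finite F4" "card F4 \<le> card F + 2 + 2 * r + r * c + c"
    using F3 S2(3,4) card_Un_le[of F3 S2] by (auto simp: F4_def)
  have "q \<in> B" "y \<noteq> q" using q(1) by (auto simp: F1_def F0_def)
  then have "reach r V E b c y q" using reach[OF AB(2) xy(2)] by blast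
  moreover have "real (card F4) \<le> b"
  proof -
    have "real (card F4) \<le> real (card F + 2 + 2 * r + r * c + c)" using F4(2) by (simp only: of_nat_le_iff)
    then show ?thesis using F(2) b(1) by simp
  qed
  ultimately obtain S3 where S3: "S3 \<subseteq> V" "S3 \<inter> F4 = {}" "finite S3" "card S3 \<le> c"
     "factorable r E (insert y S3)" "factorable r E (insert q S3)"
    using reachD[OF _ F4(1)] by metis
  define S where "S = insert p (insert q (R \<union> R' \<union> S1 \<union> S2 \<union> S3))"
  have disF: "x \<in> F0" "y \<in> F0" "F \<subseteq> F0" "F0 \<subseteq> F1" "insert p R \<subseteq> F1" "F1 \<subseteq> F2" "insert q R' \<subseteq> F2" "F2 \<subseteq> F3" "S1 \<subseteq> F3" "F3 \<subseteq> F4" "S2 \<subseteq> F4"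
    by (auto simp: F0_def F1_def F2_def F3_def F4_def)
  have xneq: "x \<noteq> y" using AB0 xy by blast
  have fin_pR: "factorable r E (insert p R)" "factorable r E (insert q R')"
    using p(4) q(4) by (auto intro: factorable_is_K)
  have d1: "x \<notin> R" "y \<notin> R" "x \<notin> R'" "y \<notin> R'" "x \<noteq> p" "x \<noteq> q" "y \<noteq> p" "y \<noteq> q" "p \<noteq> q" "p \<notin> R'" "q \<notin> R"
    using p q disF by auto
  have sub2: "insert x (insert y (insert p (insert q (R \<union> R')))) \<subseteq> F2" by (auto simp: F0_def F1_def F2_def)
  have d2: "S1 \<inter> insert x (insert y (insert p (insert q (R \<union> R')))) = {}" using S1(1) sub2 by blast
  have sub3: "insert x (insert y (insert p (insert q (R \<union> R')))) \<union> S1 \<subseteq> F3" using sub2 unfolding F3_def by blast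
  have d3: "S2 \<inter> (insert x (insert y (insert p (insert q (R \<union> R')))) \<union> S1) = {}" using S2(2) sub3 by blast
  have sub4: "insert x (insert y (insert p (insert q (R \<union> R')))) \<union> S1 \<union> S2 \<subseteq> F4" using sub3 unfolding F4_def by blast
  have d4: "S3 \<inter> (insert x (insert y (insert p (insert q (R \<union> R')))) \<union> S1 \<union> S2) = {}" using S3(2) sub4 by blast
  have x1: "insert x S2 \<inter> insert p R = {}" using d1(1,5) d3 by blast
  have x2: "(insert x S2 \<union> insert p R) \<inter> (R' \<union> S1) = {}" using d1(3,10) d2 d3 disR by blast
  have x3: "((insert x S2 \<union> insert p R) \<union> (R' \<union> S1)) \<inter> insert q S3 = {}"
    using d1(6,9,11) q(3) d2 d3 d4 by blast
  have y1: "insert y S3 \<inter> insert q R' = {}" using d1(4,8) d4 by blast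
  have y2: "(insert y S3 \<union> insert q R') \<inter> (R \<union> S1) = {}" using d1(2,11) d2 d4 disR by blast
  have y3: "((insert y S3 \<union> insert q R') \<union> (R \<union> S1)) \<inter> insert p S2 = {}"
    using d1(7,9,10) p(3) d2 d3 d4 by blast
  \<comment> \<open>With \<open>x\<close> the pieces are \<open>x\<close> with \<open>S2\<close>,
    the clique on \<open>p\<close> and \<open>R\<close>, \<open>R'\<close> with \<open>S1\<close>,
    and \<open>q\<close> with \<open>S3\<close>; with \<open>y\<close> the roles of the two cliques
    are swapped.\<close>
  have "factorable r E (((insert x S2 \<union> insert p R) \<union> (R' \<union> S1)) \<union> insert q S3)"
    by (rule factorable_Un[OF factorable_Un[OF factorable_Un[OF S2(5) fin_pR(1) x1] S1(5) x2] S3(6) x3])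
  moreover have "((insert x S2 \<union> insert p R) \<union> (R' \<union> S1)) \<union> insert q S3 = insert x S" by (auto simp: S_def)
  moreover have "factorable r E (((insert y S3 \<union> insert q R') \<union> (R \<union> S1)) \<union> insert p S2)"
    by (rule factorable_Un[OF factorable_Un[OF factorable_Un[OF S3(5) fin_pR(2) y1] S1(4) y2] S2(6) y3])
  moreover have "((insert y S3 \<union> insert q R') \<union> (R \<union> S1)) \<union> insert p S2 = insert y S" by (auto simp: S_def)
  moreover have "x \<notin> S" "y \<notin> S" using d1 d2 d3 d4 xneq by (auto simp: S_def)
  moreover have "S \<subseteq> V - F"
  proof -
    have "p \<in> V" "q \<in> V" using p(1) q(1) AB \<C>(2) by auto
    moreover have "F \<subseteq> F1" "F \<subseteq> F2" "F \<subseteq> F3" "F \<subseteq> F4" using disF by auto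
    then have "p \<notin> F" "q \<notin> F" "S1 \<inter> F = {}" "S2 \<inter> F = {}" "S3 \<inter> F = {}" "R \<inter> F = {}" "R' \<inter> F = {}"
      using p(1) q(1) S1(1) S2(2) S3(2) p(2) q(2) disF(3) by (auto 0 2)
    ultimately show ?thesis using S1(1) S2(1) S3(1) RU \<C>(2) unfolding S_def by blast
  qed
  moreover have "card S \<le> 2 * r + r * c + 2 * c"
  proof -
    have "S = insert p R \<union> insert q R' \<union> S1 \<union> S2 \<union> S3" by (auto simp: S_def)
    then have "card S \<le> card (insert p R) + card (insert q R') + card S1 + card S2 + card S3"
      by (simp only:) (intro order_trans[OF card_Un_le] add_mono order_refl)
    moreover have "card (insert p R) = r" "card (insert q R') = r"
      using fR fR' p(3) q(3) by simp_all
    ultimately show ?thesis using S1(3) rc S2(4) S3(4) by linarith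
  qed
  ultimately show "\<exists>S\<subseteq>V - F. finite S \<and> card S \<le> 2 * r + r * c + 2 * c \<and> x \<notin> S \<and> y \<notin> S \<and>
        factorable r E (insert x S) \<and> factorable r E (insert y S)"
    using fR(1) fR'(1) S1(2) S2(3) S3(3) by (intro exI[of _ S]) (auto simp: S_def)
qed

text \<open>Otherwise the low-degree vertices together with \<open>Y'\<close> would witness
  irregularity.\<close>

lemma regular_low_degree:
  assumes "\<not> irregular \<epsilon> E X Y" "finite X" "finite Y" "Y' \<subseteq> Y" "\<epsilon> * card Y \<le> card Y'" "0 < \<epsilon>" "0 < card X"
  shows "real (card {v\<in>X. real (card (nb E v \<inter> Y')) < (dens E X Y - \<epsilon>) * card Y'}) < \<epsilon> * card X"
proof (rule ccontr)
  let ?S = "{v\<in>X. real (card (nb E v \<inter> Y')) < (dens E X Y - \<epsilon>) * card Y'}"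
  assume "\<not> ?thesis"
  then have S: "\<epsilon> * card X \<le> card ?S" by simp
  have fY': "finite Y'" using assms(3,4) by (auto intro: finite_subset)
  have "0 < \<epsilon> * card X" using assms by simp
  then have "0 < real (card ?S)" using S by linarith
  then have ne: "?S \<noteq> {}" by (metis card.empty of_nat_0 less_irrefl)
  have "(dens E X Y - \<epsilon>) * (real (card ?S) * real (card Y')) \<le> ee E ?S Y'"
    by (rule regular_pair[OF assms(1) _ assms(4) S assms(5)]) (use assms(2) fY' in auto)
  also have "\<dots> = (\<Sum>v\<in>?S. real (card (nb E v \<inter> Y')))" using fY' by (simp add: ee_eq_sum_card)
  also have "\<dots> < (\<Sum>v\<in>?S. (dens E X Y - \<epsilon>) * card Y')"
    using ne assms(2) by (intro sum_strict_mono) auto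
  finally show False by (simp add: mult_ac)
qed

text \<open>If no class almost spans, choose typical \<open>x\<close> and \<open>y\<close> in
  different classes whose cells have positive density. Degrees above one half yield a third vertex
  \<open>z\<close> whose densities to them add up to more than 1, so one pair, say that of
  \<open>x\<close> and \<open>z\<close>, has density above one half and carries large cliques. If
  \<open>z\<close> lies in another class than \<open>x\<close>, such a clique can be rooted in
  either class; otherwise it lies in the class of \<open>x\<close>, and a vertex from the cell of
  \<open>y\<close> adjacent to it is the second root.\<close>

lemma transferral:
  fixes l r m :: nat and \<mu> \<eta> :: real
  assumes lr: "l < r" "3 * r \<le> 4 * l" and \<mu>: "0 < \<mu>" and \<eta>: "0 < \<eta>" "4 * \<eta> \<le> \<mu>"
  shows "\<exists>\<alpha>>0. \<exists>\<phi>>0. \<exists>N. \<forall>(V :: 'a set) E \<C>. simple_graph V E \<longrightarrow> N \<le> card V \<longrightarrow>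
     K_dense l V E (\<alpha> * real (card V)) \<longrightarrow> (\<forall>v\<in>V. (1 / 2 + \<mu>) * real (card V) \<le> real (card (nb E v))) \<longrightarrow>
     finite \<C> \<longrightarrow> card \<C> \<le> m \<longrightarrow> disjoint \<C> \<longrightarrow> \<Union>\<C> \<subseteq> V \<longrightarrow> real (card (V - \<Union>\<C>)) \<le> \<eta> / 4 * real (card V) \<longrightarrow>
     (\<exists>C\<in>\<C>. real (card (V - C)) \<le> \<eta> * real (card V)) \<or>
     (\<exists>A\<in>\<C>. \<exists>B\<in>\<C>. A \<noteq> B \<and> (\<exists>\<kappa>. \<forall>F. finite F \<longrightarrow> real (card F) \<le> \<phi> * real (card V) \<longrightarrow>
        rooted_clique r E \<C> A \<kappa> F \<and> rooted_clique r E \<C> B \<kappa> F))"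
proof -
  have l0: "0 < l" using lr by simp
  define \<mu>' where "\<mu>' = min \<mu> 1"
  have \<mu>': "0 < \<mu>'" "\<mu>' \<le> \<mu>" "\<mu>' \<le> 1" using \<mu> by (auto simp: \<mu>'_def)
  define \<epsilon>1 where "\<epsilon>1 = min (\<eta> / 4) (\<mu>' / 12)"
  have \<epsilon>1: "0 < \<epsilon>1" "\<epsilon>1 \<le> \<eta> / 4" "\<epsilon>1 \<le> \<mu>' / 12" using \<eta> \<mu>' by (auto simp: \<epsilon>1_def)
  \<comment> \<open>A square, so that by Markov's inequality all but \<open>\<epsilon>1 * n\<close>
    vertices see at most \<open>\<epsilon>1 * n\<close> irregular partners.\<close>
  define \<epsilon> where "\<epsilon> = \<epsilon>1 * \<epsilon>1"
  have "\<epsilon>1 * \<epsilon>1 \<le> 1 * \<epsilon>1" using \<epsilon>1 \<mu>' by (intro mult_right_mono) auto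
  then have \<epsilon>: "0 < \<epsilon>" "\<epsilon> \<le> \<epsilon>1" using \<epsilon>1 by (auto simp: \<epsilon>_def)
  obtain M where M: "\<forall>(V :: 'a set) E \<A>. finite V \<longrightarrow> finite \<A> \<longrightarrow> card \<A> \<le> m \<longrightarrow>
    (\<exists>\<B>. \<A> \<subseteq> \<B> \<and> finite \<B> \<and> card \<B> \<le> M \<and>
      real (card {(x, y) \<in> V \<times> V. irregular \<epsilon> E (cell V \<B> x) (cell V \<B> y)}) \<le> \<epsilon> * (real (card V))\<^sup>2)"
    using regularity[OF \<epsilon>(1), of m] by blast
  define \<beta> where "\<beta> = \<epsilon> / 2 ^ M"
  have \<beta>: "0 < \<beta>" "2 ^ M * \<beta> = \<epsilon>" using \<epsilon> by (auto simp: \<beta>_def)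
  define \<phi> where "\<phi> = \<beta> / 4"
  \<comment> \<open>Sized for \<open>dense_pair_clique\<close> with excess \<open>\<mu>' / 4\<close>
    on sets of at least \<open>\<mu>' / 8 * (\<beta> * n)\<close> vertices; the final division by 2
    leaves room for the summand \<open>l\<close>.\<close>
  define \<alpha> where "\<alpha> = \<mu>' / 8 * (\<mu>' / 8 * \<beta>) / 2 ^ l / 2"
  have \<phi>: "0 < \<phi>" using \<beta> by (simp add: \<phi>_def)
  have \<alpha>: "0 < \<alpha>" using \<beta> \<mu>' by (simp add: \<alpha>_def)
  define N where "N = nat \<lceil>real l / \<alpha>\<rceil> + 1"
  have main: "(\<exists>C\<in>\<C>. real (card (V - C)) \<le> \<eta> * real (card V)) \<or>
     (\<exists>A\<in>\<C>. \<exists>B\<in>\<C>. A \<noteq> B \<and> (\<exists>\<kappa>. \<forall>F. finite F \<longrightarrow> real (card F) \<le> \<phi> * real (card V) \<longrightarrow>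
        rooted_clique r E \<C> A \<kappa> F \<and> rooted_clique r E \<C> B \<kappa> F))"
    if G: "simple_graph V E" and nN: "N \<le> card V" and D: "K_dense l V E (\<alpha> * real (card V))"
      and deg0: "\<forall>v\<in>V. (1 / 2 + \<mu>) * real (card V) \<le> real (card (nb E v))"
      and \<C>: "finite \<C>" "card \<C> \<le> m" "disjoint \<C>" "\<Union>\<C> \<subseteq> V"
      and exc: "real (card (V - \<Union>\<C>)) \<le> \<eta> / 4 * real (card V)"
    for V :: "'a set" and E \<C>
  proof -
    define n where "n = real (card V)"
    have fV: "finite V" using G by (simp add: simple_graph_def)
    have "real l / \<alpha> \<le> real N" "1 \<le> real N" unfolding N_def by linarith+
    moreover have "real N \<le> n" using nN by (simp add: n_def)
    ultimately have "real l / \<alpha> \<le> n" "1 \<le> n" by linarith+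
    then have n: "real l \<le> \<alpha> * n" "0 < n" using \<alpha> by (auto simp: field_simps)
    \<comment> \<open>Starting the refinement from \<open>\<C>\<close> makes every cell lie inside a
      class or outside all of them.\<close>
    obtain \<B> where B: "\<C> \<subseteq> \<B>" "finite \<B>" "card \<B> \<le> M"
      and irr: "real (card {(x, y) \<in> V \<times> V. irregular \<epsilon> E (cell V \<B> x) (cell V \<B> y)}) \<le> \<epsilon> * (real (card V))\<^sup>2"
      using M[rule_format, OF fV \<C>(1,2), of E] by auto
    let ?c = "cell V \<B>" and ?f = "cdens V \<B> E"
    have fc: "finite (?c z)" for z using finite_subset[OF cell_subset fV] .
    define bad where "bad x y \<longleftrightarrow> irregular \<epsilon> E (?c x) (?c y)" for x y
    have bad_sym: "bad x y \<longleftrightarrow> bad y x" for x y unfolding bad_def by (rule irregular_commute)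
    define W where "W = {x\<in>\<Union>\<C>. \<beta> * n \<le> card (?c x) \<and> real (card {y\<in>V. bad x y}) \<le> \<epsilon>1 * n}"
    have cell_sub: "?c x \<subseteq> C" if "C \<in> \<C>" "x \<in> C" for x C
      using cell_mem[of _ V \<B> x C] that B(1) by blast
    have many_bad: "real (card {x\<in>V. \<epsilon>1 * n < real (card {y\<in>V. bad x y})}) \<le> \<epsilon>1 * n"
    proof -
      let ?S = "{x\<in>V. \<epsilon>1 * n < real (card {y\<in>V. bad x y})}"
      have "(\<epsilon>1 * n) * real (card ?S) = (\<Sum>x\<in>?S. \<epsilon>1 * n)" by simp
      also have "\<dots> \<le> (\<Sum>x\<in>?S. real (card {y\<in>V. bad x y}))" by (intro sum_mono) auto
      also have "\<dots> = real (card (SIGMA x:?S. {y\<in>V. bad x y}))"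
        using fV by (subst card_SigmaI) auto
      also have "card (SIGMA x:?S. {y\<in>V. bad x y}) \<le> card {(x, y) \<in> V \<times> V. irregular \<epsilon> E (?c x) (?c y)}"
        using fV by (intro card_mono finite_subset[of "{(x, y) \<in> V \<times> V. irregular \<epsilon> E (?c x) (?c y)}" "V \<times> V"])
          (auto simp: bad_def)
      finally have "(\<epsilon>1 * n) * real (card ?S) \<le> (\<epsilon>1 * n) * (\<epsilon>1 * n)"
        using irr by (simp add: n_def \<epsilon>_def power2_eq_square mult_ac)
      then show ?thesis using \<epsilon>1 n(2) by simp
    qed
    have WV: "W \<subseteq> V" using \<C>(4) by (auto simp: W_def)
    have VW: "real (card (V - W)) \<le> \<eta> * n"
    proof -
      have "V - W \<subseteq> (V - \<Union>\<C>) \<union> ({x\<in>V. real (card (?c x)) < \<beta> * n} \<union> {x\<in>V. \<epsilon>1 * n < real (card {y\<in>V. bad x y})})"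
        by (auto simp: W_def not_le)
      then have "card (V - W) \<le> card ((V - \<Union>\<C>) \<union> ({x\<in>V. real (card (?c x)) < \<beta> * n} \<union> {x\<in>V. \<epsilon>1 * n < real (card {y\<in>V. bad x y})}))"
        by (rule card_mono[rotated]) (use fV in simp)
      also have "\<dots> \<le> card (V - \<Union>\<C>) + (card {x\<in>V. real (card (?c x)) < \<beta> * n} + card {x\<in>V. \<epsilon>1 * n < real (card {y\<in>V. bad x y})})"
        by (intro order_trans[OF card_Un_le] add_mono order_refl card_Un_le)
      finally have "real (card (V - W)) \<le> real (card (V - \<Union>\<C>)) + (real (card {x\<in>V. real (card (?c x)) < \<beta> * n}) + real (card {x\<in>V. \<epsilon>1 * n < real (card {y\<in>V. bad x y})}))"
        by linarith
      moreover have "real (card {x\<in>V. real (card (?c x)) < \<beta> * n}) \<le> 2 ^ M * (\<beta> * n)"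
        by (rule small_cells[OF fV B(2,3)]) (use \<beta> n in simp)
      moreover have "2 ^ M * (\<beta> * n) = \<epsilon> * n" using \<beta>(2) by (simp add: mult.assoc[symmetric])
      moreover have "\<epsilon> * n \<le> \<eta> / 4 * n" "\<epsilon>1 * n \<le> \<eta> / 4 * n" using \<epsilon> \<epsilon>1 n by (auto intro: mult_right_mono)
      moreover have "0 \<le> \<eta> * n" using \<eta> n by simp
      ultimately show ?thesis using many_bad exc[folded n_def] by linarith
    qed
    show ?thesis
    proof (cases "\<exists>C\<in>\<C>. W \<subseteq> C")
      case True
      then obtain C where C: "C \<in> \<C>" "W \<subseteq> C" by blast
      then have "card (V - C) \<le> card (V - W)" using fV by (intro card_mono) auto
      then have "real (card (V - C)) \<le> \<eta> * real (card V)" using VW by (simp add: n_def)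
      then show ?thesis using C(1) by blast
    next
      case False
      have deg: "(1 / 2 + \<mu>) * n \<le> (\<Sum>y\<in>V. ?f x y)" if "x \<in> V" for x
        by (rule cdens_degree[OF fV that]) (use deg0 nb_subset[OF G] in \<open>simp add: n_def Int_absorb2\<close>)
      have f01: "0 \<le> ?f x y" "?f x y \<le> 1" for x y by (rule dens_nonneg, rule dens_le_1)
      have fsym: "?f x y = ?f y x" for x y by (rule dens_commute)
      have sumVW: "(\<Sum>y\<in>V. of_bool (y \<notin> W)) \<le> \<eta> * n"
      proof -
        have "V \<inter> {y. y \<notin> W} = V - W" by auto
        then show ?thesis using VW fV by simp
      qed
      have sumbad: "(\<Sum>y\<in>V. of_bool (bad x y)) \<le> \<epsilon>1 * n" if "x \<in> W" for x
        using that fV by (simp add: W_def Int_def)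
      have "W \<noteq> {}"
      proof
        assume "W = {}"
        then have "n \<le> \<eta> * n" using VW by (simp add: n_def)
        moreover have "\<mu> < 1"
        proof -
          obtain v where "v \<in> V" using n(2) by (auto simp: n_def card_gt_0_iff)
          then have "(1 / 2 + \<mu>) * n \<le> real (card (nb E v))" using deg0 by (simp add: n_def)
          also have "\<dots> \<le> n" unfolding n_def using nb_subset[OF G] fV by (simp add: card_mono)
          finally show ?thesis using n(2) by simp
        qed
        then have "\<eta> * n < 1 * n" using \<eta> n(2) by (intro mult_strict_right_mono) auto
        ultimately show False by simp
      qed
      then obtain x1 where x1: "x1 \<in> W" by blast
      then obtain C1 where C1: "C1 \<in> \<C>" "x1 \<in> C1" by (auto simp: W_def)
      obtain x2 where x2: "x2 \<in> W" "x2 \<notin> C1" using False C1(1) by blast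
      then obtain C2 where C2: "C2 \<in> \<C>" "x2 \<in> C2" by (auto simp: W_def)
      have C12: "C1 \<inter> C2 = {}" using \<C>(3) C1 C2 x2 unfolding disjoint_def by blast
      have sub12: "C1 \<subseteq> V" "C2 \<subseteq> V" using C1 C2 \<C>(4) by auto
      have "card C1 + card C2 \<le> card V"
        using card_mono[OF fV, of "C1 \<union> C2"] sub12 C12 fV
        by (simp add: card_Un_disjoint finite_subset)
      \<comment> \<open>Of two disjoint classes one has at most half of the vertices; a typical
        vertex in it must send positive density outside, as degrees exceed one half.\<close>
      then have "real (card C1) \<le> n / 2 \<or> real (card C2) \<le> n / 2" unfolding n_def by linarith
      then obtain A x where A: "A \<in> \<C>" "x \<in> A" "x \<in> W" "real (card A) \<le> n / 2"
        using x1 x2 C1 C2 by blast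
      have AV: "A \<subseteq> V" using A \<C>(4) by blast
      have xV: "x \<in> V" using A WV by blast
      obtain y where y: "y \<in> W" "y \<notin> A" "\<not> bad x y" "\<mu>' / 4 \<le> ?f x y"
      proof (rule ccontr)
        assume neg: "\<not> thesis"
        have "(\<Sum>y\<in>V. ?f x y) \<le> (\<Sum>y\<in>V. of_bool (y \<in> A) + (of_bool (y \<notin> W) + (of_bool (bad x y) + \<mu>' / 4)))"
        proof (intro sum_mono)
          fix y
          have "y \<in> A \<or> y \<notin> W \<or> bad x y \<or> ?f x y < \<mu>' / 4" using neg that by (meson not_le)
          moreover have "(0::real) \<le> of_bool (y \<in> A)" "(0::real) \<le> of_bool (y \<notin> W)" "(0::real) \<le> of_bool (bad x y)" by simp_all
          moreover have "y \<in> A \<Longrightarrow> of_bool (y \<in> A) = (1::real)" "y \<notin> W \<Longrightarrow> of_bool (y \<notin> W) = (1::real)" "bad x y \<Longrightarrow> of_bool (bad x y) = (1::real)" by simp_all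
          ultimately show "?f x y \<le> of_bool (y \<in> A) + (of_bool (y \<notin> W) + (of_bool (bad x y) + \<mu>' / 4))"
            using f01(2)[of x y] \<mu>'(1) by (elim disjE) linarith+
        qed
        also have "\<dots> = (\<Sum>y\<in>V. of_bool (y \<in> A)) + ((\<Sum>y\<in>V. of_bool (y \<notin> W)) + ((\<Sum>y\<in>V. of_bool (bad x y)) + \<mu>' / 4 * n))"
          by (simp only: sum.distrib) (simp add: n_def)
        also have "(\<Sum>y\<in>V. of_bool (y \<in> A)) = real (card A)" using AV fV by (simp add: Int_absorb1)
        finally have "(1 / 2 + \<mu>) * n \<le> n / 2 + (\<eta> * n + (\<epsilon>1 * n + \<mu>' / 4 * n))"
          using deg[OF xV] A(4) sumVW sumbad[OF A(3)] by linarith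
        moreover have "\<eta> * n + (\<epsilon>1 * n + \<mu>' / 4 * n) = (\<eta> + \<epsilon>1 + \<mu>' / 4) * n" by (simp add: algebra_simps)
        moreover have "(\<eta> + \<epsilon>1 + \<mu>' / 4) * n < \<mu> * n"
          using \<eta> \<epsilon>1 \<mu>' \<mu> n(2) by (intro mult_strict_right_mono) linarith+
        ultimately show False by (simp add: distrib_right)
      qed
      have yV: "y \<in> V" using y WV by blast
      obtain B' where B': "B' \<in> \<C>" "y \<in> B'" using y(1) by (auto simp: W_def)
      have AB: "A \<noteq> B'" using B' y(2) by blast
      obtain z where z: "z \<in> W" "\<not> bad x z" "\<not> bad y z" "1 + \<mu> \<le> ?f x z + ?f y z"
      proof (rule ccontr)
        assume neg: "\<not> thesis"
        have "(\<Sum>z\<in>V. ?f x z + ?f y z) \<le> (\<Sum>z\<in>V. 2 * of_bool (z \<notin> W) + (2 * of_bool (bad x z) + (2 * of_bool (bad y z) + (1 + \<mu>))))"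
        proof (intro sum_mono)
          fix z
          have "z \<notin> W \<or> bad x z \<or> bad y z \<or> ?f x z + ?f y z < 1 + \<mu>" using neg that by (meson not_le)
          moreover have "(0::real) \<le> of_bool (z \<notin> W)" "(0::real) \<le> of_bool (bad x z)" "(0::real) \<le> of_bool (bad y z)" by simp_all
          moreover have "z \<notin> W \<Longrightarrow> of_bool (z \<notin> W) = (1::real)" "bad x z \<Longrightarrow> of_bool (bad x z) = (1::real)" "bad y z \<Longrightarrow> of_bool (bad y z) = (1::real)" by simp_all
          ultimately show "?f x z + ?f y z \<le> 2 * of_bool (z \<notin> W) + (2 * of_bool (bad x z) + (2 * of_bool (bad y z) + (1 + \<mu>)))"
            using f01(2)[of x z] f01(2)[of y z] \<mu> by (elim disjE) linarith+
        qed
        also have "\<dots> = 2 * (\<Sum>z\<in>V. of_bool (z \<notin> W)) + (2 * (\<Sum>z\<in>V. of_bool (bad x z)) + (2 * (\<Sum>z\<in>V. of_bool (bad y z)) + (1 + \<mu>) * n))"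
          by (simp only: sum.distrib sum_distrib_left) (simp add: n_def algebra_simps)
        finally have "(1 / 2 + \<mu>) * n + (1 / 2 + \<mu>) * n \<le> 2 * (\<eta> * n) + (2 * (\<epsilon>1 * n) + (2 * (\<epsilon>1 * n) + (1 + \<mu>) * n))"
          using deg[OF xV] deg[OF yV] sumVW sumbad[OF A(3)] sumbad[OF y(1)]
          unfolding sum.distrib by linarith
        moreover have "(2 * \<eta> + 4 * \<epsilon>1) * n < \<mu> * n"
          using \<eta> \<epsilon>1 \<mu> n(2) by (intro mult_strict_right_mono) linarith+
        ultimately show False by (simp add: algebra_simps)
      qed
      \<comment> \<open>Stated for general \<open>x\<close> and \<open>y\<close>, since either of
        them may form the pair of density above one half with \<open>z\<close>.\<close>
      have sym_case: "\<exists>A\<in>\<C>. \<exists>B\<in>\<C>. A \<noteq> B \<and> (\<exists>\<kappa>. \<forall>F. finite F \<longrightarrow> real (card F) \<le> \<phi> * real (card V) \<longrightarrow>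
          rooted_clique r E \<C> A \<kappa> F \<and> rooted_clique r E \<C> B \<kappa> F)"
        if x: "x \<in> W" "x \<in> A" "A \<in> \<C>" and y: "y \<in> W" "y \<in> B'" "B' \<in> \<C>" and AB: "A \<noteq> B'"
          and reg: "\<not> bad y x" "\<not> bad x z" "\<not> bad y z"
          and f: "1 / 2 + \<mu>' / 2 \<le> ?f x z" "\<mu>' / 4 \<le> ?f y x" "\<mu>' / 4 \<le> ?f y z"
        for x y A B'
      proof -
        have V: "x \<in> V" "y \<in> V" "z \<in> V" using x y z WV by auto
        have size: "\<beta> * n \<le> card (?c u)" if "u \<in> W" for u using that by (simp add: W_def)
        have pos: "0 < card (?c u)" if "u \<in> V" for u using cell_self[OF that, of \<B>] fc by (auto simp: card_gt_0_iff)
        obtain D' where D': "D' \<in> \<C>" "z \<in> D'" using z(1) by (auto simp: W_def)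
        have sub_pair: "\<exists>T Q. T \<subseteq> X \<and> Q \<subseteq> Y \<and> T \<inter> Q = {} \<and> card T = l div 2 + 1 \<and> card Q = l \<and> is_K (l div 2 + 1 + l) E (T \<union> Q)"
          if X: "X \<subseteq> ?c x" "\<mu>' / 8 * card (?c x) \<le> card X" and Y: "Y \<subseteq> ?c z" "\<mu>' / 8 * card (?c z) \<le> card Y" for X Y
        proof -
          have fXY: "finite X" "finite Y" using X Y fc by (auto intro: finite_subset)
          have e8: "\<epsilon> \<le> \<mu>' / 8" using \<epsilon> \<epsilon>1 \<mu>' by linarith
          have eX: "\<epsilon> * card (?c x) \<le> card X" using X(2) mult_right_mono[OF e8, of "real (card (?c x))"] by linarith
          have eY: "\<epsilon> * card (?c z) \<le> card Y" using Y(2) mult_right_mono[OF e8, of "real (card (?c z))"] by linarith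
          have "(?f x z - \<epsilon>) * (real (card X) * real (card Y)) \<le> ee E X Y"
            by (rule regular_pair[OF _ X(1) Y(1) eX eY fXY]) (use reg(2) in \<open>simp add: bad_def\<close>)
          moreover have "(1 / 2 + \<mu>' / 4) * (real (card X) * real (card Y)) \<le> (?f x z - \<epsilon>) * (real (card X) * real (card Y))"
            using f(1) e8 \<mu>' by (intro mult_right_mono) auto
          ultimately have e: "(1 / 2 + \<mu>' / 4) * real (card X) * real (card Y) \<le> ee E X Y" by (simp add: mult.assoc)
          have bX: "\<mu>' / 8 * (\<beta> * n) \<le> card X" using X(2) mult_left_mono[OF size[OF x(1)], of "\<mu>' / 8"] \<mu>' by linarith
          have bY: "\<mu>' / 8 * (\<beta> * n) \<le> card Y" using Y(2) mult_left_mono[OF size[OF z(1)], of "\<mu>' / 8"] \<mu>' by linarith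
          have p0: "0 < \<mu>' / 8 * (\<beta> * n)" using \<mu>' \<beta> n by simp
          have an: "\<alpha> * n + \<alpha> * n = \<mu>' / 8 * (\<mu>' / 8 * (\<beta> * n)) / 2 ^ l" by (simp add: \<alpha>_def)
          have an0: "0 < \<alpha> * n" using \<alpha> n by simp
          have "\<mu>' / 8 * (\<mu>' / 8 * (\<beta> * n)) / 2 ^ l \<le> \<mu>' / 8 * (\<mu>' / 8 * (\<beta> * n)) / 1"
            using p0 \<mu>' by (intro divide_left_mono) auto
          moreover have "\<mu>' / 8 * (\<mu>' / 8 * (\<beta> * n)) \<le> \<mu>' / 8 * card X" using bX \<mu>' by (intro mult_left_mono) auto
          ultimately have aX: "\<alpha> * n \<le> \<mu>' / 4 / 2 * real (card X)" using an an0 by linarith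
          have "\<mu>' / 8 * (\<mu>' / 8 * (\<beta> * n)) / 2 ^ l \<le> \<mu>' / 8 * card Y / 2 ^ l"
            using bY \<mu>' by (intro divide_right_mono mult_left_mono) auto
          then have aY: "\<alpha> * n + l \<le> \<mu>' / 4 / 2 * real (card Y) / 2 ^ l" using an n(1) by simp
          have c0: "0 < \<mu>' / 4" using \<mu>' by simp
          have XV: "X \<subseteq> V" "Y \<subseteq> V" by (rule subset_trans[OF X(1) cell_subset], rule subset_trans[OF Y(1) cell_subset])
          have pXY: "0 < card X" "0 < card Y" using bX bY p0 by linarith+
          obtain T Q where "T \<subseteq> X" "Q \<subseteq> Y" "T \<inter> Q = {}" "card T = l div 2 + 1" "card Q = l"
              "is_K (l div 2 + 1 + l) E (T \<union> Q)"
            using dense_pair_clique[OF G D[folded n_def] l0 XV c0 e pXY(1) aX pXY(2) aY] by metis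
          then show ?thesis by blast
        qed
        \<comment> \<open>Cells of typical vertices have at least \<open>\<beta> * n\<close>
          vertices, so a forbidden set of order \<open>\<phi> * n = \<beta> * n / 4\<close> leaves
          three quarters of each.\<close>
        have minusF: "3 / 4 * card (?c u) \<le> card (?c u - F)" "finite (?c u - F)"
          if "u \<in> W" "finite F" "real (card F) \<le> \<phi> * n" for u F
        proof -
          have "card (?c u) \<le> card (?c u - F) + card F" using diff_card_le_card_Diff[OF that(2), of "?c u"] by linarith
          moreover have "\<phi> * n \<le> card (?c u) / 4" using size[OF that(1)] by (simp add: \<phi>_def)
          ultimately show "3 / 4 * card (?c u) \<le> card (?c u - F)" using that(3) by linarith
          show "finite (?c u - F)" using fc by simp
        qed
        have cxA: "?c x \<subseteq> A" using cell_sub x by blast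
        have cyB: "?c y \<subseteq> B'" using cell_sub y by blast
        have czD: "?c z \<subseteq> D'" using cell_sub D' by blast
        have div: "r - l + 1 \<le> l div 2 + 1" "r \<le> l div 2 + 1 + l" using lr by linarith+
        have uniq: "C \<inter> C' = {}" if "C \<in> \<C>" "C' \<in> \<C>" "C \<noteq> C'" for C C'
          using \<C>(3) that unfolding disjoint_def by blast
        show ?thesis
        proof (cases "D' = A")
          case False
          \<comment> \<open>From a clique with \<open>r - l + 1\<close> vertices in \<open>A\<close>
            and \<open>l\<close> in \<open>D'\<close>, one vertex is removed on each side to get the
            common rest; either removed vertex may then be the root. The distribution depends on the
            classes alone, not on \<open>F\<close>.\<close>
          define \<kappa> where "\<kappa> C = (if C = A then r - l else if C = D' then l - 1 else 0)" for C
          have \<kappa>: "\<forall>C\<in>\<C>. card ((T \<union> Q) \<inter> C) = \<kappa> C" if "T \<subseteq> A" "Q \<subseteq> D'" "card T = r - l" "card Q = l - 1" for T Q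
          proof
            fix C assume C: "C \<in> \<C>"
            consider "C = A" | "C = D'" "C \<noteq> A" | "C \<noteq> A" "C \<noteq> D'" by blast
            then show "card ((T \<union> Q) \<inter> C) = \<kappa> C"
            proof cases
              case 1
              then have "(T \<union> Q) \<inter> C = T" using that uniq[OF x(3) D'(1)] False by blast
              then show ?thesis using 1 that by (simp add: \<kappa>_def)
            next
              case 2
              then have "(T \<union> Q) \<inter> C = Q" using that uniq[OF x(3) D'(1)] False by blast
              then show ?thesis using 2 that by (simp add: \<kappa>_def)
            next
              case 3
              then have "(T \<union> Q) \<inter> C = {}" using that uniq[OF x(3) C] uniq[OF D'(1) C] by blast
              then show ?thesis using 3 by (simp add: \<kappa>_def)
            qed
          qed
          have "rooted_clique r E \<C> A \<kappa> F \<and> rooted_clique r E \<C> D' \<kappa> F"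
            if F: "finite F" "real (card F) \<le> \<phi> * real (card V)" for F
          proof -
            have F': "real (card F) \<le> \<phi> * n" using F(2) by (simp add: n_def)
            have m8: "\<mu>' / 8 * card (?c u) \<le> 3 / 4 * card (?c u)" for u using \<mu>' by (intro mult_right_mono) auto
            obtain T Q where TQ: "T \<subseteq> ?c x - F" "Q \<subseteq> ?c z - F" "T \<inter> Q = {}" "card T = l div 2 + 1" "card Q = l"
                "is_K (l div 2 + 1 + l) E (T \<union> Q)"
              using sub_pair[of "?c x - F" "?c z - F"] minusF(1)[OF x(1) F(1) F'] minusF(1)[OF z(1) F(1) F'] m8
              by (meson Diff_subset order_trans)
            have fTQ: "finite T" "finite Q" using TQ(6) by (auto simp: is_K_def)
            obtain T1 where T1: "T1 \<subseteq> T" "card T1 = r - l + 1"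
              using obtain_subset_with_card_n[of "r - l + 1" T] div TQ(4) by metis
            then obtain p where p: "p \<in> T1" by fastforce
            obtain q where q: "q \<in> Q" using TQ(5) l0 by fastforce
            define T2 where "T2 = T1 - {p}"
            define Q2 where "Q2 = Q - {q}"
            have cT2: "card T2 = r - l" "T2 \<subseteq> T" "p \<notin> T2" using T1 p by (auto simp: T2_def card_Diff_singleton)
            have cQ2: "card Q2 = l - 1" "Q2 \<subseteq> Q" "q \<notin> Q2" using TQ(5) q by (auto simp: Q2_def card_Diff_singleton)
            have fT2: "finite T2" "finite Q2" using cT2 cQ2 fTQ by (auto intro: finite_subset)
            have disj: "T2 \<inter> Q2 = {}" "p \<notin> Q" "q \<notin> T" using cT2 cQ2 TQ(3) p q T1(1) by auto
            have in_cls: "T \<subseteq> A - F" "Q \<subseteq> D' - F" using TQ cxA czD by auto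
            have c1: "card (insert p (T2 \<union> Q2)) = r" "card (insert q (T2 \<union> Q2)) = r"
              using fT2 cT2 cQ2 disj lr l0 by (auto simp: card_insert_if card_Un_disjoint)
            have s1: "insert p (T2 \<union> Q2) \<subseteq> T \<union> Q" "insert q (T2 \<union> Q2) \<subseteq> T \<union> Q" using cT2 cQ2 p q T1(1) by auto
            have K: "is_K r E (insert p (T2 \<union> Q2))" "is_K r E (insert q (T2 \<union> Q2))"
              using is_K_subset[OF TQ(6) s1(1)] is_K_subset[OF TQ(6) s1(2)] c1 by auto
            have kk: "\<forall>C\<in>\<C>. card ((T2 \<union> Q2) \<inter> C) = \<kappa> C" by (rule \<kappa>) (use cT2 cQ2 in_cls in auto)
            have RU: "T2 \<union> Q2 \<subseteq> \<Union>\<C> - F" using cT2(2) cQ2(2) in_cls x(3) D'(1) by blast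
            have "rooted_clique r E \<C> A \<kappa> F" unfolding rooted_clique_def
              by (rule exI[of _ p], rule exI[of _ "T2 \<union> Q2"]) (use RU K kk cT2 disj in_cls p T1(1) cQ2(2) in auto)
            moreover have "rooted_clique r E \<C> D' \<kappa> F" unfolding rooted_clique_def
              by (rule exI[of _ q], rule exI[of _ "T2 \<union> Q2"]) (use RU K kk cQ2 disj in_cls q cT2(2) in auto)
            ultimately show ?thesis ..
          qed
          then show ?thesis using x(3) D'(1) False by metis
        next
          case True
          \<comment> \<open>Here the rest lies entirely in \<open>A\<close>; it is completed either
            by a further vertex of \<open>A\<close> or by a vertex from the cell of
            \<open>y\<close>.\<close>
          define \<kappa> where "\<kappa> C = (if C = A then r - 1 else 0)" for C
          have "rooted_clique r E \<C> A \<kappa> F \<and> rooted_clique r E \<C> B' \<kappa> F"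
            if F: "finite F" "real (card F) \<le> \<phi> * real (card V)" for F
          proof -
            have F': "real (card F) \<le> \<phi> * n" using F(2) by (simp add: n_def)
            have e1: "\<epsilon> \<le> \<mu>' / 12" using \<epsilon> \<epsilon>1 by linarith
            have low: "real (card {v\<in>?c y. real (card (nb E v \<inter> (?c u - F))) < (?f y u - \<epsilon>) * card (?c u - F)}) < \<epsilon> * card (?c y)"
              if u: "u \<in> W" "\<not> bad y u" for u
            proof (rule regular_low_degree)
              have "\<epsilon> * card (?c u) \<le> 3 / 4 * card (?c u)" using e1 \<mu>' by (intro mult_right_mono) auto
              then show "\<epsilon> * card (?c u) \<le> card (?c u - F)" using minusF(1)[OF u(1) F(1) F'] by linarith
            qed (use u(2) fc pos[OF V(2)] \<epsilon> in \<open>auto simp: bad_def\<close>)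
            let ?L = "\<lambda>u. {v\<in>?c y. real (card (nb E v \<inter> (?c u - F))) < (?f y u - \<epsilon>) * card (?c u - F)}"
            \<comment> \<open>By regularity less than a \<open>2 * \<epsilon>\<close> fraction of
              the cell of \<open>y\<close> has low degree to the cell of \<open>x\<close> or of
              \<open>z\<close>, so outside \<open>F\<close> a vertex with many neighbours in both
              survives.\<close>
            have "\<not> ?c y - F \<subseteq> ?L x \<union> ?L z"
            proof
              assume "?c y - F \<subseteq> ?L x \<union> ?L z"
              then have "card (?c y - F) \<le> card (?L x \<union> ?L z)" using fc by (intro card_mono) auto
              also have "\<dots> \<le> card (?L x) + card (?L z)" by (rule card_Un_le)
              finally have "real (card (?c y - F)) < 2 * (\<epsilon> * card (?c y))"
                using low[OF x(1) reg(1)] low[OF z(1) reg(3)] by linarith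
              moreover have "2 * \<epsilon> * card (?c y) \<le> 3 / 4 * card (?c y)" using e1 \<mu>' by (intro mult_right_mono) auto
              ultimately show False using minusF(1)[OF y(1) F(1) F'] by (simp add: mult.assoc)
            qed
            then obtain v where v: "v \<in> ?c y - F" "v \<notin> ?L x" "v \<notin> ?L z" by blast
            have deg_v: "\<mu>' / 8 * card (?c u) \<le> card (nb E v \<inter> (?c u - F))"
              if u: "u \<in> W" "v \<notin> ?L u" "\<mu>' / 4 \<le> ?f y u" for u
            proof -
              have "(\<mu>' / 4 - \<mu>' / 12) * (3 / 4 * card (?c u)) \<le> (?f y u - \<epsilon>) * card (?c u - F)"
                using u(3) e1 \<mu>' minusF(1)[OF u(1) F(1) F'] by (intro mult_mono) auto
              moreover have "(?f y u - \<epsilon>) * card (?c u - F) \<le> card (nb E v \<inter> (?c u - F))"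
                using u(2) v(1) by (auto simp: not_less)
              ultimately show ?thesis by simp
            qed
            obtain T Q where TQ: "T \<subseteq> nb E v \<inter> (?c x - F)" "Q \<subseteq> nb E v \<inter> (?c z - F)"
                "is_K (l div 2 + 1 + l) E (T \<union> Q)"
              using sub_pair[of "nb E v \<inter> (?c x - F)" "nb E v \<inter> (?c z - F)"] deg_v[OF x(1) v(2) f(2)] deg_v[OF z(1) v(3) f(3)]
              by (meson Diff_subset inf.coboundedI2)
            obtain S where S: "S \<subseteq> T \<union> Q" "is_K r E S" using is_K_obtain[OF TQ(3) div(2)] by blast
            have SA: "S \<subseteq> A - F" "S \<subseteq> nb E v"
            proof -
              have "T \<union> Q \<subseteq> A - F" "T \<union> Q \<subseteq> nb E v" using TQ(1,2) cxA czD True by blast+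
              then show "S \<subseteq> A - F" "S \<subseteq> nb E v" using S(1) by blast+
            qed
            have fS: "finite S" "card S = r" using S(2) by (auto simp: is_K_def)
            obtain p where p: "p \<in> S" using fS lr by fastforce
            define R where "R = S - {p}"
            have R: "card R = r - 1" "p \<notin> R" "insert p R = S" "R \<subseteq> A - F" "R \<subseteq> nb E v"
              using fS p SA by (auto simp: R_def)
            have vB: "v \<in> B' - F" using v(1) cyB by blast
            have vR: "v \<notin> R" using vB R(4) uniq[OF x(3) y(3) AB] by blast
            have KR: "is_K (r - 1) E R" using is_K_subset[OF S(2), of R] R(1) by (simp add: R_def)
            have "is_K (Suc (r - 1)) E (insert v R)" by (rule is_K_insert[OF KR vR R(5)])
            then have Kv: "is_K r E (insert v R)" using lr by simp
            have kk: "\<forall>C\<in>\<C>. card (R \<inter> C) = \<kappa> C"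
            proof
              fix C assume C: "C \<in> \<C>"
              show "card (R \<inter> C) = \<kappa> C"
              proof (cases "C = A")
                case True
                then have "R \<inter> C = R" using R(4) by blast
                then show ?thesis using True R(1) by (simp add: \<kappa>_def)
              next
                case False
                then have "R \<inter> C = {}" using R(4) uniq[OF x(3) C] by blast
                then show ?thesis using False by (simp add: \<kappa>_def)
              qed
            qed
            have RU: "R \<subseteq> \<Union>\<C> - F" using R(4) x(3) by blast
            have "rooted_clique r E \<C> A \<kappa> F" unfolding rooted_clique_def
              by (rule exI[of _ p], rule exI[of _ R]) (use RU R S(2) kk SA p in auto)
            moreover have "rooted_clique r E \<C> B' \<kappa> F" unfolding rooted_clique_def
              by (rule exI[of _ v], rule exI[of _ R]) (use RU Kv kk vB vR in auto)
            ultimately show ?thesis ..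
          qed
          then show ?thesis using x(3) y(3) AB by metis
        qed
      qed
      have "?f x z \<le> 1" "?f y z \<le> 1" by (rule f01)+
      then consider "1 / 2 + \<mu>' / 2 \<le> ?f x z" "\<mu>' / 4 \<le> ?f y z" | "1 / 2 + \<mu>' / 2 \<le> ?f y z" "\<mu>' / 4 \<le> ?f x z"
        using z(4) \<mu>' by linarith
      then show ?thesis
      proof cases
        case 1
        then show ?thesis
          using sym_case[of x A y B'] A y B' AB z bad_sym[of x y] fsym[of x y] by auto
      next
        case 2
        then show ?thesis
          using sym_case[of y B' x A] A y B' AB z by auto
      qed
    qed
  qed
  show ?thesis
    by (rule exI[of _ \<alpha>], rule conjI[OF \<alpha>], rule exI[of _ \<phi>], rule conjI[OF \<phi>], rule exI[of _ N])
      (intro allI impI, rule main)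
qed

text \<open>Induction on the number of classes: unless one class already almost spans, two can be
  merged. Each merge shrinks \<open>\<beta>\<close> and enlarges \<open>c\<close> by amounts
  independent of the graph, so boundedly many merges are affordable.\<close>

lemma single_closed_class:
  fixes l r k c :: nat and \<mu> \<eta> \<beta> :: real
  assumes lr: "l < r" "3 * r \<le> 4 * l" and \<mu>: "0 < \<mu>" and \<eta>: "0 < \<eta>" "4 * \<eta> \<le> \<mu>" and \<beta>: "0 < \<beta>"
  shows "\<exists>\<beta>'>0. \<exists>c'. \<exists>\<alpha>>0. \<exists>N. \<forall>(V :: 'a set) E \<C>. simple_graph V E \<longrightarrow> N \<le> card V \<longrightarrow>
     K_dense l V E (\<alpha> * real (card V)) \<longrightarrow> (\<forall>v\<in>V. (1 / 2 + \<mu>) * real (card V) \<le> real (card (nb E v))) \<longrightarrow>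
     finite \<C> \<longrightarrow> card \<C> \<le> k \<longrightarrow> disjoint \<C> \<longrightarrow> \<Union>\<C> \<subseteq> V \<longrightarrow> real (card (V - \<Union>\<C>)) \<le> \<eta> / 4 * real (card V) \<longrightarrow>
     (\<forall>C\<in>\<C>. \<forall>x\<in>C. \<forall>y\<in>C. x \<noteq> y \<longrightarrow> reach r V E (\<beta> * real (card V)) c x y) \<longrightarrow>
     (\<exists>C\<subseteq>V. real (card (V - C)) \<le> \<eta> * real (card V) \<and>
        (\<forall>x\<in>C. \<forall>y\<in>C. x \<noteq> y \<longrightarrow> reach r V E (\<beta>' * real (card V)) c' x y))"
  using \<beta>
proof (induction k arbitrary: \<beta> c)
  case 0
  have "\<exists>C\<subseteq>V. real (card (V - C)) \<le> \<eta> * real (card V) \<and>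
        (\<forall>x\<in>C. \<forall>y\<in>C. x \<noteq> y \<longrightarrow> reach r V E (1 * real (card V)) 0 x y)"
    if "finite \<C>" "card \<C> \<le> 0" "real (card (V - \<Union>\<C>)) \<le> \<eta> / 4 * real (card V)" for V :: "'a set" and E \<C>
  proof -
    \<comment> \<open>Without classes the bound on the uncovered vertices applies to all of
      \<open>V\<close>, so the empty set is a valid class.\<close>
    have "\<C> = {}" using that by simp
    moreover have "\<eta> / 4 * real (card V) \<le> \<eta> * real (card V)" using \<eta> by (intro mult_right_mono) auto
    ultimately show ?thesis using that(3) by (intro exI[of _ "{}"]) auto
  qed
  then show ?case
    by (intro exI[of _ "1::real"] conjI zero_less_one exI[of _ "0::nat"] allI impI) blast
next
  case (Suc k)
  obtain \<alpha>1 \<phi> :: real and N1 where \<alpha>1: "0 < \<alpha>1" and \<phi>: "0 < \<phi>" and T: "\<forall>(V :: 'a set) E \<C>. simple_graph V E \<longrightarrow> N1 \<le> card V \<longrightarrow>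
     K_dense l V E (\<alpha>1 * real (card V)) \<longrightarrow> (\<forall>v\<in>V. (1 / 2 + \<mu>) * real (card V) \<le> real (card (nb E v))) \<longrightarrow>
     finite \<C> \<longrightarrow> card \<C> \<le> Suc k \<longrightarrow> disjoint \<C> \<longrightarrow> \<Union>\<C> \<subseteq> V \<longrightarrow> real (card (V - \<Union>\<C>)) \<le> \<eta> / 4 * real (card V) \<longrightarrow>
     (\<exists>C\<in>\<C>. real (card (V - C)) \<le> \<eta> * real (card V)) \<or>
     (\<exists>A\<in>\<C>. \<exists>B\<in>\<C>. A \<noteq> B \<and> (\<exists>\<kappa>. \<forall>F. finite F \<longrightarrow> real (card F) \<le> \<phi> * real (card V) \<longrightarrow>
        rooted_clique r E \<C> A \<kappa> F \<and> rooted_clique r E \<C> B \<kappa> F))"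
    using transferral[OF lr \<mu> \<eta>, of "Suc k", where 'a = 'a] by metis
  define \<beta>1 where "\<beta>1 = min \<beta> \<phi> / 2"
  have \<beta>1: "0 < \<beta>1" "2 * \<beta>1 \<le> \<beta>" "2 * \<beta>1 \<le> \<phi>" using Suc.prems \<phi> by (auto simp: \<beta>1_def)
  define c1 where "c1 = 2 * r + r * c + 2 * c"
  obtain \<beta>2 \<alpha>2 :: real and c2 N2 where \<beta>2: "0 < \<beta>2" and \<alpha>2: "0 < \<alpha>2" and IH: "\<forall>(V :: 'a set) E \<C>. simple_graph V E \<longrightarrow> N2 \<le> card V \<longrightarrow>
     K_dense l V E (\<alpha>2 * real (card V)) \<longrightarrow> (\<forall>v\<in>V. (1 / 2 + \<mu>) * real (card V) \<le> real (card (nb E v))) \<longrightarrow>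
     finite \<C> \<longrightarrow> card \<C> \<le> k \<longrightarrow> disjoint \<C> \<longrightarrow> \<Union>\<C> \<subseteq> V \<longrightarrow> real (card (V - \<Union>\<C>)) \<le> \<eta> / 4 * real (card V) \<longrightarrow>
     (\<forall>C\<in>\<C>. \<forall>x\<in>C. \<forall>y\<in>C. x \<noteq> y \<longrightarrow> reach r V E (\<beta>1 * real (card V)) c1 x y) \<longrightarrow>
     (\<exists>C\<subseteq>V. real (card (V - C)) \<le> \<eta> * real (card V) \<and>
        (\<forall>x\<in>C. \<forall>y\<in>C. x \<noteq> y \<longrightarrow> reach r V E (\<beta>2 * real (card V)) c2 x y))"
    using Suc.IH[OF \<beta>1(1), of c1] by (elim exE conjE) (rule that)
  define L where "L = 4 * real r + real (r * c) + 2 * real c + 4"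
  define N where "N = max N1 (max N2 (nat \<lceil>L / \<beta>1\<rceil> + 1))"
  define \<alpha> where "\<alpha> = min \<alpha>1 \<alpha>2"
  define \<beta>' where "\<beta>' = min \<beta> \<beta>2"
  have \<alpha>: "0 < \<alpha>" and \<beta>': "0 < \<beta>'" using \<alpha>1 \<alpha>2 \<beta>2 Suc.prems by (auto simp: \<alpha>_def \<beta>'_def)
  have main: "\<exists>C\<subseteq>V. real (card (V - C)) \<le> \<eta> * real (card V) \<and>
        (\<forall>x\<in>C. \<forall>y\<in>C. x \<noteq> y \<longrightarrow> reach r V E (\<beta>' * real (card V)) (max c c2) x y)"
    if G: "simple_graph V E" and nN: "N \<le> card V" and D: "K_dense l V E (\<alpha> * real (card V))"
      and deg: "\<forall>v\<in>V. (1 / 2 + \<mu>) * real (card V) \<le> real (card (nb E v))"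
      and \<C>: "finite \<C>" "card \<C> \<le> Suc k" "disjoint \<C>" "\<Union>\<C> \<subseteq> V"
      and exc: "real (card (V - \<Union>\<C>)) \<le> \<eta> / 4 * real (card V)"
      and cl: "\<forall>C\<in>\<C>. \<forall>x\<in>C. \<forall>y\<in>C. x \<noteq> y \<longrightarrow> reach r V E (\<beta> * real (card V)) c x y"
    for V :: "'a set" and E \<C>
  proof -
    define n where "n = real (card V)"
    have N12: "N1 \<le> card V" "N2 \<le> card V" using nN by (auto simp: N_def)
    have D1: "K_dense l V E (\<alpha>1 * real (card V))" "K_dense l V E (\<alpha>2 * real (card V))"
      by (rule K_dense_mono[OF D], simp add: \<alpha>_def mult_right_mono)+
    have "L / \<beta>1 \<le> real (nat \<lceil>L / \<beta>1\<rceil> + 1)" by linarith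
    also have "\<dots> \<le> n" using nN unfolding N_def n_def by simp
    finally have L: "L \<le> \<beta>1 * n" using \<beta>1 by (simp add: field_simps)
    have n0: "0 \<le> n" by (simp add: n_def)
    have "2 * \<beta>1 * n \<le> \<beta> * n" "2 * \<beta>1 * n \<le> \<phi> * n" using \<beta>1 n0 by (auto intro: mult_right_mono)
    then have L': "\<beta>1 * n + L \<le> \<beta> * n" "\<beta>1 * n + L \<le> \<phi> * n" using L by linarith+
    have up: "reach r V E (\<beta>' * n) (max c c2) x y"
      if "reach r V E (\<beta> * n) c x y \<or> reach r V E (\<beta>2 * n) c2 x y" for x y
      using that n0 unfolding \<beta>'_def by (auto elim!: reach_mono intro!: mult_right_mono)
    from T[rule_format, OF G N12(1) D1(1) deg[rule_format] \<C> exc]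
    show ?thesis
    proof
      assume "\<exists>C\<in>\<C>. real (card (V - C)) \<le> \<eta> * real (card V)"
      then obtain C where C: "C \<in> \<C>" "real (card (V - C)) \<le> \<eta> * real (card V)" by blast
      moreover have "\<forall>x\<in>C. \<forall>y\<in>C. x \<noteq> y \<longrightarrow> reach r V E (\<beta>' * real (card V)) (max c c2) x y"
        using cl C(1) up unfolding n_def by blast
      ultimately show ?thesis using \<C>(4) by (intro exI[of _ C]) auto
    next
      assume "\<exists>A\<in>\<C>. \<exists>B\<in>\<C>. A \<noteq> B \<and> (\<exists>\<kappa>. \<forall>F. finite F \<longrightarrow> real (card F) \<le> \<phi> * real (card V) \<longrightarrow>
        rooted_clique r E \<C> A \<kappa> F \<and> rooted_clique r E \<C> B \<kappa> F)"
      then obtain A B \<kappa> where AB: "A \<in> \<C>" "B \<in> \<C>" "A \<noteq> B"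
        and \<kappa>: "\<And>F. finite F \<Longrightarrow> real (card F) \<le> \<phi> * n \<Longrightarrow> rooted_clique r E \<C> A \<kappa> F \<and> rooted_clique r E \<C> B \<kappa> F"
        unfolding n_def by blast
      have merged: "reach r V E (\<beta>1 * n) c1 x y" if "x \<in> A" "y \<in> B" for x y
        unfolding c1_def
      proof (rule merge_reach[OF \<C>(3,4) AB _ \<kappa> _ _ that])
        show "reach r V E (\<beta> * n) c x y" if "C \<in> \<C>" "x \<in> C" "y \<in> C" "x \<noteq> y" for C x y
          using cl that unfolding n_def by blast
      qed (use L' lr in \<open>auto simp: L_def\<close>)
      define \<C>' where "\<C>' = insert (A \<union> B) (\<C> - {A, B})"
      have cl1: "reach r V E (\<beta>1 * n) c1 x y" if "C \<in> \<C>" "x \<in> C" "y \<in> C" "x \<noteq> y" for C x y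
      proof (rule reach_mono)
        show "reach r V E (\<beta> * n) c x y" using cl that unfolding n_def by blast
        show "\<beta>1 * n \<le> \<beta> * n" using \<beta>1 n0 by (intro mult_right_mono) auto
        show "c \<le> c1" by (simp add: c1_def)
      qed
      have "\<forall>C\<in>\<C>'. \<forall>x\<in>C. \<forall>y\<in>C. x \<noteq> y \<longrightarrow> reach r V E (\<beta>1 * real (card V)) c1 x y"
      proof (intro ballI impI)
        fix C x y assume C: "C \<in> \<C>'" "x \<in> C" "y \<in> C" "x \<noteq> y"
        then consider "C \<in> \<C>" | "x \<in> A" "y \<in> A" | "x \<in> B" "y \<in> B" | "x \<in> A" "y \<in> B" | "x \<in> B" "y \<in> A"
          unfolding \<C>'_def by blast
        then show "reach r V E (\<beta>1 * real (card V)) c1 x y"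
          unfolding n_def[symmetric]
          by cases (use cl1 AB C merged reach_sym[OF merged] in blast)+
      qed
      moreover have "finite \<C>'" using \<C>(1) by (simp add: \<C>'_def)
      moreover have "card \<C>' \<le> k"
      proof -
        have "card (\<C> - {A, B}) = card \<C> - 2" using AB \<C>(1) by (subst card_Diff_subset) auto
        moreover have "card \<C>' \<le> Suc (card (\<C> - {A, B}))" unfolding \<C>'_def using \<C>(1) by (simp add: card_insert_if)
        moreover have "card {A, B} \<le> card \<C>" using AB \<C>(1) by (intro card_mono) auto
        ultimately show ?thesis using \<C>(2) AB(3) by simp
      qed
      moreover have "disjoint \<C>'"
        using \<C>(3) AB unfolding \<C>'_def disjoint_def by (auto; blast)
      moreover have "\<Union>\<C>' = \<Union>\<C>" using AB by (auto simp: \<C>'_def)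
      ultimately obtain C where "C \<subseteq> V" "real (card (V - C)) \<le> \<eta> * real (card V)"
          "\<forall>x\<in>C. \<forall>y\<in>C. x \<noteq> y \<longrightarrow> reach r V E (\<beta>2 * real (card V)) c2 x y"
        using IH[rule_format, OF G N12(2) D1(2) deg[rule_format], of \<C>'] \<C>(4) exc by auto
      then show ?thesis using up unfolding n_def by (intro exI[of _ C]) blast
    qed
  qed
  show ?case
    by (rule exI[of _ \<beta>'], rule conjI[OF \<beta>'], rule exI[of _ "max c c2"], rule exI[of _ \<alpha>], rule conjI[OF \<alpha>],
        rule exI[of _ N]) (intro allI impI, rule main)
qed

text \<open>A common \<open>(r - 1)\<close>-clique of two vertices is a connector, so
  \<open>common_clique\<close> supplies the pairs required by \<open>closed_classes\<close>; the
  resulting classes are then merged into one.\<close>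

lemma almost_spanning_closed_class:
  fixes l r :: nat and \<mu> \<eta> :: real
  assumes lr: "l < r" "3 * r \<le> 4 * l" and \<mu>: "0 < \<mu>" and \<eta>: "0 < \<eta>" "4 * \<eta> \<le> \<mu>"
  shows "\<exists>\<beta>>0. \<exists>c. \<exists>\<alpha>>0. \<exists>N. \<forall>(V :: nat set) E. simple_graph V E \<longrightarrow> N \<le> card V \<longrightarrow>
     K_dense l V E (\<alpha> * real (card V)) \<longrightarrow>
     (\<forall>v\<in>V. (1 / (2 - RT_density l (r - 1)) + \<mu>) * real (card V) \<le> real (card (nb E v))) \<longrightarrow>
     (\<exists>C\<subseteq>V. real (card (V - C)) \<le> \<eta> * real (card V) \<and>
        (\<forall>x\<in>C. \<forall>y\<in>C. x \<noteq> y \<longrightarrow> reach r V E (\<beta> * real (card V)) c x y))"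
proof -
  have l0: "0 < l" and r0: "0 < r" using lr by auto
  define \<delta> where "\<delta> = 1 / (2 - RT_density l (r - 1))"
  have \<delta>: "1 / 2 \<le> \<delta>" using RT_density_bounds[OF l0, of "r - 1"] by (simp add: \<delta>_def divide_simps)
  obtain m and \<beta>0 \<alpha>0 :: real where \<beta>0: "0 < \<beta>0" and \<alpha>0: "0 < \<alpha>0" and A: "\<forall>(V :: nat set) E I. simple_graph V E \<longrightarrow> V \<noteq> {} \<longrightarrow>
     K_dense l V E (\<alpha>0 * real (card V)) \<longrightarrow>
     (\<forall>v\<in>V. (\<delta> + \<mu>) * real (card V) \<le> real (card (nb E v))) \<longrightarrow>
     I \<subseteq> V \<longrightarrow> m \<le> card I \<longrightarrow>
     (\<exists>x\<in>I. \<exists>y\<in>I. x \<noteq> y \<and> (\<forall>F. finite F \<longrightarrow> real (card F) \<le> \<beta>0 * real (card V) \<longrightarrow>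
        (\<exists>S\<subseteq>nb E x \<inter> nb E y - F. is_K (r - 1) E S)))"
    using common_clique[OF l0 \<mu>, of "r - 1"] unfolding \<delta>_def[symmetric] by blast
  \<comment> \<open>Small enough for the exceptional set of \<open>closed_classes\<close>, of order
    at most \<open>m\<^sup>2 * 2 * \<beta>1 * n\<close>, to stay below
    \<open>\<eta> / 4 * n\<close>.\<close>
  define \<beta>1 where "\<beta>1 = min \<beta>0 (\<eta> / (8 * ((real m)\<^sup>2 + 1)))"
  have m0: "0 < 8 * ((real m)\<^sup>2 + 1)" by (simp add: add_nonneg_pos)
  have \<beta>1: "0 < \<beta>1" "\<beta>1 \<le> \<beta>0" "\<beta>1 \<le> \<eta> / (8 * ((real m)\<^sup>2 + 1))"
    using \<beta>0 \<eta> m0 by (auto simp: \<beta>1_def)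
  have m\<beta>: "(real m)\<^sup>2 * (2 * \<beta>1) \<le> \<eta> / 4"
  proof -
    have "\<beta>1 * (8 * ((real m)\<^sup>2 + 1)) \<le> \<eta>" using \<beta>1(3) m0 by (simp add: pos_le_divide_eq)
    then have "8 * ((real m)\<^sup>2 * \<beta>1) + 8 * \<beta>1 \<le> \<eta>" by (simp add: algebra_simps)
    then show ?thesis using \<beta>1(1) by simp
  qed
  obtain \<beta>2 :: real and c2 N2 where \<beta>2: "0 < \<beta>2" and B: "\<forall>(V :: nat set) E. finite V \<longrightarrow> N2 \<le> card V \<longrightarrow>
    (\<forall>I\<subseteq>V. m \<le> card I \<longrightarrow> (\<exists>x\<in>I. \<exists>y\<in>I. x \<noteq> y \<and> reach r V E (\<beta>1 * card V) (r - 1) x y)) \<longrightarrow>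
    (\<exists>\<C>. finite \<C> \<and> card \<C> \<le> m \<and> disjoint \<C> \<and> \<Union>\<C> \<subseteq> V \<and>
      real (card (V - \<Union>\<C>)) \<le> (real m)\<^sup>2 * (2 * \<beta>1 * card V) \<and>
      (\<forall>C\<in>\<C>. \<forall>x\<in>C. \<forall>y\<in>C. x \<noteq> y \<longrightarrow> reach r V E (\<beta>2 * real (card V)) c2 x y))"
    using closed_classes[OF \<beta>1(1), of m r "r - 1", where 'a = nat] by metis
  obtain \<beta>3 \<alpha>3 :: real and c3 N3 where \<beta>3: "0 < \<beta>3" and \<alpha>3: "0 < \<alpha>3" and C: "\<forall>(V :: nat set) E \<C>. simple_graph V E \<longrightarrow> N3 \<le> card V \<longrightarrow>
     K_dense l V E (\<alpha>3 * real (card V)) \<longrightarrow> (\<forall>v\<in>V. (1 / 2 + \<mu>) * real (card V) \<le> real (card (nb E v))) \<longrightarrow>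
     finite \<C> \<longrightarrow> card \<C> \<le> m \<longrightarrow> disjoint \<C> \<longrightarrow> \<Union>\<C> \<subseteq> V \<longrightarrow> real (card (V - \<Union>\<C>)) \<le> \<eta> / 4 * real (card V) \<longrightarrow>
     (\<forall>C\<in>\<C>. \<forall>x\<in>C. \<forall>y\<in>C. x \<noteq> y \<longrightarrow> reach r V E (\<beta>2 * real (card V)) c2 x y) \<longrightarrow>
     (\<exists>C\<subseteq>V. real (card (V - C)) \<le> \<eta> * real (card V) \<and>
        (\<forall>x\<in>C. \<forall>y\<in>C. x \<noteq> y \<longrightarrow> reach r V E (\<beta>3 * real (card V)) c3 x y))"
    using single_closed_class[OF lr \<mu> \<eta> \<beta>2, of m c2, where 'a = nat] by (elim exE conjE) (rule that)
  define \<alpha> where "\<alpha> = min \<alpha>0 \<alpha>3"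
  have \<alpha>: "0 < \<alpha>" using \<alpha>0 \<alpha>3 by (simp add: \<alpha>_def)
  define N where "N = max 1 (max N2 N3)"
  have main: "\<exists>C\<subseteq>V. real (card (V - C)) \<le> \<eta> * real (card V) \<and>
        (\<forall>x\<in>C. \<forall>y\<in>C. x \<noteq> y \<longrightarrow> reach r V E (\<beta>3 * real (card V)) c3 x y)"
    if G: "simple_graph V E" and nN: "N \<le> card V" and D: "K_dense l V E (\<alpha> * real (card V))"
      and deg: "\<forall>v\<in>V. (\<delta> + \<mu>) * real (card V) \<le> real (card (nb E v))"
    for V :: "nat set" and E
  proof -
    have fV: "finite V" using G by (simp add: simple_graph_def)
    have ne: "V \<noteq> {}" and N23: "N2 \<le> card V" "N3 \<le> card V" using nN by (auto simp: N_def)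
    have D0: "K_dense l V E (\<alpha>0 * real (card V))" "K_dense l V E (\<alpha>3 * real (card V))"
      by (rule K_dense_mono[OF D], simp add: \<alpha>_def mult_right_mono)+
    have "\<exists>x\<in>I. \<exists>y\<in>I. x \<noteq> y \<and> reach r V E (\<beta>1 * card V) (r - 1) x y" if I: "I \<subseteq> V" "m \<le> card I" for I
    proof -
      obtain x y where xy: "x \<in> I" "y \<in> I" "x \<noteq> y" and S: "\<And>F. finite F \<Longrightarrow> real (card F) \<le> \<beta>0 * real (card V) \<Longrightarrow>
        \<exists>S\<subseteq>nb E x \<inter> nb E y - F. is_K (r - 1) E S"
        using A[rule_format, OF G ne D0(1) deg[rule_format] I] by blast
      have "reach r V E (\<beta>1 * card V) (r - 1) x y"
        unfolding reach_def
      proof (intro allI impI)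
        fix F :: "nat set" assume F: "finite F" "real (card F) \<le> \<beta>1 * card V"
        have "\<beta>1 * card V \<le> \<beta>0 * card V" using \<beta>1 by (intro mult_right_mono) auto
        then obtain S where S': "S \<subseteq> nb E x \<inter> nb E y - F" "is_K (r - 1) E S" using S[OF F(1)] F(2) by auto
        have notin: "x \<notin> S" "y \<notin> S" using S'(1) nb_irrefl[OF G] by auto
        have "factorable r E (insert z S)" if "z \<notin> S" "S \<subseteq> nb E z" for z
        proof -
          have "is_K (Suc (r - 1)) E (insert z S)" by (rule is_K_insert[OF S'(2) that])
          then show ?thesis using r0 by (intro factorable_is_K) simp
        qed
        then have "factorable r E (insert x S)" "factorable r E (insert y S)" using S'(1) notin by blast+
        moreover have "S \<subseteq> V - F" using S'(1) nb_subset[OF G] by blast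
        moreover have "finite S" "card S = r - 1" using S'(2) by (auto simp: is_K_def)
        ultimately show "\<exists>S\<subseteq>V - F. finite S \<and> card S \<le> r - 1 \<and> x \<notin> S \<and> y \<notin> S \<and>
          factorable r E (insert x S) \<and> factorable r E (insert y S)"
          using notin by (intro exI[of _ S]) simp
      qed
      then show ?thesis using xy by blast
    qed
    then obtain \<C> where \<C>: "finite \<C>" "card \<C> \<le> m" "disjoint \<C>" "\<Union>\<C> \<subseteq> V"
      "real (card (V - \<Union>\<C>)) \<le> (real m)\<^sup>2 * (2 * \<beta>1 * card V)"
      "\<forall>C\<in>\<C>. \<forall>x\<in>C. \<forall>y\<in>C. x \<noteq> y \<longrightarrow> reach r V E (\<beta>2 * real (card V)) c2 x y"
      using B[rule_format, OF fV N23(1), of E] by blast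
    have "(real m)\<^sup>2 * (2 * \<beta>1 * card V) = ((real m)\<^sup>2 * (2 * \<beta>1)) * card V" by simp
    also have "\<dots> \<le> \<eta> / 4 * card V" by (rule mult_right_mono[OF m\<beta>]) simp
    finally have exc: "real (card (V - \<Union>\<C>)) \<le> \<eta> / 4 * card V" using \<C>(5) by linarith
    have "(1 / 2 + \<mu>) * card V \<le> (\<delta> + \<mu>) * card V" using \<delta> by (intro mult_right_mono) auto
    then have deg': "(1 / 2 + \<mu>) * real (card V) \<le> real (card (nb E v))" if "v \<in> V" for v
      using deg that by force
    show ?thesis
      by (rule C[rule_format, OF G N23(2) D0(2) deg' \<C>(1-4) exc]) (use \<C>(6) in blast)+
  qed
  show ?thesis unfolding \<delta>_def[symmetric]
    by (rule exI[of _ \<beta>3], rule conjI[OF \<beta>3], rule exI[of _ c3], rule exI[of _ \<alpha>], rule conjI[OF \<alpha>],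
        rule exI[of _ N]) (intro allI impI, rule main)
qed

section \<open>Matchings in bipartite graphs\<close>

text \<open>The Halmos-Vaughan induction: if every proper nonempty subset has a surplus, one vertex
  may be matched arbitrarily; otherwise a tight subset is matched first and its neighbourhood
  removed.\<close>

lemma hall_marriage:
  assumes "finite A" "\<And>a. a \<in> A \<Longrightarrow> finite (N a)"
    and "\<And>S. S \<subseteq> A \<Longrightarrow> card S \<le> card (\<Union>a\<in>S. N a)"
  shows "\<exists>f. inj_on f A \<and> (\<forall>a\<in>A. f a \<in> N a)"
  using assms
proof (induction A arbitrary: N rule: finite_psubset_induct)
  case (psubset A)
  note fN = psubset.prems(1) and hall = psubset.prems(2)
  show ?case
  proof (cases "A = {}")
    case False
    then obtain a where a: "a \<in> A" by blast
    show ?thesis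
    proof (cases "\<forall>S. S \<subset> A \<longrightarrow> S \<noteq> {} \<longrightarrow> card S < card (\<Union>x\<in>S. N x)")
      case True
      have "1 \<le> card (N a)" using hall[of "{a}"] a by simp
      then obtain b where b: "b \<in> N a" by (metis card.empty ex_in_conv not_one_le_zero)
      define N' where "N' x = N x - {b}" for x
      have psub: "A - {a} \<subset> A" using a by blast
      have "\<exists>f. inj_on f (A - {a}) \<and> (\<forall>x\<in>A - {a}. f x \<in> N' x)"
      proof (rule psubset.IH[OF psub])
        show "finite (N' x)" if "x \<in> A - {a}" for x using fN that by (simp add: N'_def)
        show "card S \<le> card (\<Union>x\<in>S. N' x)" if S: "S \<subseteq> A - {a}" for S
        proof (cases "S = {}")
          case False
          have "S \<subset> A" using S a by blast
          then have "card S < card (\<Union>x\<in>S. N x)" using True False by blast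
          moreover have "(\<Union>x\<in>S. N' x) = (\<Union>x\<in>S. N x) - {b}" by (auto simp: N'_def)
          moreover have "card (\<Union>x\<in>S. N x) \<le> card ((\<Union>x\<in>S. N x) - {b}) + 1"
            using diff_card_le_card_Diff[of "{b}" "\<Union>x\<in>S. N x"] by simp
          ultimately show ?thesis by simp
        qed simp
      qed
      then obtain f where f: "inj_on f (A - {a})" "\<forall>x\<in>A - {a}. f x \<in> N' x" by blast
      have "inj_on (f(a := b)) A"
        using f unfolding inj_on_def N'_def by auto
      moreover have "\<forall>x\<in>A. (f(a := b)) x \<in> N x" using f(2) b by (auto simp: N'_def)
      ultimately show ?thesis by blast
    next
      case False
      then obtain S where S: "S \<subset> A" "S \<noteq> {}" "card (\<Union>x\<in>S. N x) \<le> card S" by (meson not_less)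
      have fS: "finite S" using S(1) psubset.hyps by (auto intro: finite_subset)
      have "\<exists>f. inj_on f S \<and> (\<forall>x\<in>S. f x \<in> N x)"
        by (rule psubset.IH[OF S(1)]) (use S(1) fN hall in auto)
      then obtain f1 where f1: "inj_on f1 S" "\<forall>x\<in>S. f1 x \<in> N x" by blast
      define NS where "NS = (\<Union>x\<in>S. N x)"
      define N' where "N' x = N x - NS" for x
      have psub: "A - S \<subset> A" using S by blast
      have "\<exists>f. inj_on f (A - S) \<and> (\<forall>x\<in>A - S. f x \<in> N' x)"
      proof (rule psubset.IH[OF psub])
        show "finite (N' x)" if "x \<in> A - S" for x using fN that by (simp add: N'_def)
        show "card T \<le> card (\<Union>x\<in>T. N' x)" if T: "T \<subseteq> A - S" for T
        proof -
          have fT: "finite T" using T psubset.hyps by (auto intro: finite_subset)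
          have "card S + card T = card (S \<union> T)" using T fS fT by (intro card_Un_disjoint[symmetric]) auto
          also have "\<dots> \<le> card (\<Union>x\<in>S \<union> T. N x)" using T S(1) by (intro hall) auto
          also have "(\<Union>x\<in>S \<union> T. N x) = NS \<union> (\<Union>x\<in>T. N' x)" by (auto simp: NS_def N'_def)
          also have "card \<dots> \<le> card NS + card (\<Union>x\<in>T. N' x)" by (rule card_Un_le)
          finally show ?thesis using S(3) by (simp add: NS_def)
        qed
      qed
      then obtain f2 where f2: "inj_on f2 (A - S)" "\<forall>x\<in>A - S. f2 x \<in> N' x" by blast
      define f where "f x = (if x \<in> S then f1 x else f2 x)" for x
      have cross: "f1 x \<noteq> f2 y" if "x \<in> S" "y \<in> A - S" for x y
        using f1(2) f2(2) that by (auto simp: N'_def NS_def)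
      have "inj_on f A"
      proof (rule inj_onI)
        fix x y assume xy: "x \<in> A" "y \<in> A" "f x = f y"
        show "x = y"
        proof (cases "x \<in> S"; cases "y \<in> S")
          assume "x \<in> S" "y \<in> S"
          then show ?thesis using xy f1(1) by (auto simp: f_def inj_on_def)
        next
          assume "x \<in> S" "y \<notin> S"
          then show ?thesis using xy cross[of x y] by (auto simp: f_def)
        next
          assume "x \<notin> S" "y \<in> S"
          then show ?thesis using xy cross[of y x] by (auto simp: f_def)
        next
          assume "x \<notin> S" "y \<notin> S"
          then show ?thesis using xy f2(1) by (auto simp: f_def inj_on_def)
        qed
      qed
      moreover have "\<forall>x\<in>A. f x \<in> N x" using f1(2) f2(2) by (auto simp: f_def N'_def)
      ultimately show ?thesis by blast
    qed
  qed simp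
qed

text \<open>A weak form of Stirling's formula, from
  \<open>(1 + 1 / s) ^ s \<le> exp 1 \<le> 3\<close>. It gives the usual binomial bound with 3 in
  place of Euler's number.\<close>

lemma power_self_le_fact: "(real s) ^ s \<le> 3 ^ s * fact s"
proof (induction s)
  case (Suc s)
  show ?case
  proof (cases "s = 0")
    case False
    have eq: "(real (Suc s)) ^ s = (real s) ^ s * (1 + 1 / real s) ^ s"
      using False by (simp add: power_mult_distrib[symmetric] field_simps)
    have "(1 + 1 / real s) ^ s \<le> exp (1 / real s) ^ s"
      by (intro power_mono exp_ge_add_one_self) simp
    also have "exp (1 / real s) ^ s = exp 1" using False by (simp add: exp_of_nat_mult[symmetric])
    also have "exp 1 \<le> (3::real)" by (rule exp_le)
    finally have "(1 + 1 / real s) ^ s \<le> 3" .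
    then have "(real s) ^ s * (1 + 1 / real s) ^ s \<le> (real s) ^ s * 3" by (rule mult_left_mono) simp
    then have "(real (Suc s)) ^ s \<le> (real s) ^ s * 3" using eq by simp
    also have "\<dots> \<le> (3 ^ s * fact s) * 3" using Suc.IH by simp
    finally have "real (Suc s) * (real (Suc s)) ^ s \<le> real (Suc s) * ((3 ^ s * fact s) * 3)"
      by (rule mult_left_mono) simp
    then show ?thesis by (simp add: mult_ac)
  qed simp
qed simp

lemma binomial_le_power:
  assumes "0 < s"
  shows "real (n choose s) \<le> (3 * real n / real s) ^ s"
proof -
  have "real (n choose s) * fact s \<le> real n ^ s"
    using binomial_fact_pow[of n s] by (metis of_nat_fact of_nat_le_iff of_nat_mult of_nat_power)
  then have "real (n choose s) * (3 ^ s * fact s) \<le> (3 * real n) ^ s"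
    by (simp add: power_mult_distrib mult_ac)
  moreover have "real (n choose s) * real s ^ s \<le> real (n choose s) * (3 ^ s * fact s)"
    by (intro mult_left_mono power_self_le_fact) simp
  ultimately have "real (n choose s) * real s ^ s \<le> (3 * real n) ^ s" by linarith
  then show ?thesis using assms by (simp add: power_divide pos_le_divide_eq)
qed

text \<open>Counting choice functions: a bad function maps some set of size \<open>s\<close> into a set of size \<open>s\<close>.\<close>

lemma expanding_functions:
  assumes L: "finite L" and R: "finite R" and card: "card L \<le> 2 * card R"
  shows "\<exists>g. (\<forall>x\<in>L. \<forall>i<22. g x i \<in> R) \<and>
    (\<forall>S\<subseteq>L. 5 * card S \<le> 4 * card R \<longrightarrow> card S \<le> card (\<Union>x\<in>S. g x ` {..<22::nat}))"
proof (cases "card R = 0")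
  case True
  then have "L = {}" using card L by simp
  then show ?thesis by auto
next
  case False
  define n where "n = card R"
  have n0: "0 < n" using False by (simp add: n_def)
  define \<Omega> where "\<Omega> = PiE L (\<lambda>_. PiE {..<22::nat} (\<lambda>_. R))"
  define Bad where "Bad S T = PiE L (\<lambda>x. PiE {..<22::nat} (\<lambda>_. if x \<in> S then T else R))" for S T
  \<comment> \<open>A set violating expansion has its image inside some \<open>T\<close> of exactly
    its own order, so pairs of equal cardinality suffice.\<close>
  define P where "P = {(S, T). S \<subseteq> L \<and> T \<subseteq> R \<and> card S = card T \<and> 0 < card S \<and> 5 * card S \<le> 4 * n}"
  have fP: "finite P" by (rule finite_subset[of _ "Pow L \<times> Pow R"]) (use L R in \<open>auto simp: P_def\<close>)
  have c\<Omega>: "real (card \<Omega>) = (real n ^ 22) ^ card L"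
    using L R by (simp add: \<Omega>_def card_PiE n_def)
  have cBad: "real (card (Bad S T)) = (real n ^ 22) ^ card L * (real (card S) / real n) ^ (22 * card S)" if ST: "(S, T) \<in> P" for S T
  proof -
    have S: "S \<subseteq> L" "T \<subseteq> R" "card S = card T" "finite S" using ST L by (auto simp: P_def intro: finite_subset)
    have "card (Bad S T) = (\<Prod>x\<in>L. card (if x \<in> S then T else R) ^ 22)"
      unfolding Bad_def using L by (simp add: card_PiE)
    also have "\<dots> = (\<Prod>x\<in>L - S. n ^ 22) * (\<Prod>x\<in>S. card S ^ 22)"
      by (subst prod.subset_diff[OF S(1) L]) (simp add: n_def S(3))
    also have "\<dots> = (n ^ 22) ^ (card L - card S) * (card S ^ 22) ^ card S"
      using S by (simp add: card_Diff_subset)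
    finally have "real (card (Bad S T)) = (real n ^ 22) ^ (card L - card S) * (real (card S) ^ 22) ^ card S" by simp
    moreover have "(real n ^ 22) ^ card L = (real n ^ 22) ^ (card L - card S) * (real n ^ 22) ^ card S"
      using card_mono[OF L S(1)] by (simp add: power_add[symmetric])
    moreover have "(real (card S) / real n) ^ (22 * card S) = (real (card S) ^ 22) ^ card S / (real n ^ 22) ^ card S"
      by (simp add: power_mult power_divide)
    ultimately show ?thesis using n0 by simp
  qed
  \<comment> \<open>With \<open>q = s / n\<close>, the two binomials and the probability combine to
    at most \<open>(18 * q ^ 20) ^ s\<close>. The 22 choices per vertex are what makes
    \<open>18 * (4 / 5) ^ 20\<close> less than \<open>1 / 4\<close>, so that the geometric series
    stays below 1.\<close>
  have summand: "real (card L choose s) * real (n choose s) * (real s / real n) ^ (22 * s) \<le> (1 / 4) ^ s"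
    if s: "0 < s" "5 * s \<le> 4 * n" for s
  proof -
    define q where "q = real s / real n"
    have q: "0 < q" "q \<le> 4 / 5" using s n0 by (auto simp: q_def field_simps)
    have "3 * real (card L) / real s \<le> 6 / q"
      using card s n0 by (simp add: q_def n_def divide_simps)
    then have "(3 * real (card L) / real s) ^ s \<le> (6 / q) ^ s" by (intro power_mono) auto
    then have "real (card L choose s) \<le> (6 / q) ^ s" using binomial_le_power[OF s(1), of "card L"] by linarith
    moreover have "real (n choose s) \<le> (3 / q) ^ s"
      using binomial_le_power[OF s(1), of n] by (simp add: q_def)
    ultimately have "real (card L choose s) * real (n choose s) * q ^ (22 * s) \<le> (6 / q) ^ s * (3 / q) ^ s * q ^ (22 * s)"
      using q by (intro mult_right_mono mult_mono) auto
    also have "\<dots> = (6 / q * (3 / q) * q ^ 22) ^ s" by (simp only: power_mult_distrib power_mult)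
    also have "6 / q * (3 / q) * q ^ 22 = 18 * q ^ 20"
    proof -
      have "q ^ 22 = q ^ 20 * (q * q)" using power_add[of q 20 2] by (simp add: power2_eq_square)
      then show ?thesis using q(1) by simp
    qed
    also have "(18 * q ^ 20) ^ s \<le> (1 / 4) ^ s"
    proof (rule power_mono)
      have "q ^ 20 \<le> (4 / 5) ^ 20" using q by (intro power_mono) auto
      also have "\<dots> \<le> (1 / 72 :: real)" by (simp add: power_divide)
      finally show "18 * q ^ 20 \<le> 1 / 4" by simp
    qed (use q in simp)
    finally show ?thesis by (simp add: q_def)
  qed
  have "\<not> \<Omega> \<subseteq> (\<Union>(S, T)\<in>P. Bad S T)"
  proof
    assume sub: "\<Omega> \<subseteq> (\<Union>(S, T)\<in>P. Bad S T)"
    have fBad: "finite (Bad S T)" if "(S, T) \<in> P" for S T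
      unfolding Bad_def using that L R by (intro finite_PiE) (auto simp: P_def intro: finite_subset)
    have "card \<Omega> \<le> card (\<Union>p\<in>P. Bad (fst p) (snd p))"
      using sub fP fBad by (intro card_mono) (auto simp: split_def)
    also have "\<dots> \<le> (\<Sum>p\<in>P. card (Bad (fst p) (snd p)))" by (rule card_UN_le[OF fP])
    finally have "real (card \<Omega>) \<le> (\<Sum>p\<in>P. real (card (Bad (fst p) (snd p))))"
      unfolding of_nat_sum[symmetric] of_nat_le_iff .
    also have "\<dots> = (\<Sum>p\<in>P. (real n ^ 22) ^ card L * (real (card (fst p)) / real n) ^ (22 * card (fst p)))"
      by (intro sum.cong refl cBad) simp
    also have "\<dots> = (real n ^ 22) ^ card L * (\<Sum>p\<in>P. (real (card (fst p)) / real n) ^ (22 * card (fst p)))"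
      by (simp add: sum_distrib_left)
    finally have ge1: "1 \<le> (\<Sum>p\<in>P. (real (card (fst p)) / real n) ^ (22 * card (fst p)))"
      using n0 unfolding c\<Omega> by simp
    define J where "J = {s. 0 < s \<and> 5 * s \<le> 4 * n}"
    have fJ: "finite J" by (rule finite_subset[of _ "{..n}"]) (auto simp: J_def)
    have img: "(\<lambda>p. card (fst p)) ` P \<subseteq> J" by (auto simp: P_def J_def)
    have "(\<Sum>p\<in>P. (real (card (fst p)) / real n) ^ (22 * card (fst p))) =
        (\<Sum>s\<in>J. \<Sum>p\<in>{p\<in>P. card (fst p) = s}. (real (card (fst p)) / real n) ^ (22 * card (fst p)))"
      by (rule sum.group[OF fP fJ img, symmetric])
    also have "\<dots> = (\<Sum>s\<in>J. real (card {p\<in>P. card (fst p) = s}) * (real s / real n) ^ (22 * s))"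
      by (intro sum.cong refl) simp
    also have "\<dots> \<le> (\<Sum>s\<in>J. (1 / 4) ^ s)"
    proof (intro sum_mono)
      fix s assume s: "s \<in> J"
      have "{p\<in>P. card (fst p) = s} = {S. S \<subseteq> L \<and> card S = s} \<times> {T. T \<subseteq> R \<and> card T = s}"
        using s by (auto simp: P_def J_def)
      then have "card {p\<in>P. card (fst p) = s} = (card L choose s) * (n choose s)"
        using L R by (simp add: card_cartesian_product n_subsets n_def)
      then show "real (card {p\<in>P. card (fst p) = s}) * (real s / real n) ^ (22 * s) \<le> (1 / 4) ^ s"
        using summand[of s] s by (simp add: J_def)
    qed
    also have "\<dots> \<le> (\<Sum>s\<in>{1..n}. (1 / 4) ^ s)"
      by (rule sum_mono2) (auto simp: J_def)
    also have "\<dots> < 1"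
    proof -
      have "(\<Sum>s\<in>{1..n}. (1 / 4 :: real) ^ s) = (\<Sum>s\<in>{..<n}. (1 / 4) ^ Suc s)"
        by (rule sum.reindex_bij_witness[of _ Suc "\<lambda>s. s - 1"]) auto
      also have "\<dots> = 1 / 4 * (\<Sum>s<n. (1 / 4) ^ s)" by (simp add: sum_distrib_left)
      also have "\<dots> = 1 / 4 * ((1 - (1 / 4) ^ n) / (1 - 1 / 4))" by (simp add: sum_gp_strict)
      also have "\<dots> = (1 - (1 / 4) ^ n) / 3" by simp
      also have "\<dots> < 1"
      proof -
        have gt: "(1 - x) / 3 < 1" if "0 < x" for x :: real using that by simp
        show ?thesis by (rule gt) simp
      qed
      finally show ?thesis .
    qed
    finally show False using ge1 by simp
  qed
  then obtain g where g: "g \<in> \<Omega>" "g \<notin> (\<Union>(S, T)\<in>P. Bad S T)" by blast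
  have gR: "g x i \<in> R" if "x \<in> L" "i < 22" for x i
    using g(1) that by (auto simp: \<Omega>_def PiE_def Pi_def)
  show ?thesis
  proof (intro exI[of _ g] conjI ballI allI impI)
    show "g x i \<in> R" if "x \<in> L" "i < 22" for x i using gR that .
    fix S assume S: "S \<subseteq> L" "5 * card S \<le> 4 * card R"
    show "card S \<le> card (\<Union>x\<in>S. g x ` {..<22::nat})"
    proof (rule ccontr)
      let ?N = "\<Union>x\<in>S. g x ` {..<22::nat}"
      assume neg: "\<not> ?thesis"
      have N: "?N \<subseteq> R" using gR S(1) by auto
      have "card S \<le> card R" using S(2) by simp
      then obtain T where T: "?N \<subseteq> T" "T \<subseteq> R" "card T = card S"
        using exists_subset_between[OF _ _ N R, of "card S"] neg by (metis nat_le_linear)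
      have "0 < card S" using neg by simp
      then have "(S, T) \<in> P" using S T by (simp add: P_def n_def)
      moreover have "g \<in> Bad S T"
        using g(1) T(1) unfolding Bad_def \<Omega>_def by (auto simp: PiE_def Pi_def extensional_def)
      ultimately show False using g(2) by blast
    qed
  qed
qed

text \<open>Small subsets of either side expand, so by Hall's theorem a perfect matching survives the
  deletion of any \<open>k\<close> vertices of \<open>X\<close>.\<close>

lemma resilient_template:
  fixes X :: "'a set" and Z :: "'b set"
  assumes fin: "finite X" "finite Y" "finite Z" and XY: "X \<inter> Y = {}"
    and x: "0 < card X" "k \<le> card X" and Y: "card Y = 2 * card X" and Z: "card Z + k = 3 * card X"
  obtains T where "T \<subseteq> (X \<union> Y) \<times> Z" "finite T" "card T \<le> 132 * card X"
    "\<And>X'. X' \<subseteq> X \<Longrightarrow> card X' + k = card X \<Longrightarrow> \<exists>f. bij_betw f (X' \<union> Y) Z \<and> (\<forall>v\<in>X' \<union> Y. (v, f v) \<in> T)"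
proof -
  have cXY: "card (X \<union> Y) = 3 * card X" using fin XY Y by (simp add: card_Un_disjoint)
  obtain g1 where g1: "\<And>v i. v \<in> X \<union> Y \<Longrightarrow> i < 22 \<Longrightarrow> g1 v i \<in> Z"
    "\<And>S. S \<subseteq> X \<union> Y \<Longrightarrow> 5 * card S \<le> 4 * card Z \<Longrightarrow> card S \<le> card (\<Union>v\<in>S. g1 v ` {..<22::nat})"
  proof -
    have "finite (X \<union> Y)" "card (X \<union> Y) \<le> 2 * card Z" using fin cXY x Z by auto
    from expanding_functions[OF this(1) fin(3) this(2)] show ?thesis using that by blast
  qed
  obtain g2 where g2: "\<And>z i. z \<in> Z \<Longrightarrow> i < 22 \<Longrightarrow> g2 z i \<in> Y"
    "\<And>S. S \<subseteq> Z \<Longrightarrow> 5 * card S \<le> 4 * card Y \<Longrightarrow> card S \<le> card (\<Union>z\<in>S. g2 z ` {..<22::nat})"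
  proof -
    have "card Z \<le> 2 * card Y" using x Y Z by linarith
    from expanding_functions[OF fin(3,2) this] show ?thesis using that by blast
  qed
  define T1 where "T1 = (\<lambda>(v, i). (v, g1 v i)) ` ((X \<union> Y) \<times> {..<22::nat})"
  define T2 where "T2 = (\<lambda>(z, i). (g2 z i, z)) ` (Z \<times> {..<22::nat})"
  define T where "T = T1 \<union> T2"
  \<comment> \<open>At most 22 choices for each of \<open>3 * card X\<close> vertices; the other
    side is no larger.\<close>
  have T1: "card T1 \<le> 66 * card X"
    unfolding T1_def using fin cXY by (intro order_trans[OF card_image_le]) (auto simp: card_cartesian_product)
  have T2: "card T2 \<le> 66 * card X"
    unfolding T2_def using fin Z by (intro order_trans[OF card_image_le]) (auto simp: card_cartesian_product)
  show ?thesis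
  proof (rule that[of T])
    show "T \<subseteq> (X \<union> Y) \<times> Z" using g1(1) g2(1) by (auto simp: T_def T1_def T2_def)
    show "finite T" using fin by (simp add: T_def T1_def T2_def)
    show "card T \<le> 132 * card X" unfolding T_def using card_Un_le[of T1 T2] T1 T2 by linarith
    fix X' assume X': "X' \<subseteq> X" "card X' + k = card X"
    define A where "A = X' \<union> Y"
    have fA: "finite A" using X'(1) fin by (auto simp: A_def intro: finite_subset)
    have "card A = card X' + card Y"
      unfolding A_def using X'(1) fin XY by (intro card_Un_disjoint) (auto intro: finite_subset)
    then have cA: "card A = card Z" using X'(2) Y Z by linarith
    define N where "N v = {z\<in>Z. (v, z) \<in> T}" for v
    have "\<exists>f. inj_on f A \<and> (\<forall>v\<in>A. f v \<in> N v)"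
    proof (rule hall_marriage[OF fA])
      show "finite (N v)" for v using fin by (simp add: N_def)
      fix S assume S: "S \<subseteq> A"
      have SXY: "S \<subseteq> X \<union> Y" using S X'(1) by (auto simp: A_def)
      have fS: "finite S" using S fA by (rule finite_subset)
      let ?NS = "\<Union>v\<in>S. N v"
      have NZ: "?NS \<subseteq> Z" by (auto simp: N_def)
      have fNS: "finite ?NS" using NZ fin(3) by (rule finite_subset)
      show "card S \<le> card ?NS"
      proof (cases "5 * card S \<le> 4 * card Z")
        case True
        have "(\<Union>v\<in>S. g1 v ` {..<22::nat}) \<subseteq> ?NS"
          using g1(1) SXY by (force simp: N_def T_def T1_def)
        then have "card (\<Union>v\<in>S. g1 v ` {..<22::nat}) \<le> card ?NS" by (rule card_mono[OF fNS])
        then show ?thesis using g1(2)[OF SXY True] by linarith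
      next
        case False
        show ?thesis
        proof (rule ccontr)
          assume neg: "\<not> ?thesis"
          have SA: "card S \<le> card Z" using card_mono[OF fA S] cA by simp
          have "card (Z - ?NS) = card Z - card ?NS" using NZ fNS by (rule card_Diff_subset[rotated])
          then have "card Z - card S + 1 \<le> card (Z - ?NS)" using neg SA by linarith
          \<comment> \<open>A Hall violator with more than four fifths of \<open>card Z\<close>
            vertices is refuted from the other side: \<open>W\<close> consists of vertices of
            \<open>Z\<close> not reached from \<open>S\<close>, so its neighbours lie in
            \<open>A - S\<close>, which is one vertex too few for the expansion of
            \<open>W\<close>.\<close>
          then obtain W where W: "W \<subseteq> Z - ?NS" "card W = card Z - card S + 1"
            by (metis obtain_subset_with_card_n)
          have "5 * card W \<le> 4 * card Y" using W(2) False Y Z x SA by linarith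
          then have "card W \<le> card (\<Union>z\<in>W. g2 z ` {..<22::nat})" using g2(2)[of W] W(1) by blast
          also have "\<dots> \<le> card (A - S)"
          proof (rule card_mono)
            show "finite (A - S)" using fA by simp
            show "(\<Union>z\<in>W. g2 z ` {..<22::nat}) \<subseteq> A - S"
            proof
              fix y assume "y \<in> (\<Union>z\<in>W. g2 z ` {..<22::nat})"
              then obtain z i where zi: "z \<in> W" "i < 22" "y = g2 z i" by auto
              then have zZ: "z \<in> Z" "z \<notin> ?NS" using W(1) by auto
              have "(y, z) \<in> T" using zi zZ by (force simp: T_def T2_def)
              then have "y \<notin> S" using zZ by (auto simp: N_def)
              then show "y \<in> A - S" using g2(1)[OF zZ(1) zi(2)] zi(3) by (simp add: A_def)
            qed
          qed
          also have "\<dots> = card Z - card S" using S fS cA by (simp add: card_Diff_subset)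
          finally show False using W(2) by simp
        qed
      qed
    qed
    then obtain f where f: "inj_on f A" "\<forall>v\<in>A. f v \<in> N v" by blast
    have "f ` A \<subseteq> Z" using f(2) by (auto simp: N_def)
    moreover have "card (f ` A) = card Z" using card_image[OF f(1)] cA by simp
    ultimately have "f ` A = Z" using card_subset_eq[OF fin(3)] by blast
    then show "\<exists>f. bij_betw f (X' \<union> Y) Z \<and> (\<forall>v\<in>X' \<union> Y. (v, f v) \<in> T)"
      using f unfolding A_def bij_betw_def N_def by (intro exI[of _ f]) auto
  qed
qed

section \<open>Random subsets\<close>

text \<open>Every vertex of \<open>C\<close> is kept independently with probability
  \<open>\<theta>\<close>. The trace on each \<open>A\<close> is binomial, Hoeffding's inequality
  bounds its deviation, and a union bound over \<open>\<F>\<close> leaves positive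
  probability.\<close>

lemma random_subset:
  fixes C :: "'a set" and \<theta> \<gamma> n :: real
  assumes C: "finite C" "real (card C) \<le> n" and \<theta>: "0 \<le> \<theta>" "\<theta> \<le> 1" and \<gamma>: "0 < \<gamma>" and n: "0 < n"
    and F: "finite \<F>" "\<F> \<subseteq> Pow C" and small: "real (card \<F>) * (2 * exp (- 2 * \<gamma>\<^sup>2 * n)) < 1"
  shows "\<exists>X\<subseteq>C. \<forall>A\<in>\<F>. \<bar>real (card (A \<inter> X)) - \<theta> * card A\<bar> < \<gamma> * n"
proof -
  define M where "M = Pi_pmf C False (\<lambda>_. bernoulli_pmf \<theta>)"
  define bad where "bad A = {f. \<gamma> * n \<le> \<bar>real (card {x\<in>A. f x}) - \<theta> * card A\<bar>}" for A :: "'a set"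
  have bad: "measure_pmf.prob M (bad A) \<le> 2 * exp (- 2 * \<gamma>\<^sup>2 * n)" if A: "A \<in> \<F>" for A
  proof (cases "card A = 0")
    case True
    have fA: "finite A" using A F(2) C(1) by (auto intro: finite_subset)
    then have "bad A = {}" using True \<gamma> n by (auto simp: bad_def not_le)
    then show ?thesis by simp
  next
    case False
    interpret binomial_distribution "card A" \<theta> by unfold_locales (use \<theta> in auto)
    have AC: "A \<subseteq> C" using A F(2) by blast
    have fA: "finite A" using AC C(1) by (rule finite_subset)
    have "binomial_pmf (card A) \<theta> = map_pmf (\<lambda>f. card {x\<in>A. f x}) (Pi_pmf A False (\<lambda>_. bernoulli_pmf \<theta>))"
      by (rule binomial_pmf_altdef'[OF fA refl]) (use \<theta> in simp)
    also have "\<dots> = map_pmf (\<lambda>f. card {x\<in>A. f x}) M"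
      unfolding M_def Pi_pmf_subset[OF C(1) AC] map_pmf_comp by (intro map_pmf_cong refl arg_cong[of _ _ card]) auto
    finally have eq: "binomial_pmf (card A) \<theta> = map_pmf (\<lambda>f. card {x\<in>A. f x}) M" .
    have "measure_pmf.prob M (bad A) = measure_pmf.prob (binomial_pmf (card A) \<theta>) {x. \<bar>real x - card A * \<theta>\<bar> \<ge> \<gamma> * n}"
      unfolding eq by (simp add: bad_def vimage_def mult.commute)
    also have "\<dots> \<le> 2 * exp (- 2 * (\<gamma> * n)\<^sup>2 / card A)"
      using prob_abs_ge[of "\<gamma> * n"] False \<gamma> n by simp
    also have "\<dots> \<le> 2 * exp (- 2 * \<gamma>\<^sup>2 * n)"
    proof -
      have cA: "real (card A) \<le> n" using card_mono[OF C(1) AC] C(2) by linarith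
      have "2 * \<gamma>\<^sup>2 * n * card A \<le> 2 * \<gamma>\<^sup>2 * n * n" using cA n by (intro mult_left_mono) auto
      then have "2 * \<gamma>\<^sup>2 * n \<le> 2 * (\<gamma> * n)\<^sup>2 / card A"
        using False by (simp add: pos_le_divide_eq power_mult_distrib power2_eq_square mult_ac)
      then show ?thesis by simp
    qed
    finally show ?thesis .
  qed
  have "measure_pmf.prob M (\<Union>A\<in>\<F>. bad A) \<le> (\<Sum>A\<in>\<F>. measure_pmf.prob M (bad A))"
    by (rule measure_pmf.finite_measure_subadditive_finite[OF F(1)]) simp
  also have "\<dots> \<le> (\<Sum>A\<in>\<F>. 2 * exp (- 2 * \<gamma>\<^sup>2 * n))" by (rule sum_mono[OF bad])
  also have "\<dots> < 1" using small by simp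
  finally have "(\<Union>A\<in>\<F>. bad A) \<noteq> UNIV" by (metis less_irrefl measure_pmf_UNIV)
  then obtain f where f: "f \<notin> (\<Union>A\<in>\<F>. bad A)" by blast
  show ?thesis
  proof (intro exI[of _ "{x\<in>C. f x}"] conjI ballI)
    fix A assume A: "A \<in> \<F>"
    then have "A \<inter> {x\<in>C. f x} = {x\<in>A. f x}" using F(2) by auto
    then show "\<bar>real (card (A \<inter> {x\<in>C. f x})) - \<theta> * card A\<bar> < \<gamma> * n"
      using f A by (auto simp: bad_def not_le)
  qed auto
qed

section \<open>Absorption\<close>

lemma simple_graph_induced: "simple_graph V E \<Longrightarrow> W \<subseteq> V \<Longrightarrow> simple_graph W (induced_edges E W)"
  unfolding simple_graph_def induced_edges_def by (auto intro: finite_subset)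

text \<open>The excess \<open>\<mu>\<close> pays for two separate matters: the neighbourhood of
  \<open>v\<close> may lose \<open>\<mu> * card X\<close> vertices to \<open>F\<close> and still be
  large enough for \<open>dense_neighbourhood\<close>, while the degrees of the vertices inside it
  keep their excess and give density \<open>\<rho> + \<mu>\<close>.\<close>

lemma clique_avoiding:
  fixes l s :: nat and \<mu> :: real
  assumes l: "0 < l" and \<mu>: "0 < \<mu>"
  shows "\<exists>\<epsilon>>0. \<forall>(V :: nat set) E X F v. simple_graph V E \<longrightarrow> X \<subseteq> V \<longrightarrow> X \<noteq> {} \<longrightarrow>
    K_dense l V E (\<epsilon> * real (card X)) \<longrightarrow>
    (\<forall>u\<in>insert v X. (1 / (2 - RT_density l s) + \<mu>) * real (card X) \<le> real (card (nb E u \<inter> X))) \<longrightarrow>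
    real (card (X \<inter> F)) \<le> \<mu> * real (card X) \<longrightarrow> (\<exists>S\<subseteq>nb E v \<inter> X - F. is_K s E S)"
proof -
  define \<rho> where "\<rho> = RT_density l s"
  have \<rho>: "0 \<le> \<rho>" "\<rho> \<le> 1" using RT_density_bounds[OF l, of s] by (auto simp: \<rho>_def)
  define \<delta> where "\<delta> = 1 / (2 - \<rho>)"
  have \<delta>: "1 / 2 \<le> \<delta>" using \<rho> by (simp add: \<delta>_def divide_simps)
  obtain \<epsilon>0 where \<epsilon>0: "0 < \<epsilon>0" and W: "\<forall>(V :: nat set) E w. simple_graph V E \<longrightarrow> 0 < (\<Sum>v\<in>V. w v) \<longrightarrow>
       (\<forall>U\<subseteq>V. K_free l U E \<longrightarrow> real (\<Sum>v\<in>U. w v) \<le> \<epsilon>0 * real (\<Sum>v\<in>V. w v)) \<longrightarrow>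
       (RT_density l s + \<mu>) * (real (\<Sum>v\<in>V. w v))\<^sup>2 \<le>
          (\<Sum>u\<in>V. \<Sum>v\<in>V. of_bool ({u, v} \<in> E) * real (w u) * real (w v)) \<longrightarrow>
       (\<exists>S\<subseteq>V. is_K s E S)"
    using weighted_clique_exists[OF l \<mu>, of s] by (elim exE conjE) (rule that)
  show ?thesis
  \<comment> \<open>\<open>Y\<close> has at least half of the vertices of \<open>X\<close>, which
    costs the factor 2.\<close>
  proof (intro exI[of _ "\<epsilon>0 / 2"] conjI allI impI)
    show "0 < \<epsilon>0 / 2" using \<epsilon>0 by simp
    fix V :: "nat set" and E X F v
    assume G: "simple_graph V E" and X: "X \<subseteq> V" "X \<noteq> {}" and D: "K_dense l V E (\<epsilon>0 / 2 * real (card X))"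
      and deg0: "\<forall>u\<in>insert v X. (1 / (2 - RT_density l s) + \<mu>) * real (card X) \<le> real (card (nb E u \<inter> X))"
      and F: "real (card (X \<inter> F)) \<le> \<mu> * real (card X)"
    define x where "x = real (card X)"
    have fX: "finite X" using X(1) G by (auto simp: simple_graph_def intro: finite_subset)
    have x0: "0 < x" using fX X(2) by (simp add: x_def card_gt_0_iff)
    have deg: "(\<delta> + \<mu>) * x \<le> real (card (nb E u \<inter> X))" if "u \<in> insert v X" for u
      using deg0[rule_format, OF that] by (simp add: \<delta>_def \<rho>_def x_def)
    define Y where "Y = nb E v \<inter> X - F"
    have YX: "Y \<subseteq> X" by (auto simp: Y_def)
    have YV: "Y \<subseteq> V" using YX X(1) by blast
    have fY: "finite Y" using YX fX by (rule finite_subset)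
    have "card (nb E v \<inter> X) \<le> card (Y \<union> X \<inter> F)" using fY fX by (intro card_mono) (auto simp: Y_def)
    then have "card (nb E v \<inter> X) \<le> card Y + card (X \<inter> F)" using card_Un_le[of Y "X \<inter> F"] by linarith
    then have Yx: "\<delta> * x \<le> real (card Y)" using deg[of v] F by (simp add: x_def distrib_right)
    have degY: "real (card Y) - (1 - \<delta> - \<mu>) * x \<le> real (card (nb E u \<inter> Y))" if u: "u \<in> Y" for u
    proof -
      have "card Y + card (nb E u \<inter> X) = card (Y \<union> nb E u \<inter> X) + card (Y \<inter> (nb E u \<inter> X))"
        using fY fX by (intro card_Un_Int) auto
      moreover have "card (Y \<union> nb E u \<inter> X) \<le> card X" using YX fX by (intro card_mono) auto
      moreover have "Y \<inter> (nb E u \<inter> X) = nb E u \<inter> Y" using YX by auto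
      ultimately have "real (card Y) + real (card (nb E u \<inter> X)) \<le> x + real (card (nb E u \<inter> Y))"
        by (simp add: x_def flip: of_nat_add)
      then show ?thesis using deg[of u] u YX by (auto simp: algebra_simps)
    qed
    have "0 < \<delta> * x" using \<delta> x0 by simp
    then have Y0: "0 < real (card Y)" using Yx by linarith
    then obtain u where u: "u \<in> Y" by fastforce
    have "card (nb E u \<inter> Y) \<le> card Y" using fY by (intro card_mono) auto
    then have "0 \<le> (1 - \<delta> - \<mu>) * x" using degY[OF u] by linarith
    then have le1: "\<delta> + \<mu> \<le> 1" using x0 by (simp add: zero_le_mult_iff)
    have "(\<rho> + \<mu>) * (real (card Y))\<^sup>2 \<le> ee E Y Y"
      by (rule dense_neighbourhood[OF \<rho>, where m = x]) (use \<mu> le1 fY Yx x0 degY in \<open>auto simp: \<delta>_def\<close>)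
    also have "ee E Y Y = (\<Sum>u\<in>Y. \<Sum>v\<in>Y. of_bool ({u, v} \<in> induced_edges E Y) * real 1 * real 1)"
      unfolding ee_def by (intro sum.cong refl) (simp add: induced_edges_def)
    finally have den: "(RT_density l s + \<mu>) * (real (\<Sum>v\<in>Y. 1))\<^sup>2 \<le> \<dots>" by (simp add: \<rho>_def)
    have small: "\<forall>U\<subseteq>Y. K_free l U (induced_edges E Y) \<longrightarrow> real (\<Sum>v\<in>U. 1) \<le> \<epsilon>0 * real (\<Sum>v\<in>Y. 1)"
    proof (intro allI impI, rule ccontr)
      fix U assume U: "U \<subseteq> Y" "K_free l U (induced_edges E Y)" "\<not> real (\<Sum>v\<in>U. 1) \<le> \<epsilon>0 * real (\<Sum>v\<in>Y. 1)"
      have "1 / 2 * x \<le> \<delta> * x" using \<delta> x0 by (intro mult_right_mono) auto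
      then have "\<epsilon>0 * (1 / 2 * x) \<le> \<epsilon>0 * real (card Y)" using Yx \<epsilon>0 by (intro mult_left_mono) auto
      then have "\<epsilon>0 / 2 * real (card X) \<le> real (card U)" using U(3) by (simp add: x_def)
      then obtain S where "S \<subseteq> U" "is_K l E S" using K_dense_obtain[OF D] U(1) YV by (metis subset_trans)
      then show False using U(1,2) is_K_induced[of S Y l E] unfolding K_free_def by blast
    qed
    have pos: "0 < (\<Sum>v\<in>Y. 1 :: nat)" using Y0 by simp
    obtain S where S: "S \<subseteq> Y" "is_K s (induced_edges E Y) S"
      using W[rule_format, OF simple_graph_induced[OF G YV] pos small[rule_format] den] by blast
    then show "\<exists>S\<subseteq>nb E v \<inter> X - F. is_K s E S"
      using is_K_induced[OF S(1), of s E] unfolding Y_def by blast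
  qed
qed

text \<open>Sets are picked one after the other, each avoiding \<open>F\<close> and all earlier
  choices; the budget \<open>q\<close> covers all of them together.\<close>

lemma greedy_disjoint_sets:
  fixes q :: real
  assumes "finite T"
    and step: "\<And>t G. t \<in> T \<Longrightarrow> finite G \<Longrightarrow> real (card G) \<le> q \<Longrightarrow>
      \<exists>A. finite A \<and> card A \<le> p \<and> A \<inter> G = {} \<and> P t A"
    and F: "finite F" "real (card F) + real (card T * p) \<le> q"
  shows "\<exists>A. (\<forall>t\<in>T. finite (A t) \<and> card (A t) \<le> p \<and> A t \<inter> F = {} \<and> P t (A t)) \<and>
    (\<forall>s\<in>T. \<forall>t\<in>T. s \<noteq> t \<longrightarrow> A s \<inter> A t = {})"
  using assms
proof (induction T arbitrary: F rule: finite_induct)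
  case (insert t T)
  have ct: "card (insert t T) * p = card T * p + p" using insert.hyps by simp
  have "real (card F) \<le> q"
    using insert.prems(3) of_nat_0_le_iff[of "card (insert t T) * p"] by linarith
  then have "\<exists>A. finite A \<and> card A \<le> p \<and> A \<inter> F = {} \<and> P t A"
    using insert.prems(2) by (intro insert.prems(1)) simp_all
  then obtain A where A: "finite A" "card A \<le> p" "A \<inter> F = {}" "P t A" by blast
  have "real (card (F \<union> A)) + real (card T * p) \<le> q"
    using card_Un_le[of F A] A(2) insert.prems(3) unfolding ct by linarith
  moreover have "finite (F \<union> A)" using A(1) insert.prems(2) by simp
  ultimately have "\<exists>B. (\<forall>t\<in>T. finite (B t) \<and> card (B t) \<le> p \<and> B t \<inter> (F \<union> A) = {} \<and> P t (B t)) \<and>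
      (\<forall>s\<in>T. \<forall>t\<in>T. s \<noteq> t \<longrightarrow> B s \<inter> B t = {})"
    using insert.prems(1) by (intro insert.IH) simp_all
  then obtain B where B: "\<forall>t\<in>T. finite (B t) \<and> card (B t) \<le> p \<and> B t \<inter> (F \<union> A) = {} \<and> P t (B t)"
      "\<forall>s\<in>T. \<forall>t\<in>T. s \<noteq> t \<longrightarrow> B s \<inter> B t = {}"
    by (elim exE conjE) (rule that)
  define B' where "B' = B(t := A)"
  have B': "B' t = A" "\<And>s. s \<in> T \<Longrightarrow> B' s = B s" using insert.hyps(2) by (auto simp: B'_def)
  have "finite (B' s) \<and> card (B' s) \<le> p \<and> B' s \<inter> F = {} \<and> P s (B' s)" if "s \<in> insert t T" for s
    using that A B(1) B' by (cases "s = t") auto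
  moreover have "B' s \<inter> B' s' = {}" if s: "s \<in> insert t T" "s' \<in> insert t T" "s \<noteq> s'" for s s'
  proof (cases "s = t \<or> s' = t")
    case True
    then consider "s = t" "s' \<in> T" | "s' = t" "s \<in> T" using s by blast
    then show ?thesis
    proof cases
      case 1
      then show ?thesis using B(1)[rule_format, of s'] B' by auto
    next
      case 2
      then show ?thesis using B(1)[rule_format, of s] B' by auto
    qed
  next
    case False
    then show ?thesis using B(2) B' s by auto
  qed
  ultimately show ?case by blast
qed simp

text \<open>\<open>A\<close> consists of a spare clique \<open>W\<close> and a connector
  \<open>D\<close> exchanging \<open>S\<close> for \<open>W\<close>: without \<open>S\<close> it is
  tiled as \<open>W \<union> D\<close>, with \<open>S\<close> as \<open>S \<union> D\<close>
  together with the clique \<open>W\<close>.\<close>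

lemma set_absorber:
  fixes b \<phi> :: real
  assumes CV: "C \<subseteq> V" and closed: "\<And>x y. x \<in> C \<Longrightarrow> y \<in> C \<Longrightarrow> x \<noteq> y \<Longrightarrow> reach r V E b c x y"
    and cliques: "\<And>F. finite F \<Longrightarrow> real (card F) \<le> \<phi> \<Longrightarrow> \<exists>W\<subseteq>C - F. is_K r E W"
    and S: "S \<subseteq> C" "finite S" "card S = r"
    and F: "finite F" "real (card F) + 2 * real r + real (r * c) \<le> b" "real (card F) + real r \<le> \<phi>"
  shows "\<exists>A. finite A \<and> card A \<le> r * c + r \<and> A \<inter> F = {} \<and> (A \<subseteq> V - S \<and> factorable r E A \<and> factorable r E (A \<union> S))"
proof -
  have "real (card (F \<union> S)) \<le> \<phi>" using card_Un_le[of F S] F(3) S(3) by linarith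
  then obtain W where W: "W \<subseteq> C - (F \<union> S)" "is_K r E W" using cliques[of "F \<union> S"] F(1) S(2) by blast
  have fW: "finite W" "card W = r" using W(2) by (auto simp: is_K_def)
  obtain h where h: "bij_betw h S W" using finite_same_card_bij[OF S(2) fW(1)] S(3) fW(2) by auto
  have hW: "h ` S = W" "inj_on h S" using h by (auto simp: bij_betw_def)
  have "\<exists>D\<subseteq>V - F. finite D \<and> card D \<le> card S * c \<and> D \<inter> (S \<union> h ` S) = {} \<and>
     factorable r E (S \<union> D) \<and> factorable r E (h ` S \<union> D)"
  proof (rule reach_sets[OF S(2) _ hW(2) _ F(1)])
    show "reach r V E b c x (h x)" if "x \<in> S" for x
      using that S(1) W(1) hW(1) by (intro closed) auto
    show "S \<inter> h ` S = {}" using W(1) hW(1) by auto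
    show "real (card F) + real (2 * card S) + real (card S * c) \<le> b" using F(2) S(3) by simp
  qed
  then obtain D where D: "D \<subseteq> V - F" "finite D" "card D \<le> r * c" "D \<inter> (S \<union> W) = {}"
    "factorable r E (S \<union> D)" "factorable r E (W \<union> D)"
    using S(3) hW(1) by auto
  have "factorable r E ((S \<union> D) \<union> W)"
    by (rule factorable_Un[OF D(5) factorable_is_K[OF W(2)]]) (use D(4) W(1) in auto)
  moreover have "(S \<union> D) \<union> W = W \<union> D \<union> S" by auto
  moreover have "card (W \<union> D) \<le> r * c + r" using card_Un_le[of W D] D(3) fW(2) by linarith
  moreover have "W \<union> D \<subseteq> V - S" "(W \<union> D) \<inter> F = {}" using D(1,4) W(1) CV by auto
  ultimately show ?thesis using D fW by (intro exI[of _ "W \<union> D"]) auto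
qed

text \<open>The template assigns to every set of surviving vertices of \<open>X\<close>, together with \<open>Y\<close>, a
  perfect matching to the \<open>(r-1)\<close>-sets; each edge of it carries an absorber for the \<open>r\<close>-set it
  spans, which is used exactly when the edge belongs to the matching.\<close>

lemma absorbing_set:
  fixes V :: "nat set" and b \<phi> :: real
  assumes fV: "finite V" and r: "0 < r" and CV: "C \<subseteq> V"
    and closed: "\<And>x y. x \<in> C \<Longrightarrow> y \<in> C \<Longrightarrow> x \<noteq> y \<Longrightarrow> reach r V E b c x y"
    and cliques: "\<And>F. finite F \<Longrightarrow> real (card F) \<le> \<phi> \<Longrightarrow> \<exists>W\<subseteq>C - F. is_K r E W"
    and X: "X \<subseteq> C" "0 < card X" "k \<le> card X"
    and q: "real (140 * card X * (r * c + r)) \<le> b" "real (140 * card X * (r * c + r)) \<le> \<phi>"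
  shows "\<exists>A\<subseteq>V - X. card A \<le> 140 * card X * (r * c + r) \<and>
    (\<forall>X'\<subseteq>X. card X' + k = card X \<longrightarrow> factorable r E (A \<union> X'))"
proof -
  define x where "x = card X"
  define p where "p = r * c + r"
  have rp: "r \<le> p" by (simp add: p_def)
  have fC: "finite C" using CV fV by (rule finite_subset)
  have fX: "finite X" using X(1) fC by (rule finite_subset)
  have x0: "0 < x" using X(2) by (simp add: x_def)
  have xp: "x * r \<le> x * p" "x \<le> x * p" "p \<le> x * p"
    using rp x0 r by auto
  \<comment> \<open>The constant 140 dominates the \<open>3 * x * r\<close> vertices of the template
    plus an absorber of \<open>p\<close> vertices for each of \<open>132 * x\<close> template edges,
    with room for the connectors.\<close>
  have b: "real (140 * (x * p)) \<le> b" and \<phi>: "real (140 * (x * p)) \<le> \<phi>"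
    using q by (simp_all add: x_def p_def mult.assoc)
  \<comment> \<open>Otherwise \<open>C\<close> itself would be an admissible forbidden set, leaving
    no room for a clique.\<close>
  have "3 * x \<le> card C"
  proof (rule ccontr)
    assume "\<not> ?thesis"
    then have "card C \<le> 140 * (x * p)" using xp(2) by linarith
    then have "real (card C) \<le> \<phi>" using \<phi> by (metis of_nat_le_iff order_trans)
    then obtain W where "W \<subseteq> C - C" "is_K r E W" using cliques[OF fC] by blast
    then show False using r by (auto simp: is_K_def)
  qed
  then have "2 * x \<le> card (C - X)" using X(1) fX by (simp add: card_Diff_subset x_def)
  then obtain Y where Y: "Y \<subseteq> C - X" "card Y = 2 * x" by (metis obtain_subset_with_card_n)
  have fY: "finite Y" using Y(1) fC by (auto intro: finite_subset)
  \<comment> \<open>The number of vertices to be matched: \<open>card X - k\<close> from a surviving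
    set \<open>X'\<close> and \<open>2 * card X\<close> from \<open>Y\<close>.\<close>
  define m where "m = 3 * x - k"
  have m: "m \<le> 3 * x" by (simp add: m_def)
  \<comment> \<open>The cliques serve here as a supply of fresh vertices of
    \<open>C\<close>.\<close>
  have "\<exists>Z. (\<forall>i\<in>{..<m}. finite (Z i) \<and> card (Z i) \<le> r \<and> Z i \<inter> (X \<union> Y) = {} \<and> (Z i \<subseteq> C \<and> card (Z i) = r - 1)) \<and>
    (\<forall>i\<in>{..<m}. \<forall>j\<in>{..<m}. i \<noteq> j \<longrightarrow> Z i \<inter> Z j = {})"
  proof (rule greedy_disjoint_sets)
    fix G :: "nat set" assume "finite G" "real (card G) \<le> \<phi>"
    then obtain W where W: "W \<subseteq> C - G" "is_K r E W" using cliques by blast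
    obtain W' where "W' \<subseteq> W" "is_K (r - 1) E W'" using is_K_obtain[OF W(2), of "r - 1"] by auto
    then show "\<exists>A. finite A \<and> card A \<le> r \<and> A \<inter> G = {} \<and> (A \<subseteq> C \<and> card A = r - 1)"
      using W(1) by (intro exI[of _ W']) (auto simp: is_K_def)
  next
    have "card (X \<union> Y) + card {..<m} * r \<le> 3 * x + 3 * x * r"
      using card_Un_le[of X Y] Y(2) m by (intro add_mono mult_le_mono) (auto simp: x_def)
    also have "\<dots> \<le> 140 * (x * p)" unfolding mult.assoc using xp by linarith
    finally have "real (card (X \<union> Y) + card {..<m} * r) \<le> real (140 * (x * p))" by (simp only: of_nat_le_iff)
    from order_trans[OF this \<phi>] show "real (card (X \<union> Y)) + real (card {..<m} * r) \<le> \<phi>"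
      by (simp only: of_nat_add)
  qed (use fX fY in auto)
  then obtain Z where Z0: "\<forall>i\<in>{..<m}. finite (Z i) \<and> card (Z i) \<le> r \<and> Z i \<inter> (X \<union> Y) = {} \<and>
        (Z i \<subseteq> C \<and> card (Z i) = r - 1)"
      and Zd0: "\<forall>i\<in>{..<m}. \<forall>j\<in>{..<m}. i \<noteq> j \<longrightarrow> Z i \<inter> Z j = {}"
    by (elim exE conjE) (rule that)
  have Z: "finite (Z i)" "Z i \<inter> (X \<union> Y) = {}" "Z i \<subseteq> C" "card (Z i) = r - 1" if "i < m" for i
    using Z0[rule_format, of i] that by simp_all
  have Zd: "Z i \<inter> Z j = {}" if "i < m" "j < m" "i \<noteq> j" for i j
    using Zd0 that by simp
  have "card {..<m} + k = 3 * card X" using X(3) by (simp add: m_def x_def)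
  moreover have "X \<inter> Y = {}" using Y(1) by blast
  ultimately obtain T where T: "T \<subseteq> (X \<union> Y) \<times> {..<m}" "finite T" "card T \<le> 132 * card X"
    "\<And>X'. X' \<subseteq> X \<Longrightarrow> card X' + k = card X \<Longrightarrow>
        \<exists>f. bij_betw f (X' \<union> Y) {..<m} \<and> (\<forall>v\<in>X' \<union> Y. (v, f v) \<in> T)"
    using resilient_template[of X Y "{..<m}" k] fX fY X(2,3) Y(2) unfolding x_def by (metis finite_lessThan)
  define S where "S t = insert (fst t) (Z (snd t))" for t
  define H where "H = X \<union> Y \<union> (\<Union>i<m. Z i)"
  have fH: "finite H" using fX fY Z(1) by (auto simp: H_def)
  have cH: "card H \<le> 3 * x * r"
  proof -
    have "card (\<Union>i<m. Z i) \<le> (\<Sum>i<m. card (Z i))" by (rule card_UN_le) simp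
    also have "\<dots> = m * (r - 1)" using Z(4) by simp
    also have "\<dots> \<le> 3 * x * (r - 1)" using m by (rule mult_le_mono1)
    finally have "card H \<le> x + 2 * x + 3 * x * (r - 1)"
      unfolding H_def using card_Un_le[of "X \<union> Y" "\<Union>i<m. Z i"] card_Un_le[of X Y] Y(2) by (simp add: x_def)
    also have "\<dots> = 3 * x * r" using r by (cases r) auto
    finally show ?thesis .
  qed
  have S: "S t \<subseteq> C" "finite (S t)" "card (S t) = r" "S t \<subseteq> H" if t: "t \<in> T" for t
  proof -
    have t1: "fst t \<in> X \<union> Y" "snd t < m" using t T(1) by auto
    then show "S t \<subseteq> C" "finite (S t)" "S t \<subseteq> H" using X(1) Y(1) Z(1,3) by (auto simp: S_def H_def)
    have "fst t \<notin> Z (snd t)" using t1 Z(2)[of "snd t"] by blast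
    then show "card (S t) = r" using Z(1,4)[OF t1(2)] r by (simp add: S_def)
  qed
  have "\<exists>B. (\<forall>t\<in>T. finite (B t) \<and> card (B t) \<le> p \<and> B t \<inter> H = {} \<and>
      (B t \<subseteq> V - S t \<and> factorable r E (B t) \<and> factorable r E (B t \<union> S t))) \<and>
    (\<forall>s\<in>T. \<forall>t\<in>T. s \<noteq> t \<longrightarrow> B s \<inter> B t = {})"
  proof (rule greedy_disjoint_sets[OF T(2), where q = "real (135 * (x * p))"])
    fix t and G :: "nat set" assume t: "t \<in> T" and G: "finite G" "real (card G) \<le> real (135 * (x * p))"
    have "real (2 * r + r * c) \<le> real (2 * (x * p))" using xp(3) unfolding of_nat_le_iff p_def by linarith
    then have rc: "2 * real r + real (r * c) \<le> real (2 * (x * p))" by simp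
    show "\<exists>A. finite A \<and> card A \<le> p \<and> A \<inter> G = {} \<and> (A \<subseteq> V - S t \<and> factorable r E A \<and> factorable r E (A \<union> S t))"
      unfolding p_def
    proof (rule set_absorber[OF CV closed cliques S(1-3)[OF t] G(1)])
      have q: "real (135 * (x * p)) + real (2 * (x * p)) \<le> real (140 * (x * p))"
        unfolding of_nat_add[symmetric] of_nat_le_iff by linarith
      show "real (card G) + 2 * real r + real (r * c) \<le> b" using G(2) rc b q by linarith
      have "0 \<le> real (r * c)" by simp
      then show "real (card G) + real r \<le> \<phi>" using G(2) rc \<phi> q by linarith
    qed
  next
    have "card H + card T * p \<le> 3 * x * r + 132 * x * p"
      using cH T(3) by (intro add_mono mult_le_mono1) (auto simp: x_def)
    also have "\<dots> \<le> 135 * (x * p)" using xp(1) by (simp add: mult.assoc)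
    finally show "real (card H) + real (card T * p) \<le> real (135 * (x * p))"
      unfolding of_nat_add[symmetric] of_nat_le_iff .
  qed (rule fH)
  then obtain B where B0: "\<forall>t\<in>T. finite (B t) \<and> card (B t) \<le> p \<and> B t \<inter> H = {} \<and>
        (B t \<subseteq> V - S t \<and> factorable r E (B t) \<and> factorable r E (B t \<union> S t))"
      and Bd0: "\<forall>s\<in>T. \<forall>t\<in>T. s \<noteq> t \<longrightarrow> B s \<inter> B t = {}"
    by (elim exE conjE) (rule that)
  have B: "finite (B t)" "card (B t) \<le> p" "B t \<inter> H = {}" "B t \<subseteq> V"
      "factorable r E (B t)" "factorable r E (B t \<union> S t)" if "t \<in> T" for t
    using B0[rule_format, OF that] by auto
  have Bd: "B s \<inter> B t = {}" if "s \<in> T" "t \<in> T" "s \<noteq> t" for s t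
    using Bd0 that by simp
  define A where "A = (H - X) \<union> (\<Union>t\<in>T. B t)"
  show ?thesis
  proof (intro exI[of _ A] conjI allI impI)
    have "Z i \<subseteq> V" if "i < m" for i using Z(3)[OF that] CV by blast
    then have HV: "H \<subseteq> V" using X(1) Y(1) CV unfolding H_def by blast
    have XH: "X \<subseteq> H" by (auto simp: H_def)
    have "B t \<subseteq> V - X" if "t \<in> T" for t using B(3,4)[OF that] XH by blast
    then show "A \<subseteq> V - X" using HV unfolding A_def by blast
    have "card A \<le> card (H - X) + card (\<Union>t\<in>T. B t)" unfolding A_def by (rule card_Un_le)
    also have "card (H - X) \<le> card H" by (intro card_mono fH) auto
    also have "card (\<Union>t\<in>T. B t) \<le> (\<Sum>t\<in>T. card (B t))" by (rule card_UN_le[OF T(2)])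
    also have "\<dots> \<le> card T * p" using sum_bounded_above[of T "\<lambda>t. card (B t)" p] B(2) by simp
    also have "\<dots> \<le> 132 * x * p" using T(3) by (intro mult_le_mono1) (simp add: x_def)
    finally have "card A \<le> card H + 132 * x * p" by simp
    then show "card A \<le> 140 * card X * (r * c + r)"
      unfolding x_def[symmetric] p_def[symmetric] mult.assoc using cH xp(1) by linarith
    fix X' assume X': "X' \<subseteq> X" "card X' + k = card X"
    obtain f where f: "bij_betw f (X' \<union> Y) {..<m}" "\<forall>v\<in>X' \<union> Y. (v, f v) \<in> T" using T(4)[OF X'] by blast
    define used where "used t \<longleftrightarrow> fst t \<in> X' \<union> Y \<and> snd t = f (fst t)" for t
    define D where "D t = (if used t then B t \<union> S t else B t)" for t
    have "factorable r E (\<Union>t\<in>T. D t)"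
    proof (rule factorable_UN[OF T(2)])
      show "factorable r E (D t)" if "t \<in> T" for t using B(5,6)[OF that] by (simp add: D_def)
      fix s t assume st: "s \<in> T" "t \<in> T" "s \<noteq> t"
      have "S s \<inter> S t = {}" if u: "used s" "used t"
      proof -
        have ne: "fst s \<noteq> fst t" using u st(3) by (auto simp: used_def prod_eq_iff)
        have sm: "snd s < m" "snd t < m" "fst s \<in> X \<union> Y" "fst t \<in> X \<union> Y" using st(1,2) T(1) by auto
        have "snd s \<noteq> snd t" using u ne f(1) unfolding used_def bij_betw_def inj_on_def by metis
        then have "Z (snd s) \<inter> Z (snd t) = {}" using Zd sm by blast
        moreover have "fst s \<notin> Z (snd t)" "fst t \<notin> Z (snd s)" using Z(2) sm by blast+
        ultimately show ?thesis using ne by (auto simp: S_def)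
      qed
      moreover have "B s \<inter> S t = {}" "B t \<inter> S s = {}" using B(3) S(4) st by blast+
      ultimately show "D s \<inter> D t = {}" using Bd[OF st] by (auto simp: D_def)
    qed
    moreover have "(\<Union>t\<in>T. D t) = A \<union> X'"
    proof (rule equalityI)
      have S_sub: "S t \<subseteq> (H - X) \<union> X'" if t: "t \<in> T" "used t" for t
      proof -
        have "snd t < m" using t(1) T(1) by auto
        then have "Z (snd t) \<subseteq> H - X" using Z(2) by (auto simp: H_def)
        moreover have "Y \<subseteq> H - X" using Y(1) by (auto simp: H_def)
        ultimately show ?thesis using t(2) by (auto simp: S_def used_def)
      qed
      have "D t \<subseteq> A \<union> X'" if t: "t \<in> T" for t
      proof (cases "used t")
        case True
        then show ?thesis using S_sub[OF t True] t by (auto simp: D_def A_def)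
      next
        case False
        then show ?thesis using t by (auto simp: D_def A_def)
      qed
      then show "(\<Union>t\<in>T. D t) \<subseteq> A \<union> X'" by blast
      have S_in: "S (v, f v) \<subseteq> (\<Union>t\<in>T. D t)" if v: "v \<in> X' \<union> Y" for v
      proof -
        have "(v, f v) \<in> T" using f(2) v by blast
        moreover have "S (v, f v) \<subseteq> D (v, f v)" using v by (auto simp: D_def used_def)
        ultimately show ?thesis by blast
      qed
      have 1: "X' \<union> Y \<subseteq> (\<Union>t\<in>T. D t)" using S_in by (fastforce simp: S_def)
      have 2: "Z i \<subseteq> (\<Union>t\<in>T. D t)" if i: "i < m" for i
      proof -
        have "i \<in> f ` (X' \<union> Y)" using f(1) i by (simp add: bij_betw_def)
        then obtain v where "v \<in> X' \<union> Y" "f v = i" by blast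
        then show ?thesis using S_in[of v] by (simp add: S_def)
      qed
      have 3: "(\<Union>t\<in>T. B t) \<subseteq> (\<Union>t\<in>T. D t)" by (auto simp: D_def)
      show "A \<union> X' \<subseteq> (\<Union>t\<in>T. D t)" using 1 2 3 by (auto simp: A_def H_def)
    qed
    ultimately show "factorable r E (A \<union> X')" by simp
  qed
qed

text \<open>Cliques into \<open>X\<close> cover the leftover \<open>U\<close> at the price of
  \<open>card B\<close> reservoir vertices. Divisibility of \<open>card V\<close> makes
  \<open>k - card B\<close> a multiple of \<open>r\<close>, so further \<open>r\<close>-cliques
  inside \<open>X\<close> bring the number of used vertices to exactly \<open>k\<close>, the amount
  the absorber tolerates.\<close>

lemma factor_from_absorbing_set:
  fixes V :: "'a set" and \<kappa> :: real
  assumes G: "simple_graph V E" and r: "0 < r" and AX: "A \<subseteq> V - X" "X \<subseteq> V"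
    and absorb: "\<And>X'. X' \<subseteq> X \<Longrightarrow> card X' + k = card X \<Longrightarrow> factorable r E (A \<union> X')"
    and F: "tiling r E F" "\<Union>F \<subseteq> V - A - X" "r * card (V - A - X - \<Union>F) \<le> k"
    and k: "k \<le> card X" "real k \<le> \<kappa>" "\<kappa> < real (card X)"
    and cover: "\<And>v Q. v \<in> V \<Longrightarrow> real (card (X \<inter> Q)) \<le> \<kappa> \<Longrightarrow> \<exists>S\<subseteq>nb E v \<inter> X - Q. is_K (r - 1) E S"
    and dvd: "r dvd card V"
  shows "factorable r E V"
proof -
  have fV: "finite V" using G by (simp add: simple_graph_def)
  have fX: "finite X" and fA: "finite A" using AX fV by (auto intro: finite_subset)
  define U where "U = V - A - X - \<Union>F"
  have fU: "finite U" using fV by (simp add: U_def)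
  have kX: "r * card U \<le> k" using F(3) by (simp add: U_def)
  have root: "is_K r E (insert v S)" if "is_K (r - 1) E S" "S \<subseteq> nb E v" for v S
    using is_K_insert[OF that(1) _ that(2)] nb_irrefl[OF G, of v] that(2) r by auto
  have small: "real (card (X \<inter> Q)) \<le> \<kappa>" if "real (card Q) \<le> \<kappa>" "finite Q" for Q
    using card_mono[OF that(2), of "X \<inter> Q"] that(1) by simp
  have "\<exists>S. (\<forall>v\<in>U. finite (S v) \<and> card (S v) \<le> r - 1 \<and> S v \<inter> {} = {} \<and> (S v \<subseteq> nb E v \<inter> X \<and> is_K (r - 1) E (S v))) \<and>
    (\<forall>u\<in>U. \<forall>v\<in>U. u \<noteq> v \<longrightarrow> S u \<inter> S v = {})"
  proof (rule greedy_disjoint_sets[OF fU, where q = \<kappa>])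
    fix v and Q :: "'a set" assume v: "v \<in> U" and Q: "finite Q" "real (card Q) \<le> \<kappa>"
    obtain S where "S \<subseteq> nb E v \<inter> X - Q" "is_K (r - 1) E S" using cover[of v Q] small[OF Q(2,1)] v by (auto simp: U_def)
    then show "\<exists>A. finite A \<and> card A \<le> r - 1 \<and> A \<inter> Q = {} \<and> (A \<subseteq> nb E v \<inter> X \<and> is_K (r - 1) E A)"
      by (intro exI[of _ S]) (auto simp: is_K_def)
  next
    have "card U * (r - 1) \<le> card U * r" by (intro mult_le_mono2) simp
    also have "\<dots> \<le> k" using kX by (simp add: mult.commute)
    finally have "real (card U * (r - 1)) \<le> real k" by (simp only: of_nat_le_iff)
    from order_trans[OF this k(2)] show "real (card {}) + real (card U * (r - 1)) \<le> \<kappa>" by simp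
  qed simp
  then obtain S where S0: "\<forall>v\<in>U. finite (S v) \<and> card (S v) \<le> r - 1 \<and> S v \<inter> {} = {} \<and>
        (S v \<subseteq> nb E v \<inter> X \<and> is_K (r - 1) E (S v))"
      and Sd0: "\<forall>u\<in>U. \<forall>v\<in>U. u \<noteq> v \<longrightarrow> S u \<inter> S v = {}"
    by (elim exE conjE) (rule that)
  have S: "S v \<subseteq> nb E v \<inter> X" "is_K (r - 1) E (S v)" if "v \<in> U" for v
    using S0[rule_format, OF that] by simp_all
  have Sd: "S u \<inter> S v = {}" if "u \<in> U" "v \<in> U" "u \<noteq> v" for u v
    using Sd0 that by simp
  define B where "B = (\<Union>v\<in>U. S v)"
  have BX: "B \<subseteq> X" using S(1) by (auto simp: B_def)
  have fB: "finite B" using BX fX by (rule finite_subset)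
  have cB: "card B = card U * (r - 1)"
  proof -
    have "card B = (\<Sum>v\<in>U. card (S v))"
      unfolding B_def using fU S(2) Sd by (intro card_UN_disjoint) (auto simp: is_K_def)
    also have "\<dots> = (\<Sum>v\<in>U. r - 1)" using S(2) by (intro sum.cong) (auto simp: is_K_def)
    finally show ?thesis by simp
  qed
  have facUB: "factorable r E (U \<union> B)"
  proof -
    have UX: "U \<inter> X = {}" by (auto simp: U_def)
    have "factorable r E (\<Union>v\<in>U. insert v (S v))"
    proof (rule factorable_UN[OF fU])
      show "factorable r E (insert v (S v))" if "v \<in> U" for v
        using S[OF that] by (intro factorable_is_K root) auto
      show "insert u (S u) \<inter> insert v (S v) = {}" if "u \<in> U" "v \<in> U" "u \<noteq> v" for u v
        using Sd[OF that] S(1)[OF that(1)] S(1)[OF that(2)] that UX by auto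
    qed
    moreover have "(\<Union>v\<in>U. insert v (S v)) = U \<union> B" by (auto simp: B_def)
    ultimately show ?thesis by simp
  qed
  have cUB: "card U * r = card U + card B" unfolding cB using r by (cases r) auto
  \<comment> \<open>A single absorption instance shows that \<open>card A + (card X - k)\<close> is
    divisible by \<open>r\<close>.\<close>
  obtain X0 where X0: "X0 \<subseteq> X" "card X0 = card X - k" by (metis obtain_subset_with_card_n diff_le_self)
  have "r dvd card (A \<union> X0)" using absorb[of X0] X0 k(1) factorable_card by fastforce
  moreover have "card (A \<union> X0) = card A + card X0"
    using X0(1) AX fA fX by (intro card_Un_disjoint) (auto intro: finite_subset)
  ultimately have d1: "r dvd card A + (card X - k)" using X0(2) by simp
  have dF: "r dvd card (\<Union>F)" using tiling_card(2)[OF F(1)] by simp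
  have "card V = card A + card X + card (\<Union>F) + card U"
  proof -
    have "V = A \<union> X \<union> \<Union>F \<union> U" using AX F(2) by (auto simp: U_def)
    then have "card V = card (A \<union> X \<union> \<Union>F \<union> U)" by simp
    also have "\<dots> = card (A \<union> X \<union> \<Union>F) + card U"
      using fA fX fU tiling_card(1)[OF F(1)] by (intro card_Un_disjoint) (auto simp: U_def)
    also have "card (A \<union> X \<union> \<Union>F) = card (A \<union> X) + card (\<Union>F)"
      using fA fX tiling_card(1)[OF F(1)] F(2) by (intro card_Un_disjoint) auto
    also have "card (A \<union> X) = card A + card X" using fA fX AX by (intro card_Un_disjoint) auto
    finally show ?thesis .
  qed
  then have "card V = (card A + (card X - k)) + card (\<Union>F) + (k + card U)" using k(1) by simp
  then have "r dvd k + card U" using dvd d1 dF by (metis dvd_add dvd_add_right_iff)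
  moreover have "k + card U = (k - card B) + card U * r" using kX cUB by (simp add: mult.commute)
  ultimately have "r dvd k - card B" by (metis dvd_add_left_iff dvd_triv_right)
  then obtain j where j: "k - card B = r * j" by (auto simp: dvd_def)
  have Bk: "card B \<le> k" using kX cUB by (simp add: mult.commute)
  have "\<exists>K. (\<forall>i\<in>{..<j}. finite (K i) \<and> card (K i) \<le> r \<and> K i \<inter> B = {} \<and> (K i \<subseteq> X \<and> is_K r E (K i))) \<and>
    (\<forall>i\<in>{..<j}. \<forall>i'\<in>{..<j}. i \<noteq> i' \<longrightarrow> K i \<inter> K i' = {})"
  proof (rule greedy_disjoint_sets[where q = \<kappa>])
    fix i and Q :: "'a set" assume Q: "finite Q" "real (card Q) \<le> \<kappa>"
    have "\<not> X \<subseteq> Q" using card_mono[OF Q(1), of X] Q(2) k(3) by auto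
    then obtain v where v: "v \<in> X" "v \<notin> Q" by blast
    obtain S where S: "S \<subseteq> nb E v \<inter> X - Q" "is_K (r - 1) E S" using cover[of v Q] small[OF Q(2,1)] v AX(2) by auto
    have "is_K r E (insert v S)" using S by (intro root) auto
    then show "\<exists>A. finite A \<and> card A \<le> r \<and> A \<inter> Q = {} \<and> (A \<subseteq> X \<and> is_K r E A)"
      using S(1) v by (intro exI[of _ "insert v S"]) (auto simp: is_K_def)
  next
    have "card B + card {..<j} * r = k" using j Bk by (simp add: mult.commute)
    then have "real (card B) + real (card {..<j} * r) = real k" by (metis of_nat_add)
    then show "real (card B) + real (card {..<j} * r) \<le> \<kappa>" using k(2) by (simp only:)
  qed (use fB in auto)
  then obtain K where K0: "\<forall>i\<in>{..<j}. finite (K i) \<and> card (K i) \<le> r \<and> K i \<inter> B = {} \<and> (K i \<subseteq> X \<and> is_K r E (K i))"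
      and Kd0: "\<forall>i\<in>{..<j}. \<forall>i'\<in>{..<j}. i \<noteq> i' \<longrightarrow> K i \<inter> K i' = {}"
    by (elim exE conjE) (rule that)
  have K: "K i \<inter> B = {}" "K i \<subseteq> X" "is_K r E (K i)" if "i < j" for i
    using K0[rule_format, of i] that by simp_all
  have Kd: "K i \<inter> K i' = {}" if "i < j" "i' < j" "i \<noteq> i'" for i i'
    using Kd0 that by simp
  define D where "D = (\<Union>i<j. K i)"
  have D: "D \<subseteq> X" "D \<inter> B = {}" using K(1,2) by (auto simp: D_def)
  have fD: "finite D" using D(1) fX by (rule finite_subset)
  have facD: "factorable r E D"
    unfolding D_def using K(3) Kd by (intro factorable_UN factorable_is_K) auto
  have "card D = (\<Sum>i<j. card (K i))"
    unfolding D_def using K(3) Kd by (intro card_UN_disjoint) (auto simp: is_K_def)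
  also have "\<dots> = (\<Sum>i<j. r)" using K(3) by (intro sum.cong) (auto simp: is_K_def)
  finally have cD: "card D = r * j" by simp
  have "card (B \<union> D) = k" using fB fD D(2) cD j Bk by (subst card_Un_disjoint) auto
  moreover have "card (X - (B \<union> D)) = card X - card (B \<union> D)"
    using BX D(1) fB fD by (intro card_Diff_subset) auto
  ultimately have "factorable r E (A \<union> (X - (B \<union> D)))" using k(1) by (intro absorb) auto
  then have "factorable r E ((A \<union> (X - (B \<union> D))) \<union> D)" using facD by (rule factorable_Un) (use AX D(1) in auto)
  then have "factorable r E (((A \<union> (X - (B \<union> D))) \<union> D) \<union> (U \<union> B))"
    using facUB by (rule factorable_Un) (use AX D BX in \<open>auto simp: U_def\<close>)
  moreover have "factorable r E (\<Union>F)" using F(1) by (auto simp: factorable_def)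
  ultimately have "factorable r E ((((A \<union> (X - (B \<union> D))) \<union> D) \<union> (U \<union> B)) \<union> \<Union>F)"
    by (rule factorable_Un) (use F(2) BX D(1) in \<open>auto simp: U_def\<close>)
  moreover have "(((A \<union> (X - (B \<union> D))) \<union> D) \<union> (U \<union> B)) \<union> \<Union>F = V"
    using AX BX D(1) F(2) by (auto simp: U_def)
  ultimately show ?thesis by simp
qed

text \<open>\<open>random_subset\<close> is applied to \<open>C\<close> and to the traces of all
  neighbourhoods on \<open>C\<close>; this family has at most \<open>card V + 1\<close> members,
  which the exponential tail beats.\<close>

lemma reservoir_exists:
  fixes \<theta> \<mu> \<delta> :: real
  assumes \<theta>: "0 < \<theta>" "\<theta> \<le> 1" and \<mu>: "0 < \<mu>" "\<mu> \<le> 1" and \<delta>: "0 \<le> \<delta>" "\<delta> \<le> 1"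
  shows "\<exists>N. \<forall>(V :: 'a set) E C. simple_graph V E \<longrightarrow> N \<le> card V \<longrightarrow> C \<subseteq> V \<longrightarrow>
    real (card (V - C)) \<le> \<mu> / 8 * real (card V) \<longrightarrow>
    (\<forall>v\<in>V. (\<delta> + \<mu>) * real (card V) \<le> real (card (nb E v))) \<longrightarrow>
    (\<exists>X\<subseteq>C. \<theta> / 2 * real (card V) \<le> real (card X) \<and> real (card X) \<le> 2 * \<theta> * real (card V) \<and>
       (\<forall>v\<in>V. (\<delta> + \<mu> / 2) * real (card X) \<le> real (card (nb E v \<inter> X))))"
proof -
  \<comment> \<open>Half of the excess \<open>\<mu>\<close> pays for the vertices outside
    \<open>C\<close> (\<open>\<mu> / 8\<close>), the deviation of the degree
    (\<open>\<mu> / 10\<close>) and the surplus order of \<open>X\<close> (at most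
    \<open>3 / 2 * (\<mu> / 10)\<close>).\<close>
  define \<gamma> where "\<gamma> = \<theta> * \<mu> / 10"
  have \<gamma>: "0 < \<gamma>" using \<theta> \<mu> by (simp add: \<gamma>_def)
  have "eventually (\<lambda>n::nat. (real n + 1) * (2 * exp (- 2 * \<gamma>\<^sup>2 * real n)) < 1) sequentially"
    using \<gamma> by real_asymp
  then obtain N0 where N0: "\<And>n. N0 \<le> n \<Longrightarrow> (real n + 1) * (2 * exp (- 2 * \<gamma>\<^sup>2 * real n)) < 1"
    by (auto simp: eventually_sequentially)
  show ?thesis
  proof (intro exI[of _ "max N0 1"] allI impI)
    fix V :: "'a set" and E C
    assume G: "simple_graph V E" and N: "max N0 1 \<le> card V" and C: "C \<subseteq> V"
      "real (card (V - C)) \<le> \<mu> / 8 * real (card V)"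
      and deg: "\<forall>v\<in>V. (\<delta> + \<mu>) * real (card V) \<le> real (card (nb E v))"
    define n where "n = real (card V)"
    have n0: "0 < n" using N by (simp add: n_def)
    have fV: "finite V" using G by (simp add: simple_graph_def)
    have fC: "finite C" using C(1) fV by (rule finite_subset)
    have Cn: "real (card C) \<le> n" using card_mono[OF fV C(1)] by (simp add: n_def)
    have CV: "n - \<mu> / 8 * n \<le> real (card C)"
    proof -
      have "card V \<le> card C + card (V - C)" using card_Un_le[of C "V - C"] C(1) by (simp add: Un_absorb1)
      then show ?thesis using C(2) by (simp add: n_def)
    qed
    define \<F> where "\<F> = insert C ((\<lambda>v. nb E v \<inter> C) ` V)"
    have fF: "finite \<F>" using fV by (simp add: \<F>_def)
    have "card \<F> \<le> Suc (card ((\<lambda>v. nb E v \<inter> C) ` V))"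
      unfolding \<F>_def using fV by (simp add: card_insert_if)
    also have "\<dots> \<le> Suc (card V)" using card_image_le[OF fV, of "\<lambda>v. nb E v \<inter> C"] by simp
    finally have "real (card \<F>) \<le> real (card V) + 1" by simp
    then have "real (card \<F>) * (2 * exp (- 2 * \<gamma>\<^sup>2 * n)) \<le> (real (card V) + 1) * (2 * exp (- 2 * \<gamma>\<^sup>2 * n))"
      by (rule mult_right_mono) simp
    also have "\<dots> < 1" using N0[of "card V"] N by (simp add: n_def)
    finally have small: "real (card \<F>) * (2 * exp (- 2 * \<gamma>\<^sup>2 * n)) < 1" .
    have "\<exists>X\<subseteq>C. \<forall>A\<in>\<F>. \<bar>real (card (A \<inter> X)) - \<theta> * card A\<bar> < \<gamma> * n"
      by (rule random_subset[OF fC Cn _ _ \<gamma> n0 fF _ small]) (use \<theta> in \<open>auto simp: \<F>_def\<close>)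
    then obtain X where X: "X \<subseteq> C" and conc: "\<And>A. A \<in> \<F> \<Longrightarrow> \<bar>real (card (A \<inter> X)) - \<theta> * card A\<bar> < \<gamma> * n"
      by blast
    have CX: "C \<inter> X = X" using X by blast
    have cX: "\<bar>real (card X) - \<theta> * card C\<bar> < \<gamma> * n" using conc[of C] by (simp add: \<F>_def CX)
    have \<gamma>n: "\<gamma> * n = \<mu> / 10 * (\<theta> * n)" by (simp add: \<gamma>_def)
    have \<theta>n: "0 < \<theta> * n" using \<theta> n0 by simp
    have \<mu>\<theta>: "\<mu> * (\<theta> * n) \<le> 1 * (\<theta> * n)" using \<mu> \<theta>n by (intro mult_right_mono) auto
    have "\<theta> * real (card C) \<le> \<theta> * n" using Cn \<theta> by (intro mult_left_mono) auto
    then have up: "real (card X) \<le> \<theta> * n + \<mu> / 10 * (\<theta> * n)" using cX \<gamma>n by linarith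
    have "\<theta> * (n - \<mu> / 8 * n) \<le> \<theta> * real (card C)" using CV \<theta> by (intro mult_left_mono) auto
    moreover have "\<theta> * (n - \<mu> / 8 * n) = \<theta> * n - \<mu> / 8 * (\<theta> * n)" by (simp add: algebra_simps)
    ultimately have lo: "\<theta> * n - \<mu> / 8 * (\<theta> * n) - \<mu> / 10 * (\<theta> * n) \<le> real (card X)"
      using cX \<gamma>n by linarith
    show "\<exists>X\<subseteq>C. \<theta> / 2 * real (card V) \<le> real (card X) \<and> real (card X) \<le> 2 * \<theta> * real (card V) \<and>
       (\<forall>v\<in>V. (\<delta> + \<mu> / 2) * real (card X) \<le> real (card (nb E v \<inter> X)))"
    proof (intro exI[of _ X] conjI ballI X)
      show "\<theta> / 2 * real (card V) \<le> real (card X)" using lo \<mu>\<theta> \<theta>n by (simp flip: n_def)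
      show "real (card X) \<le> 2 * \<theta> * real (card V)" using up \<mu>\<theta> \<theta>n by (simp flip: n_def)
      fix v assume v: "v \<in> V"
      have "nb E v \<subseteq> (nb E v \<inter> C) \<union> (V - C)" using nb_subset[OF G] by blast
      then have "card (nb E v) \<le> card ((nb E v \<inter> C) \<union> (V - C))"
        using fV fC by (intro card_mono) auto
      also have "\<dots> \<le> card (nb E v \<inter> C) + card (V - C)" by (rule card_Un_le)
      finally have "(\<delta> + \<mu>) * n - \<mu> / 8 * n \<le> real (card (nb E v \<inter> C))"
        using deg[rule_format, OF v] C(2) by (simp add: n_def)
      then have "\<theta> * ((\<delta> + \<mu>) * n - \<mu> / 8 * n) \<le> \<theta> * real (card (nb E v \<inter> C))"
        using \<theta> by (intro mult_left_mono) auto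
      moreover have "nb E v \<inter> C \<inter> X = nb E v \<inter> X" using X by blast
      then have "\<bar>real (card (nb E v \<inter> X)) - \<theta> * card (nb E v \<inter> C)\<bar> < \<gamma> * n"
        using v conc[of "nb E v \<inter> C"] by (simp add: \<F>_def)
      moreover have "\<theta> * ((\<delta> + \<mu>) * n - \<mu> / 8 * n) = (\<delta> + \<mu>) * (\<theta> * n) - \<mu> / 8 * (\<theta> * n)"
        by (simp add: algebra_simps)
      ultimately have nv: "(\<delta> + \<mu>) * (\<theta> * n) - \<mu> / 8 * (\<theta> * n) - \<mu> / 10 * (\<theta> * n) \<le> real (card (nb E v \<inter> X))"
        using \<gamma>n by linarith
      have "(\<delta> + \<mu> / 2) * real (card X) \<le> (\<delta> + \<mu> / 2) * (\<theta> * n + \<mu> / 10 * (\<theta> * n))"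
        using up \<delta> \<mu> by (intro mult_left_mono) auto
      also have "\<dots> = (\<delta> + \<mu> / 2 + (\<delta> + \<mu> / 2) * (\<mu> / 10)) * (\<theta> * n)" by (simp add: algebra_simps)
      also have "\<dots> \<le> (\<delta> + \<mu> - \<mu> / 8 - \<mu> / 10) * (\<theta> * n)"
      proof (rule mult_right_mono)
        have "(\<delta> + \<mu> / 2) * (\<mu> / 10) \<le> (3 / 2) * (\<mu> / 10)" using \<delta> \<mu> by (intro mult_right_mono) auto
        then show "\<delta> + \<mu> / 2 + (\<delta> + \<mu> / 2) * (\<mu> / 10) \<le> \<delta> + \<mu> - \<mu> / 8 - \<mu> / 10" using \<mu> by linarith
      qed (use \<theta>n in simp)
      also have "\<dots> = (\<delta> + \<mu>) * (\<theta> * n) - \<mu> / 8 * (\<theta> * n) - \<mu> / 10 * (\<theta> * n)" by (simp add: algebra_simps)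
      finally show "(\<delta> + \<mu> / 2) * real (card X) \<le> real (card (nb E v \<inter> X))" using nv by linarith
    qed
  qed
qed

section \<open>Assembly of the factor\<close>

lemma almost_perfect_tiling_within:
  fixes l r :: nat and a :: real
  assumes G: "simple_graph V E" and D: "K_dense l V E a" and a: "1 \<le> a" and R: "R \<subseteq> V"
    and lr: "l < r" "3 * r \<le> 4 * l"
    and deg: "\<And>v. v \<in> R \<Longrightarrow> real (card R) / 2 \<le> real (card (nb E v \<inter> R))"
  obtains F where "tiling r E F" "\<Union>F \<subseteq> R" "real (card (R - \<Union>F)) \<le> (4 * r * 2 ^ r * (2 * r + 1)) * a"
proof -
  let ?E = "induced_edges E R"
  have D': "K_dense l R ?E a"
    unfolding K_dense_def
  proof (intro allI impI)
    fix U assume U: "U \<subseteq> R" "a \<le> real (card U)"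
    then obtain S where S: "S \<subseteq> U" "is_K l E S" using K_dense_obtain[OF D] R by (metis subset_trans)
    have "is_K l ?E S" using S U(1) is_K_induced[of S R l E] by blast
    then show "\<exists>S\<subseteq>U. is_K l ?E S" using S(1) by blast
  qed
  have deg': "real (card R) / 2 \<le> real (card (nb ?E v))" if v: "v \<in> R" for v
  proof -
    have "nb ?E v = nb E v \<inter> R" using v by (auto simp: nb_def induced_edges_def)
    then show ?thesis using deg[OF v] by simp
  qed
  obtain F where F: "tiling r ?E F" "\<Union>F \<subseteq> R" "real (card (R - \<Union>F)) \<le> (4 * r * 2 ^ r * (2 * r + 1)) * a"
    using almost_perfect_tiling[OF simple_graph_induced[OF G R] D' a lr deg'] by auto
  have "is_K r E S" if S: "S \<in> F" for S
  proof -
    have "S \<subseteq> R" using F(2) S by blast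
    moreover have "is_K r ?E S" using F(1) S by (simp add: tiling_def)
    ultimately show ?thesis using is_K_induced by blast
  qed
  then have "tiling r E F" using F(1) by (simp add: tiling_def)
  then show ?thesis using that F(2,3) by blast
qed

text \<open>The order of the constants matters: the absorber must be small against the robustness
  \<open>\<beta>\<close> of the connectors, which fixes the density \<open>\<theta>\<close> of the
  reservoir, and only then is \<open>\<alpha>\<close> chosen so small that the remainder of the
  tiling is far below the order of the reservoir.\<close>

lemma factor_exists:
  fixes l r :: nat and \<mu> :: real
  assumes lr: "l < r" "3 * r \<le> 4 * l" and \<mu>: "0 < \<mu>" "\<mu> \<le> 1"
  shows "\<exists>\<alpha>>0. \<exists>N. \<forall>(V :: nat set) E. simple_graph V E \<longrightarrow> N \<le> card V \<longrightarrow> r dvd card V \<longrightarrow>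
    K_dense l V E (\<alpha> * real (card V)) \<longrightarrow>
    (\<forall>v\<in>V. (1 / (2 - RT_density l (r - 1)) + \<mu>) * real (card V) \<le> real (card (nb E v))) \<longrightarrow>
    factorable r E V"
proof -
  have l0: "0 < l" and r0: "0 < r" using lr by auto
  define \<delta> where "\<delta> = 1 / (2 - RT_density l (r - 1))"
  have \<delta>: "1 / 2 \<le> \<delta>" "\<delta> \<le> 1" using RT_density_bounds[OF l0, of "r - 1"] by (auto simp: \<delta>_def divide_simps)
  have "0 < \<mu> / 8" "4 * (\<mu> / 8) \<le> \<mu>" "0 < \<mu> / 2" using \<mu> by auto
  note pos = this
  obtain \<beta> \<alpha>1 :: real and c N1 where \<beta>: "0 < \<beta>" and \<alpha>1: "0 < \<alpha>1" and closed: "\<forall>(V :: nat set) E.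
     simple_graph V E \<longrightarrow> N1 \<le> card V \<longrightarrow> K_dense l V E (\<alpha>1 * real (card V)) \<longrightarrow>
     (\<forall>v\<in>V. (1 / (2 - RT_density l (r - 1)) + \<mu>) * real (card V) \<le> real (card (nb E v))) \<longrightarrow>
     (\<exists>C\<subseteq>V. real (card (V - C)) \<le> \<mu> / 8 * real (card V) \<and>
        (\<forall>x\<in>C. \<forall>y\<in>C. x \<noteq> y \<longrightarrow> reach r V E (\<beta> * real (card V)) c x y))"
    using almost_spanning_closed_class[OF lr \<mu>(1) pos(1,2)] by (elim exE conjE) (rule that)
  obtain \<epsilon> where \<epsilon>: "0 < \<epsilon>" and avoid: "\<forall>(V :: nat set) E X F v. simple_graph V E \<longrightarrow> X \<subseteq> V \<longrightarrow> X \<noteq> {} \<longrightarrow>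
    K_dense l V E (\<epsilon> * real (card X)) \<longrightarrow>
    (\<forall>u\<in>insert v X. (1 / (2 - RT_density l (r - 1)) + \<mu> / 2) * real (card X) \<le> real (card (nb E u \<inter> X))) \<longrightarrow>
    real (card (X \<inter> F)) \<le> \<mu> / 2 * real (card X) \<longrightarrow> (\<exists>S\<subseteq>nb E v \<inter> X - F. is_K (r - 1) E S)"
    using clique_avoiding[OF l0 pos(3), of "r - 1"] by (elim exE conjE) (rule that)
  define p where "p = r * c + r"
  have p0: "0 < p" using r0 by (simp add: p_def)
  define \<phi> where "\<phi> = min \<beta> (\<mu> / 4)"
  have \<phi>: "0 < \<phi>" "\<phi> \<le> \<beta>" "\<phi> \<le> \<mu> / 4" using \<beta> \<mu> by (auto simp: \<phi>_def)
  \<comment> \<open>The reservoir has at most \<open>2 * \<theta> * n\<close> vertices, so an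
    absorber of order \<open>140 * card X * p\<close> has at most \<open>\<phi> * n\<close>.\<close>
  define \<theta> where "\<theta> = \<phi> / (280 * p)"
  have \<theta>0: "0 < \<theta>" using \<phi> p0 by (simp add: \<theta>_def)
  have \<theta>p: "280 * real p * \<theta> = \<phi>" using p0 by (simp add: \<theta>_def)
  have "280 * 1 * \<theta> \<le> 280 * real p * \<theta>" using p0 \<theta>0 by (intro mult_right_mono mult_left_mono) auto
  then have \<theta>\<phi>: "280 * \<theta> \<le> \<phi>" using \<theta>p by simp
  then have \<theta>1: "\<theta> \<le> 1" using \<phi> \<mu> by linarith
  have \<delta>0: "0 \<le> \<delta>" using \<delta> by simp
  obtain N2 where reservoir: "\<forall>(V :: nat set) E C. simple_graph V E \<longrightarrow> N2 \<le> card V \<longrightarrow> C \<subseteq> V \<longrightarrow>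
    real (card (V - C)) \<le> \<mu> / 8 * real (card V) \<longrightarrow>
    (\<forall>v\<in>V. (\<delta> + \<mu>) * real (card V) \<le> real (card (nb E v))) \<longrightarrow>
    (\<exists>X\<subseteq>C. \<theta> / 2 * real (card V) \<le> real (card X) \<and> real (card X) \<le> 2 * \<theta> * real (card V) \<and>
       (\<forall>v\<in>V. (\<delta> + \<mu> / 2) * real (card X) \<le> real (card (nb E v \<inter> X))))"
    using reservoir_exists[OF \<theta>0 \<theta>1 \<mu> \<delta>0 \<delta>(2)] by (elim exE) (rule that)
  define K where "K = (4 * r * 2 ^ r * (2 * r + 1))"
  have K0: "0 < K" using r0 by (simp add: K_def)
  \<comment> \<open>The last entry keeps \<open>r\<close> times the tiling remainder below
    \<open>\<mu> * \<theta> / 8 * n\<close>, half of the guaranteed slack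
    \<open>\<mu> / 2 * (\<theta> / 2 * n)\<close>; the other half absorbs the rounding of
    \<open>k\<close>.\<close>
  define \<alpha> where "\<alpha> = min (min \<alpha>1 \<epsilon>) (min (\<epsilon> * \<theta> / 2) (\<mu> * \<theta> / (8 * r * K)))"
  have \<alpha>: "0 < \<alpha>" "\<alpha> \<le> \<alpha>1" "\<alpha> \<le> \<epsilon>" "\<alpha> \<le> \<epsilon> * \<theta> / 2" "\<alpha> \<le> \<mu> * \<theta> / (8 * r * K)"
    using \<alpha>1 \<epsilon> \<theta>0 \<mu> r0 K0 by (auto simp: \<alpha>_def)
  have \<alpha>K: "r * K * \<alpha> \<le> \<mu> * \<theta> / 8" using \<alpha>(5) r0 K0 by (simp add: field_simps)
  define N where "N = max (max N1 N2) (max (nat \<lceil>1 / \<alpha>\<rceil>) (nat \<lceil>8 / (\<mu> * \<theta>)\<rceil>))"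
  show ?thesis
  proof (intro exI[of _ \<alpha>] exI[of _ "N + 1"] conjI \<alpha>(1) allI impI)
    fix V :: "nat set" and E
    assume G: "simple_graph V E" and nN: "N + 1 \<le> card V" and dvd: "r dvd card V"
      and D: "K_dense l V E (\<alpha> * real (card V))"
      and deg: "\<forall>v\<in>V. (1 / (2 - RT_density l (r - 1)) + \<mu>) * real (card V) \<le> real (card (nb E v))"
    define n where "n = real (card V)"
    have fV: "finite V" using G by (simp add: simple_graph_def)
    have n0: "0 < n" using nN by (simp add: n_def)
    have "nat \<lceil>1 / \<alpha>\<rceil> \<le> N" "nat \<lceil>8 / (\<mu> * \<theta>)\<rceil> \<le> N"
      unfolding N_def by (rule max.coboundedI2[OF max.cobounded1], rule max.coboundedI2[OF max.cobounded2])
    then have "nat \<lceil>1 / \<alpha>\<rceil> \<le> card V" "nat \<lceil>8 / (\<mu> * \<theta>)\<rceil> \<le> card V" using nN by linarith+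
    then have "1 / \<alpha> \<le> n" "8 / (\<mu> * \<theta>) \<le> n" unfolding n_def by linarith+
    then have n1: "1 \<le> \<alpha> * n" "8 \<le> \<mu> * \<theta> * n" using \<alpha>(1) \<mu> \<theta>0 by (simp_all add: field_simps)
    have "K_dense l V E (\<alpha>1 * real (card V))"
      by (rule K_dense_mono[OF D]) (use \<alpha> in \<open>auto intro: mult_right_mono\<close>)
    moreover have "N1 \<le> card V" "N2 \<le> card V" using nN by (auto simp: N_def)
    ultimately obtain C where C: "C \<subseteq> V" "real (card (V - C)) \<le> \<mu> / 8 * real (card V)"
        and reach: "\<forall>x\<in>C. \<forall>y\<in>C. x \<noteq> y \<longrightarrow> reach r V E (\<beta> * real (card V)) c x y"
      using closed G deg by meson
    have deg': "\<forall>v\<in>V. (\<delta> + \<mu>) * real (card V) \<le> real (card (nb E v))" using deg by (simp add: \<delta>_def)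
    obtain X where X: "X \<subseteq> C" "\<theta> / 2 * real (card V) \<le> real (card X)" "real (card X) \<le> 2 * \<theta> * real (card V)"
       "\<forall>v\<in>V. (\<delta> + \<mu> / 2) * real (card X) \<le> real (card (nb E v \<inter> X))"
      using reservoir[rule_format, OF G \<open>N2 \<le> card V\<close> C] deg' by blast
    define x where "x = real (card X)"
    have x: "\<theta> / 2 * n \<le> x" "x \<le> 2 * \<theta> * n" using X(2,3) by (simp_all add: x_def n_def)
    have "0 < \<theta> / 2 * n" using \<theta>0 n0 by simp
    then have x0: "0 < x" using x(1) by linarith
    have XV: "X \<subseteq> V" using X(1) C(1) by blast
    have Xne: "X \<noteq> {}" using x0 by (auto simp: x_def)
    have cover: "\<exists>S\<subseteq>nb E v \<inter> X - Q. is_K (r - 1) E S" if v: "v \<in> V" and Q: "real (card (X \<inter> Q)) \<le> \<mu> / 2 * x" for v Q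
    proof (rule avoid[rule_format, OF G XV Xne])
      have "\<epsilon> * (\<theta> / 2 * n) \<le> \<epsilon> * x" using x(1) \<epsilon> by (intro mult_left_mono) auto
      moreover have "\<alpha> * n \<le> \<epsilon> * \<theta> / 2 * n" using \<alpha>(4) n0 by (intro mult_right_mono) auto
      ultimately show "K_dense l V E (\<epsilon> * real (card X))" by (intro K_dense_mono[OF D]) (simp add: n_def x_def)
      show "(1 / (2 - RT_density l (r - 1)) + \<mu> / 2) * real (card X) \<le> real (card (nb E u \<inter> X))"
        if "u \<in> insert v X" for u
        using X(4) that v XV by (auto simp: \<delta>_def)
    qed (use Q in \<open>simp add: x_def\<close>)
    \<comment> \<open>The vertices outside \<open>C\<close> are added to the forbidden set, so the
      clique found through \<open>v\<close> lies inside the class.\<close>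
    have cliques: "\<exists>W\<subseteq>C - Q. is_K r E W" if Q: "finite Q" "real (card Q) \<le> \<phi> * n" for Q
    proof -
      have VC: "V \<inter> ((V - C) \<union> Q) \<subseteq> (V - C) \<union> Q" by blast
      have "card (V \<inter> ((V - C) \<union> Q)) \<le> card (V - C) + card Q"
        using card_mono[OF _ VC] card_Un_le[of "V - C" Q] fV Q(1) by simp
      moreover have "\<phi> * n \<le> \<mu> / 4 * n" using \<phi>(3) n0 by (intro mult_right_mono) auto
      moreover have "0 < \<mu> * n" using \<mu> n0 by simp
      ultimately have small: "real (card (V \<inter> ((V - C) \<union> Q))) \<le> \<mu> / 2 * n"
        using C(2) Q(2) by (simp add: n_def)
      have "\<mu> / 2 * n < 1 * n" using \<mu> n0 by (intro mult_strict_right_mono) auto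
      then have "card (V \<inter> ((V - C) \<union> Q)) < card V" using small by (simp add: n_def)
      then have "\<not> V \<subseteq> (V - C) \<union> Q" by (metis inf.absorb1 less_irrefl)
      then obtain v where v: "v \<in> C" "v \<notin> Q" "v \<in> V" by blast
      have Vne: "V \<noteq> {}" using v by blast
      have "\<exists>S\<subseteq>nb E v \<inter> V - ((V - C) \<union> Q). is_K (r - 1) E S"
      proof (rule avoid[rule_format, OF G order_refl Vne])
        show "K_dense l V E (\<epsilon> * real (card V))"
          by (rule K_dense_mono[OF D]) (use \<alpha> in \<open>auto intro: mult_right_mono\<close>)
        fix u assume "u \<in> insert v V"
        then have u: "u \<in> V" using v by blast
        have "(\<delta> + \<mu> / 2) * n \<le> (\<delta> + \<mu>) * n" using \<mu> n0 by (intro mult_right_mono) auto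
        moreover have "nb E u \<inter> V = nb E u" using nb_subset[OF G] by blast
        ultimately show "(1 / (2 - RT_density l (r - 1)) + \<mu> / 2) * real (card V) \<le> real (card (nb E u \<inter> V))"
          using deg'[rule_format, OF u] by (simp add: n_def \<delta>_def)
      qed (use small in \<open>simp add: n_def\<close>)
      then obtain S where S: "S \<subseteq> nb E v \<inter> V - ((V - C) \<union> Q)" "is_K (r - 1) E S" by blast
      have "is_K (Suc (r - 1)) E (insert v S)"
        by (rule is_K_insert[OF S(2)]) (use S(1) nb_irrefl[OF G, of v] in auto)
      then have "is_K r E (insert v S)" using r0 by simp
      then show ?thesis using S(1) v by (intro exI[of _ "insert v S"]) auto
    qed
    \<comment> \<open>A share \<open>\<mu> / 2\<close> of the reservoir may be used up while
      \<open>cover\<close> still applies to every vertex.\<close>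
    define k where "k = nat \<lfloor>\<mu> / 2 * x\<rfloor>"
    have "0 \<le> \<mu> / 2 * x" using \<mu> x0 by simp
    then have k: "real k \<le> \<mu> / 2 * x" "\<mu> / 2 * x - 1 \<le> real k" unfolding k_def by linarith+
    have \<mu>x: "\<mu> / 2 * x < 1 * x" using \<mu> x0 by (intro mult_strict_right_mono) auto
    then have kX: "k \<le> card X" using k(1) by (simp add: x_def)
    have "140 * real p * x \<le> 140 * real p * (2 * \<theta> * n)" using x(2) by (intro mult_left_mono) auto
    also have "\<dots> = (280 * real p * \<theta>) * n" by simp
    also have "\<dots> = \<phi> * n" by (simp only: \<theta>p)
    finally have px: "real (140 * card X * (r * c + r)) \<le> \<phi> * n" by (simp add: x_def p_def mult_ac)
    have "\<phi> * n \<le> \<beta> * n" using \<phi>(2) n0 by (intro mult_right_mono) auto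
    then have px': "real (140 * card X * (r * c + r)) \<le> \<beta> * n" using px by linarith
    have "0 < card X" using x0 by (simp add: x_def)
    have "\<exists>A\<subseteq>V - X. card A \<le> 140 * card X * (r * c + r) \<and>
        (\<forall>X'\<subseteq>X. card X' + k = card X \<longrightarrow> factorable r E (A \<union> X'))"
    proof (rule absorbing_set[OF fV r0 C(1) _ cliques X(1) \<open>0 < card X\<close> kX px' px])
      show "reach r V E (\<beta> * n) c x y" if "x \<in> C" "y \<in> C" "x \<noteq> y" for x y
        using reach that by (simp add: n_def)
    qed
    then obtain A where A: "A \<subseteq> V - X" "card A \<le> 140 * card X * (r * c + r)"
      and absorb: "\<forall>X'\<subseteq>X. card X' + k = card X \<longrightarrow> factorable r E (A \<union> X')" by blast
    define R where "R = V - A - X"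
    have RV: "R \<subseteq> V" by (auto simp: R_def)
    have fR: "finite R" using RV fV by (rule finite_subset)
    have AXsmall: "real (card A) + x \<le> \<mu> / 2 * n"
    proof -
      have "real (card A) \<le> \<phi> * n" using A(2) px by (meson of_nat_le_iff order_trans)
      moreover have "2 * \<theta> * n \<le> \<phi> * n" using \<theta>\<phi> \<theta>0 n0 by (intro mult_right_mono) auto
      moreover have "\<phi> * n \<le> \<mu> / 4 * n" using \<phi>(3) n0 by (intro mult_right_mono) auto
      ultimately show ?thesis using x(2) by simp
    qed
    have degR: "real (card R) / 2 \<le> real (card (nb E v \<inter> R))" if v: "v \<in> R" for v
    proof -
      have fin: "finite (A \<union> X)" using A(1) XV fV by (auto intro: finite_subset)
      have "card (nb E v) \<le> card ((nb E v \<inter> R) \<union> (A \<union> X))"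
        using nb_subset[OF G, of v] fR fin by (intro card_mono) (auto simp: R_def)
      also have "\<dots> \<le> card (nb E v \<inter> R) + (card A + card X)"
        using card_Un_le[of "nb E v \<inter> R" "A \<union> X"] card_Un_le[of A X] by linarith
      finally have "real (card (nb E v)) \<le> real (card (nb E v \<inter> R)) + (real (card A) + x)"
        by (simp add: x_def flip: of_nat_add)
      moreover have "(\<delta> + \<mu>) * n \<le> real (card (nb E v))" using deg' v RV by (auto simp: n_def)
      moreover have "1 / 2 * n \<le> \<delta> * n" using \<delta>(1) n0 by (intro mult_right_mono) auto
      moreover have "0 < \<mu> * n" using \<mu> n0 by simp
      moreover have "real (card R) \<le> n" using card_mono[OF fV RV] by (simp add: n_def)
      ultimately show ?thesis using AXsmall by (simp add: distrib_right)
    qed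
    have D': "K_dense l V E (\<alpha> * n)" using D by (simp add: n_def)
    obtain F where F: "tiling r E F" "\<Union>F \<subseteq> R" "real (card (R - \<Union>F)) \<le> K * (\<alpha> * n)"
      unfolding K_def using almost_perfect_tiling_within[OF G D' n1(1) RV lr degR] by blast
    show "factorable r E V"
    proof (rule factor_from_absorbing_set[OF G r0 A(1) XV _ F(1) _ _ kX k(1) _ cover dvd])
      show "factorable r E (A \<union> X')" if "X' \<subseteq> X" "card X' + k = card X" for X' using absorb that by blast
      show "\<Union>F \<subseteq> V - A - X" using F(2) by (simp add: R_def)
      have "real r * real (card (R - \<Union>F)) \<le> real r * (K * (\<alpha> * n))" using F(3) by (intro mult_left_mono) auto
      also have "\<dots> = r * K * \<alpha> * n" by simp
      also have "\<dots> \<le> \<mu> * \<theta> / 8 * n" using \<alpha>K n0 by (intro mult_right_mono) auto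
      also have "\<dots> \<le> \<mu> / 2 * (\<theta> / 2 * n) - 1" using n1(2) by simp
      also have "\<dots> \<le> \<mu> / 2 * x - 1" using x(1) \<mu> by (intro diff_right_mono mult_left_mono) auto
      also have "\<dots> \<le> real k" by (rule k(2))
      finally show "r * card (V - A - X - \<Union>F) \<le> k" unfolding R_def by (simp only: of_nat_mult[symmetric] of_nat_le_iff)
      show "\<mu> / 2 * x < real (card X)" using \<mu>x by (simp add: x_def)
    qed
  qed
qed

theorem theorem1p3:
  fixes r l :: nat
  assumes "l < r" and "3 / 4 * real r \<le> real l"
  shows
    "(\<forall>\<mu>>0. \<exists>\<alpha>>0. \<exists>N. \<forall>n>N. r dvd n \<longrightarrow>
        (\<forall>(V :: nat set) E. simple_graph V E \<longrightarrow> card V = n \<longrightarrow>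
           real (min_degree V E) \<ge> (1 / (2 - RT_density l (r - 1)) + \<mu>) * real n \<longrightarrow>
           real (indep_number l V E) \<le> \<alpha> * real n \<longrightarrow>
           (\<exists>F. K_factor r V E F)))
     \<and> (\<forall>\<eta>>0. \<forall>\<alpha>>0. \<forall>N. \<exists>n>N. r dvd n \<and>
        (\<exists>(V :: nat set) E. simple_graph V E \<and> card V = n \<and>
           real (min_degree V E) \<ge> (1 / (2 - RT_density l (r - 1)) - \<eta>) * real n \<and>
           real (indep_number l V E) \<le> \<alpha> * real n \<and>
           \<not> (\<exists>F. K_factor r V E F)))"
proof (intro conjI allI impI)
  have lr: "l < r" "3 * r \<le> 4 * l" using assms by linarith+
  then have l0: "0 < l" and r2: "2 \<le> r" by linarith+
  {
    fix \<mu> :: real assume \<mu>: "0 < \<mu>"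
    \<comment> \<open>The factor is constructed for an excess of at most 1; a larger excess only
      strengthens the degree condition.\<close>
    then have \<mu>1: "0 < min \<mu> 1" "min \<mu> 1 \<le> 1" by auto
    obtain \<alpha> :: real and N where \<alpha>: "0 < \<alpha>" and main: "\<forall>(V :: nat set) E. simple_graph V E \<longrightarrow> N \<le> card V \<longrightarrow> r dvd card V \<longrightarrow>
        K_dense l V E (\<alpha> * real (card V)) \<longrightarrow>
        (\<forall>v\<in>V. (1 / (2 - RT_density l (r - 1)) + min \<mu> 1) * real (card V) \<le> real (card (nb E v))) \<longrightarrow>
        factorable r E V"
      using factor_exists[OF lr \<mu>1] by (elim exE conjE) (rule that)
    show "\<exists>\<alpha>>0. \<exists>N. \<forall>n>N. r dvd n \<longrightarrow>
        (\<forall>(V :: nat set) E. simple_graph V E \<longrightarrow> card V = n \<longrightarrow>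
           real (min_degree V E) \<ge> (1 / (2 - RT_density l (r - 1)) + \<mu>) * real n \<longrightarrow>
           real (indep_number l V E) \<le> \<alpha> * real n \<longrightarrow>
           (\<exists>F. K_factor r V E F))"
    \<comment> \<open>\<open>K_dense\<close> asks for a strict bound on K_l-free sets, which halving
      \<open>\<alpha>\<close> provides.\<close>
    proof (intro exI[of _ "\<alpha> / 2"] exI[of _ N] conjI allI impI)
      show "0 < \<alpha> / 2" using \<alpha> by simp
      fix n :: nat and V :: "nat set" and E
      assume n: "N < n" "r dvd n" and G: "simple_graph V E" and V: "card V = n"
        and deg: "real (min_degree V E) \<ge> (1 / (2 - RT_density l (r - 1)) + \<mu>) * real n"
        and ind: "real (indep_number l V E) \<le> \<alpha> / 2 * real n"
      have fV: "finite V" using G by (simp add: simple_graph_def)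
      have "0 < \<alpha> / 2 * real n" using \<alpha> n(1) by simp
      note n0 = this
      have "K_dense l V E (\<alpha> * real (card V))"
        unfolding K_dense_def
      proof (intro allI impI, rule ccontr)
        fix U assume U: "U \<subseteq> V" "\<alpha> * real (card V) \<le> real (card U)" "\<not> (\<exists>S\<subseteq>U. is_K l E S)"
        then have "real (card U) \<le> \<alpha> / 2 * real n"
          using ind indep_number_le_iff[OF fV l0, of "\<alpha> / 2 * real n" E] n0 by (auto simp: K_free_def)
        then show False using U(2) n0 V by simp
      qed
      moreover have "(1 / (2 - RT_density l (r - 1)) + min \<mu> 1) * real (card V) \<le> real (card (nb E v))" if "v \<in> V" for v
      proof -
        have "(1 / (2 - RT_density l (r - 1)) + min \<mu> 1) * real n \<le> (1 / (2 - RT_density l (r - 1)) + \<mu>) * real n"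
          by (intro mult_right_mono) auto
        also have "\<dots> \<le> real (min_degree V E)" by (rule deg)
        also have "\<dots> \<le> real (card (nb E v))" using min_degree_le[OF G that] by simp
        finally show ?thesis by (simp add: V)
      qed
      ultimately have "factorable r E V" using main G n V by simp
      then show "\<exists>F. K_factor r V E F" using r2 by (intro factorable_imp_K_factor) auto
    qed
  }
  fix \<eta> \<alpha> :: real and N :: nat assume \<eta>: "0 < \<eta>" and \<alpha>: "0 < \<alpha>"
  show "\<exists>n>N. r dvd n \<and>
        (\<exists>(V :: nat set) E. simple_graph V E \<and> card V = n \<and>
           real (min_degree V E) \<ge> (1 / (2 - RT_density l (r - 1)) - \<eta>) * real n \<and>
           real (indep_number l V E) \<le> \<alpha> * real n \<and>
           \<not> (\<exists>F. K_factor r V E F))"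
  proof (cases "RT_density l (r - 1) = 0")
    case True
    then show ?thesis using two_cliques_no_factor[OF r2 l0 \<eta> \<alpha>, of N] by simp
  next
    case False
    then have "0 < RT_density l (r - 1)" using RT_density_bounds(1)[OF l0, of "r - 1"] by linarith
    then show ?thesis by (rule uncovered_vertex[OF r2 l0 \<eta> \<alpha>])
  qed
qed

end
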